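(* Let $A$ be a fibrant and $K$ a cofibrant pointed simplicial presheaf in $\mathcal M$. For integers $q\ge p\ge0$ put $$D_1^{p,q}(K,A)=[S^{q-p}\wedge K,t_{p+1}A],\qquad E_1^{p,q}(K,A)=[S^{q-p}\wedge K,s_pA],$$ and consider the maps: - $f^{p,q}(K,A):D_1^{p+1,q+1}(K,A)\to D_1^{p,q}(K,A)$, induced by $\nu_{p+1}^A:t_{p+2}A\to t_{p+1}A$; - $g^{p,q}(K,A):D_1^{p,q}(K,A)\to E_1^{p+1,q}(K,A)$, defined only for $q-p\ge1$, the composite $[S^{q-p}\wedge K,t_{p+1}A]\cong[S^{q-p-1}\wedge K,\Omega_{S^1}t_{p+1}A]\to[S^{q-p-1}\wedge K,s_{p+1}A]$ induced by the boundary map of the fibre sequence $s_{p+1}A\to t_{p+2}A\to t_{p+1}A$; - $h^{p,q}(K,A):E_1^{p,q}(K,A)\to D_1^{p,q}(K,A)$, induced by $i_p^A:s_pA\to t_{p+1}A$ for $p\ge1$, and $h^{0,q}(K,A)=id$. Then these data form an extended exact couple $$D_1(K,A)\xrightarrow{f}D_1(K,A)\xrightarrow{g}E_1(K,A)\xrightarrow{h}D_1(K,A).$$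
   Context: $X$ is a Noetherian separated base scheme of finite Krull dimension, and $Sm_X$ is the category of smooth schemes of finite type over $X$, regarded as a site with the Nisnevich topology. Closed subsets are considered as closed subschemes with the reduced structure. $\mathcal M$ is the category of pointed simplicial presheaves on $Sm_X$ with Jardine's motivic (injective) model structure: cofibrations are the monomorphisms and weak equivalences are the motivic ($\mathbb A^1$-local Nisnevich) weak equivalences; it is a simplicial model category. $\mathcal H$ is its homotopy category, $\mathrm{Ho}:\mathcal M\to\mathcal H$ the localization functor, and $[-,-]$ denotes morphism sets in $\mathcal H$. $S^r$ is the $r$-fold smash power of the simplicial circle ($S^0$ the unit), and $\Omega_{S^1}$ is the (derived) right adjoint of $S^1\wedge -$. For $Y\in Sm_X$, $Y_+$ denotes the presheaf represented by $Y$ with a disjoint base point. For $Z$ closed in $Y$, $codim_Y Z$ is the infimum of $\dim \mathcal O_{Y,z}$ over the generic points $z$ of $Z$ (so it is $\infty$ if $Z=\emptyset$). For $n\ge 0$, $WB_n$ is the set of maps $\iota_{U,Y}:U_+\to Y_+$ induced by open immersions $U\to Y$ with $Y\in Sm_X$ irreducible, $Z=Y\setminus U\in Sm_X$ and $codim_Y Z\ge n+1$; $WB_n\mathcal M$ is the left Bousfield localization of $\mathcal M$ with respect to $WB_n$. The functors $\tau_n:\mathcal M\to\mathcal M$ ($n\ge1$), with natural transformations $\tau_{\le n}:id\to\tau_n$ and $\nu_n:\tau_{n+1}\to\tau_n$, are defined inductively using the functorial factorizations (trivial cofibration followed by fibration): $A\xrightarrow{\tau_{\le 1}^A}\tau_1A\to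 *$ is the factorization of $A\to *$ in $WB_0\mathcal M$; and given $\tau_{\le n}^A:A\to\tau_nA$, it is factored in $WB_n\mathcal M$ as a trivial cofibration $\tau_{\le n+1}^A:A\to\tau_{n+1}A$ followed by a fibration $\nu_n^A:\tau_{n+1}A\to\tau_nA$. For $n\ge1$, $\tilde s_nA$ is the pullback of $\nu_n^A$ along the base point $*\to\tau_nA$, with projection $i_n^A:\tilde s_nA\to\tau_{n+1}A$; $\tilde s_0=\tau_1$. These induce functors $t_n,s_n:\mathcal H\to\mathcal H$ with $t_n\circ\mathrm{Ho}=\mathrm{Ho}\circ\tau_n$, $s_n\circ\mathrm{Ho}=\mathrm{Ho}\circ\tilde s_n$, $s_0=t_1$, and $s_nA\xrightarrow{i_n^A} t_{n+1}A\xrightarrow{\nu_n^A} t_nA$ is a fibre sequence in $\mathcal H$ for $n\ge1$. "Extended exact couple" is in the sense of Bousfield–Kan (Homotopy limits, completions and localizations, Ch. IX, 4.1–4.2): the data consist, for each stage $p\geq 0$, of the sequence (writing $t_0A=*$) $$\cdots\to[S^{2}\wedge K,t_pA]\to[S^1\wedge K,s_pA]\xrightarrow{h}[S^1\wedge K,t_{p+1}A]\xrightarrow{f}[S^1\wedge K,t_pA]\xrightarrow{g}[K,s_pA]\xrightarrow{h}[K,t_{p+1}A]\xrightarrow{f}[K,t_pA],$$ in which the last three terms are pointed sets, all others are groups, and these are abelian except possibly the three terms involving $S^1\wedge K$; the last three maps are maps of pointed sets and all others are homomorphisms; the image of $[S^2\wedge K,t_pA]$ lies in the centre of $[S^1\wedge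 K,s_pA]$; the sequence is exact (kernel equals image); and there is an action of $[S^1\wedge K,t_pA]$ on $[K,s_pA]$ such that $g$ is the map given by acting on the base point, and two elements of $[K,s_pA]$ have the same image in $[K,t_{p+1}A]$ if and only if they lie in the same orbit. *)

theory Defs
  imports "HOL-Homology.Homology" "HOL-Algebra.Ring_Divisibility"
    "HOL-Algebra.Generated_Rings" "HOL-Algebra.Group_Action" "HOL-Library.Extended_Nat"
begin

section \<open>Locally ringed spaces\<close>

record ('p, 'r) rspace =
  sp :: "'p topology"
  Sec :: "'p set \<Rightarrow> 'r ring"
  res :: "'p set \<Rightarrow> 'p set \<Rightarrow> 'r \<Rightarrow> 'r"

abbreviation pts :: "('p, 'r) rspace \<Rightarrow> 'p set"
  where "pts Y \<equiv> topspace (sp Y)"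

definition sheaf_of_rings :: "('p, 'r) rspace \<Rightarrow> bool" where
  "sheaf_of_rings Y \<longleftrightarrow>
    (\<forall>U. openin (sp Y) U \<longrightarrow> cring (Sec Y U)) \<and>
    (\<forall>U V. openin (sp Y) U \<and> openin (sp Y) V \<and> V \<subseteq> U \<longrightarrow>
       res Y U V \<in> ring_hom (Sec Y U) (Sec Y V)) \<and>
    (\<forall>U s. openin (sp Y) U \<and> s \<in> carrier (Sec Y U) \<longrightarrow> res Y U U s = s) \<and>
    (\<forall>U V W s. openin (sp Y) U \<and> openin (sp Y) V \<and> openin (sp Y) W \<and> W \<subseteq> V \<and> V \<subseteq> U \<and>
       s \<in> carrier (Sec Y U) \<longrightarrow> res Y V W (res Y U V s) = res Y U W s) \<and>
    (\<forall>\<U> s. (\<forall>U\<in>\<U>. openin (sp Y) U \<and> s U \<in> carrier (Sec Y U)) \<and>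
       (\<forall>U\<in>\<U>. \<forall>V\<in>\<U>. res Y U (U \<inter> V) (s U) = res Y V (U \<inter> V) (s V)) \<longrightarrow>
       (\<exists>!t. t \<in> carrier (Sec Y (\<Union>\<U>)) \<and> (\<forall>U\<in>\<U>. res Y (\<Union>\<U>) U t = s U)))"

definition germ :: "('p, 'r) rspace \<Rightarrow> 'p \<Rightarrow> 'p set \<Rightarrow> 'r \<Rightarrow> ('p set \<times> 'r) set" where
  "germ Y x U s = {(V, t). openin (sp Y) V \<and> x \<in> V \<and> t \<in> carrier (Sec Y V) \<and>
     (\<exists>W. openin (sp Y) W \<and> x \<in> W \<and> W \<subseteq> U \<inter> V \<and> res Y U W s = res Y V W t)}"

definition stalk :: "('p, 'r) rspace \<Rightarrow> 'p \<Rightarrow> (('p set \<times> 'r) set) ring" where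
  "stalk Y x =
    (let nb = (\<lambda>U. openin (sp Y) U \<and> x \<in> U) in
     \<lparr>carrier = {germ Y x U s | U s. nb U \<and> s \<in> carrier (Sec Y U)},
      monoid.mult = (\<lambda>a b. THE c. \<exists>U s t. nb U \<and> s \<in> carrier (Sec Y U) \<and> t \<in> carrier (Sec Y U) \<and>
                a = germ Y x U s \<and> b = germ Y x U t \<and> c = germ Y x U (s \<otimes>\<^bsub>Sec Y U\<^esub> t)),
      monoid.one = germ Y x (pts Y) \<one>\<^bsub>Sec Y (pts Y)\<^esub>,
      ring.zero = germ Y x (pts Y) \<zero>\<^bsub>Sec Y (pts Y)\<^esub>,
      ring.add = (\<lambda>a b. THE c. \<exists>U s t. nb U \<and> s \<in> carrier (Sec Y U) \<and> t \<in> carrier (Sec Y U) \<and>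
                a = germ Y x U s \<and> b = germ Y x U t \<and> c = germ Y x U (s \<oplus>\<^bsub>Sec Y U\<^esub> t))\<rparr>)"

definition local_ring :: "'r ring \<Rightarrow> bool" where
  "local_ring R \<longleftrightarrow> cring R \<and> (\<exists>!m. maximalideal m R)"

definition max_ideal :: "'r ring \<Rightarrow> 'r set" where
  "max_ideal R = (THE m. maximalideal m R)"

definition locally_ringed :: "('p, 'r) rspace \<Rightarrow> bool" where
  "locally_ringed Y \<longleftrightarrow> sheaf_of_rings Y \<and> (\<forall>x\<in>pts Y. local_ring (stalk Y x))"

record ('p, 'r, 'q, 's) morph =
  src :: "('p, 'r) rspace"
  tgt :: "('q, 's) rspace"
  pt :: "'p \<Rightarrow> 'q"
  sh :: "'q set \<Rightarrow> 's \<Rightarrow> 'r"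

definition preim :: "('p, 'r, 'q, 's) morph \<Rightarrow> 'q set \<Rightarrow> 'p set" where
  "preim f V = {x \<in> pts (src f). pt f x \<in> V}"

definition stalk_map ::
  "('p, 'r, 'q, 's) morph \<Rightarrow> 'p \<Rightarrow> ('q set \<times> 's) set \<Rightarrow> ('p set \<times> 'r) set" where
  "stalk_map f x a = (THE c. \<exists>V t. openin (sp (tgt f)) V \<and> pt f x \<in> V \<and>
      t \<in> carrier (Sec (tgt f) V) \<and> a = germ (tgt f) (pt f x) V t \<and>
      c = germ (src f) x (preim f V) (sh f V t))"

text \<open>The extensionality conditions make equality in HOL of two such records agree with equality
  of morphisms.\<close>

definition lrs_morph :: "('p, 'r, 'q, 's) morph \<Rightarrow> bool" where
  "lrs_morph f \<longleftrightarrow>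
    locally_ringed (src f) \<and> locally_ringed (tgt f) \<and>
    continuous_map (sp (src f)) (sp (tgt f)) (pt f) \<and> pt f \<in> extensional (pts (src f)) \<and>
    (\<forall>V. openin (sp (tgt f)) V \<longrightarrow>
       sh f V \<in> ring_hom (Sec (tgt f) V) (Sec (src f) (preim f V)) \<and>
       sh f V \<in> extensional (carrier (Sec (tgt f) V))) \<and>
    (\<forall>V. \<not> openin (sp (tgt f)) V \<longrightarrow> sh f V = (\<lambda>_. undefined)) \<and>
    (\<forall>V W t. openin (sp (tgt f)) V \<and> openin (sp (tgt f)) W \<and> W \<subseteq> V \<and>
       t \<in> carrier (Sec (tgt f) V) \<longrightarrow>
       sh f W (res (tgt f) V W t) = res (src f) (preim f V) (preim f W) (sh f V t)) \<and>
    (\<forall>x\<in>pts (src f).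
       stalk_map f x ` max_ideal (stalk (tgt f) (pt f x)) \<subseteq> max_ideal (stalk (src f) x))"

definition mcomp :: "('q, 's, 'v, 'w) morph \<Rightarrow> ('p, 'r, 'q, 's) morph \<Rightarrow> ('p, 'r, 'v, 'w) morph"
  where "mcomp g f =
    \<lparr>src = src f, tgt = tgt g, pt = compose (pts (src f)) (pt g) (pt f),
     sh = (\<lambda>W. if openin (sp (tgt g)) W
               then compose (carrier (Sec (tgt g) W)) (sh f (preim g W)) (sh g W)
               else (\<lambda>_. undefined))\<rparr>"

definition mid :: "('p, 'r) rspace \<Rightarrow> ('p, 'r, 'p, 'r) morph" where
  "mid Y = \<lparr>src = Y, tgt = Y, pt = (\<lambda>x\<in>pts Y. x),
     sh = (\<lambda>V. if openin (sp Y) V then (\<lambda>t\<in>carrier (Sec Y V). t) else (\<lambda>_. undefined))\<rparr>"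

definition lrs_iso :: "('p, 'r, 'q, 's) morph \<Rightarrow> bool" where
  "lrs_iso f \<longleftrightarrow> lrs_morph f \<and> (\<exists>g. lrs_morph g \<and> src g = tgt f \<and> tgt g = src f \<and>
     mcomp g f = mid (src f) \<and> mcomp f g = mid (tgt f))"

section \<open>Schemes\<close>

definition fraction :: "'r ring \<Rightarrow> 'r set \<Rightarrow> 'r \<Rightarrow> 'r \<Rightarrow> ('r \<times> 'r) set" where
  "fraction R P a b = {(c, d). c \<in> carrier R \<and> d \<in> carrier R - P \<and>
     (\<exists>t\<in>carrier R - P. t \<otimes>\<^bsub>R\<^esub> ((a \<otimes>\<^bsub>R\<^esub> d) \<ominus>\<^bsub>R\<^esub> (c \<otimes>\<^bsub>R\<^esub> b)) = \<zero>\<^bsub>R\<^esub>)}"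

definition loc_ring :: "'r ring \<Rightarrow> 'r set \<Rightarrow> (('r \<times> 'r) set) ring" where
  "loc_ring R P =
    (let F = (\<lambda>x a b. a \<in> carrier R \<and> b \<in> carrier R - P \<and> x = fraction R P a b) in
     \<lparr>carrier = {x. \<exists>a b. F x a b},
      monoid.mult = (\<lambda>x y. THE z. \<exists>a b c d. F x a b \<and> F y c d \<and>
                z = fraction R P (a \<otimes>\<^bsub>R\<^esub> c) (b \<otimes>\<^bsub>R\<^esub> d)),
      monoid.one = fraction R P \<one>\<^bsub>R\<^esub> \<one>\<^bsub>R\<^esub>,
      ring.zero = fraction R P \<zero>\<^bsub>R\<^esub> \<one>\<^bsub>R\<^esub>,
      ring.add = (\<lambda>x y. THE z. \<exists>a b c d. F x a b \<and> F y c d \<and>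
                z = fraction R P ((a \<otimes>\<^bsub>R\<^esub> d) \<oplus>\<^bsub>R\<^esub> (c \<otimes>\<^bsub>R\<^esub> b)) (b \<otimes>\<^bsub>R\<^esub> d))\<rparr>)"

definition spec_top :: "'r ring \<Rightarrow> 'r set topology" where
  "spec_top R = topology (\<lambda>U. \<exists>A\<subseteq>carrier R. U = {P. primeideal P R \<and> \<not> A \<subseteq> P})"

definition spec_sec :: "'r ring \<Rightarrow> 'r set set \<Rightarrow> ('r set \<Rightarrow> ('r \<times> 'r) set) ring" where
  "spec_sec R U =
    \<lparr>carrier = {s \<in> extensional U. (\<forall>P\<in>U. s P \<in> carrier (loc_ring R P)) \<and>
        (\<forall>P\<in>U. \<exists>V a b. openin (spec_top R) V \<and> P \<in> V \<and> V \<subseteq> U \<and> a \<in> carrier R \<and> b \<in> carrier R \<and>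
           (\<forall>Q\<in>V. b \<notin> Q \<and> s Q = fraction R Q a b))},
     monoid.mult = (\<lambda>s t. \<lambda>P\<in>U. s P \<otimes>\<^bsub>loc_ring R P\<^esub> t P),
     monoid.one = (\<lambda>P\<in>U. \<one>\<^bsub>loc_ring R P\<^esub>),
     ring.zero = (\<lambda>P\<in>U. \<zero>\<^bsub>loc_ring R P\<^esub>),
     ring.add = (\<lambda>s t. \<lambda>P\<in>U. s P \<oplus>\<^bsub>loc_ring R P\<^esub> t P)\<rparr>"

definition Spec :: "'r ring \<Rightarrow> ('r set, 'r set \<Rightarrow> ('r \<times> 'r) set) rspace" where
  "Spec R = \<lparr>sp = spec_top R, Sec = spec_sec R, res = (\<lambda>U V s. restrict s V)\<rparr>"

definition affine_scheme :: "('p, 'r) rspace \<Rightarrow> bool" where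
  "affine_scheme Y \<longleftrightarrow> locally_ringed Y \<and>
     (\<exists>(R :: 'r ring) f. cring R \<and> lrs_iso f \<and> src f = Y \<and> tgt f = Spec R)"

definition open_sub :: "('p, 'r) rspace \<Rightarrow> 'p set \<Rightarrow> ('p, 'r) rspace" where
  "open_sub Y U = \<lparr>sp = subtopology (sp Y) U, Sec = Sec Y, res = res Y\<rparr>"

definition affine_open :: "('p, 'r) rspace \<Rightarrow> 'p set \<Rightarrow> bool" where
  "affine_open Y U \<longleftrightarrow> openin (sp Y) U \<and> affine_scheme (open_sub Y U)"

definition scheme :: "('p, 'r) rspace \<Rightarrow> bool" where
  "scheme Y \<longleftrightarrow> locally_ringed Y \<and> (\<forall>x\<in>pts Y. \<exists>U. affine_open Y U \<and> x \<in> U)"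

definition noetherian_scheme :: "('p, 'r) rspace \<Rightarrow> bool" where
  "noetherian_scheme Y \<longleftrightarrow> scheme Y \<and>
     (\<exists>\<U>. finite \<U> \<and> (\<forall>U\<in>\<U>. affine_open Y U \<and> noetherian_ring (Sec Y U)) \<and> \<Union>\<U> = pts Y)"

definition reduced_scheme :: "('p, 'r) rspace \<Rightarrow> bool" where
  "reduced_scheme Y \<longleftrightarrow> scheme Y \<and>
     (\<forall>U s n. openin (sp Y) U \<and> s \<in> carrier (Sec Y U) \<and> s [^]\<^bsub>Sec Y U\<^esub> (n::nat) = \<zero>\<^bsub>Sec Y U\<^esub> \<longrightarrow>
        s = \<zero>\<^bsub>Sec Y U\<^esub>)"

definition irreducible_set :: "'p topology \<Rightarrow> 'p set \<Rightarrow> bool" where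
  "irreducible_set T S \<longleftrightarrow> S \<subseteq> topspace T \<and> S \<noteq> {} \<and>
     (\<forall>C D. closedin T C \<and> closedin T D \<and> S \<subseteq> C \<union> D \<longrightarrow> S \<subseteq> C \<or> S \<subseteq> D)"

definition topological_dim :: "'p topology \<Rightarrow> enat" where
  "topological_dim T = Sup {enat n | n. \<exists>C. (\<forall>i\<le>n. closedin T (C i) \<and> irreducible_set T (C i)) \<and>
     (\<forall>i<n. C i \<subset> C (Suc i))}"

definition krull_dim :: "'r ring \<Rightarrow> enat" where
  "krull_dim R = Sup {enat n | n. \<exists>P. (\<forall>i\<le>n. primeideal (P i) R) \<and> (\<forall>i<n. P i \<subset> P (Suc i))}"

definition generic_points :: "('p, 'r) rspace \<Rightarrow> 'p set \<Rightarrow> 'p set" where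
  "generic_points Y Z = {z \<in> Z. \<forall>z'\<in>Z. z \<in> sp Y closure_of {z'} \<longrightarrow> z' = z}"

definition codim :: "('p, 'r) rspace \<Rightarrow> 'p set \<Rightarrow> enat" where
  "codim Y Z = (INF z\<in>generic_points Y Z. krull_dim (stalk Y z))"

section \<open>Morphisms of schemes\<close>

definition open_immersion :: "('p, 'r, 'q, 's) morph \<Rightarrow> bool" where
  "open_immersion f \<longleftrightarrow> lrs_morph f \<and>
     (let W = pt f ` pts (src f) in
       openin (sp (tgt f)) W \<and> homeomorphic_map (sp (src f)) (subtopology (sp (tgt f)) W) (pt f) \<and>
       (\<forall>V. openin (sp (tgt f)) V \<and> V \<subseteq> W \<longrightarrow>
          bij_betw (sh f V) (carrier (Sec (tgt f) V)) (carrier (Sec (src f) (preim f V)))))"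

definition closed_immersion :: "('p, 'r, 'q, 's) morph \<Rightarrow> bool" where
  "closed_immersion f \<longleftrightarrow> lrs_morph f \<and>
     (let W = pt f ` pts (src f) in
       closedin (sp (tgt f)) W \<and> homeomorphic_map (sp (src f)) (subtopology (sp (tgt f)) W) (pt f)) \<and>
     (\<forall>x\<in>pts (src f).
       stalk_map f x ` carrier (stalk (tgt f) (pt f x)) = carrier (stalk (src f) x))"

definition is_self_product ::
  "('p, 'r) rspace \<Rightarrow> ('q, 's, 'p, 'r) morph \<Rightarrow> ('q, 's, 'p, 'r) morph \<Rightarrow> bool" where
  "is_self_product X p1 p2 \<longleftrightarrow>
     lrs_morph p1 \<and> lrs_morph p2 \<and> src p1 = src p2 \<and> tgt p1 = X \<and> tgt p2 = X \<and> scheme (src p1) \<and>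
     (\<forall>(u :: ('q, 's, 'p, 'r) morph) (v :: ('q, 's, 'p, 'r) morph).
        lrs_morph u \<and> lrs_morph v \<and> src u = src v \<and> scheme (src u) \<and> tgt u = X \<and> tgt v = X \<longrightarrow>
        (\<exists>!w :: ('q, 's, 'q, 's) morph. lrs_morph w \<and> src w = src u \<and> tgt w = src p1 \<and>
           mcomp p1 w = u \<and> mcomp p2 w = v))"

text \<open>Separated means that the diagonal of \<open>X \<times> X\<close> (over the integers) is a closed immersion.
  For infinite \<^typ>\<open>'a\<close> the product has points and sections that fit into \<^typ>\<open>'a set\<close>, but in
  general not into \<^typ>\<open>'a\<close> (consider the spectrum of the complex numbers).\<close>

definition separated :: "('a, 'a) rspace \<Rightarrow> bool" where
  "separated X \<longleftrightarrow>
     (\<forall>(p1 :: ('a set, 'a set, 'a, 'a) morph) p2 d.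
        is_self_product X p1 p2 \<and> lrs_morph d \<and> src d = X \<and> tgt d = src p1 \<and>
        mcomp p1 d = mid X \<and> mcomp p2 d = mid X \<longrightarrow> closed_immersion d)"

definition locally_finite_type :: "('p, 'r, 'q, 's) morph \<Rightarrow> bool" where
  "locally_finite_type f \<longleftrightarrow>
     (\<forall>V U. affine_open (tgt f) V \<and> affine_open (src f) U \<and> U \<subseteq> preim f V \<longrightarrow>
        (\<exists>S. finite S \<and> S \<subseteq> carrier (Sec (src f) U) \<and>
           carrier (Sec (src f) U) =
             generate_ring (Sec (src f) U)
               (S \<union> (\<lambda>t. res (src f) (preim f V) U (sh f V t)) ` carrier (Sec (tgt f) V))))"

definition finite_type :: "('p, 'r, 'q, 's) morph \<Rightarrow> bool" where
  "finite_type f \<longleftrightarrow> locally_finite_type f \<and>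
     (\<forall>V. openin (sp (tgt f)) V \<and> compactin (sp (tgt f)) V \<longrightarrow> compactin (sp (src f)) (preim f V))"

definition first_order_thickening :: "('p, 'r, 'q, 's) morph \<Rightarrow> bool" where
  "first_order_thickening i \<longleftrightarrow>
     closed_immersion i \<and> affine_scheme (tgt i) \<and> scheme (src i) \<and>
     (let T = pts (tgt i); R = Sec (tgt i) T;
          I = {a \<in> carrier R. sh i T a = \<zero>\<^bsub>Sec (src i) (preim i T)\<^esub>}
      in \<forall>a\<in>I. \<forall>b\<in>I. a \<otimes>\<^bsub>R\<^esub> b = \<zero>\<^bsub>R\<^esub>)"

definition lifts ::
  "('a, 'a, 'a, 'a) morph \<Rightarrow> ('a, 'a, 'a, 'a) morph \<Rightarrow> ('a, 'a, 'a, 'a) morph \<Rightarrow>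
   ('a, 'a, 'a, 'a) morph \<Rightarrow> ('a, 'a, 'a, 'a) morph set" where
  "lifts f i g0 g = {h. lrs_morph h \<and> src h = tgt i \<and> tgt h = src f \<and> mcomp h i = g0 \<and> mcomp f h = g}"

definition thickening_square ::
  "('a, 'a, 'a, 'a) morph \<Rightarrow> ('a, 'a, 'a, 'a) morph \<Rightarrow> ('a, 'a, 'a, 'a) morph \<Rightarrow>
   ('a, 'a, 'a, 'a) morph \<Rightarrow> bool" where
  "thickening_square f i g0 g \<longleftrightarrow> first_order_thickening i \<and> lrs_morph g0 \<and> lrs_morph g \<and>
     src g0 = src i \<and> tgt g0 = src f \<and> src g = tgt i \<and> tgt g = tgt f \<and> mcomp f g0 = mcomp g i"

text \<open>Smooth (etale) means formally smooth (etale) and locally of finite presentation. All targets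
  below are locally Noetherian, so that finite presentation is the same as finite type. For morphisms
  locally of finite type between schemes over the infinite type \<^typ>\<open>'a\<close>, test schemes over
  \<^typ>\<open>'a\<close> suffice.\<close>

definition smooth :: "('a, 'a, 'a, 'a) morph \<Rightarrow> bool" where
  "smooth f \<longleftrightarrow> locally_finite_type f \<and>
     (\<forall>i g0 g. thickening_square f i g0 g \<longrightarrow> (\<exists>h. h \<in> lifts f i g0 g))"

definition etale :: "('a, 'a, 'a, 'a) morph \<Rightarrow> bool" where
  "etale f \<longleftrightarrow> locally_finite_type f \<and>
     (\<forall>i g0 g. thickening_square f i g0 g \<longrightarrow> (\<exists>!h. h \<in> lifts f i g0 g))"

text \<open>The (automatically injective) map of residue fields at \<open>x\<close> is an isomorphism.\<close>

definition residue_iso :: "('p, 'r, 'q, 's) morph \<Rightarrow> 'p \<Rightarrow> bool" where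
  "residue_iso f x \<longleftrightarrow>
     (\<forall>b\<in>carrier (stalk (src f) x). \<exists>a\<in>carrier (stalk (tgt f) (pt f x)).
        b \<ominus>\<^bsub>stalk (src f) x\<^esub> stalk_map f x a \<in> max_ideal (stalk (src f) x))"

section \<open>Categories\<close>

record ('o, 'f) arrow =
  Dom :: 'o
  Cod :: 'o
  Fn :: 'f

abbreviation Arr :: "'o \<Rightarrow> 'o \<Rightarrow> 'f \<Rightarrow> ('o, 'f) arrow"
  where "Arr a b f \<equiv> \<lparr>Dom = a, Cod = b, Fn = f\<rparr>"

record ('o, 'f) category =
  Ob :: "'o set"
  Ar :: "('o, 'f) arrow set"
  Idn :: "'o \<Rightarrow> ('o, 'f) arrow"
  Cmp :: "('o, 'f) arrow \<Rightarrow> ('o, 'f) arrow \<Rightarrow> ('o, 'f) arrow"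

definition homset :: "('o, 'f) category \<Rightarrow> 'o \<Rightarrow> 'o \<Rightarrow> ('o, 'f) arrow set" where
  "homset C a b = {f \<in> Ar C. Dom f = a \<and> Cod f = b}"

definition is_category :: "('o, 'f) category \<Rightarrow> bool" where
  "is_category C \<longleftrightarrow>
     (\<forall>f\<in>Ar C. Dom f \<in> Ob C \<and> Cod f \<in> Ob C) \<and>
     (\<forall>a\<in>Ob C. Idn C a \<in> homset C a a) \<and>
     (\<forall>f\<in>Ar C. \<forall>g\<in>Ar C. Dom g = Cod f \<longrightarrow> Cmp C g f \<in> homset C (Dom f) (Cod g)) \<and>
     (\<forall>f\<in>Ar C. Cmp C f (Idn C (Dom f)) = f \<and> Cmp C (Idn C (Cod f)) f = f) \<and>
     (\<forall>f\<in>Ar C. \<forall>g\<in>Ar C. \<forall>h\<in>Ar C. Dom g = Cod f \<and> Dom h = Cod g \<longrightarrow>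
        Cmp C h (Cmp C g f) = Cmp C (Cmp C h g) f)"

definition flip :: "('o, 'f) arrow \<Rightarrow> ('o, 'f) arrow" where
  "flip f = Arr (Cod f) (Dom f) (Fn f)"

definition opposite :: "('o, 'f) category \<Rightarrow> ('o, 'f) category" where
  "opposite C = \<lparr>Ob = Ob C, Ar = flip ` Ar C, Idn = (\<lambda>a. flip (Idn C a)),
     Cmp = (\<lambda>g f. flip (Cmp C (flip f) (flip g)))\<rparr>"

definition square :: "('o, 'f) category \<Rightarrow> ('o, 'f) arrow \<Rightarrow> ('o, 'f) arrow \<Rightarrow>
    ('o, 'f) arrow \<Rightarrow> ('o, 'f) arrow \<Rightarrow> bool" where
  "square C f g u v \<longleftrightarrow> f \<in> Ar C \<and> g \<in> Ar C \<and> u \<in> homset C (Dom f) (Dom g) \<and>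
     v \<in> homset C (Cod f) (Cod g) \<and> Cmp C g u = Cmp C v f"

definition finite_limits :: "('o, 'f) category \<Rightarrow> bool" where
  "finite_limits C \<longleftrightarrow>
     (\<exists>t\<in>Ob C. \<forall>a\<in>Ob C. \<exists>!f. f \<in> homset C a t) \<and>
     (\<forall>f\<in>Ar C. \<forall>g\<in>Ar C. Cod f = Cod g \<longrightarrow>
        (\<exists>p\<in>Ar C. \<exists>q\<in>Ar C. Dom p = Dom q \<and> Cod p = Dom f \<and> Cod q = Dom g \<and>
           Cmp C f p = Cmp C g q \<and>
           (\<forall>u\<in>Ar C. \<forall>v\<in>Ar C. Dom u = Dom v \<and> Cod u = Dom f \<and> Cod v = Dom g \<and>
              Cmp C f u = Cmp C g v \<longrightarrow>
              (\<exists>!w. w \<in> homset C (Dom u) (Dom p) \<and> Cmp C p w = u \<and> Cmp C q w = v))))"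

definition monomorphisms :: "('o, 'f) category \<Rightarrow> ('o, 'f) arrow set" where
  "monomorphisms C = {f \<in> Ar C. \<forall>g\<in>Ar C. \<forall>h\<in>Ar C. Cod g = Dom f \<and> Cod h = Dom f \<and> Dom g = Dom h \<and>
     Cmp C f g = Cmp C f h \<longrightarrow> g = h}"

definition has_lifting :: "('o, 'f) category \<Rightarrow> ('o, 'f) arrow \<Rightarrow> ('o, 'f) arrow \<Rightarrow> bool" where
  "has_lifting C i p \<longleftrightarrow> (\<forall>u v. square C i p u v \<longrightarrow>
     (\<exists>h. h \<in> homset C (Cod i) (Dom p) \<and> Cmp C h i = u \<and> Cmp C p h = v))"

definition rlp :: "('o, 'f) category \<Rightarrow> ('o, 'f) arrow set \<Rightarrow> ('o, 'f) arrow set" where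
  "rlp C S = {p \<in> Ar C. \<forall>i\<in>S. has_lifting C i p}"

definition is_retract :: "('o, 'f) category \<Rightarrow> ('o, 'f) arrow \<Rightarrow> ('o, 'f) arrow \<Rightarrow> bool" where
  "is_retract C f g \<longleftrightarrow> (\<exists>u v u' v'. square C f g u v \<and> square C g f u' v' \<and>
     Cmp C u' u = Idn C (Dom f) \<and> Cmp C v' v = Idn C (Cod f))"

text \<open>A (closed) model structure in the sense of Quillen, with weak equivalences \<open>W\<close>, cofibrations
  \<open>Cf\<close> and fibrations \<open>Fb\<close>.\<close>

definition model_category :: "('o, 'f) category \<Rightarrow> ('o, 'f) arrow set \<Rightarrow> ('o, 'f) arrow set \<Rightarrow>
    ('o, 'f) arrow set \<Rightarrow> bool" where
  "model_category C W Cf Fb \<longleftrightarrow>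
     is_category C \<and> finite_limits C \<and> finite_limits (opposite C) \<and>
     W \<subseteq> Ar C \<and> Cf \<subseteq> Ar C \<and> Fb \<subseteq> Ar C \<and>
     (\<forall>f\<in>Ar C. \<forall>g\<in>Ar C. Dom g = Cod f \<longrightarrow>
        (f \<in> W \<and> g \<in> W \<longrightarrow> Cmp C g f \<in> W) \<and> (f \<in> W \<and> Cmp C g f \<in> W \<longrightarrow> g \<in> W) \<and>
        (g \<in> W \<and> Cmp C g f \<in> W \<longrightarrow> f \<in> W)) \<and>
     (\<forall>f g. is_retract C f g \<longrightarrow>
        (g \<in> W \<longrightarrow> f \<in> W) \<and> (g \<in> Cf \<longrightarrow> f \<in> Cf) \<and> (g \<in> Fb \<longrightarrow> f \<in> Fb)) \<and>
     (\<forall>i\<in>Cf. \<forall>p\<in>Fb. i \<in> W \<or> p \<in> W \<longrightarrow> has_lifting C i p) \<and>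
     (\<forall>f\<in>Ar C. (\<exists>i\<in>Cf \<inter> W. \<exists>p\<in>Fb. Dom p = Cod i \<and> f = Cmp C p i) \<and>
               (\<exists>i\<in>Cf. \<exists>p\<in>Fb \<inter> W. Dom p = Cod i \<and> f = Cmp C p i))"

text \<open>\<open>\<Phi> f\<close> is the factorization of \<open>f\<close>, and \<open>\<Psi> f g u v\<close> the induced arrow of the middle objects.\<close>

definition functorial_factorization ::
  "('o, 'f) category \<Rightarrow> ('o, 'f) arrow set \<Rightarrow> ('o, 'f) arrow set \<Rightarrow>
   (('o, 'f) arrow \<Rightarrow> ('o, 'f) arrow \<times> ('o, 'f) arrow) \<Rightarrow>
   (('o, 'f) arrow \<Rightarrow> ('o, 'f) arrow \<Rightarrow> ('o, 'f) arrow \<Rightarrow> ('o, 'f) arrow \<Rightarrow> ('o, 'f) arrow) \<Rightarrow> bool"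
  where
  "functorial_factorization C L R \<Phi> \<Psi> \<longleftrightarrow>
     (\<forall>f\<in>Ar C. fst (\<Phi> f) \<in> L \<and> snd (\<Phi> f) \<in> R \<and> Dom (fst (\<Phi> f)) = Dom f \<and>
        Dom (snd (\<Phi> f)) = Cod (fst (\<Phi> f)) \<and> Cod (snd (\<Phi> f)) = Cod f \<and>
        Cmp C (snd (\<Phi> f)) (fst (\<Phi> f)) = f) \<and>
     (\<forall>f g u v. square C f g u v \<longrightarrow>
        square C (fst (\<Phi> f)) (fst (\<Phi> g)) u (\<Psi> f g u v) \<and>
        square C (snd (\<Phi> f)) (snd (\<Phi> g)) (\<Psi> f g u v) v) \<and>
     (\<forall>f\<in>Ar C. \<Psi> f f (Idn C (Dom f)) (Idn C (Cod f)) = Idn C (Cod (fst (\<Phi> f)))) \<and>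
     (\<forall>f g k u v u' v'. square C f g u v \<and> square C g k u' v' \<longrightarrow>
        \<Psi> f k (Cmp C u' u) (Cmp C v' v) = Cmp C (\<Psi> g k u' v') (\<Psi> f g u v))"

section \<open>Localization of a category\<close>

text \<open>The Gabriel--Zisman localization at \<open>W\<close>: an arrow from \<open>A\<close> to \<open>B\<close> is a class of zigzags,
  listed in the order in which they are traversed from \<open>A\<close> to \<open>B\<close>.\<close>

datatype 'x zig = Fwd 'x | Bwd 'x

inductive zpath :: "('o, 'f) category \<Rightarrow> ('o, 'f) arrow set \<Rightarrow> 'o \<Rightarrow> 'o \<Rightarrow>
    ('o, 'f) arrow zig list \<Rightarrow> bool" for C W where
  zpath_nil: "A \<in> Ob C \<Longrightarrow> zpath C W A A []"
| zpath_fwd: "f \<in> Ar C \<Longrightarrow> zpath C W (Cod f) B p \<Longrightarrow> zpath C W (Dom f) B (Fwd f # p)"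
| zpath_bwd: "w \<in> W \<Longrightarrow> zpath C W (Dom w) B p \<Longrightarrow> zpath C W (Cod w) B (Bwd w # p)"

inductive zeq :: "('o, 'f) category \<Rightarrow> ('o, 'f) arrow set \<Rightarrow> 'o \<Rightarrow> 'o \<Rightarrow>
    ('o, 'f) arrow zig list \<Rightarrow> ('o, 'f) arrow zig list \<Rightarrow> bool" for C W where
  zeq_refl: "zpath C W A B p \<Longrightarrow> zeq C W A B p p"
| zeq_sym: "zeq C W A B p q \<Longrightarrow> zeq C W A B q p"
| zeq_trans: "zeq C W A B p q \<Longrightarrow> zeq C W A B q r \<Longrightarrow> zeq C W A B p r"
| zeq_append: "zeq C W A B p q \<Longrightarrow> zeq C W B D p' q' \<Longrightarrow> zeq C W A D (p @ p') (q @ q')"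
| zeq_id: "A \<in> Ob C \<Longrightarrow> zeq C W A A [Fwd (Idn C A)] []"
| zeq_comp: "f \<in> Ar C \<Longrightarrow> g \<in> Ar C \<Longrightarrow> Dom g = Cod f \<Longrightarrow>
    zeq C W (Dom f) (Cod g) [Fwd f, Fwd g] [Fwd (Cmp C g f)]"
| zeq_inv1: "w \<in> W \<Longrightarrow> zeq C W (Dom w) (Dom w) [Fwd w, Bwd w] []"
| zeq_inv2: "w \<in> W \<Longrightarrow> zeq C W (Cod w) (Cod w) [Bwd w, Fwd w] []"

definition zclass :: "('o, 'f) category \<Rightarrow> ('o, 'f) arrow set \<Rightarrow> 'o \<Rightarrow> 'o \<Rightarrow>
    ('o, 'f) arrow zig list \<Rightarrow> ('o, ('o, 'f) arrow zig list set) arrow" where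
  "zclass C W A B p = Arr A B {q. zeq C W A B p q}"

definition localization :: "('o, 'f) category \<Rightarrow> ('o, 'f) arrow set \<Rightarrow>
    ('o, ('o, 'f) arrow zig list set) category" where
  "localization C W =
    \<lparr>Ob = Ob C,
     Ar = {zclass C W A B p | A B p. zpath C W A B p},
     Idn = (\<lambda>A. zclass C W A A []),
     Cmp = (\<lambda>\<psi> \<phi>. Arr (Dom \<phi>) (Cod \<psi>)
        {r. \<exists>p\<in>Fn \<phi>. \<exists>q\<in>Fn \<psi>. zeq C W (Dom \<phi>) (Cod \<psi>) (p @ q) r})\<rparr>"

definition loc_fun :: "('o, 'f) category \<Rightarrow> ('o, 'f) arrow set \<Rightarrow> ('o, 'f) arrow \<Rightarrow>
    ('o, ('o, 'f) arrow zig list set) arrow" where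
  "loc_fun C W f = zclass C W (Dom f) (Cod f) [Fwd f]"

section \<open>Smooth schemes and the Nisnevich topology\<close>

text \<open>An object of \<open>Sm X\<close> is the structure morphism of a smooth scheme of finite type over \<open>X\<close>.
  If \<^typ>\<open>'a\<close> is infinite, each such scheme has cardinality at most that of \<^typ>\<open>'a\<close> and hence is
  isomorphic to one over \<^typ>\<open>'a\<close>.\<close>

type_synonym 'a smobj = "('a, 'a, 'a, 'a) morph"
type_synonym 'a smarr = "('a smobj, ('a, 'a, 'a, 'a) morph) arrow"

definition smooth_over :: "('a, 'a) rspace \<Rightarrow> 'a smobj set" where
  "smooth_over X = {\<pi>. lrs_morph \<pi> \<and> scheme (src \<pi>) \<and> tgt \<pi> = X \<and> smooth \<pi> \<and> finite_type \<pi>}"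

definition Sm :: "('a, 'a) rspace \<Rightarrow> ('a smobj, ('a, 'a, 'a, 'a) morph) category" where
  "Sm X =
    \<lparr>Ob = smooth_over X,
     Ar = {u. Dom u \<in> smooth_over X \<and> Cod u \<in> smooth_over X \<and> lrs_morph (Fn u) \<and>
              src (Fn u) = src (Dom u) \<and> tgt (Fn u) = src (Cod u) \<and> mcomp (Cod u) (Fn u) = Dom u},
     Idn = (\<lambda>\<pi>. Arr \<pi> \<pi> (mid (src \<pi>))),
     Cmp = (\<lambda>g f. Arr (Dom f) (Cod g) (mcomp (Fn g) (Fn f)))\<rparr>"

definition nis_cover :: "('a, 'a) rspace \<Rightarrow> 'a smobj \<Rightarrow> 'a smarr set \<Rightarrow> bool" where
  "nis_cover X U S \<longleftrightarrow> (\<forall>v\<in>S. v \<in> Ar (Sm X) \<and> Cod v = U \<and> etale (Fn v)) \<and>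
     (\<forall>u\<in>pts (src U). \<exists>v\<in>S. \<exists>x\<in>pts (src (Dom v)). pt (Fn v) x = u \<and> residue_iso (Fn v) x)"

text \<open>\<open>p\<close> is the projection of the affine line over \<open>Cod p\<close>: together with a global function \<open>t\<close>
  it represents \<open>T \<mapsto> \<O>(T)\<close> on schemes over \<open>Cod p\<close>.\<close>

definition affine_line :: "('a, 'a) rspace \<Rightarrow> 'a smarr \<Rightarrow> bool" where
  "affine_line X p \<longleftrightarrow> p \<in> Ar (Sm X) \<and>
     (let L = src (Dom p); Y = src (Cod p) in
      \<exists>t\<in>carrier (Sec L (pts L)).
        \<forall>(g :: ('a, 'a, 'a, 'a) morph) s. scheme (src g) \<and> lrs_morph g \<and> tgt g = Y \<and>
          s \<in> carrier (Sec (src g) (pts (src g))) \<longrightarrow>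
          (\<exists>!h. lrs_morph h \<and> src h = src g \<and> tgt h = L \<and> mcomp (Fn p) h = g \<and> sh h (pts L) t = s))"

section \<open>Simplicial sets\<close>

definition Delta :: "nat \<Rightarrow> nat \<Rightarrow> (nat \<Rightarrow> nat) set" where
  "Delta m n = {\<theta> \<in> {..m} \<rightarrow>\<^sub>E {..n}. mono_on {..m} \<theta>}"

definition coface :: "nat \<Rightarrow> nat \<Rightarrow> nat" where
  "coface j i = (if i < j then i else Suc i)"

text \<open>\<open>Op S m n \<theta>\<close> is the map from \<open>n\<close>-simplices to \<open>m\<close>-simplices given by \<open>\<theta> \<in> Delta m n\<close>.\<close>

record 's sset =
  Spx :: "nat \<Rightarrow> 's set"
  Op :: "nat \<Rightarrow> nat \<Rightarrow> (nat \<Rightarrow> nat) \<Rightarrow> 's \<Rightarrow> 's"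

definition is_sset :: "'s sset \<Rightarrow> bool" where
  "is_sset S \<longleftrightarrow>
     (\<forall>m n. \<forall>\<theta>\<in>Delta m n. Op S m n \<theta> \<in> Spx S n \<rightarrow> Spx S m) \<and>
     (\<forall>n. \<forall>x\<in>Spx S n. Op S n n (\<lambda>i\<in>{..n}. i) x = x) \<and>
     (\<forall>k m n. \<forall>\<phi>\<in>Delta k m. \<forall>\<theta>\<in>Delta m n. \<forall>x\<in>Spx S n.
        Op S k m \<phi> (Op S m n \<theta> x) = Op S k n (compose {..k} \<theta> \<phi>) x)"

definition is_smap :: "'s sset \<Rightarrow> 't sset \<Rightarrow> (nat \<Rightarrow> 's \<Rightarrow> 't) \<Rightarrow> bool" where
  "is_smap S T f \<longleftrightarrow> (\<forall>n. f n \<in> Spx S n \<rightarrow> Spx T n) \<and>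
     (\<forall>m n. \<forall>\<theta>\<in>Delta m n. \<forall>x\<in>Spx S n. f m (Op S m n \<theta> x) = Op T m n \<theta> (f n x))"

definition face :: "'s sset \<Rightarrow> nat \<Rightarrow> nat \<Rightarrow> 's \<Rightarrow> 's" where
  "face S n j = Op S (n - 1) n (restrict (coface j) {..n - 1})"

definition kan_fibration :: "'s sset \<Rightarrow> 't sset \<Rightarrow> (nat \<Rightarrow> 's \<Rightarrow> 't) \<Rightarrow> bool" where
  "kan_fibration S T f \<longleftrightarrow>
     (\<forall>n k x y. 1 \<le> n \<and> k \<le> n \<and> y \<in> Spx T n \<and>
        (\<forall>j\<le>n. j \<noteq> k \<longrightarrow> x j \<in> Spx S (n - 1) \<and> f (n - 1) (x j) = face T n j y) \<and>
        (2 \<le> n \<longrightarrow> (\<forall>i j. i < j \<and> j \<le> n \<and> i \<noteq> k \<and> j \<noteq> k \<longrightarrow>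
           face S (n - 1) i (x j) = face S (n - 1) (j - 1) (x i))) \<longrightarrow>
        (\<exists>z\<in>Spx S n. f n z = y \<and> (\<forall>j\<le>n. j \<noteq> k \<longrightarrow> face S n j z = x j)))"

subsection \<open>Geometric realization and weak equivalences\<close>

definition push :: "nat \<Rightarrow> (nat \<Rightarrow> nat) \<Rightarrow> (nat \<Rightarrow> real) \<Rightarrow> nat \<Rightarrow> real" where
  "push m \<theta> t = (\<lambda>j. \<Sum>i | i \<le> m \<and> \<theta> i = j. t i)"

definition real_points :: "'s sset \<Rightarrow> (nat \<times> 's \<times> (nat \<Rightarrow> real)) set" where
  "real_points S = {(n, x, t). x \<in> Spx S n \<and> t \<in> standard_simplex n}"

definition real_step :: "'s sset \<Rightarrow> (nat \<times> 's \<times> (nat \<Rightarrow> real)) rel" where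
  "real_step S = {((m, Op S m n \<theta> x, t), (n, x, push m \<theta> t)) | m n \<theta> x t.
     \<theta> \<in> Delta m n \<and> x \<in> Spx S n \<and> t \<in> standard_simplex m}"

definition real_class ::
  "'s sset \<Rightarrow> nat \<times> 's \<times> (nat \<Rightarrow> real) \<Rightarrow> (nat \<times> 's \<times> (nat \<Rightarrow> real)) set" where
  "real_class S z = (real_step S \<union> (real_step S)\<inverse>)\<^sup>* `` {z}"

definition realization :: "'s sset \<Rightarrow> (nat \<times> 's \<times> (nat \<Rightarrow> real)) set topology" where
  "realization S = topology (\<lambda>U. U \<subseteq> real_class S ` real_points S \<and>
     (\<forall>n. \<forall>x\<in>Spx S n. openin (subtopology (powertop_real UNIV) (standard_simplex n))
        {t \<in> standard_simplex n. real_class S (n, x, t) \<in> U}))"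

definition real_map :: "'s sset \<Rightarrow> 't sset \<Rightarrow> (nat \<Rightarrow> 's \<Rightarrow> 't) \<Rightarrow>
    (nat \<times> 's \<times> (nat \<Rightarrow> real)) set \<Rightarrow> (nat \<times> 't \<times> (nat \<Rightarrow> real)) set" where
  "real_map S T f c = (THE d. \<exists>n x t. (n, x, t) \<in> real_points S \<and> c = real_class S (n, x, t) \<and>
     d = real_class T (n, f n x, t))"

definition real_vertex :: "'s sset \<Rightarrow> 's \<Rightarrow> (nat \<times> 's \<times> (nat \<Rightarrow> real)) set" where
  "real_vertex S x = real_class S (0, x, \<lambda>i. if i = 0 then 1 else 0)"

definition cube :: "nat \<Rightarrow> (nat \<Rightarrow> real) set" where
  "cube n = {t. (\<forall>i. 0 \<le> t i \<and> t i \<le> 1) \<and> (\<forall>i\<ge>n. t i = 0)}"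

definition cube_bd :: "nat \<Rightarrow> (nat \<Rightarrow> real) set" where
  "cube_bd n = {t \<in> cube n. \<exists>i<n. t i = 0 \<or> t i = 1}"

definition cube_homotopic :: "nat \<Rightarrow> 'x topology \<Rightarrow> 'x \<Rightarrow>
    ((nat \<Rightarrow> real) \<Rightarrow> 'x) \<Rightarrow> ((nat \<Rightarrow> real) \<Rightarrow> 'x) \<Rightarrow> bool" where
  "cube_homotopic n T x =
     homotopic_with (\<lambda>h. \<forall>t\<in>cube_bd n. h t = x) (subtopology (powertop_real UNIV) (cube n)) T"

text \<open>The underlying set of \<open>\<pi>\<^sub>n(T, x)\<close>. For \<open>n = 0\<close> the boundary of the cube is empty, so that
  \<open>x\<close> plays no role.\<close>

definition pi_set :: "nat \<Rightarrow> 'x topology \<Rightarrow> 'x \<Rightarrow> ((nat \<Rightarrow> real) \<Rightarrow> 'x) set set" where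
  "pi_set n T x = {Collect (cube_homotopic n T x \<alpha>) | \<alpha>. cube_homotopic n T x \<alpha> \<alpha>}"

definition pi_map :: "nat \<Rightarrow> 'y topology \<Rightarrow> 'y \<Rightarrow> ('x \<Rightarrow> 'y) \<Rightarrow>
    ((nat \<Rightarrow> real) \<Rightarrow> 'x) set \<Rightarrow> ((nat \<Rightarrow> real) \<Rightarrow> 'y) set" where
  "pi_map n T y g c = {\<beta>. \<exists>\<alpha>\<in>c. cube_homotopic n T y (g \<circ> \<alpha>) \<beta>}"

definition spi :: "nat \<Rightarrow> 's sset \<Rightarrow> 's \<Rightarrow>
    ((nat \<Rightarrow> real) \<Rightarrow> (nat \<times> 's \<times> (nat \<Rightarrow> real)) set) set set" where
  "spi n S x = pi_set n (realization S) (real_vertex S x)"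

definition spi_map :: "nat \<Rightarrow> 's sset \<Rightarrow> 't sset \<Rightarrow> 't \<Rightarrow> (nat \<Rightarrow> 's \<Rightarrow> 't) \<Rightarrow>
    ((nat \<Rightarrow> real) \<Rightarrow> (nat \<times> 's \<times> (nat \<Rightarrow> real)) set) set \<Rightarrow>
    ((nat \<Rightarrow> real) \<Rightarrow> (nat \<times> 't \<times> (nat \<Rightarrow> real)) set) set" where
  "spi_map n S T y f = pi_map n (realization T) (real_vertex T y) (real_map S T f)"

definition weak_equiv :: "'s sset \<Rightarrow> 't sset \<Rightarrow> (nat \<Rightarrow> 's \<Rightarrow> 't) \<Rightarrow> bool" where
  "weak_equiv S T f \<longleftrightarrow> (\<forall>n x. n = 0 \<or> x \<in> Spx S 0 \<longrightarrow>
     bij_betw (spi_map n S T (f 0 x) f) (spi n S x) (spi n T (f 0 x)))"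

section \<open>Simplicial presheaves\<close>

record ('a, 'b) spsh =
  Val :: "'a smobj \<Rightarrow> 'b sset"
  Rst :: "'a smarr \<Rightarrow> nat \<Rightarrow> 'b \<Rightarrow> 'b"

record ('a, 'b) pspsh = "('a, 'b) spsh" +
  Bpt :: "'a smobj \<Rightarrow> nat \<Rightarrow> 'b"

type_synonym ('a, 'b) family = "'a smobj \<Rightarrow> nat \<Rightarrow> 'b \<Rightarrow> 'b"
type_synonym ('a, 'b) parr = "(('a, 'b) pspsh, ('a, 'b) family) arrow"

definition is_presheaf :: "('a, 'a) rspace \<Rightarrow> ('a, 'b, 'm) spsh_scheme \<Rightarrow> bool" where
  "is_presheaf X P \<longleftrightarrow>
     (\<forall>Y\<in>Ob (Sm X). is_sset (Val P Y)) \<and>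
     (\<forall>u\<in>Ar (Sm X). is_smap (Val P (Cod u)) (Val P (Dom u)) (Rst P u)) \<and>
     (\<forall>Y\<in>Ob (Sm X). \<forall>n. \<forall>x\<in>Spx (Val P Y) n. Rst P (Idn (Sm X) Y) n x = x) \<and>
     (\<forall>u\<in>Ar (Sm X). \<forall>v\<in>Ar (Sm X). Dom u = Cod v \<longrightarrow>
        (\<forall>n. \<forall>x\<in>Spx (Val P (Cod u)) n. Rst P (Cmp (Sm X) u v) n x = Rst P v n (Rst P u n x)))"

definition is_pointed_presheaf :: "('a, 'a) rspace \<Rightarrow> ('a, 'b) pspsh \<Rightarrow> bool" where
  "is_pointed_presheaf X P \<longleftrightarrow> is_presheaf X P \<and>
     (\<forall>Y\<in>Ob (Sm X). \<forall>n. Bpt P Y n \<in> Spx (Val P Y) n) \<and>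
     (\<forall>Y\<in>Ob (Sm X). \<forall>m n. \<forall>\<theta>\<in>Delta m n. Op (Val P Y) m n \<theta> (Bpt P Y n) = Bpt P Y m) \<and>
     (\<forall>u\<in>Ar (Sm X). \<forall>n. Rst P u n (Bpt P (Cod u) n) = Bpt P (Dom u) n)"

definition canon :: "('a, 'a) rspace \<Rightarrow> ('a, 'b, 'm) spsh_scheme \<Rightarrow> ('a, 'b) family \<Rightarrow>
    ('a, 'b) family" where
  "canon X P F = (\<lambda>Y n. if Y \<in> Ob (Sm X) then restrict (F Y n) (Spx (Val P Y) n) else (\<lambda>_. undefined))"

definition is_presheaf_map :: "('a, 'a) rspace \<Rightarrow>
    (('a, 'b, 'm) spsh_scheme, ('a, 'b) family) arrow \<Rightarrow> bool" where
  "is_presheaf_map X f \<longleftrightarrow>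
     (\<forall>Y\<in>Ob (Sm X). is_smap (Val (Dom f) Y) (Val (Cod f) Y) (Fn f Y)) \<and>
     (\<forall>u\<in>Ar (Sm X). \<forall>n. \<forall>x\<in>Spx (Val (Dom f) (Cod u)) n.
        Fn f (Dom u) n (Rst (Dom f) u n x) = Rst (Cod f) u n (Fn f (Cod u) n x)) \<and>
     Fn f = canon X (Dom f) (Fn f)"

definition id_map :: "('a, 'a) rspace \<Rightarrow> ('a, 'b, 'm) spsh_scheme \<Rightarrow>
    (('a, 'b, 'm) spsh_scheme, ('a, 'b) family) arrow" where
  "id_map X P = Arr P P (canon X P (\<lambda>Y n x. x))"

definition comp_map :: "('a, 'a) rspace \<Rightarrow>
    (('a, 'b, 'm) spsh_scheme, ('a, 'b) family) arrow \<Rightarrow>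
    (('a, 'b, 'm) spsh_scheme, ('a, 'b) family) arrow \<Rightarrow>
    (('a, 'b, 'm) spsh_scheme, ('a, 'b) family) arrow" where
  "comp_map X g f = Arr (Dom f) (Cod g) (canon X (Dom f) (\<lambda>Y n x. Fn g Y n (Fn f Y n x)))"

definition sPre :: "('a, 'a) rspace \<Rightarrow> (('a, 'b) spsh, ('a, 'b) family) category" where
  "sPre X =
    \<lparr>Ob = {P. is_presheaf X P},
     Ar = {f. is_presheaf X (Dom f) \<and> is_presheaf X (Cod f) \<and> is_presheaf_map X f},
     Idn = id_map X, Cmp = comp_map X\<rparr>"

definition psPre :: "('a, 'a) rspace \<Rightarrow> (('a, 'b) pspsh, ('a, 'b) family) category" where
  "psPre X =
    \<lparr>Ob = {P. is_pointed_presheaf X P},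
     Ar = {f. is_pointed_presheaf X (Dom f) \<and> is_pointed_presheaf X (Cod f) \<and> is_presheaf_map X f \<and>
              (\<forall>Y\<in>Ob (Sm X). \<forall>n. Fn f Y n (Bpt (Dom f) Y n) = Bpt (Cod f) Y n)},
     Idn = id_map X, Cmp = comp_map X\<rparr>"

definition forget :: "('a, 'b) pspsh \<Rightarrow> ('a, 'b) spsh" where
  "forget P = \<lparr>Val = Val P, Rst = Rst P\<rparr>"

definition forget_map :: "('a, 'b) parr \<Rightarrow> (('a, 'b) spsh, ('a, 'b) family) arrow" where
  "forget_map f = Arr (forget (Dom f)) (forget (Cod f)) (Fn f)"

definition point :: "('a, 'b) pspsh" where
  "point = \<lparr>Val = (\<lambda>_. \<lparr>Spx = (\<lambda>_. {undefined}), Op = (\<lambda>_ _ _ x. x)\<rparr>),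
     Rst = (\<lambda>_ _ x. x), Bpt = (\<lambda>_ _. undefined)\<rparr>"

definition zero_map :: "('a, 'a) rspace \<Rightarrow> ('a, 'b) pspsh \<Rightarrow> ('a, 'b) pspsh \<Rightarrow> ('a, 'b) parr" where
  "zero_map X P Q = Arr P Q (canon X P (\<lambda>Y n _. Bpt Q Y n))"

definition fibre :: "('a, 'b) parr \<Rightarrow> ('a, 'b) pspsh" where
  "fibre f =
    \<lparr>Val = (\<lambda>Y. \<lparr>Spx = (\<lambda>n. {x \<in> Spx (Val (Dom f) Y) n. Fn f Y n x = Bpt (Cod f) Y n}),
                 Op = Op (Val (Dom f) Y)\<rparr>),
     Rst = Rst (Dom f), Bpt = Bpt (Dom f)\<rparr>"

definition fibre_incl :: "('a, 'a) rspace \<Rightarrow> ('a, 'b) parr \<Rightarrow> ('a, 'b) parr" where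
  "fibre_incl X f = Arr (fibre f) (Dom f) (canon X (fibre f) (\<lambda>Y n x. x))"

subsection \<open>Smashing with a simplicial set\<close>

text \<open>An \<open>n\<close>-simplex of the standard \<open>k\<close>-simplex is the sorted list of its \<open>n + 1\<close> vertices. In
  quotients, the empty list is the base point.\<close>

definition simplex :: "nat \<Rightarrow> nat \<Rightarrow> nat list set" where
  "simplex k n = {t. length t = Suc n \<and> sorted t \<and> set t \<subseteq> {..k}}"

definition list_op :: "nat \<Rightarrow> (nat \<Rightarrow> nat) \<Rightarrow> nat list \<Rightarrow> nat list" where
  "list_op m \<theta> t = map (\<lambda>i. t ! \<theta> i) [0..<Suc m]"

definition simplex_quot :: "nat \<Rightarrow> (nat list \<Rightarrow> bool) \<Rightarrow> nat list sset" where
  "simplex_quot k Q =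
    \<lparr>Spx = (\<lambda>n. insert [] {t \<in> simplex k n. \<not> Q t}),
     Op = (\<lambda>m n \<theta> t. if t = [] \<or> Q (list_op m \<theta> t) then [] else list_op m \<theta> t)\<rparr>"

definition simplex_plus :: "nat \<Rightarrow> nat list sset" where
  "simplex_plus k = simplex_quot k (\<lambda>_. False)"

definition constant_list :: "nat list \<Rightarrow> bool" where
  "constant_list t \<longleftrightarrow> card (set t) = 1"

text \<open>The standard \<open>k\<close>-simplex with its vertices identified; for \<open>k = 1\<close> this is the simplicial
  circle.\<close>

definition simplex_mod_vertices :: "nat \<Rightarrow> nat list sset" where
  "simplex_mod_vertices k = simplex_quot k constant_list"

abbreviation circle :: "nat list sset"
  where "circle \<equiv> simplex_mod_vertices 1"

text \<open>\<open>enc\<close> is injective when \<^typ>\<open>'b\<close> is infinite.\<close>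

definition enc :: "nat list \<times> 'b \<Rightarrow> 'b" where
  "enc = (SOME e. inj e)"

definition dec :: "'b \<Rightarrow> nat list \<times> 'b" where
  "dec = inv_into UNIV enc"

definition smash_pair :: "('a, 'b) pspsh \<Rightarrow> 'a smobj \<Rightarrow> nat \<Rightarrow> nat list \<Rightarrow> 'b \<Rightarrow> 'b" where
  "smash_pair A Y n t a = (if t = [] \<or> a = Bpt A Y n then enc ([], undefined) else enc (t, a))"

definition smash :: "nat list sset \<Rightarrow> ('a, 'b) pspsh \<Rightarrow> ('a, 'b) pspsh" where
  "smash T A =
    \<lparr>Val = (\<lambda>Y. \<lparr>Spx = (\<lambda>n. {smash_pair A Y n t a | t a. t \<in> Spx T n \<and> a \<in> Spx (Val A Y) n}),
        Op = (\<lambda>m n \<theta> w. case dec w of (t, a) \<Rightarrow>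
                smash_pair A Y m (Op T m n \<theta> t) (Op (Val A Y) m n \<theta> a))\<rparr>),
     Rst = (\<lambda>u n w. case dec w of (t, a) \<Rightarrow> smash_pair A (Dom u) n t (Rst A u n a)),
     Bpt = (\<lambda>_ _. enc ([], undefined))\<rparr>"

definition smash_map :: "('a, 'a) rspace \<Rightarrow> nat list sset \<Rightarrow> ('a, 'b) parr \<Rightarrow> ('a, 'b) parr" where
  "smash_map X T f = Arr (smash T (Dom f)) (smash T (Cod f))
     (canon X (smash T (Dom f))
        (\<lambda>Y n w. case dec w of (t, a) \<Rightarrow> smash_pair (Cod f) Y n t (Fn f Y n a)))"

definition smash_left :: "('a, 'a) rspace \<Rightarrow> nat list sset \<Rightarrow> nat list sset \<Rightarrow>
    (nat list \<Rightarrow> nat list) \<Rightarrow> ('a, 'b) pspsh \<Rightarrow> ('a, 'b) parr" where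
  "smash_left X T T' \<phi> A = Arr (smash T A) (smash T' A)
     (canon X (smash T A) (\<lambda>Y n w. case dec w of (t, a) \<Rightarrow> smash_pair A Y n (\<phi> t) a))"

text \<open>\<open>S\<^sup>r \<and> K\<close>, with the \<open>r\<close>-fold smash power of the circle bracketed to the right.\<close>

definition susp :: "nat \<Rightarrow> ('a, 'b) pspsh \<Rightarrow> ('a, 'b) pspsh" where
  "susp r K = (smash circle ^^ r) K"

text \<open>The inclusion of \<open>A\<close> at the vertex \<open>v\<close> of the cylinder, and the collapse of its two ends.\<close>

definition cyl_end :: "('a, 'a) rspace \<Rightarrow> nat \<Rightarrow> ('a, 'b) pspsh \<Rightarrow> ('a, 'b) parr" where
  "cyl_end X v A = Arr A (smash (simplex_plus 1) A)
     (canon X A (\<lambda>Y n a. smash_pair A Y n (replicate (Suc n) v) a))"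

definition cyl_collapse :: "('a, 'a) rspace \<Rightarrow> ('a, 'b) pspsh \<Rightarrow> ('a, 'b) parr" where
  "cyl_collapse X A =
     smash_left X (simplex_plus 1) circle (\<lambda>t. if constant_list t then [] else t) A"

subsection \<open>Mapping spaces\<close>

definition pMap :: "('a, 'a) rspace \<Rightarrow> ('a, 'b) pspsh \<Rightarrow> ('a, 'b) pspsh \<Rightarrow> ('a, 'b) parr sset" where
  "pMap X A B =
    \<lparr>Spx = (\<lambda>n. homset (psPre X) (smash (simplex_plus n) A) B),
     Op = (\<lambda>m n \<theta> \<sigma>. Cmp (psPre X) \<sigma> (smash_left X (simplex_plus m) (simplex_plus n) (map \<theta>) A))\<rparr>"

definition pMap_pre :: "('a, 'a) rspace \<Rightarrow> ('a, 'b) parr \<Rightarrow> nat \<Rightarrow> ('a, 'b) parr \<Rightarrow> ('a, 'b) parr" where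
  "pMap_pre X f n \<sigma> = Cmp (psPre X) \<sigma> (smash_map X (simplex_plus n) f)"

definition tensor :: "nat \<Rightarrow> ('a, 'b) spsh \<Rightarrow> ('a, 'b) spsh" where
  "tensor k P =
    \<lparr>Val = (\<lambda>Y. \<lparr>Spx = (\<lambda>n. enc ` (simplex k n \<times> Spx (Val P Y) n)),
        Op = (\<lambda>m n \<theta> w. case dec w of (t, a) \<Rightarrow> enc (list_op m \<theta> t, Op (Val P Y) m n \<theta> a))\<rparr>),
     Rst = (\<lambda>u n w. case dec w of (t, a) \<Rightarrow> enc (t, Rst P u n a))\<rparr>"

definition uMap :: "('a, 'a) rspace \<Rightarrow> ('a, 'b) spsh \<Rightarrow> ('a, 'b) spsh \<Rightarrow>
    (('a, 'b) spsh, ('a, 'b) family) arrow sset" where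
  "uMap X P Z =
    \<lparr>Spx = (\<lambda>n. homset (sPre X) (tensor n P) Z),
     Op = (\<lambda>m n \<theta> \<sigma>. Cmp (sPre X) \<sigma> (Arr (tensor m P) (tensor n P)
        (canon X (tensor m P) (\<lambda>Y l w. case dec w of (t, a) \<Rightarrow> enc (map \<theta> t, a)))))\<rparr>"

definition uMap_pre :: "('a, 'a) rspace \<Rightarrow> (('a, 'b) spsh, ('a, 'b) family) arrow \<Rightarrow> nat \<Rightarrow>
    (('a, 'b) spsh, ('a, 'b) family) arrow \<Rightarrow> (('a, 'b) spsh, ('a, 'b) family) arrow" where
  "uMap_pre X f n \<sigma> = Cmp (sPre X) \<sigma> (Arr (tensor n (Dom f)) (tensor n (Cod f))
     (canon X (tensor n (Dom f)) (\<lambda>Y l w. case dec w of (t, a) \<Rightarrow> enc (t, Fn f Y l a))))"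

section \<open>The motivic model structure\<close>

text \<open>Isomorphisms on all Nisnevich sheaves of homotopy groups: for each \<open>U\<close> and base point the
  maps of presheaves of homotopy groups are locally injective and locally surjective.\<close>

definition local_weak_equiv :: "('a, 'a) rspace \<Rightarrow>
    (('a, 'b) spsh, ('a, 'b) family) arrow \<Rightarrow> bool" where
  "local_weak_equiv X f \<longleftrightarrow> f \<in> Ar (sPre X) \<and>
     (\<forall>U\<in>Ob (Sm X). \<forall>n x. n = 0 \<or> x \<in> Spx (Val (Dom f) U) 0 \<longrightarrow>
       (let P = Dom f; Q = Cod f;
            F = (\<lambda>V x. spi_map n (Val P V) (Val Q V) (Fn f V 0 x) (Fn f V));
            rP = (\<lambda>v. spi_map n (Val P U) (Val P (Dom v)) (Rst P v 0 x) (Rst P v));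
            rQ = (\<lambda>v. spi_map n (Val Q U) (Val Q (Dom v)) (Rst Q v 0 (Fn f U 0 x)) (Rst Q v))
        in (\<forall>a\<in>spi n (Val P U) x. \<forall>b\<in>spi n (Val P U) x. F U x a = F U x b \<longrightarrow>
              (\<exists>S. nis_cover X U S \<and> (\<forall>v\<in>S. rP v a = rP v b))) \<and>
           (\<forall>c\<in>spi n (Val Q U) (Fn f U 0 x).
              \<exists>S. nis_cover X U S \<and> (\<forall>v\<in>S. \<exists>a\<in>spi n (Val P (Dom v)) (Rst P v 0 x).
                F (Dom v) (Rst P v 0 x) a = rQ v c))))"

definition motivic_fibrant :: "('a, 'a) rspace \<Rightarrow> ('a, 'b) spsh \<Rightarrow> bool" where
  "motivic_fibrant X Z \<longleftrightarrow> Z \<in> Ob (sPre X) \<and>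
     (\<forall>j u. j \<in> monomorphisms (sPre X) \<and> local_weak_equiv X j \<and> u \<in> homset (sPre X) (Dom j) Z \<longrightarrow>
        (\<exists>w\<in>homset (sPre X) (Cod j) Z. Cmp (sPre X) w j = u)) \<and>
     (\<forall>p. affine_line X p \<longrightarrow> weak_equiv (Val Z (Cod p)) (Val Z (Dom p)) (Rst Z p))"

definition motivic_weq :: "('a, 'a) rspace \<Rightarrow> ('a, 'b) parr set" where
  "motivic_weq X = {f \<in> Ar (psPre X). let g = forget_map f in
     \<forall>Z. motivic_fibrant X Z \<longrightarrow> weak_equiv (uMap X (Cod g) Z) (uMap X (Dom g) Z) (uMap_pre X g)}"

definition motivic_fib :: "('a, 'a) rspace \<Rightarrow> ('a, 'b) parr set" where
  "motivic_fib X = rlp (psPre X) (monomorphisms (psPre X) \<inter> motivic_weq X)"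

definition pMap_pullback :: "('a, 'a) rspace \<Rightarrow> ('a, 'b) parr \<Rightarrow> ('a, 'b) parr \<Rightarrow>
    (('a, 'b) parr \<times> ('a, 'b) parr) sset" where
  "pMap_pullback X i p =
    \<lparr>Spx = (\<lambda>n. {(a, b). a \<in> Spx (pMap X (Dom i) (Dom p)) n \<and> b \<in> Spx (pMap X (Cod i) (Cod p)) n \<and>
              Cmp (psPre X) p a = pMap_pre X i n b}),
     Op = (\<lambda>m n \<theta> (a, b). (Op (pMap X (Dom i) (Dom p)) m n \<theta> a, Op (pMap X (Cod i) (Cod p)) m n \<theta> b))\<rparr>"

text \<open>Quillen's axiom SM7 for the standard simplicial enrichment \<^const>\<open>pMap\<close>.\<close>

definition simplicial_model :: "('a, 'a) rspace \<Rightarrow> ('a, 'b) parr set \<Rightarrow> ('a, 'b) parr set \<Rightarrow>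
    ('a, 'b) parr set \<Rightarrow> bool" where
  "simplicial_model X W Cf Fb \<longleftrightarrow> model_category (psPre X) W Cf Fb \<and>
     (\<forall>i\<in>Cf. \<forall>p\<in>Fb.
        let S = pMap X (Cod i) (Dom p); T = pMap_pullback X i p;
            f = (\<lambda>n \<sigma>. (pMap_pre X i n \<sigma>, Cmp (psPre X) p \<sigma>))
        in kan_fibration S T f \<and> (i \<in> W \<or> p \<in> W \<longrightarrow> weak_equiv S T f))"

definition is_fibrant :: "('a, 'a) rspace \<Rightarrow> ('a, 'b) parr set \<Rightarrow> ('a, 'b) pspsh \<Rightarrow> bool" where
  "is_fibrant X Fb A \<longleftrightarrow> A \<in> Ob (psPre X) \<and> zero_map X A point \<in> Fb"

definition is_cofibrant :: "('a, 'a) rspace \<Rightarrow> ('a, 'b) parr set \<Rightarrow> ('a, 'b) pspsh \<Rightarrow> bool" where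
  "is_cofibrant X Cf A \<longleftrightarrow> A \<in> Ob (psPre X) \<and> zero_map X point A \<in> Cf"

section \<open>The localizations \<open>WB\<^sub>n\<M>\<close>\<close>

text \<open>\<open>rep_enc\<close> is injective for \<^typ>\<open>'b\<close> large enough.\<close>

definition rep_enc :: "'a smarr option \<Rightarrow> 'b" where
  "rep_enc = (SOME e. inj e)"

definition rep_plus :: "('a, 'a) rspace \<Rightarrow> 'a smobj \<Rightarrow> ('a, 'b) pspsh" where
  "rep_plus X Y =
    \<lparr>Val = (\<lambda>V. \<lparr>Spx = (\<lambda>_. rep_enc ` insert None (Some ` homset (Sm X) V Y)), Op = (\<lambda>_ _ _ w. w)\<rparr>),
     Rst = (\<lambda>v _ w. rep_enc (map_option (\<lambda>u. Cmp (Sm X) u v) (inv_into UNIV rep_enc w))),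
     Bpt = (\<lambda>_ _. rep_enc (None :: 'a smarr option))\<rparr>"

definition rep_plus_map :: "('a, 'a) rspace \<Rightarrow> 'a smarr \<Rightarrow> ('a, 'b) parr" where
  "rep_plus_map X j = Arr (rep_plus X (Dom j)) (rep_plus X (Cod j))
     (canon X (rep_plus X (Dom j))
        (\<lambda>V n w. rep_enc (map_option (\<lambda>u. Cmp (Sm X) j u) (inv_into UNIV rep_enc w))))"

definition WB :: "('a, 'a) rspace \<Rightarrow> nat \<Rightarrow> ('a, 'b) parr set" where
  "WB X n = {rep_plus_map X j | j. j \<in> Ar (Sm X) \<and> open_immersion (Fn j) \<and>
     (let Y = src (Cod j); Z = pts Y - pt (Fn j) ` pts (src (Fn j)) in
       irreducible_set (sp Y) (pts Y) \<and>
       (\<exists>i :: ('a, 'a, 'a, 'a) morph. closed_immersion i \<and> tgt i = Y \<and> reduced_scheme (src i) \<and>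
          pt i ` pts (src i) = Z \<and> mcomp (Cod j) i \<in> Ob (Sm X)) \<and>
       enat (Suc n) \<le> codim Y Z)}"

text \<open>Left Bousfield localization of the motivic structure at a set \<open>S\<close> of maps: the cofibrations
  are unchanged. All objects are cofibrant, so \<^const>\<open>pMap\<close> into fibrant objects computes
  homotopy function complexes.\<close>

definition local_object :: "('a, 'a) rspace \<Rightarrow> ('a, 'b) parr set \<Rightarrow> ('a, 'b) pspsh \<Rightarrow> bool" where
  "local_object X S Z \<longleftrightarrow> is_fibrant X (motivic_fib X) Z \<and>
     (\<forall>f\<in>S. weak_equiv (pMap X (Cod f) Z) (pMap X (Dom f) Z) (pMap_pre X f))"

definition local_weq :: "('a, 'a) rspace \<Rightarrow> ('a, 'b) parr set \<Rightarrow> ('a, 'b) parr set" where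
  "local_weq X S = {f \<in> Ar (psPre X). \<forall>Z. local_object X S Z \<longrightarrow>
     weak_equiv (pMap X (Cod f) Z) (pMap X (Dom f) Z) (pMap_pre X f)}"

definition local_fib :: "('a, 'a) rspace \<Rightarrow> ('a, 'b) parr set \<Rightarrow> ('a, 'b) parr set" where
  "local_fib X S = rlp (psPre X) (monomorphisms (psPre X) \<inter> local_weq X S)"

section \<open>The tower\<close>

text \<open>\<open>\<Phi> n\<close> is the factorization used in \<open>WB\<^sub>n\<M>\<close>. With \<open>\<tau>\<^sub>0A = *\<close>, the map \<open>\<tau>\<^sub>\<le>\<^sub>1\<close> arises by the same
  rule as the others.\<close>

primrec tau_le :: "('a, 'a) rspace \<Rightarrow> (nat \<Rightarrow> ('a, 'b) parr \<Rightarrow> ('a, 'b) parr \<times> ('a, 'b) parr) \<Rightarrow>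
    ('a, 'b) pspsh \<Rightarrow> nat \<Rightarrow> ('a, 'b) parr" where
  "tau_le X \<Phi> A 0 = zero_map X A point"
| "tau_le X \<Phi> A (Suc n) = fst (\<Phi> n (tau_le X \<Phi> A n))"

definition tau where "tau X \<Phi> A n = Cod (tau_le X \<Phi> A n)"

definition nu where "nu X \<Phi> A n = snd (\<Phi> n (tau_le X \<Phi> A n))"

definition sfib where "sfib X \<Phi> A n = (if n = 0 then tau X \<Phi> A 1 else fibre (nu X \<Phi> A n))"

definition sincl where
  "sincl X \<Phi> A n = (if n = 0 then Idn (psPre X) (tau X \<Phi> A 1) else fibre_incl X (nu X \<Phi> A n))"

section \<open>The homotopy category\<close>

type_synonym ('a, 'b) harr = "(('a, 'b) pspsh, ('a, 'b) parr zig list set) arrow"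

definition HoC :: "('a, 'a) rspace \<Rightarrow> (('a, 'b) pspsh, ('a, 'b) parr zig list set) category" where
  "HoC X = localization (psPre X) (motivic_weq X)"

definition Ho :: "('a, 'a) rspace \<Rightarrow> ('a, 'b) parr \<Rightarrow> ('a, 'b) harr" where
  "Ho X = loc_fun (psPre X) (motivic_weq X)"

definition Hsusp :: "('a, 'a) rspace \<Rightarrow> ('a, 'b) harr \<Rightarrow> ('a, 'b) harr" where
  "Hsusp X \<phi> = Arr (smash circle (Dom \<phi>)) (smash circle (Cod \<phi>))
     {r. \<exists>p\<in>Fn \<phi>. zeq (psPre X) (motivic_weq X) (smash circle (Dom \<phi>)) (smash circle (Cod \<phi>))
           (map (map_zig (smash_map X circle)) p) r}"

definition adjoint_map :: "('a, 'a) rspace \<Rightarrow> ('a, 'b) harr \<Rightarrow> ('a, 'b) harr \<Rightarrow> ('a, 'b) harr" where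
  "adjoint_map X \<epsilon> \<phi> = Cmp (HoC X) \<epsilon> (Hsusp X \<phi>)"

text \<open>\<open>\<Omega>\<close> with counit \<open>\<epsilon>\<close> is a right adjoint of \<open>S\<^sup>1 \<and> -\<close> on the homotopy category.\<close>

definition loop_adjunction :: "('a, 'a) rspace \<Rightarrow> (('a, 'b) pspsh \<Rightarrow> ('a, 'b) pspsh) \<Rightarrow>
    (('a, 'b) pspsh \<Rightarrow> ('a, 'b) harr) \<Rightarrow> bool" where
  "loop_adjunction X \<Omega> \<epsilon> \<longleftrightarrow> (\<forall>B\<in>Ob (HoC X). \<Omega> B \<in> Ob (HoC X) \<and>
     \<epsilon> B \<in> homset (HoC X) (smash circle (\<Omega> B)) B \<and>
     (\<forall>K\<in>Ob (HoC X). bij_betw (adjoint_map X (\<epsilon> B))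
        (homset (HoC X) K (\<Omega> B)) (homset (HoC X) (smash circle K) B)))"

text \<open>The boundary map \<open>\<Omega>B \<rightarrow> F\<close> of a fibration \<open>p\<close> from \<open>E\<close> to \<open>B\<close> with fibre inclusion \<open>i\<close> of \<open>F\<close>
  into \<open>E\<close>, for fibrant \<open>B\<close> (Quillen): lift the tautological loop, viewed as a homotopy on
  \<open>\<Omega>B\<close>, to \<open>E\<close> starting at the base point; the other end of the lift lies in \<open>F\<close>.\<close>

definition boundary_map :: "('a, 'a) rspace \<Rightarrow> (('a, 'b) pspsh \<Rightarrow> ('a, 'b) pspsh) \<Rightarrow>
    (('a, 'b) pspsh \<Rightarrow> ('a, 'b) harr) \<Rightarrow> ('a, 'b) parr \<Rightarrow> ('a, 'b) parr \<Rightarrow> ('a, 'b) harr" where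
  "boundary_map X \<Omega> \<epsilon> p i =
     (let B = Cod p; E = Dom p; F = Dom i; M = psPre X in
      THE \<delta>. \<exists>e l d. e \<in> homset M (smash circle (\<Omega> B)) B \<and> Ho X e = \<epsilon> B \<and>
        l \<in> homset M (smash (simplex_plus 1) (\<Omega> B)) E \<and>
        Cmp M p l = Cmp M e (cyl_collapse X (\<Omega> B)) \<and>
        Cmp M l (cyl_end X 0 (\<Omega> B)) = zero_map X (\<Omega> B) E \<and>
        d \<in> homset M (\<Omega> B) F \<and> Cmp M l (cyl_end X 1 (\<Omega> B)) = Cmp M i d \<and> \<delta> = Ho X d)"

text \<open>\<open>[S\<^sup>r \<and> K, B]\<close> with its base point and, for \<open>r \<ge> 1\<close>, its group structure. The latter comes from
  the outer circle coordinate: if \<open>c\<close> is a map on the 2-simplex with vertices identified (smashed with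
  \<open>K'\<close>), then the product of its faces \<open>d\<^sub>0c\<close> and \<open>d\<^sub>2c\<close> is \<open>d\<^sub>1c\<close>, as for simplicial homotopy
  groups in Goerss--Jardine, I.7. With this order the action on \<open>[K, F]\<close> by lifting is a left action. The field \<open>mult\<close> is
  meaningless for \<open>r = 0\<close>.\<close>

definition edge_map :: "('a, 'a) rspace \<Rightarrow> nat \<Rightarrow> ('a, 'b) pspsh \<Rightarrow> ('a, 'b) parr" where
  "edge_map X j K = smash_left X circle (simplex_mod_vertices 2) (map (coface j)) K"

definition Hgrp :: "('a, 'a) rspace \<Rightarrow> nat \<Rightarrow> ('a, 'b) pspsh \<Rightarrow> ('a, 'b) pspsh \<Rightarrow>
    ('a, 'b) harr monoid" where
  "Hgrp X r K B =
    \<lparr>carrier = homset (HoC X) (susp r K) B,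
     monoid.mult = (\<lambda>a b. case r of 0 \<Rightarrow> undefined | Suc r' \<Rightarrow>
       (let K' = susp r' K; H = HoC X in
        THE x. \<exists>c\<in>homset H (smash (simplex_mod_vertices 2) K') B.
          Cmp H c (Ho X (edge_map X 0 K')) = a \<and> Cmp H c (Ho X (edge_map X 2 K')) = b \<and>
          Cmp H c (Ho X (edge_map X 1 K')) = x)),
     monoid.one = Ho X (zero_map X (susp r K) B)\<rparr>"

section \<open>The exact couple\<close>

definition D1 where "D1 X \<Phi> K A p q = Hgrp X (q - p) K (tau X \<Phi> A (p + 1))"

definition E1 where "E1 X \<Phi> K A p q = Hgrp X (q - p) K (sfib X \<Phi> A p)"

definition f1 :: "('a, 'a) rspace \<Rightarrow> (nat \<Rightarrow> ('a, 'b) parr \<Rightarrow> ('a, 'b) parr \<times> ('a, 'b) parr) \<Rightarrow>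
    ('a, 'b) pspsh \<Rightarrow> nat \<Rightarrow> nat \<Rightarrow> ('a, 'b) harr \<Rightarrow> ('a, 'b) harr" where
  "f1 X \<Phi> A p q \<phi> = Cmp (HoC X) (Ho X (nu X \<Phi> A (p + 1))) \<phi>"

definition g1 :: "('a, 'a) rspace \<Rightarrow> (nat \<Rightarrow> ('a, 'b) parr \<Rightarrow> ('a, 'b) parr \<times> ('a, 'b) parr) \<Rightarrow>
    (('a, 'b) pspsh \<Rightarrow> ('a, 'b) pspsh) \<Rightarrow> (('a, 'b) pspsh \<Rightarrow> ('a, 'b) harr) \<Rightarrow>
    ('a, 'b) pspsh \<Rightarrow> ('a, 'b) pspsh \<Rightarrow> nat \<Rightarrow> nat \<Rightarrow> ('a, 'b) harr \<Rightarrow> ('a, 'b) harr" where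
  "g1 X \<Phi> \<Omega> \<epsilon> K A p q \<phi> =
     (let B = tau X \<Phi> A (p + 1) in
      Cmp (HoC X) (boundary_map X \<Omega> \<epsilon> (nu X \<Phi> A (p + 1)) (sincl X \<Phi> A (p + 1)))
        (inv_into (homset (HoC X) (susp (q - p - 1) K) (\<Omega> B)) (adjoint_map X (\<epsilon> B)) \<phi>))"

definition h1 :: "('a, 'a) rspace \<Rightarrow> (nat \<Rightarrow> ('a, 'b) parr \<Rightarrow> ('a, 'b) parr \<times> ('a, 'b) parr) \<Rightarrow>
    ('a, 'b) pspsh \<Rightarrow> nat \<Rightarrow> nat \<Rightarrow> ('a, 'b) harr \<Rightarrow> ('a, 'b) harr" where
  "h1 X \<Phi> A p q \<phi> = (if p = 0 then \<phi> else Cmp (HoC X) (Ho X (sincl X \<Phi> A p)) \<phi>)"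

definition ker_of :: "'x monoid \<Rightarrow> 'y monoid \<Rightarrow> ('x \<Rightarrow> 'y) \<Rightarrow> 'x set" where
  "ker_of G H f = {x \<in> carrier G. f x = \<one>\<^bsub>H\<^esub>}"

definition pointed_map :: "'x monoid \<Rightarrow> 'y monoid \<Rightarrow> ('x \<Rightarrow> 'y) \<Rightarrow> bool" where
  "pointed_map G H f \<longleftrightarrow> f \<in> carrier G \<rightarrow> carrier H \<and> f \<one>\<^bsub>G\<^esub> = \<one>\<^bsub>H\<^esub>"

text \<open>One stage of a Bousfield--Kan extended exact couple,
  \<open>\<dots> \<rightarrow> T\<^sub>2 \<rightarrow> S\<^sub>1 \<rightarrow> T'\<^sub>1 \<rightarrow> T\<^sub>1 \<rightarrow> S\<^sub>0 \<rightarrow> T'\<^sub>0 \<rightarrow> T\<^sub>0\<close>,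
  with \<open>f\<^sub>r : T'\<^sub>r \<rightarrow> T\<^sub>r\<close>, \<open>g\<^sub>r : T\<^sub>r\<^sub>+\<^sub>1 \<rightarrow> S\<^sub>r\<close> and \<open>h\<^sub>r : S\<^sub>r \<rightarrow> T'\<^sub>r\<close>. In degree 0 only the carrier and
  the base point are used.\<close>

definition extended_exact_stage :: "(nat \<Rightarrow> 'x monoid) \<Rightarrow> (nat \<Rightarrow> 'x monoid) \<Rightarrow> (nat \<Rightarrow> 'y monoid) \<Rightarrow>
    (nat \<Rightarrow> 'x \<Rightarrow> 'x) \<Rightarrow> (nat \<Rightarrow> 'x \<Rightarrow> 'y) \<Rightarrow> (nat \<Rightarrow> 'y \<Rightarrow> 'x) \<Rightarrow> bool" where
  "extended_exact_stage T' T S f g h \<longleftrightarrow>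
     (\<forall>r\<ge>1. group (T' r) \<and> group (T r) \<and> group (S r)) \<and>
     (\<forall>r\<ge>2. comm_group (T' r) \<and> comm_group (T r) \<and> comm_group (S r)) \<and>
     (\<forall>r\<ge>1. f r \<in> hom (T' r) (T r) \<and> g r \<in> hom (T (Suc r)) (S r) \<and> h r \<in> hom (S r) (T' r)) \<and>
     \<one>\<^bsub>T' 0\<^esub> \<in> carrier (T' 0) \<and> \<one>\<^bsub>T 0\<^esub> \<in> carrier (T 0) \<and> \<one>\<^bsub>S 0\<^esub> \<in> carrier (S 0) \<and>
     pointed_map (T' 0) (T 0) (f 0) \<and> pointed_map (T 1) (S 0) (g 0) \<and> pointed_map (S 0) (T' 0) (h 0) \<and>
     (\<forall>x\<in>g 1 ` carrier (T 2). \<forall>y\<in>carrier (S 1). x \<otimes>\<^bsub>S 1\<^esub> y = y \<otimes>\<^bsub>S 1\<^esub> x) \<and>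
     (\<forall>r. h r ` carrier (S r) = ker_of (T' r) (T r) (f r)) \<and>
     (\<forall>r. g r ` carrier (T (Suc r)) = ker_of (S r) (T' r) (h r)) \<and>
     (\<forall>r. f (Suc r) ` carrier (T' (Suc r)) = ker_of (T (Suc r)) (S r) (g r)) \<and>
     (\<exists>act. group_action (T 1) (carrier (S 0)) act \<and>
        (\<forall>a\<in>carrier (T 1). g 0 a = act a \<one>\<^bsub>S 0\<^esub>) \<and>
        (\<forall>x\<in>carrier (S 0). \<forall>y\<in>carrier (S 0).
           h 0 x = h 0 y \<longleftrightarrow> (\<exists>a\<in>carrier (T 1). y = act a x)))"

text \<open>Stage \<open>p\<close> involves \<open>D\<^sup>p\<^sup>-\<^sup>1\<^sup>,\<^sup>*\<close>, \<open>E\<^sup>p\<^sup>,\<^sup>*\<close> and \<open>D\<^sup>p\<^sup>,\<^sup>*\<close>. For \<open>p = 0\<close> the first of these is not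
  part of the couple: it is replaced by a column \<open>D0\<close> of trivial groups (here \<open>[S\<^sup>r \<and> K, *]\<close>), with
  trivial maps.\<close>

definition extended_exact_couple :: "(nat \<Rightarrow> 'x monoid) \<Rightarrow> (nat \<Rightarrow> nat \<Rightarrow> 'x monoid) \<Rightarrow>
    (nat \<Rightarrow> nat \<Rightarrow> 'y monoid) \<Rightarrow> (nat \<Rightarrow> nat \<Rightarrow> 'x \<Rightarrow> 'x) \<Rightarrow> (nat \<Rightarrow> nat \<Rightarrow> 'x \<Rightarrow> 'y) \<Rightarrow>
    (nat \<Rightarrow> nat \<Rightarrow> 'y \<Rightarrow> 'x) \<Rightarrow> bool" where
  "extended_exact_couple D0 D E f g h \<longleftrightarrow>
     (\<forall>r. carrier (D0 r) = {\<one>\<^bsub>D0 r\<^esub>}) \<and>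
     extended_exact_stage (\<lambda>r. D 0 r) D0 (\<lambda>r. E 0 r)
       (\<lambda>r _. \<one>\<^bsub>D0 r\<^esub>) (\<lambda>r _. \<one>\<^bsub>E 0 r\<^esub>) (\<lambda>r. h 0 r) \<and>
     (\<forall>p\<ge>1. extended_exact_stage (\<lambda>r. D p (p + r)) (\<lambda>r. D (p - 1) (p - 1 + r)) (\<lambda>r. E p (p + r))
       (\<lambda>r. f (p - 1) (p - 1 + r)) (\<lambda>r. g (p - 1) (p + r)) (\<lambda>r. h p (p + r)))"

end

theory Submission
  imports Defs
begin

text \<open>For fibrant \<open>B\<close> the maps from \<open>K\<close> to \<open>B\<close> in the homotopy category are simplicial homotopy classes of maps
  of presheaves, since weak equivalences act bijectively on such classes and so every zigzag acts. Axiom SM7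
  makes the mapping spaces of a fibration \<open>p\<close> from \<open>E\<close> to \<open>B\<close> with fibre \<open>F\<close> into Kan fibrations. Hence a
  loop \<open>x : S\<^sup>1 \<and> K \<rightarrow> B\<close> lifts to a homotopy of maps \<open>K \<rightarrow> E\<close> that starts at a given \<open>d : K \<rightarrow> F\<close>. It
  ends at a map to \<open>F\<close>, whose class is the action of \<open>x\<close> on \<open>d\<close>, and \<open>g x\<close> is the action of \<open>x\<close> on the base
  point. Exactness, the orbit condition and centrality follow by filling horns. For a fibrant replacement \<open>R\<close> of
  \<open>\<Omega>B\<close> every loop comes from a map \<open>K \<rightarrow> R\<close> by composition with the tautological loop. This compares the
  lifting with the boundary map on \<open>\<Omega>B\<close> and, by an Eckmann--Hilton argument, makes \<open>g\<close> a homomorphism.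
  All of this applies to the tower because motivic trivial cofibrations are \<open>WB\<^sub>n\<close>-local equivalences, so that
  the maps \<open>\<nu>\<^sub>n\<close> are motivic fibrations between motivically fibrant objects.\<close>

section \<open>The localization of a category\<close>

text \<open>Cofibrations are the monomorphisms, so every object is cofibrant, every trivial
  fibration has a section, and this section is a trivial cofibration. Equality in the homotopy
  category is known only through zigzags, while horns need strict equations. Path objects bridge
  this: a homotopy becomes a strict map to \<open>P\<close>, and two triangles in \<open>B\<close>
  with homotopic sides become one triangle in \<open>Q\<close> to be lifted to \<open>P\<close>. The
  loop object is given only by an adjunction in the homotopy category and need not be fibrant, so
  maps into it need not come from presheaf maps. Passing to a fibrant \<open>R\<close> means
  extending the counit to \<open>S1 R\<close>, hence that smashing with the circle preserves trivial
  cofibrations; as SM7 speaks of simplices, this is proved by hand. The boundary map uses up the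
  outer circle of \<open>S1 (S1 L)\<close>. The product of its source is formed in that circle, the
  product of its target in the remaining inner one; this mismatch forces the interchange argument. A
  similar interchange gives centrality. Pairs, as in smash products and kernel pairs, are coded in
  \<open>'b\<close>, which is where its infinity enters.\<close>

lemma zpath_Nil_iff [simp]: "zpath C W A B [] \<longleftrightarrow> A = B \<and> A \<in> Ob C"
  by (auto elim: zpath.cases intro: zpath.intros)

lemma zpath_Fwd_iff [simp]: "zpath C W A B (Fwd f # p) \<longleftrightarrow> f \<in> Ar C \<and> Dom f = A \<and> zpath C W (Cod f) B p"
  by (auto elim: zpath.cases intro: zpath.intros)

lemma zpath_Bwd_iff [simp]: "zpath C W A B (Bwd f # p) \<longleftrightarrow> f \<in> W \<and> Cod f = A \<and> zpath C W (Dom f) B p"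
  by (auto elim: zpath.cases intro: zpath.intros)

lemma zpath_append: "zpath C W A B p \<Longrightarrow> zpath C W B D q \<Longrightarrow> zpath C W A D (p @ q)"
  by (induction rule: zpath.induct) auto

locale category =
  fixes C :: "('o, 'f) category"
  assumes is_category: "is_category C"
begin

abbreviation comp (infixr "\<cdot>" 70) where "g \<cdot> f \<equiv> Cmp C g f"

lemma in_hom: "f \<in> homset C a b \<longleftrightarrow> f \<in> Ar C \<and> Dom f = a \<and> Cod f = b"
  by (simp add: homset_def)

lemma Dom_Ob: "f \<in> Ar C \<Longrightarrow> Dom f \<in> Ob C" and Cod_Ob: "f \<in> Ar C \<Longrightarrow> Cod f \<in> Ob C"
  using is_category by (auto simp: is_category_def)

lemma Idn_hom: "a \<in> Ob C \<Longrightarrow> Idn C a \<in> homset C a a"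
  using is_category by (auto simp: is_category_def)

lemma comp_hom: "f \<in> homset C a b \<Longrightarrow> g \<in> homset C b c \<Longrightarrow> g \<cdot> f \<in> homset C a c"
  using is_category by (auto simp: is_category_def in_hom)

lemma comp_Idn: "f \<in> homset C a b \<Longrightarrow> f \<cdot> Idn C a = f"
  and Idn_comp: "f \<in> homset C a b \<Longrightarrow> Idn C b \<cdot> f = f"
  using is_category by (auto simp: is_category_def in_hom)

lemma assoc: "f \<in> homset C a b \<Longrightarrow> g \<in> homset C b c \<Longrightarrow> h \<in> homset C c d \<Longrightarrow>
    h \<cdot> (g \<cdot> f) = (h \<cdot> g) \<cdot> f"
  using is_category by (auto simp: is_category_def in_hom)

lemma comp_Ar: "f \<in> Ar C \<Longrightarrow> g \<in> Ar C \<Longrightarrow> Dom g = Cod f \<Longrightarrow> g \<cdot> f \<in> Ar C"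
  and Dom_comp: "f \<in> Ar C \<Longrightarrow> g \<in> Ar C \<Longrightarrow> Dom g = Cod f \<Longrightarrow> Dom (g \<cdot> f) = Dom f"
  and Cod_comp: "f \<in> Ar C \<Longrightarrow> g \<in> Ar C \<Longrightarrow> Dom g = Cod f \<Longrightarrow> Cod (g \<cdot> f) = Cod g"
  using comp_hom[of f "Dom f" "Cod f" g "Cod g"] by (auto simp: in_hom)

end

locale localized_category = category C for C :: "('o, 'f) category" +
  fixes W :: "('o, 'f) arrow set"
  assumes W_Ar: "W \<subseteq> Ar C"
begin

abbreviation "L \<equiv> localization C W"
abbreviation "q \<equiv> loc_fun C W"

lemma zpath_ends: "zpath C W A B p \<Longrightarrow> A \<in> Ob C \<and> B \<in> Ob C"
  by (induction rule: zpath.induct) (use W_Ar in \<open>auto simp: Dom_Ob Cod_Ob\<close>)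

lemma zclass_eq_iff: "zpath C W A B p \<Longrightarrow> zclass C W A B p = zclass C W A B p' \<longleftrightarrow> zeq C W A B p p'"
proof
  assume "zpath C W A B p" "zclass C W A B p = zclass C W A B p'"
  then have "zeq C W A B p' p" using zeq_refl[of C W A B p] by (auto simp: zclass_def)
  then show "zeq C W A B p p'" by (rule zeq_sym)
next
  assume "zeq C W A B p p'"
  then have "zeq C W A B p r \<longleftrightarrow> zeq C W A B p' r" for r
    by (meson zeq_sym zeq_trans)
  then show "zclass C W A B p = zclass C W A B p'" by (simp add: zclass_def)
qed

lemma Dom_zclass [simp]: "Dom (zclass C W A B p) = A" and Cod_zclass [simp]: "Cod (zclass C W A B p) = B"
  by (simp_all add: zclass_def)

lemma Ob_L [simp]: "Ob L = Ob C"
  by (simp add: localization_def)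

lemma in_hom_L: "\<phi> \<in> homset L A B \<longleftrightarrow> (\<exists>p. zpath C W A B p \<and> \<phi> = zclass C W A B p)"
  by (auto simp: homset_def localization_def)

text \<open>By \<open>zeq_append\<close> all concatenations of representatives are equivalent, so
  the set in the definition of composition is a single class.\<close>

lemma comp_zclass:
  assumes "zpath C W A B p" "zpath C W B D p'"
  shows "Cmp L (zclass C W B D p') (zclass C W A B p) = zclass C W A D (p @ p')"
proof -
  have "(\<exists>q. zeq C W A B p q \<and> (\<exists>q'. zeq C W B D p' q' \<and> zeq C W A D (q @ q') r)) \<longleftrightarrow> zeq C W A D (p @ p') r" for r
    by (meson assms zeq_append zeq_trans zeq_sym zeq_refl)
  then show ?thesis by (simp add: localization_def zclass_def)
qed

lemma comp_hom_L: "\<phi> \<in> homset L A B \<Longrightarrow> \<psi> \<in> homset L B D \<Longrightarrow> Cmp L \<psi> \<phi> \<in> homset L A D"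
  by (auto simp: in_hom_L comp_zclass intro: zpath_append)

lemma assoc_L: "\<phi> \<in> homset L A B \<Longrightarrow> \<psi> \<in> homset L B D \<Longrightarrow> \<theta> \<in> homset L D E \<Longrightarrow>
    Cmp L \<theta> (Cmp L \<psi> \<phi>) = Cmp L (Cmp L \<theta> \<psi>) \<phi>"
  by (auto simp: in_hom_L comp_zclass zpath_append)

lemma q_hom: "f \<in> homset C A B \<Longrightarrow> q f \<in> homset L A B"
  unfolding in_hom_L loc_fun_def by (intro exI[of _ "[Fwd f]"]) (auto simp: in_hom Cod_Ob)

lemma q_comp: "f \<in> homset C A B \<Longrightarrow> g \<in> homset C B D \<Longrightarrow> Cmp L (q g) (q f) = q (g \<cdot> f)"
proof -
  assume f: "f \<in> homset C A B" and g: "g \<in> homset C B D"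
  then have p: "zpath C W A B [Fwd f]" "zpath C W B D [Fwd g]" by (auto simp: in_hom Cod_Ob)
  have "zeq C W A D [Fwd f, Fwd g] [Fwd (g \<cdot> f)]"
    using f g zeq_comp[of f C g W] by (auto simp: in_hom)
  then show "Cmp L (q g) (q f) = q (g \<cdot> f)"
    using comp_zclass[OF p] zclass_eq_iff zpath_append[OF p] f g comp_hom[OF f g]
    by (auto simp: loc_fun_def in_hom)
qed

lemma q_Idn: "A \<in> Ob C \<Longrightarrow> q (Idn C A) = Idn L A"
  using Idn_hom[of A] zeq_id[of A C W]
  by (simp add: loc_fun_def localization_def zclass_eq_iff in_hom)

lemma Idn_L: "\<phi> \<in> homset L A B \<Longrightarrow> Cmp L \<phi> (q (Idn C A)) = \<phi>" "\<phi> \<in> homset L A B \<Longrightarrow> Cmp L (q (Idn C B)) \<phi> = \<phi>"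
proof -
  assume "\<phi> \<in> homset L A B"
  then obtain p where p: "zpath C W A B p" "\<phi> = zclass C W A B p" by (auto simp: in_hom_L)
  then have AB: "A \<in> Ob C" "B \<in> Ob C" using zpath_ends by auto
  have "zpath C W A A []" "zpath C W B B []" using AB by auto
  from comp_zclass[OF this(1) p(1)] comp_zclass[OF p(1) this(2)] p(2) AB
  show "Cmp L \<phi> (q (Idn C A)) = \<phi>" "Cmp L (q (Idn C B)) \<phi> = \<phi>"
    by (auto simp: q_Idn) (simp_all add: localization_def)
qed

text \<open>The inverse is recorded as the class of one backward step because \<open>ho_surj\<close>
  meets it in this form when it reads a zigzag.\<close>

lemma W_inverse:
  assumes "w \<in> W" "w \<in> homset C A B"
  shows "\<exists>v. v \<in> homset L B A \<and> v = zclass C W B A [Bwd w] \<and> Cmp L v (q w) = q (Idn C A) \<and> Cmp L (q w) v = q (Idn C B)"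
proof -
  have AB: "A \<in> Ob C" "B \<in> Ob C" using assms by (auto simp: in_hom Dom_Ob Cod_Ob)
  have p: "zpath C W B A [Bwd w]" "zpath C W A B [Fwd w]" using assms AB by (auto simp: in_hom)
  then have "Cmp L (zclass C W B A [Bwd w]) (q w) = q (Idn C A)" "Cmp L (q w) (zclass C W B A [Bwd w]) = q (Idn C B)"
    using comp_zclass[OF p] comp_zclass[OF p(2,1)] zeq_inv1[OF assms(1), of C] zeq_inv2[OF assms(1), of C] AB assms
    by (simp_all add: loc_fun_def[of _ _ w] q_Idn in_hom) (auto simp: localization_def zclass_eq_iff zpath_append)
  then show ?thesis using p unfolding in_hom_L by blast
qed

lemma W_cancel_left:
  assumes "w \<in> W" "w \<in> homset C A B" "\<phi> \<in> homset L D A" "\<psi> \<in> homset L D A" "Cmp L (q w) \<phi> = Cmp L (q w) \<psi>"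
  shows "\<phi> = \<psi>"
proof -
  obtain v where v: "v \<in> homset L B A" "Cmp L v (q w) = q (Idn C A)" using W_inverse[OF assms(1,2)] by blast
  have "\<phi> = Cmp L v (Cmp L (q w) \<phi>)"
    using assoc_L[OF assms(3) q_hom[OF assms(2)] v(1)] v(2) Idn_L(2)[OF assms(3)] by simp
  also have "\<dots> = \<psi>"
    using assoc_L[OF assms(4) q_hom[OF assms(2)] v(1)] v(2) Idn_L(2)[OF assms(4)] assms(5) by simp
  finally show ?thesis .
qed

end

section \<open>Pointed simplicial presheaves\<close>

abbreviation El :: "('a, 'b) pspsh \<Rightarrow> 'a smobj \<Rightarrow> nat \<Rightarrow> 'b set" where
  "El P Y n \<equiv> Spx (Val P Y) n"

text \<open>The conditions on a raw family, which may take any values off the elements of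
  \<open>P\<close>; \<open>mk_hom\<close> normalizes such a family by \<open>canon\<close> and so
  turns it into an arrow.\<close>

definition natural_family :: "('a, 'a) rspace \<Rightarrow> ('a, 'b) pspsh \<Rightarrow> ('a, 'b) pspsh \<Rightarrow> ('a, 'b) family \<Rightarrow> bool" where
  "natural_family X P Q F \<longleftrightarrow>
     (\<forall>Y\<in>Ob (Sm X). \<forall>n. F Y n \<in> El P Y n \<rightarrow> El Q Y n) \<and>
     (\<forall>Y\<in>Ob (Sm X). \<forall>m n. \<forall>\<theta>\<in>Delta m n. \<forall>x\<in>El P Y n.
        F Y m (Op (Val P Y) m n \<theta> x) = Op (Val Q Y) m n \<theta> (F Y n x)) \<and>
     (\<forall>u\<in>Ar (Sm X). \<forall>n. \<forall>x\<in>El P (Cod u) n. F (Dom u) n (Rst P u n x) = Rst Q u n (F (Cod u) n x)) \<and>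
     (\<forall>Y\<in>Ob (Sm X). \<forall>n. F Y n (Bpt P Y n) = Bpt Q Y n)"

lemma Sm_Dom: "u \<in> Ar (Sm X) \<Longrightarrow> Dom u \<in> Ob (Sm X)" and Sm_Cod: "u \<in> Ar (Sm X) \<Longrightarrow> Cod u \<in> Ob (Sm X)"
  by (auto simp: Sm_def)

lemma Ob_psPre: "P \<in> Ob (psPre X) \<longleftrightarrow>
     (\<forall>Y\<in>Ob (Sm X). is_sset (Val P Y)) \<and>
     (\<forall>u\<in>Ar (Sm X). \<forall>n. Rst P u n \<in> El P (Cod u) n \<rightarrow> El P (Dom u) n) \<and>
     (\<forall>u\<in>Ar (Sm X). \<forall>m n. \<forall>\<theta>\<in>Delta m n. \<forall>x\<in>El P (Cod u) n.
        Rst P u m (Op (Val P (Cod u)) m n \<theta> x) = Op (Val P (Dom u)) m n \<theta> (Rst P u n x)) \<and>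
     (\<forall>Y\<in>Ob (Sm X). \<forall>n. \<forall>x\<in>El P Y n. Rst P (Idn (Sm X) Y) n x = x) \<and>
     (\<forall>u\<in>Ar (Sm X). \<forall>v\<in>Ar (Sm X). Dom u = Cod v \<longrightarrow>
        (\<forall>n. \<forall>x\<in>El P (Cod u) n. Rst P (Cmp (Sm X) u v) n x = Rst P v n (Rst P u n x))) \<and>
     (\<forall>Y\<in>Ob (Sm X). \<forall>n. Bpt P Y n \<in> El P Y n) \<and>
     (\<forall>Y\<in>Ob (Sm X). \<forall>m n. \<forall>\<theta>\<in>Delta m n. Op (Val P Y) m n \<theta> (Bpt P Y n) = Bpt P Y m) \<and>
     (\<forall>u\<in>Ar (Sm X). \<forall>n. Rst P u n (Bpt P (Cod u) n) = Bpt P (Dom u) n)"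
  by (auto simp: psPre_def is_pointed_presheaf_def is_presheaf_def is_smap_def)

lemma in_hom_psPre: "f \<in> homset (psPre X) P Q \<longleftrightarrow> P \<in> Ob (psPre X) \<and> Q \<in> Ob (psPre X) \<and>
    Dom f = P \<and> Cod f = Q \<and> natural_family X P Q (Fn f) \<and> Fn f = canon X P (Fn f)"
  by (auto simp: homset_def psPre_def is_presheaf_map_def is_smap_def natural_family_def)

lemma Bpt_El: "P \<in> Ob (psPre X) \<Longrightarrow> Y \<in> Ob (Sm X) \<Longrightarrow> Bpt P Y n \<in> El P Y n"
  and Op_Bpt: "P \<in> Ob (psPre X) \<Longrightarrow> Y \<in> Ob (Sm X) \<Longrightarrow> \<theta> \<in> Delta m n \<Longrightarrow> Op (Val P Y) m n \<theta> (Bpt P Y n) = Bpt P Y m"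
  and Rst_Bpt: "P \<in> Ob (psPre X) \<Longrightarrow> u \<in> Ar (Sm X) \<Longrightarrow> Rst P u n (Bpt P (Cod u) n) = Bpt P (Dom u) n"
  by (simp_all add: Ob_psPre)

lemma Op_El: "P \<in> Ob (psPre X) \<Longrightarrow> Y \<in> Ob (Sm X) \<Longrightarrow> \<theta> \<in> Delta m n \<Longrightarrow> x \<in> El P Y n \<Longrightarrow> Op (Val P Y) m n \<theta> x \<in> El P Y m"
  by (simp add: Ob_psPre is_sset_def Pi_iff)

lemma Rst_El: "P \<in> Ob (psPre X) \<Longrightarrow> u \<in> Ar (Sm X) \<Longrightarrow> x \<in> El P (Cod u) n \<Longrightarrow> Rst P u n x \<in> El P (Dom u) n"
  by (simp add: Ob_psPre Pi_iff)

lemma hom_Dom: "f \<in> homset (psPre X) P Q \<Longrightarrow> P \<in> Ob (psPre X)"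
  and hom_Cod: "f \<in> homset (psPre X) P Q \<Longrightarrow> Q \<in> Ob (psPre X)"
  by (simp_all add: in_hom_psPre)

definition mk :: "('a, 'a) rspace \<Rightarrow> ('a, 'b) pspsh \<Rightarrow> ('a, 'b) pspsh \<Rightarrow> ('a, 'b) family \<Rightarrow> ('a, 'b) parr" where
  "mk X P Q F = Arr P Q (canon X P F)"

lemma Fn_mk [simp]: "Y \<in> Ob (Sm X) \<Longrightarrow> x \<in> El P Y n \<Longrightarrow> Fn (mk X P Q F) Y n x = F Y n x"
  by (simp add: mk_def canon_def)

lemma Dom_mk [simp]: "Dom (mk X P Q F) = P" and Cod_mk [simp]: "Cod (mk X P Q F) = Q"
  by (simp_all add: mk_def)

lemma canon_cong: "(\<And>Y n x. Y \<in> Ob (Sm X) \<Longrightarrow> x \<in> El P Y n \<Longrightarrow> F Y n x = G Y n x) \<Longrightarrow> canon X P F = canon X P G"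
  by (auto simp: canon_def fun_eq_iff restrict_def)

lemma canon_canon [simp]: "canon X P (canon X P F) = canon X P F"
  by (auto simp: canon_def fun_eq_iff)

lemma canon_apply: "Y \<in> Ob (Sm X) \<Longrightarrow> x \<in> El P Y n \<Longrightarrow> canon X P F Y n x = F Y n x"
  by (simp add: canon_def)

lemma mk_hom:
  assumes P: "P \<in> Ob (psPre X)" and Q: "Q \<in> Ob (psPre X)" and F: "natural_family X P Q F"
  shows "mk X P Q F \<in> homset (psPre X) P Q"
proof -
  have "natural_family X P Q (canon X P F)"
    unfolding natural_family_def
  proof (intro conjI ballI allI funcsetI)
    fix Y n x assume "Y \<in> Ob (Sm X)" "x \<in> El P Y n"
    then show "canon X P F Y n x \<in> El Q Y n"
      using F by (auto simp: canon_apply natural_family_def)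
  next
    fix Y m n \<theta> x assume a: "Y \<in> Ob (Sm X)" "\<theta> \<in> Delta m n" "x \<in> El P Y n"
    then have "Op (Val P Y) m n \<theta> x \<in> El P Y m" using P by (simp add: Op_El)
    with a show "canon X P F Y m (Op (Val P Y) m n \<theta> x) = Op (Val Q Y) m n \<theta> (canon X P F Y n x)"
      using F by (simp add: canon_apply natural_family_def)
  next
    fix u n x assume a: "u \<in> Ar (Sm X)" "x \<in> El P (Cod u) n"
    then have "Rst P u n x \<in> El P (Dom u) n" using P by (simp add: Rst_El)
    with a show "canon X P F (Dom u) n (Rst P u n x) = Rst Q u n (canon X P F (Cod u) n x)"
      using F by (simp add: canon_apply natural_family_def Sm_Dom Sm_Cod)
  next
    fix Y n assume "Y \<in> Ob (Sm X)"
    then show "canon X P F Y n (Bpt P Y n) = Bpt Q Y n"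
      using P F by (simp add: canon_apply natural_family_def Ob_psPre)
  qed
  then show ?thesis using P Q by (simp add: in_hom_psPre) (simp add: mk_def)
qed

lemma hom_ext:
  assumes "f \<in> homset (psPre X) P Q" "g \<in> homset (psPre X) P Q"
    "\<And>Y n x. Y \<in> Ob (Sm X) \<Longrightarrow> x \<in> El P Y n \<Longrightarrow> Fn f Y n x = Fn g Y n x"
  shows "f = g"
  using assms canon_cong[of X P "Fn f" "Fn g"] by (simp add: in_hom_psPre)

lemma Cmp_psPre: "Cmp (psPre X) g f = mk X (Dom f) (Cod g) (\<lambda>Y n x. Fn g Y n (Fn f Y n x))"
  by (simp add: psPre_def comp_map_def mk_def)

lemma Idn_psPre: "Idn (psPre X) P = mk X P P (\<lambda>Y n x. x)"
  by (simp add: psPre_def id_map_def mk_def)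

lemma Fn_hom: "f \<in> homset (psPre X) P Q \<Longrightarrow> Y \<in> Ob (Sm X) \<Longrightarrow> x \<in> El P Y n \<Longrightarrow> Fn f Y n x \<in> El Q Y n"
  and Fn_Bpt: "f \<in> homset (psPre X) P Q \<Longrightarrow> Y \<in> Ob (Sm X) \<Longrightarrow> Fn f Y n (Bpt P Y n) = Bpt Q Y n"
  and Fn_Op: "f \<in> homset (psPre X) P Q \<Longrightarrow> Y \<in> Ob (Sm X) \<Longrightarrow> \<theta> \<in> Delta m n \<Longrightarrow> x \<in> El P Y n \<Longrightarrow>
      Fn f Y m (Op (Val P Y) m n \<theta> x) = Op (Val Q Y) m n \<theta> (Fn f Y n x)"
  and Fn_Rst: "f \<in> homset (psPre X) P Q \<Longrightarrow> u \<in> Ar (Sm X) \<Longrightarrow> x \<in> El P (Cod u) n \<Longrightarrow>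
      Fn f (Dom u) n (Rst P u n x) = Rst Q u n (Fn f (Cod u) n x)"
  by (auto simp: in_hom_psPre natural_family_def)

lemma comp_hom_psPre:
  assumes "f \<in> homset (psPre X) P Q" "g \<in> homset (psPre X) Q R"
  shows "Cmp (psPre X) g f \<in> homset (psPre X) P R"
proof -
  have "mk X P R (\<lambda>Y n x. Fn g Y n (Fn f Y n x)) \<in> homset (psPre X) P R"
    by (rule mk_hom) (use assms in \<open>auto simp: in_hom_psPre natural_family_def Sm_Dom Sm_Cod Pi_def\<close>)
  then show ?thesis using assms by (simp add: Cmp_psPre in_hom_psPre)
qed

lemma Fn_comp [simp]: "f \<in> homset (psPre X) P Q \<Longrightarrow> Y \<in> Ob (Sm X) \<Longrightarrow> x \<in> El P Y n \<Longrightarrow>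
    Fn (Cmp (psPre X) g f) Y n x = Fn g Y n (Fn f Y n x)"
  by (simp add: Cmp_psPre in_hom_psPre)

lemma Idn_hom_psPre: "P \<in> Ob (psPre X) \<Longrightarrow> Idn (psPre X) P \<in> homset (psPre X) P P"
  unfolding Idn_psPre by (rule mk_hom) (auto simp: natural_family_def)

lemma is_category_psPre: "is_category (psPre X)"
proof -
  have ar: "f \<in> Ar (psPre X) \<longleftrightarrow> f \<in> homset (psPre X) (Dom f) (Cod f)" for f :: "('a, 'b) parr"
    by (simp add: homset_def)
  show ?thesis
    unfolding is_category_def
  proof (intro conjI ballI impI)
    fix f g h :: "('a, 'b) parr"
    assume f: "f \<in> Ar (psPre X)" and g: "g \<in> Ar (psPre X)" and h: "h \<in> Ar (psPre X)"
      and e: "Dom g = Cod f \<and> Dom h = Cod g"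
    then have 1: "f \<in> homset (psPre X) (Dom f) (Cod f)" "g \<in> homset (psPre X) (Cod f) (Cod g)"
      "h \<in> homset (psPre X) (Cod g) (Cod h)" by (auto simp: homset_def)
    note 2 = comp_hom_psPre[OF 1(1,2)] comp_hom_psPre[OF 1(2,3)]
    show "Cmp (psPre X) h (Cmp (psPre X) g f) = Cmp (psPre X) (Cmp (psPre X) h g) f"
      by (rule hom_ext[of _ X "Dom f" "Cod h"])
        (use 1 2 in \<open>auto intro: comp_hom_psPre Fn_hom simp: Fn_comp[OF 1(1)] Fn_comp[OF 1(2)] Fn_comp[OF 2(1)] Fn_hom[OF 1(1)]\<close>)
  next
    fix f :: "('a, 'b) parr"
    assume "f \<in> Ar (psPre X)"
    then have f: "f \<in> homset (psPre X) (Dom f) (Cod f)" by (simp add: homset_def)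
    then have o: "Dom f \<in> Ob (psPre X)" "Cod f \<in> Ob (psPre X)" by (auto simp: in_hom_psPre)
    note i = Idn_hom_psPre[OF o(1)] Idn_hom_psPre[OF o(2)]
    show "Dom f \<in> Ob (psPre X)" "Cod f \<in> Ob (psPre X)" by fact+
    show "Cmp (psPre X) f (Idn (psPre X) (Dom f)) = f"
      by (rule hom_ext[OF comp_hom_psPre[OF i(1) f] f]) (simp add: Fn_comp[OF i(1)], simp add: Idn_psPre)
    show "Cmp (psPre X) (Idn (psPre X) (Cod f)) f = f"
      by (rule hom_ext[OF comp_hom_psPre[OF f i(2)] f]) (simp add: Fn_comp[OF f], simp add: Idn_psPre Fn_hom[OF f])
  next
    fix f g :: "('a, 'b) parr"
    assume "f \<in> Ar (psPre X)" "g \<in> Ar (psPre X)" "Dom g = Cod f"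
    then show "Cmp (psPre X) g f \<in> homset (psPre X) (Dom f) (Cod g)"
      by (intro comp_hom_psPre[of f X _ "Cod f"]) (auto simp: homset_def)
  qed (rule Idn_hom_psPre)
qed

subsection \<open>The zero object\<close>

lemma point_Ob [simp]: "point \<in> Ob (psPre X)"
  by (auto simp: Ob_psPre point_def is_sset_def)

lemma zero_mk: "zero_map X P Q = mk X P Q (\<lambda>Y n _. Bpt Q Y n)"
  by (simp add: zero_map_def mk_def)

lemma zero_hom: "P \<in> Ob (psPre X) \<Longrightarrow> Q \<in> Ob (psPre X) \<Longrightarrow> zero_map X P Q \<in> homset (psPre X) P Q"
  unfolding zero_mk by (rule mk_hom) (auto simp: natural_family_def Bpt_El Op_Bpt Rst_Bpt)

lemma Fn_zero [simp]: "Y \<in> Ob (Sm X) \<Longrightarrow> x \<in> El P Y n \<Longrightarrow> Fn (zero_map X P Q) Y n x = Bpt Q Y n"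
  by (simp add: zero_mk)

lemma zero_comp: "f \<in> homset (psPre X) P Q \<Longrightarrow> R \<in> Ob (psPre X) \<Longrightarrow> Cmp (psPre X) (zero_map X Q R) f = zero_map X P R"
  by (rule hom_ext[OF comp_hom_psPre[OF _ zero_hom] zero_hom])
    (auto simp: Fn_comp Fn_hom dest: hom_Dom hom_Cod)

lemma comp_zero: "f \<in> homset (psPre X) Q R \<Longrightarrow> P \<in> Ob (psPre X) \<Longrightarrow> Cmp (psPre X) f (zero_map X P Q) = zero_map X P R"
proof -
  assume f: "f \<in> homset (psPre X) Q R" and P: "P \<in> Ob (psPre X)"
  then have "Q \<in> Ob (psPre X)" "R \<in> Ob (psPre X)" by (auto simp: in_hom_psPre)
  note z = zero_hom[OF P this(1)] zero_hom[OF P this(2)]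
  show ?thesis
    by (rule hom_ext[OF comp_hom_psPre[OF z(1) f] z(2)]) (simp add: Fn_comp[OF z(1)] Fn_Bpt[OF f])
qed

lemma hom_point: "f \<in> homset (psPre X) P point \<Longrightarrow> f = zero_map X P point"
proof (rule hom_ext[of _ X P point])
  assume f: "f \<in> homset (psPre X) P point"
  then show "zero_map X P point \<in> homset (psPre X) P point" by (intro zero_hom) (auto dest: hom_Dom hom_Cod)
  show "Fn f Y n x = Fn (zero_map X P point) Y n x" if "Y \<in> Ob (Sm X)" "x \<in> El P Y n" for Y n x
    using Fn_hom[OF f that] that by (simp add: point_def)
qed

subsection \<open>Subobjects and fibres\<close>

definition subpsh :: "('a, 'b) pspsh \<Rightarrow> ('a smobj \<Rightarrow> nat \<Rightarrow> 'b set) \<Rightarrow> ('a, 'b) pspsh" where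
  "subpsh P S = \<lparr>Val = (\<lambda>Y. \<lparr>Spx = S Y, Op = Op (Val P Y)\<rparr>), Rst = Rst P, Bpt = Bpt P\<rparr>"

definition closed_part :: "('a, 'a) rspace \<Rightarrow> ('a, 'b) pspsh \<Rightarrow> ('a smobj \<Rightarrow> nat \<Rightarrow> 'b set) \<Rightarrow> bool" where
  "closed_part X P S \<longleftrightarrow> (\<forall>Y\<in>Ob (Sm X). \<forall>n. S Y n \<subseteq> El P Y n \<and> Bpt P Y n \<in> S Y n) \<and>
     (\<forall>Y\<in>Ob (Sm X). \<forall>m n. \<forall>\<theta>\<in>Delta m n. \<forall>x\<in>S Y n. Op (Val P Y) m n \<theta> x \<in> S Y m) \<and>
     (\<forall>u\<in>Ar (Sm X). \<forall>n. \<forall>x\<in>S (Cod u) n. Rst P u n x \<in> S (Dom u) n)"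

lemma El_subpsh [simp]: "El (subpsh P S) Y n = S Y n"
  and Op_subpsh [simp]: "Op (Val (subpsh P S) Y) = Op (Val P Y)"
  and Rst_subpsh [simp]: "Rst (subpsh P S) = Rst P"
  and Bpt_subpsh [simp]: "Bpt (subpsh P S) = Bpt P"
  by (simp_all add: subpsh_def)

lemma subpsh_Ob:
  assumes P: "P \<in> Ob (psPre X)" and S: "closed_part X P S"
  shows "subpsh P S \<in> Ob (psPre X)"
proof -
  have s: "x \<in> El P Y n" if "Y \<in> Ob (Sm X)" "x \<in> S Y n" for x Y n
    using that S by (auto simp: closed_part_def)
  show ?thesis
    using P S unfolding Ob_psPre
    by (auto simp: is_sset_def closed_part_def s Sm_Cod)
qed

definition subincl :: "('a, 'a) rspace \<Rightarrow> ('a, 'b) pspsh \<Rightarrow> ('a smobj \<Rightarrow> nat \<Rightarrow> 'b set) \<Rightarrow> ('a, 'b) parr" where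
  "subincl X P S = mk X (subpsh P S) P (\<lambda>Y n x. x)"

lemma subincl_hom: "P \<in> Ob (psPre X) \<Longrightarrow> closed_part X P S \<Longrightarrow> subincl X P S \<in> homset (psPre X) (subpsh P S) P"
  unfolding subincl_def by (rule mk_hom) (auto simp: subpsh_Ob natural_family_def closed_part_def)

lemma Fn_subincl [simp]: "Y \<in> Ob (Sm X) \<Longrightarrow> x \<in> S Y n \<Longrightarrow> Fn (subincl X P S) Y n x = x"
  by (simp add: subincl_def)

lemma injective_mono:
  assumes f: "f \<in> homset (psPre X) P Q"
    and inj: "\<And>Y n. Y \<in> Ob (Sm X) \<Longrightarrow> inj_on (Fn f Y n) (El P Y n)"
  shows "f \<in> monomorphisms (psPre X)"
  unfolding monomorphisms_def
proof (intro CollectI conjI ballI impI)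
  show "f \<in> Ar (psPre X)" using f by (simp add: homset_def)
  fix g h assume "g \<in> Ar (psPre X)" "h \<in> Ar (psPre X)"
    and "Cod g = Dom f \<and> Cod h = Dom f \<and> Dom g = Dom h \<and> Cmp (psPre X) f g = Cmp (psPre X) f h"
  then have g: "g \<in> homset (psPre X) (Dom g) P" and h: "h \<in> homset (psPre X) (Dom g) P"
    and e: "Cmp (psPre X) f g = Cmp (psPre X) f h" using f by (auto simp: homset_def)
  show "g = h"
  proof (rule hom_ext[OF g h])
    fix Y n x assume a: "Y \<in> Ob (Sm X)" "x \<in> El (Dom g) Y n"
    then have "Fn f Y n (Fn g Y n x) = Fn f Y n (Fn h Y n x)"
      using arg_cong[OF e, of "\<lambda>f. Fn f Y n x"] by (simp add: Fn_comp[OF g] Fn_comp[OF h])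
    then show "Fn g Y n x = Fn h Y n x"
      using inj_onD[OF inj[OF a(1)]] Fn_hom[OF g a] Fn_hom[OF h a] by blast
  qed
qed

definition fibre_part where "fibre_part f = (\<lambda>Y n. {x \<in> El (Dom f) Y n. Fn f Y n x = Bpt (Cod f) Y n})"

lemma fibre_subpsh: "fibre f = subpsh (Dom f) (fibre_part f)"
  by (simp add: fibre_def subpsh_def fibre_part_def)

lemma fibre_incl_subincl: "fibre_incl X f = subincl X (Dom f) (fibre_part f)"
  by (simp add: fibre_incl_def subincl_def mk_def fibre_subpsh)

lemma fibre_part_closed: "f \<in> homset (psPre X) P Q \<Longrightarrow> closed_part X P (fibre_part f)"
  by (auto simp: closed_part_def fibre_part_def in_hom_psPre natural_family_def Op_El Rst_El Op_Bpt Rst_Bpt Bpt_El Sm_Cod)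

lemma fibre_Ob: "f \<in> homset (psPre X) P Q \<Longrightarrow> fibre f \<in> Ob (psPre X)"
  using subpsh_Ob[OF hom_Dom fibre_part_closed] by (simp add: fibre_subpsh in_hom_psPre)

lemma fibre_incl_hom: "f \<in> homset (psPre X) P Q \<Longrightarrow> fibre_incl X f \<in> homset (psPre X) (fibre f) P"
  unfolding fibre_subpsh fibre_incl_subincl
  using subincl_hom[of P X "fibre_part f"] fibre_part_closed[of f X P Q] by (auto simp: in_hom_psPre)

lemma Fn_fibre_incl [simp]: "f \<in> homset (psPre X) P Q \<Longrightarrow> Y \<in> Ob (Sm X) \<Longrightarrow> x \<in> El (fibre f) Y n \<Longrightarrow> Fn (fibre_incl X f) Y n x = x"
  by (simp add: fibre_incl_subincl fibre_subpsh)

lemma fibre_incl_comp: "f \<in> homset (psPre X) P Q \<Longrightarrow> Cmp (psPre X) f (fibre_incl X f) = zero_map X (fibre f) Q"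
proof -
  assume f: "f \<in> homset (psPre X) P Q"
  note i = fibre_incl_hom[OF f]
  have Q: "Q \<in> Ob (psPre X)" using f by (simp add: in_hom_psPre)
  show ?thesis
    by (rule hom_ext[OF comp_hom_psPre[OF i f] zero_hom[OF fibre_Ob[OF f] Q]])
      (use f in \<open>auto simp: Fn_comp[OF i] fibre_def in_hom_psPre[of f] Fn_fibre_incl[OF f, unfolded fibre_def]\<close>)
qed

text \<open>The universal property of the fibre as a pullback along the base point. The values of
  \<open>g\<close> already lie in the fibre, so \<open>d\<close> uses the same family as
  \<open>g\<close> with a smaller target.\<close>

lemma factor_fibre:
  assumes f: "f \<in> homset (psPre X) P Q" and g: "g \<in> homset (psPre X) R P"
    and z: "Cmp (psPre X) f g = zero_map X R Q"
  obtains d where "d \<in> homset (psPre X) R (fibre f)" "Cmp (psPre X) (fibre_incl X f) d = g"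
proof
  have RP: "R \<in> Ob (psPre X)" "P \<in> Ob (psPre X)" using g by (auto simp: in_hom_psPre)
  have D: "Dom f = P" "Cod f = Q" using f by (auto simp: in_hom_psPre)
  have el: "Fn g Y n x \<in> El (fibre f) Y n" if "Y \<in> Ob (Sm X)" "x \<in> El R Y n" for Y n x
    using arg_cong[OF z, of "\<lambda>h. Fn h Y n x"] that Fn_hom[OF g that]
    by (simp add: fibre_subpsh fibre_part_def Fn_comp[OF g] D)
  let ?d = "mk X R (fibre f) (Fn g)"
  show d: "?d \<in> homset (psPre X) R (fibre f)"
    by (rule mk_hom[OF RP(1) fibre_Ob[OF f]])
      (use el g D in \<open>auto simp: natural_family_def Fn_Op Fn_Rst Fn_Bpt fibre_subpsh\<close>)
  show "Cmp (psPre X) (fibre_incl X f) ?d = g"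
    by (rule hom_ext[OF comp_hom_psPre[OF d fibre_incl_hom[OF f]] g]) (simp add: Fn_comp[OF d] Fn_fibre_incl[OF f] el)
qed

lemma fibre_incl_mono: "f \<in> homset (psPre X) P Q \<Longrightarrow> fibre_incl X f \<in> monomorphisms (psPre X)"
  by (rule injective_mono[OF fibre_incl_hom]) (auto simp: inj_on_def)

lemma fibre_incl_cancel:
  assumes f: "f \<in> homset (psPre X) P Q" and d: "d \<in> homset (psPre X) R (fibre f)" "d' \<in> homset (psPre X) R (fibre f)"
    and "Cmp (psPre X) (fibre_incl X f) d = Cmp (psPre X) (fibre_incl X f) d'"
  shows "d = d'"
  using fibre_incl_mono[OF f] fibre_incl_hom[OF f] assms unfolding monomorphisms_def homset_def
  by (simp del: Fn_fibre_incl)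

section \<open>Smash products with pointed simplicial sets\<close>

definition pointed_sset :: "nat list sset \<Rightarrow> bool" where
  "pointed_sset T \<longleftrightarrow> is_sset T \<and> (\<forall>n. [] \<in> Spx T n) \<and> (\<forall>m n. \<forall>\<theta>\<in>Delta m n. Op T m n \<theta> [] = [])"

text \<open>One function on lists serves all dimensions, since the length of a nonempty list
  determines its dimension and \<open>[]\<close> is the base point in each of them.\<close>

definition pointed_smap :: "nat list sset \<Rightarrow> nat list sset \<Rightarrow> (nat list \<Rightarrow> nat list) \<Rightarrow> bool" where
  "pointed_smap T T' \<psi> \<longleftrightarrow> pointed_sset T \<and> pointed_sset T' \<and> is_smap T T' (\<lambda>_. \<psi>) \<and> \<psi> [] = []"

lemma pointed_ssetD:
  assumes "pointed_sset T"
  shows "[] \<in> Spx T n" "\<theta> \<in> Delta m n \<Longrightarrow> Op T m n \<theta> [] = []"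
    "\<theta> \<in> Delta m n \<Longrightarrow> t \<in> Spx T n \<Longrightarrow> Op T m n \<theta> t \<in> Spx T m"
  using assms by (auto simp: pointed_sset_def is_sset_def Pi_iff)

lemma pointed_smapD:
  assumes "pointed_smap T T' \<psi>"
  shows "pointed_sset T" "pointed_sset T'" "\<psi> [] = []" "t \<in> Spx T n \<Longrightarrow> \<psi> t \<in> Spx T' n"
    "\<theta> \<in> Delta m n \<Longrightarrow> t \<in> Spx T n \<Longrightarrow> \<psi> (Op T m n \<theta> t) = Op T' m n \<theta> (\<psi> t)"
  using assms by (auto simp: pointed_smap_def is_smap_def Pi_iff)

locale infinite_sections =
  fixes X :: "('a, 'a) rspace" and W :: "('a, 'b) parr set"
  assumes infinite_values: "infinite (UNIV :: 'b set)"
begin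

sublocale category "psPre X :: (('a, 'b) pspsh, ('a, 'b) family) category"
  by standard (rule is_category_psPre)

abbreviation "M \<equiv> psPre X :: (('a, 'b) pspsh, ('a, 'b) family) category"
abbreviation "Hom \<equiv> homset M"
abbreviation "S \<equiv> Ob (Sm X)"
abbreviation comp_M (infixr "\<cdot>" 70) where "g \<cdot> f \<equiv> Cmp M g f"
abbreviation "Zero \<equiv> zero_map X :: ('a, 'b) pspsh \<Rightarrow> ('a, 'b) pspsh \<Rightarrow> ('a, 'b) parr"

text \<open>Lists of naturals are countable, so for infinite \<open>'b\<close> the product
  \<open>nat list \<times> 'b\<close> is no larger than \<open>'b\<close>, and \<open>SOME\<close>
  in the definition of \<open>enc\<close> finds an injection.\<close>

lemma inj_enc: "inj (enc :: nat list \<times> 'b \<Rightarrow> 'b)"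
proof -
  have "|UNIV :: nat list set| \<le>o |UNIV :: 'b set|"
  proof -
    have "|UNIV :: nat list set| \<le>o |UNIV :: nat set|"
      using card_of_ordLeqI[of to_nat "UNIV :: nat list set" "UNIV :: nat set"] by auto
    also have "|UNIV :: nat set| \<le>o |UNIV :: 'b set|"
      using infinite_values by (simp add: infinite_iff_card_of_nat)
    finally show ?thesis .
  qed
  then have "|(UNIV :: nat list set) \<times> (UNIV :: 'b set)| \<le>o |UNIV :: 'b set|"
    using infinite_values by (intro card_of_Times_ordLeq_infinite) auto
  then obtain e :: "nat list \<times> 'b \<Rightarrow> 'b" where "inj e"
    by (auto simp: card_of_ordLeq[symmetric])
  then show ?thesis unfolding enc_def by (rule someI[of inj])
qed

lemma dec_enc [simp]: "dec (enc z :: 'b) = z"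
  by (simp add: dec_def inj_enc)

lemma enc_eq_iff [simp]: "(enc z :: 'b) = enc z' \<longleftrightarrow> z = z'"
  using inj_enc by (auto dest: injD)

lemma smash_pair_eq_iff: "smash_pair (A :: ('a, 'b) pspsh) Y n t a = smash_pair A Y n t' a' \<longleftrightarrow>
    t = t' \<and> a = a' \<or> (t = [] \<or> a = Bpt A Y n) \<and> (t' = [] \<or> a' = Bpt A Y n)"
  by (auto simp: smash_pair_def)

lemma smash_pair_Nil [simp]: "smash_pair A Y n [] a = enc ([], undefined)"
  and smash_pair_Bpt [simp]: "smash_pair A Y n t (Bpt A Y n) = enc ([], undefined)"
  and Bpt_smash [simp]: "Bpt (smash T A) Y n = enc ([], undefined)"
  by (simp_all add: smash_pair_def smash_def)

lemma El_smash: "El (smash T A) Y n = {smash_pair A Y n t a | t a. t \<in> Spx T n \<and> a \<in> El A Y n}"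
  by (simp add: smash_def)

lemma smash_pair_El: "t \<in> Spx T n \<Longrightarrow> a \<in> El A Y n \<Longrightarrow> smash_pair A Y n t a \<in> El (smash T A) Y n"
  by (auto simp: El_smash)

text \<open>\<open>smash_pair\<close> sends every pair with a base point coordinate to the code of
  \<open>([], undefined)\<close>, so decoding may return a different pair. A function given by cases
  on the decoded pair is therefore only controlled if it is constant on all such pairs.\<close>

lemma case_smash_pair:
  assumes "F [] undefined = b" and "\<And>t. F t (Bpt A Y n) = b" "\<And>a. F [] a = b"
  shows "(case dec (smash_pair (A :: ('a, 'b) pspsh) Y n t a) of (t, a) \<Rightarrow> F t a) = F t a"
  using assms by (auto simp: smash_pair_def)

lemma Op_smash:
  assumes "pointed_sset T" "A \<in> Ob M" "Y \<in> S" "\<theta> \<in> Delta m n"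
  shows "Op (Val (smash T A) Y) m n \<theta> (smash_pair A Y n t a) =
    smash_pair A Y m (Op T m n \<theta> t) (Op (Val A Y) m n \<theta> a)"
proof -
  have "(case dec (smash_pair A Y n t a) of (t, a) \<Rightarrow> smash_pair A Y m (Op T m n \<theta> t) (Op (Val A Y) m n \<theta> a)) =
      smash_pair A Y m (Op T m n \<theta> t) (Op (Val A Y) m n \<theta> a)"
    by (rule case_smash_pair[where b = "enc ([], undefined)"])
      (use assms in \<open>auto simp: pointed_ssetD Op_Bpt\<close>)
  then show ?thesis by (simp add: smash_def)
qed

lemma Rst_smash:
  assumes "A \<in> Ob M" "u \<in> Ar (Sm X)"
  shows "Rst (smash T A) u n (smash_pair A (Cod u) n t a) = smash_pair A (Dom u) n t (Rst A u n a)"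
proof -
  have "(case dec (smash_pair A (Cod u) n t a) of (t, a) \<Rightarrow> smash_pair A (Dom u) n t (Rst A u n a)) =
      smash_pair A (Dom u) n t (Rst A u n a)"
    by (rule case_smash_pair[where b = "enc ([], undefined)"])
      (use assms in \<open>auto simp: Rst_Bpt\<close>)
  then show ?thesis by (simp add: smash_def)
qed

lemma smash_Ob [simp]:
  assumes T: "pointed_sset T" and A: "A \<in> Ob M"
  shows "smash T A \<in> Ob M"
proof -
  note o = Op_smash[OF T A] Rst_smash[OF A]
  note T' = pointed_ssetD(3)[OF T]
  note [simp] = Op_El[OF A] Rst_El[OF A] pointed_ssetD[OF T] Sm_Dom Sm_Cod Op_Bpt[OF A] Rst_Bpt[OF A] Bpt_El[OF A] smash_pair_El
  have [simp]: "Op T n n (\<lambda>i\<in>{..n}. i) t = t" if "t \<in> Spx T n" for n t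
    using that T by (simp add: pointed_sset_def is_sset_def)
  have [simp]: "Op T k m \<phi> (Op T m n \<theta> t) = Op T k n (compose {..k} \<theta> \<phi>) t"
    if "\<phi> \<in> Delta k m" "\<theta> \<in> Delta m n" "t \<in> Spx T n" for k m n \<phi> \<theta> t
    using that T by (simp add: pointed_sset_def is_sset_def)
  have [simp]: "Op (Val A Y) n n (\<lambda>i\<in>{..n}. i) a = a" if "Y \<in> S" "a \<in> El A Y n" for n a Y
    using that A by (simp add: Ob_psPre is_sset_def)
  have [simp]: "Op (Val A Y) k m \<phi> (Op (Val A Y) m n \<theta> t) = Op (Val A Y) k n (compose {..k} \<theta> \<phi>) t"
    if "Y \<in> S" "\<phi> \<in> Delta k m" "\<theta> \<in> Delta m n" "t \<in> El A Y n" for k m n \<phi> \<theta> t Y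
    using that A by (simp add: Ob_psPre is_sset_def)
  have [simp]: "Rst A (Idn (Sm X) Y) n x = x" if "Y \<in> S" "x \<in> El A Y n" for Y n x
    using that A by (simp add: Ob_psPre)
  have [simp]: "Rst A (Cmp (Sm X) u v) n x = Rst A v n (Rst A u n x)"
    if "u \<in> Ar (Sm X)" "v \<in> Ar (Sm X)" "Dom u = Cod v" "x \<in> El A (Cod u) n" for u v n x
    using that A by (simp add: Ob_psPre)
  have [simp]: "Rst A u m (Op (Val A (Cod u)) m n \<theta> x) = Op (Val A (Dom u)) m n \<theta> (Rst A u n x)"
    if "u \<in> Ar (Sm X)" "\<theta> \<in> Delta m n" "x \<in> El A (Cod u) n" for u m n \<theta> x
    using that A by (simp add: Ob_psPre)
  have [simp]: "compose {..k} \<theta> \<phi> \<in> Delta k n" if "\<phi> \<in> Delta k m" "\<theta> \<in> Delta m n" for k m n \<theta> \<phi>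
    using that by (auto simp: Delta_def PiE_iff compose_def mono_on_def)
  have [simp]: "(\<lambda>i\<in>{..n}. i) \<in> Delta n n" for n by (auto simp: Delta_def mono_on_def)
  have sm: "Dom (Idn (Sm X) Y) = Y" "Cod (Idn (Sm X) Y) = Y" "Dom (Cmp (Sm X) u v) = Dom v" "Cod (Cmp (Sm X) u v) = Cod u" for Y u v
    by (simp_all add: Sm_def)
  have B: "Rst (smash T A) u n (Bpt (smash T A) (Cod u) n) = Bpt (smash T A) (Dom u) n" if "u \<in> Ar (Sm X)" for u n
    using o(2)[OF that, where T = T and n = n and t = "[]"] by simp
  have rId: "Rst (smash T A) (Idn (Sm X) Y) n (smash_pair A Y n t a) = smash_pair A Y n t a" if "Y \<in> S" "a \<in> El A Y n" for Y n t a
  proof -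
    have "(case dec (smash_pair A Y n t a) of (t, a) \<Rightarrow> smash_pair A Y n t (Rst A (Idn (Sm X) Y) n a)) = smash_pair A Y n t (Rst A (Idn (Sm X) Y) n a)"
      by (rule case_smash_pair[where b = "enc ([], undefined)"])
        (use that in \<open>auto simp:\<close>)
    then show ?thesis using that by (simp add: smash_def sm)
  qed
  have rC: "Rst (smash T A) (Cmp (Sm X) u v) n (smash_pair A (Cod u) n t a) = smash_pair A (Dom v) n t (Rst A v n (Rst A u n a))"
    if "u \<in> Ar (Sm X)" "v \<in> Ar (Sm X)" "Dom u = Cod v" "a \<in> El A (Cod u) n" for u v n t a
  proof -
    have "(case dec (smash_pair A (Cod u) n t a) of (t, a) \<Rightarrow> smash_pair A (Dom v) n t (Rst A (Cmp (Sm X) u v) n a)) = smash_pair A (Dom v) n t (Rst A (Cmp (Sm X) u v) n a)"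
      by (rule case_smash_pair[where b = "enc ([], undefined)"])
        (use that Rst_Bpt[OF A that(1)] Rst_Bpt[OF A that(2)] Bpt_El[OF A] in \<open>auto simp:\<close>)
    then show ?thesis using that by (simp add: smash_def sm)
  qed
  show ?thesis
    unfolding Ob_psPre
  proof (intro conjI ballI allI funcsetI impI)
    show "is_sset (Val (smash T A) Y)" if "Y \<in> S" for Y
      unfolding is_sset_def by (auto simp: El_smash o that) (use that T' in \<open>blast intro: Op_El[OF A]\<close>)
  next
    fix u n x assume "u \<in> Ar (Sm X)" "x \<in> El (smash T A) (Cod u) n"
    then show "Rst (smash T A) u n x \<in> El (smash T A) (Dom u) n" by (auto simp: El_smash o) (blast intro: Rst_El[OF A])
  next
    fix u m n \<theta> x assume "u \<in> Ar (Sm X)" "\<theta> \<in> Delta m n" "x \<in> El (smash T A) (Cod u) n"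
    then show "Rst (smash T A) u m (Op (Val (smash T A) (Cod u)) m n \<theta> x) =
       Op (Val (smash T A) (Dom u)) m n \<theta> (Rst (smash T A) u n x)"
      by (auto simp: El_smash o)
  next
    fix Y n x assume "Y \<in> S" "x \<in> El (smash T A) Y n"
    then show "Rst (smash T A) (Idn (Sm X) Y) n x = x" by (auto simp: El_smash rId)
  next
    fix u v n x assume "u \<in> Ar (Sm X)" "v \<in> Ar (Sm X)" "Dom u = Cod v" "x \<in> El (smash T A) (Cod u) n"
    then show "Rst (smash T A) (Cmp (Sm X) u v) n x = Rst (smash T A) v n (Rst (smash T A) u n x)"
      using o(2)[of v] by (auto simp: El_smash rC o)
  next
    fix Y n assume "Y \<in> S"
    then show "Bpt (smash T A) Y n \<in> El (smash T A) Y n"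
      using smash_pair_El[of "[]" T n "Bpt A Y n" A Y] Bpt_El[OF A] pointed_ssetD(1)[OF T] by simp
  next
    fix Y m n \<theta> assume "Y \<in> S" "\<theta> \<in> Delta m n"
    then show "Op (Val (smash T A) Y) m n \<theta> (Bpt (smash T A) Y n) = Bpt (smash T A) Y m"
      using o(1)[of Y \<theta> m n "[]"] by simp
  qed (rule B)
qed

lemma smash_hom_ext:
  assumes "f \<in> Hom (smash T A) B" "g \<in> Hom (smash T A) B"
    "\<And>Y n t a. Y \<in> S \<Longrightarrow> t \<in> Spx T n \<Longrightarrow> a \<in> El A Y n \<Longrightarrow>
       Fn f Y n (smash_pair A Y n t a) = Fn g Y n (smash_pair A Y n t a)"
  shows "f = g"
  using assms by (intro hom_ext) (auto simp: El_smash)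

text \<open>Descends a function of two variables to the smash product. The case
  \<open>t = []\<close> is separate because the base point is stored as
  \<open>([], undefined)\<close>, and \<open>undefined\<close> need not be an element on which
  \<phi> behaves well.\<close>

definition bimap :: "nat list sset \<Rightarrow> ('a, 'b) pspsh \<Rightarrow> ('a, 'b) pspsh \<Rightarrow>
    ('a smobj \<Rightarrow> nat \<Rightarrow> nat list \<Rightarrow> 'b \<Rightarrow> 'b) \<Rightarrow> ('a, 'b) parr" where
  "bimap T A B \<phi> = mk X (smash T A) B (\<lambda>Y n w. case dec w of (t, a) \<Rightarrow> if t = [] then Bpt B Y n else \<phi> Y n t a)"

lemma Fn_bimap:
  assumes "Y \<in> S" "t \<in> Spx T n" "a \<in> El A Y n" "\<And>t. t \<in> Spx T n \<Longrightarrow> \<phi> Y n t (Bpt A Y n) = Bpt B Y n" "\<phi> Y n [] a = Bpt B Y n"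
  shows "Fn (bimap T A B \<phi>) Y n (smash_pair A Y n t a) = \<phi> Y n t a"
  using assms smash_pair_El[of t T n a A Y] by (auto simp: bimap_def smash_pair_def)

lemma bimap_hom:
  assumes T: "pointed_sset T" and A: "A \<in> Ob M" and B: "B \<in> Ob M"
    and el: "\<And>Y n t a. Y \<in> S \<Longrightarrow> t \<in> Spx T n \<Longrightarrow> a \<in> El A Y n \<Longrightarrow> \<phi> Y n t a \<in> El B Y n"
    and b: "\<And>Y n t. Y \<in> S \<Longrightarrow> t \<in> Spx T n \<Longrightarrow> \<phi> Y n t (Bpt A Y n) = Bpt B Y n"
    and n: "\<And>Y n a. Y \<in> S \<Longrightarrow> a \<in> El A Y n \<Longrightarrow> \<phi> Y n [] a = Bpt B Y n"
    and op: "\<And>Y m n \<theta> t a. Y \<in> S \<Longrightarrow> \<theta> \<in> Delta m n \<Longrightarrow> t \<in> Spx T n \<Longrightarrow> a \<in> El A Y n \<Longrightarrow>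
       \<phi> Y m (Op T m n \<theta> t) (Op (Val A Y) m n \<theta> a) = Op (Val B Y) m n \<theta> (\<phi> Y n t a)"
    and rst: "\<And>u n t a. u \<in> Ar (Sm X) \<Longrightarrow> t \<in> Spx T n \<Longrightarrow> a \<in> El A (Cod u) n \<Longrightarrow>
       \<phi> (Dom u) n t (Rst A u n a) = Rst B u n (\<phi> (Cod u) n t a)"
  shows "bimap T A B \<phi> \<in> Hom (smash T A) B"
proof -
  let ?F = "\<lambda>Y n w. case dec w of (t, a) \<Rightarrow> if t = [] then Bpt B Y n else \<phi> Y n t a"
  have F: "?F Y n (smash_pair A Y n t a) = \<phi> Y n t a" if "Y \<in> S" "t \<in> Spx T n" "a \<in> El A Y n" for Y n t a
    using that b n by (auto simp: smash_pair_def)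
  have FB: "?F Y n (Bpt (smash T A) Y n) = Bpt B Y n" for Y n
    by (simp add: smash_def)
  show ?thesis
    unfolding bimap_def
  proof (rule mk_hom[OF smash_Ob[OF T A] B])
    show "natural_family X (smash T A) B ?F"
      unfolding natural_family_def
    proof (intro conjI ballI allI funcsetI)
      fix Y n x assume "Y \<in> S" "x \<in> El (smash T A) Y n"
      then show "?F Y n x \<in> El B Y n" by (auto simp only: El_smash F intro: el)
    next
      fix Y m n \<theta> x assume a: "Y \<in> S" "\<theta> \<in> Delta m n" "x \<in> El (smash T A) Y n"
      then show "?F Y m (Op (Val (smash T A) Y) m n \<theta> x) = Op (Val B Y) m n \<theta> (?F Y n x)"
        by (auto simp only: El_smash F Op_smash[OF T A a(1,2)] op pointed_ssetD(3)[OF T] Op_El[OF A])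
    next
      fix u n x assume a: "u \<in> Ar (Sm X)" "x \<in> El (smash T A) (Cod u) n"
      then show "?F (Dom u) n (Rst (smash T A) u n x) = Rst B u n (?F (Cod u) n x)"
        by (auto simp only: El_smash F Rst_smash[OF A a(1)] rst Rst_El[OF A] Sm_Dom Sm_Cod)
    qed (rule FB)
  qed
qed

lemma smash_left_mk: "smash_left X T T' \<psi> A = mk X (smash T A) (smash T' A) (\<lambda>Y n w. case dec w of (t, a) \<Rightarrow> smash_pair A Y n (\<psi> t) a)"
  by (simp add: smash_left_def mk_def)

lemma Fn_smash_left:
  assumes "pointed_smap T T' \<psi>" "Y \<in> S" "t \<in> Spx T n" "a \<in> El A Y n"
  shows "Fn (smash_left X T T' \<psi> A) Y n (smash_pair A Y n t a) = smash_pair (A :: ('a, 'b) pspsh) Y n (\<psi> t) a"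
proof -
  have "(case dec (smash_pair A Y n t a) of (t, a) \<Rightarrow> smash_pair A Y n (\<psi> t) a) = smash_pair A Y n (\<psi> t) a"
    by (rule case_smash_pair[where b = "enc ([], undefined)"])
      (use pointed_smapD(3)[OF assms(1)] in \<open>auto simp:\<close>)
  then show ?thesis using assms smash_pair_El[of t T n a A Y] by (simp add: smash_left_mk)
qed

lemma smash_left_hom [intro]:
  assumes \<psi>: "pointed_smap T T' \<psi>" and A: "A \<in> Ob M"
  shows "smash_left X T T' \<psi> A \<in> Hom (smash T A) (smash T' A)"
proof -
  note T = pointed_smapD[OF \<psi>]
  have eq: "smash_left X T T' \<psi> A = bimap T A (smash T' A) (\<lambda>Y n t a. smash_pair A Y n (\<psi> t) a)"
    unfolding smash_left_mk bimap_def mk_def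
    by (intro arrow.equality; simp; intro canon_cong)
      (auto simp: El_smash smash_pair_def T(3))
  show ?thesis
    unfolding eq by (rule bimap_hom[OF T(1) A smash_Ob[OF T(2) A]])
      (use T A in \<open>auto simp: Op_smash Rst_smash smash_pair_El\<close>)
qed

lemma smash_map_mk: "smash_map X T f = mk X (smash T (Dom f)) (smash T (Cod f)) (\<lambda>Y n w. case dec w of (t, a) \<Rightarrow> smash_pair (Cod f) Y n t (Fn f Y n a))"
  by (simp add: smash_map_def mk_def)

lemma Fn_smash_map:
  assumes "f \<in> Hom A B" "Y \<in> S" "t \<in> Spx T n" "a \<in> El A Y n"
  shows "Fn (smash_map X T f) Y n (smash_pair A Y n t a) = smash_pair B Y n t (Fn f Y n a)"
proof -
  have D: "Dom f = A" "Cod f = B" using assms(1) by (simp_all add: in_hom_psPre)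
  have "(case dec (smash_pair A Y n t a) of (t, a) \<Rightarrow> smash_pair B Y n t (Fn f Y n a)) = smash_pair B Y n t (Fn f Y n a)"
    by (rule case_smash_pair[where b = "enc ([], undefined)"])
      (use Fn_Bpt[OF assms(1,2)] in \<open>auto simp: smash_pair_def\<close>)
  then show ?thesis using assms smash_pair_El[of t T n a A Y] by (simp add: smash_map_mk D)
qed

lemma smash_map_hom [intro]:
  assumes T: "pointed_sset T" and f: "f \<in> Hom A B"
  shows "smash_map X T f \<in> Hom (smash T A) (smash T B)"
proof -
  note AB = hom_Dom[OF f] hom_Cod[OF f]
  have D: "Dom f = A" "Cod f = B" using f by (simp_all add: in_hom_psPre)
  have eq: "smash_map X T f = bimap T A (smash T B) (\<lambda>Y n t a. smash_pair B Y n t (Fn f Y n a))"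
    unfolding smash_map_mk bimap_def mk_def D
    by (intro arrow.equality; simp; intro canon_cong)
      (auto simp: El_smash smash_pair_def)
  show ?thesis
    unfolding eq by (rule bimap_hom[OF T AB(1) smash_Ob[OF T AB(2)]])
      (use AB T f in \<open>auto simp: Op_smash Rst_smash smash_pair_El Fn_hom Fn_Op[symmetric] Fn_Rst[symmetric] Fn_Bpt\<close>)
qed

end

subsection \<open>Simplices and their quotients\<close>

lemma simplexD: "t \<in> simplex k n \<Longrightarrow> length t = Suc n" "t \<in> simplex k n \<Longrightarrow> t \<noteq> []"
  by (auto simp: simplex_def)

lemma simplex_map:
  assumes "t \<in> simplex k n" "\<And>i j. i \<le> j \<Longrightarrow> j \<le> k \<Longrightarrow> \<phi> i \<le> \<phi> j" "\<And>i. i \<le> k \<Longrightarrow> \<phi> i \<le> l"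
  shows "map \<phi> t \<in> simplex l n"
proof -
  have "sorted (map \<phi> t)"
    using assms unfolding simplex_def sorted_map
    by (auto intro!: sorted_wrt_mono_rel[of t "(\<le>)"])
  then show ?thesis using assms by (auto simp: simplex_def)
qed

lemma Delta_le: "\<theta> \<in> Delta m n \<Longrightarrow> i \<le> m \<Longrightarrow> \<theta> i \<le> n"
  by (auto simp: Delta_def)

lemma set_list_op: "\<theta> \<in> Delta m n \<Longrightarrow> t \<in> simplex k n \<Longrightarrow> set (list_op m \<theta> t) \<subseteq> set t"
  by (auto simp: list_op_def simplex_def Delta_le less_Suc_eq_le intro!: nth_mem simp del: upt_Suc)

lemma list_op_simplex:
  assumes \<theta>: "\<theta> \<in> Delta m n" and t: "t \<in> simplex k n"
  shows "list_op m \<theta> t \<in> simplex k m"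
proof -
  have "sorted (list_op m \<theta> t)"
    unfolding list_op_def sorted_iff_nth_mono
  proof (intro allI impI)
    fix i j assume "i \<le> j" "j < length (map (\<lambda>i. t ! \<theta> i) [0..<Suc m])"
    then have ij: "i \<le> j" "j \<le> m" by auto
    then have "\<theta> i \<le> \<theta> j" using \<theta> by (auto simp: Delta_def mono_on_def)
    moreover have "\<theta> j \<le> n" using Delta_le[OF \<theta> ij(2)] .
    ultimately have "t ! \<theta> i \<le> t ! \<theta> j" using t by (simp add: simplex_def sorted_iff_nth_mono)
    then show "map (\<lambda>i. t ! \<theta> i) [0..<Suc m] ! i \<le> map (\<lambda>i. t ! \<theta> i) [0..<Suc m] ! j"
      using ij by (simp del: upt_Suc add: nth_map_upt)
  qed
  then show ?thesis using set_list_op[OF assms] t by (auto simp: simplex_def list_op_def)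
qed

lemma list_op_id: "length t = Suc n \<Longrightarrow> list_op n (\<lambda>i\<in>{..n}. i) t = t"
  by (rule nth_equalityI) (auto simp: list_op_def simp del: upt_Suc)

lemma list_op_list_op: "\<phi> \<in> Delta l m \<Longrightarrow> list_op l \<phi> (list_op m \<theta> t) = list_op l (compose {..l} \<theta> \<phi>) t"
  by (rule nth_equalityI) (auto simp: list_op_def compose_def less_Suc_eq_le Delta_le simp del: upt_Suc)

lemma map_list_op: "\<theta> \<in> Delta m n \<Longrightarrow> length t = Suc n \<Longrightarrow> map \<phi> (list_op m \<theta> t) = list_op m \<theta> (map \<phi> t)"
  by (rule nth_equalityI) (auto simp: list_op_def less_Suc_eq_le Delta_le simp del: upt_Suc)

text \<open>Closure of \<open>Q\<close> under the simplicial operators makes the simplices with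
  \<open>Q\<close> a subcomplex, and the quotient collapses this subcomplex to
  \<open>[]\<close>.\<close>

lemma pointed_simplex_quot:
  assumes "\<And>m n \<theta> t. \<theta> \<in> Delta m n \<Longrightarrow> t \<in> simplex k n \<Longrightarrow> Q t \<Longrightarrow> Q (list_op m \<theta> t)"
  shows "pointed_sset (simplex_quot k Q)"
proof -
  have ne: "list_op m \<theta> t \<noteq> []" for m \<theta> t by (simp add: list_op_def)
  have Q: "Q (list_op l (compose {..l} \<theta> \<phi>) t)"
    if "\<phi> \<in> Delta l m" "\<theta> \<in> Delta m n" "t \<in> simplex k n" "Q (list_op m \<theta> t)" for l m n \<phi> \<theta> t
    using assms[OF that(1) list_op_simplex[OF that(2,3)] that(4)] that(1) by (simp add: list_op_list_op)
  show ?thesis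
    unfolding pointed_sset_def is_sset_def
    by (auto simp: simplex_quot_def list_op_simplex list_op_id list_op_list_op simplexD ne dest: Q)
qed

lemma not_constant_Nil [simp]: "\<not> constant_list []"
  by (simp add: constant_list_def)

lemma constant_list_op:
  assumes "\<theta> \<in> Delta m n" "t \<in> simplex k n" "constant_list t"
  shows "constant_list (list_op m \<theta> t)"
proof -
  have "list_op m \<theta> t \<noteq> []" by (simp add: list_op_def)
  then have "set (list_op m \<theta> t) \<noteq> {}" by simp
  moreover obtain a where "set t = {a}" using assms(3) by (auto simp: constant_list_def card_1_singleton_iff)
  ultimately have "set (list_op m \<theta> t) = {a}" using set_list_op[OF assms(1,2)] subset_singletonD[of _ a] by metis
  then show ?thesis by (simp add: constant_list_def)
qed

lemma pointed_plus [simp]: "pointed_sset (simplex_plus k)"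
  unfolding simplex_plus_def by (rule pointed_simplex_quot) simp

lemma pointed_mod [simp]: "pointed_sset (simplex_mod_vertices k)"
  unfolding simplex_mod_vertices_def by (rule pointed_simplex_quot) (rule constant_list_op)

lemma Spx_plus: "Spx (simplex_plus k) n = insert [] (simplex k n)"
  by (simp add: simplex_plus_def simplex_quot_def)

lemma Spx_mod: "Spx (simplex_mod_vertices k) n = insert [] {t \<in> simplex k n. \<not> constant_list t}"
  by (simp add: simplex_mod_vertices_def simplex_quot_def)

lemma Op_plus: "Op (simplex_plus k) m n \<theta> t = (if t = [] then [] else list_op m \<theta> t)"
  by (simp add: simplex_plus_def simplex_quot_def)

lemma pointed_smap_cong:
  assumes "pointed_smap T T' \<psi>" "\<And>n t. t \<in> Spx T n \<Longrightarrow> \<psi> t = \<psi>' t"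
  shows "pointed_smap T T' \<psi>'"
proof -
  note T = pointed_smapD[OF assms(1)]
  have "\<psi>' [] = []" using assms(2)[OF pointed_ssetD(1)[OF T(1)]] T(3) by simp
  moreover have "\<psi>' (Op T m n \<theta> t) = Op T' m n \<theta> (\<psi>' t)" if "\<theta> \<in> Delta m n" "t \<in> Spx T n" for m n \<theta> t
    using T(5)[OF that] assms(2)[OF that(2)] assms(2)[OF pointed_ssetD(3)[OF T(1) that]] by simp
  moreover have "\<psi>' t \<in> Spx T' n" if "t \<in> Spx T n" for t n
    using T(4)[OF that] assms(2)[OF that] by simp
  ultimately show ?thesis using T(1,2) by (simp add: pointed_smap_def is_smap_def)
qed

lemma pointed_smap_map:
  assumes p: "pointed_sset (simplex_quot k Q)" "pointed_sset (simplex_quot l Q')"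
    and \<phi>: "\<And>i j. i \<le> j \<Longrightarrow> j \<le> k \<Longrightarrow> \<phi> i \<le> \<phi> j" "\<And>i. i \<le> k \<Longrightarrow> \<phi> i \<le> l"
    and Q: "\<And>n t. t \<in> simplex k n \<Longrightarrow> Q t \<Longrightarrow> Q' (map \<phi> t)"
    and Q': "\<not> Q' []" "\<And>m n \<theta> t. \<theta> \<in> Delta m n \<Longrightarrow> t \<in> simplex l n \<Longrightarrow> Q' t \<Longrightarrow> Q' (list_op m \<theta> t)"
  shows "pointed_smap (simplex_quot k Q) (simplex_quot l Q') (\<lambda>t. if Q' (map \<phi> t) then [] else map \<phi> t)"
proof -
  have 1: "map \<phi> t \<in> simplex l n" if "t \<in> simplex k n" for t n using simplex_map[OF that \<phi>] .
  let ?\<psi> = "\<lambda>t. if Q' (map \<phi> t) then [] else map \<phi> t"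
  have "?\<psi> (Op (simplex_quot k Q) m n \<theta> t) = Op (simplex_quot l Q') m n \<theta> (?\<psi> t)"
    if \<theta>: "\<theta> \<in> Delta m n" and t: "t \<in> Spx (simplex_quot k Q) n" for m n \<theta> t
  proof (cases "t = []")
    case False
    then have t: "t \<in> simplex k n" using t by (simp add: simplex_quot_def)
    note l = list_op_simplex[OF \<theta> t] and m = map_list_op[OF \<theta> simplexD(1)[OF t], of \<phi>]
    have "Q (list_op m \<theta> t) \<Longrightarrow> Q' (list_op m \<theta> (map \<phi> t))" using Q[OF l] m by simp
    moreover have "Q' (map \<phi> t) \<Longrightarrow> Q' (list_op m \<theta> (map \<phi> t))" using Q'(2)[OF \<theta> 1[OF t]] .
    ultimately show ?thesis using False Q'(1) by (auto simp: simplex_quot_def m)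
  qed (use Q'(1) in \<open>simp add: simplex_quot_def\<close>)
  moreover have "?\<psi> t \<in> Spx (simplex_quot l Q') n" if "t \<in> Spx (simplex_quot k Q) n" for n t
    using that 1 Q'(1) by (auto simp: simplex_quot_def)
  ultimately show ?thesis
    using p Q'(1) unfolding pointed_smap_def is_smap_def by simp
qed

lemma smap_plus:
  assumes "\<And>i j. i \<le> j \<Longrightarrow> j \<le> k \<Longrightarrow> \<phi> i \<le> \<phi> j" "\<And>i. i \<le> k \<Longrightarrow> \<phi> i \<le> l"
  shows "pointed_smap (simplex_plus k) (simplex_plus l) (map \<phi>)"
  using pointed_smap_map[of k "\<lambda>_. False" l "\<lambda>_. False" \<phi>] pointed_plus assms
  unfolding simplex_plus_def by simp

text \<open>The quotient map that identifies the vertices of a simplex: the constant lists are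
  exactly the degenerate simplices on vertices.\<close>

definition collapse :: "nat list \<Rightarrow> nat list" where
  "collapse t = (if constant_list t then [] else t)"

lemma smap_collapse [simp]: "pointed_smap (simplex_plus k) (simplex_mod_vertices k) collapse"
  using pointed_smap_map[of k "\<lambda>_. False" k constant_list "\<lambda>x. x"] pointed_plus[of k] pointed_mod[of k] constant_list_op
  unfolding simplex_plus_def simplex_mod_vertices_def collapse_def[abs_def] by (simp cong: if_cong)

lemma constant_list_map: "constant_list t \<Longrightarrow> constant_list (map \<phi> t)"
  by (auto simp: constant_list_def card_1_singleton_iff)

lemma smap_mod_collapse:
  assumes "\<And>i j. i \<le> j \<Longrightarrow> j \<le> k \<Longrightarrow> \<phi> i \<le> \<phi> j" "\<And>i. i \<le> k \<Longrightarrow> \<phi> i \<le> l"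
  shows "pointed_smap (simplex_mod_vertices k) (simplex_mod_vertices l) (\<lambda>t. collapse (map \<phi> t))"
  using pointed_smap_map[of k constant_list l constant_list \<phi>] pointed_mod[of k] pointed_mod[of l] constant_list_op assms
  unfolding simplex_mod_vertices_def collapse_def[abs_def] by (simp add: constant_list_map)

lemma collapse_map_inj: "inj \<phi> \<Longrightarrow> t \<in> Spx (simplex_mod_vertices k) n \<Longrightarrow> collapse (map \<phi> t) = map \<phi> t"
  by (auto simp: Spx_mod collapse_def constant_list_def card_image inj_on_subset)

lemma inj_coface: "inj (coface j)"
  by (auto simp: inj_def coface_def split: if_splits)

lemma coface_mono: "i \<le> i' \<Longrightarrow> coface j i \<le> coface j i'"
  by (auto simp: coface_def)

lemma coface_le: "i \<le> k \<Longrightarrow> coface j i \<le> Suc k"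
  by (auto simp: coface_def)

lemma smap_coface_plus [simp]: "pointed_smap (simplex_plus k) (simplex_plus (Suc k)) (map (coface j))"
  by (rule smap_plus) (auto intro: coface_mono coface_le)

lemma smap_coface_mod [simp]: "pointed_smap (simplex_mod_vertices k) (simplex_mod_vertices (Suc k)) (map (coface j))"
  by (rule pointed_smap_cong[OF smap_mod_collapse[of k "coface j"]])
    (auto intro: coface_mono coface_le collapse_map_inj[OF inj_coface])

text \<open>The boundary of the standard simplex with a disjoint base point: a simplex lies in some
  face if and only if it misses a vertex, and \<open>[]\<close> misses all of them.\<close>

definition bd_plus :: "nat \<Rightarrow> nat list sset" where
  "bd_plus k = \<lparr>Spx = (\<lambda>n. {t \<in> Spx (simplex_plus k) n. set t \<noteq> {..k}}), Op = Op (simplex_plus k)\<rparr>"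

lemma pointed_bd [simp]: "pointed_sset (bd_plus k)"
proof -
  have "set (list_op m \<theta> t) \<noteq> {..k}" if "\<theta> \<in> Delta m n" "t \<in> simplex k n" "set t \<noteq> {..k}" for m n \<theta> t
    using set_list_op[OF that(1,2)] that(2,3) by (auto simp: simplex_def)
  moreover have "{} \<noteq> {..k}" by auto
  ultimately show ?thesis
    using pointed_plus[of k]
    by (simp add: pointed_sset_def is_sset_def bd_plus_def Pi_iff) (auto simp: Spx_plus Op_plus)
qed

lemma smap_bd [simp]: "pointed_smap (bd_plus k) (simplex_plus k) (\<lambda>t. t)"
  by (auto simp: pointed_smap_def is_smap_def) (auto simp: bd_plus_def)

context infinite_sections
begin

lemma smash_left_comp:
  assumes "pointed_smap T T' \<psi>" "pointed_smap T' T'' \<psi>'" "A \<in> Ob M"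
  shows "smash_left X T' T'' \<psi>' A \<cdot> smash_left X T T' \<psi> A = smash_left X T T'' (\<lambda>t. \<psi>' (\<psi> t)) (A :: ('a, 'b) pspsh)"
proof -
  have c: "pointed_smap T T'' (\<lambda>t. \<psi>' (\<psi> t))"
    using assms by (auto simp: pointed_smap_def is_smap_def Pi_iff)
  note h = smash_left_hom[OF assms(1,3)] smash_left_hom[OF assms(2,3)]
  show ?thesis
    by (rule smash_hom_ext[OF comp_hom[OF h] smash_left_hom[OF c assms(3)]])
      (use assms in \<open>simp add: Fn_comp[OF h(1)] smash_pair_El Fn_smash_left[OF assms(1)] Fn_smash_left[OF assms(2)] Fn_smash_left[OF c] pointed_smapD[OF assms(1)]\<close>)
qed

lemma smash_left_cong:
  assumes "pointed_smap T T' \<psi>" "\<And>n t. t \<in> Spx T n \<Longrightarrow> \<psi> t = \<psi>' t" "A \<in> Ob M"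
  shows "smash_left X T T' \<psi> A = smash_left X T T' \<psi>' (A :: ('a, 'b) pspsh)"
  by (rule smash_hom_ext[of _ T A "smash T' A"])
    (use assms pointed_smap_cong[OF assms(1,2)] in \<open>auto simp: Fn_smash_left\<close>)

lemma smash_map_comp:
  assumes "pointed_sset T" "f \<in> Hom A B" "g \<in> Hom B D"
  shows "smash_map X T g \<cdot> smash_map X T f = smash_map X T (g \<cdot> f)"
proof -
  note h = smash_map_hom[OF assms(1,2)] smash_map_hom[OF assms(1,3)]
  show ?thesis
    by (rule smash_hom_ext[OF comp_hom[OF h] smash_map_hom[OF assms(1) comp_hom[OF assms(2,3)]]])
      (use assms in \<open>simp add: Fn_comp[OF h(1)] smash_pair_El Fn_smash_map[OF assms(2)] Fn_smash_map[OF assms(3)]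
         Fn_smash_map[OF comp_hom[OF assms(2,3)]] Fn_hom[OF assms(2)] Fn_comp[OF assms(2)]\<close>)
qed

lemma smash_map_Idn:
  assumes "pointed_sset T" "A \<in> Ob M"
  shows "smash_map X T (Idn M A) = Idn M (smash T A)"
  by (rule smash_hom_ext[OF smash_map_hom[OF assms(1) Idn_hom[OF assms(2)]] Idn_hom[OF smash_Ob[OF assms]]])
    (use assms in \<open>simp add: Fn_smash_map[OF Idn_hom[OF assms(2)]]\<close>, use assms in \<open>simp add: Idn_psPre smash_pair_El\<close>)

lemma smash_left_natural:
  assumes "pointed_smap T T' \<psi>" "f \<in> Hom A B"
  shows "smash_map X T' f \<cdot> smash_left X T T' \<psi> A = smash_left X T T' \<psi> B \<cdot> smash_map X T f"
proof -
  note T = pointed_smapD[OF assms(1)] and AB = hom_Dom[OF assms(2)] hom_Cod[OF assms(2)]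
  note h = smash_left_hom[OF assms(1) AB(1)] smash_map_hom[OF T(2) assms(2)]
    smash_map_hom[OF T(1) assms(2)] smash_left_hom[OF assms(1) AB(2)]
  show ?thesis
    by (rule smash_hom_ext[OF comp_hom[OF h(1,2)] comp_hom[OF h(3,4)]])
      (use assms T in \<open>simp add: Fn_comp[OF h(1)] Fn_comp[OF h(3)] smash_pair_El Fn_smash_map[OF assms(2)] Fn_smash_left[OF assms(1)] Fn_hom[OF assms(2)]\<close>)
qed

lemma smash_map_zero:
  assumes "pointed_sset T" "A \<in> Ob M" "B \<in> Ob M"
  shows "smash_map X T (Zero A B) = Zero (smash T A) (smash T B)"
  by (rule smash_hom_ext[OF smash_map_hom[OF assms(1) zero_hom[OF assms(2,3)]] zero_hom[OF smash_Ob[OF assms(1,2)] smash_Ob[OF assms(1,3)]]])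
    (use assms in \<open>simp add: Fn_smash_map[OF zero_hom[OF assms(2,3)]] smash_pair_El\<close>)

lemma smash_left_mono:
  assumes "pointed_smap T T' \<psi>" "A \<in> Ob M" "\<And>n. inj_on \<psi> (Spx T n)"
  shows "smash_left X T T' \<psi> A \<in> monomorphisms M"
proof (rule injective_mono[OF smash_left_hom[OF assms(1,2)]])
  fix Y n assume Y: "Y \<in> S"
  have e: "\<psi> t = [] \<longleftrightarrow> t = []" if "t \<in> Spx T n" for t
    using inj_onD[OF assms(3)[of n], of t "[]"] that pointed_smapD(3)[OF assms(1)] pointed_ssetD(1)[OF pointed_smapD(1)[OF assms(1)]] by auto
  show "inj_on (Fn (smash_left X T T' \<psi> A) Y n) (El (smash T A) Y n)"
  proof (rule inj_onI)
    fix x x' assume "x \<in> El (smash T A) Y n" "x' \<in> El (smash T A) Y n"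
    then obtain t a t' a' where x: "x = smash_pair A Y n t a" "t \<in> Spx T n" "a \<in> El A Y n"
      "x' = smash_pair A Y n t' a'" "t' \<in> Spx T n" "a' \<in> El A Y n"
      by (auto simp: El_smash)
    assume "Fn (smash_left X T T' \<psi> A) Y n x = Fn (smash_left X T T' \<psi> A) Y n x'"
    then have "smash_pair A Y n (\<psi> t) a = smash_pair A Y n (\<psi> t') a'"
      using x Y by (simp add: Fn_smash_left[OF assms(1)])
    then show "x = x'"
      unfolding x smash_pair_eq_iff e[OF x(2)] e[OF x(5)] using inj_onD[OF assms(3)[of n], of t t'] x by blast
  qed
qed

end

section \<open>Lifting properties\<close>

lemma kan_fibrationD:
  assumes "kan_fibration S T f" "1 \<le> n" "k \<le> n" "y \<in> Spx T n"
    "\<forall>j\<le>n. j \<noteq> k \<longrightarrow> x j \<in> Spx S (n - 1) \<and> f (n - 1) (x j) = face T n j y"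
    "2 \<le> n \<longrightarrow> (\<forall>i j. i < j \<and> j \<le> n \<and> i \<noteq> k \<and> j \<noteq> k \<longrightarrow>
       face S (n - 1) i (x j) = face S (n - 1) (j - 1) (x i))"
  shows "\<exists>z\<in>Spx S n. f n z = y \<and> (\<forall>j\<le>n. j \<noteq> k \<longrightarrow> face S n j z = x j)"
  using assms unfolding kan_fibration_def by simp

text \<open>The homotopy theory up to the exact sequence is developed from these axioms with
  \<open>W\<close> as a parameter; \<open>motivic_presheaves\<close> sets it to the motivic weak
  equivalences.\<close>

locale presheaf_model = infinite_sections X W for X :: "('a, 'a) rspace" and W :: "('a, 'b) parr set" +
  assumes simplicial: "simplicial_model X W (monomorphisms (psPre X)) (rlp (psPre X) (monomorphisms (psPre X) \<inter> W))"
begin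

abbreviation "Cof \<equiv> monomorphisms M"
abbreviation "Fb \<equiv> rlp M (Cof \<inter> W)"

lemma model: "model_category M W Cof Fb"
  using simplicial by (simp add: simplicial_model_def)

lemma W_Ar: "W \<subseteq> Ar M"
  using model by (simp add: model_category_def)

lemma two_of_three: "\<forall>f\<in>Ar M. \<forall>g\<in>Ar M. Dom g = Cod f \<longrightarrow>
        (f \<in> W \<and> g \<in> W \<longrightarrow> g \<cdot> f \<in> W) \<and> (f \<in> W \<and> g \<cdot> f \<in> W \<longrightarrow> g \<in> W) \<and>
        (g \<in> W \<and> g \<cdot> f \<in> W \<longrightarrow> f \<in> W)"
  using model unfolding model_category_def by (elim conjE)

lemma retracts: "\<forall>f g. is_retract M f g \<longrightarrow>
        (g \<in> W \<longrightarrow> f \<in> W) \<and> (g \<in> Cof \<longrightarrow> f \<in> Cof) \<and> (g \<in> Fb \<longrightarrow> f \<in> Fb)"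
  using model unfolding model_category_def by (elim conjE)

lemma lifting: "\<forall>i\<in>Cof. \<forall>p\<in>Fb. i \<in> W \<or> p \<in> W \<longrightarrow> has_lifting M i p"
  using model unfolding model_category_def by (elim conjE)

lemma factorization: "\<forall>f\<in>Ar M. (\<exists>i\<in>Cof \<inter> W. \<exists>p\<in>Fb. Dom p = Cod i \<and> f = p \<cdot> i) \<and>
               (\<exists>i\<in>Cof. \<exists>p\<in>Fb \<inter> W. Dom p = Cod i \<and> f = p \<cdot> i)"
  using model unfolding model_category_def by (elim conjE)

lemma limits: "finite_limits M"
  using model unfolding model_category_def by (elim conjE)

lemma W_comp: "f \<in> Hom A B \<Longrightarrow> g \<in> Hom B D \<Longrightarrow> f \<in> W \<Longrightarrow> g \<in> W \<Longrightarrow> g \<cdot> f \<in> W"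
  and W_left: "f \<in> Hom A B \<Longrightarrow> g \<in> Hom B D \<Longrightarrow> f \<in> W \<Longrightarrow> g \<cdot> f \<in> W \<Longrightarrow> g \<in> W"
  and W_right: "f \<in> Hom A B \<Longrightarrow> g \<in> Hom B D \<Longrightarrow> g \<in> W \<Longrightarrow> g \<cdot> f \<in> W \<Longrightarrow> f \<in> W"
  using two_of_three[rule_format, of f g] unfolding in_hom by simp_all

lemma Cof_Ar: "Cof \<subseteq> Ar M"
  by (auto simp: monomorphisms_def)

section \<open>Lifting, factorization and fibrant objects\<close>

lemma Fb_lift:
  assumes "p \<in> Fb" "p \<in> Hom E B" "i \<in> Cof" "i \<in> W" "i \<in> Hom A A'" "u \<in> Hom A E" "v \<in> Hom A' B" "p \<cdot> u = v \<cdot> i"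
  obtains h where "h \<in> Hom A' E" "h \<cdot> i = u" "p \<cdot> h = v"
proof -
  have "has_lifting M i p" using assms(1,3,4) by (simp add: rlp_def)
  moreover have "square M i p u v" using assms by (simp add: square_def in_hom)
  ultimately obtain h where "h \<in> homset M (Cod i) (Dom p)" "h \<cdot> i = u" "p \<cdot> h = v"
    unfolding has_lifting_def by blast
  then show ?thesis using assms that[of h] by (simp add: in_hom)
qed

lemma FbW_lift:
  assumes "p \<in> Fb" "p \<in> W" "p \<in> Hom E B" "i \<in> Cof" "i \<in> Hom A A'" "u \<in> Hom A E" "v \<in> Hom A' B" "p \<cdot> u = v \<cdot> i"
  obtains h where "h \<in> Hom A' E" "h \<cdot> i = u" "p \<cdot> h = v"
proof -
  have "has_lifting M i p" using lifting assms(1,2,4) by blast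
  moreover have "square M i p u v" using assms by (simp add: square_def in_hom)
  ultimately obtain h where "h \<in> homset M (Cod i) (Dom p)" "h \<cdot> i = u" "p \<cdot> h = v"
    unfolding has_lifting_def by blast
  then show ?thesis using assms that[of h] by (simp add: in_hom)
qed

lemma factor_CW_F:
  assumes "f \<in> Hom A B"
  obtains i p E where "i \<in> Cof" "i \<in> W" "i \<in> Hom A E" "p \<in> Fb" "p \<in> Hom E B" "p \<cdot> i = f"
proof -
  have "f \<in> Ar M" using assms by (simp add: in_hom)
  then obtain i p where 1: "i \<in> Cof \<inter> W" "p \<in> Fb" "Dom p = Cod i" "f = p \<cdot> i"
    using factorization by blast
  then have 2: "i \<in> Ar M" "p \<in> Ar M" using W_Ar by (auto simp: rlp_def)
  have "Dom i = A" "Cod p = B" using assms 1 Dom_comp[OF 2 1(3)] Cod_comp[OF 2 1(3)] by (auto simp: in_hom)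
  then show ?thesis using that[of i "Cod i" p] 1 2 by (auto simp: in_hom)
qed

lemma FbI:
  assumes p: "p \<in> Hom E B"
    and l: "\<And>i A A' u v. i \<in> Cof \<Longrightarrow> i \<in> W \<Longrightarrow> i \<in> Hom A A' \<Longrightarrow> u \<in> Hom A E \<Longrightarrow> v \<in> Hom A' B \<Longrightarrow>
       p \<cdot> u = v \<cdot> i \<Longrightarrow> \<exists>h\<in>Hom A' E. h \<cdot> i = u \<and> p \<cdot> h = v"
  shows "p \<in> Fb"
proof -
  have "\<exists>h. h \<in> homset M (Cod i) (Dom p) \<and> h \<cdot> i = u \<and> p \<cdot> h = v" if "i \<in> Cof" "i \<in> W" "square M i p u v" for i u v
    using l[of i "Dom i" "Cod i" u v] p that by (auto simp: square_def in_hom)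
  then show ?thesis using p by (auto simp: rlp_def has_lifting_def in_hom)
qed

text \<open>The retract argument.\<close>

lemma triv_cofI:
  assumes i: "i \<in> Hom A A'"
    and l: "\<And>p E B u v. p \<in> Fb \<Longrightarrow> p \<in> Hom E B \<Longrightarrow> u \<in> Hom A E \<Longrightarrow> v \<in> Hom A' B \<Longrightarrow>
       p \<cdot> u = v \<cdot> i \<Longrightarrow> \<exists>h\<in>Hom A' E. h \<cdot> i = u \<and> p \<cdot> h = v"
  shows "i \<in> Cof \<and> i \<in> W"
proof -
  obtain j p E where j: "j \<in> Cof" "j \<in> W" "j \<in> Hom A E" and p: "p \<in> Fb" "p \<in> Hom E A'" "p \<cdot> j = i"
    using factor_CW_F[OF i] by metis
  have A: "A \<in> Ob M" "A' \<in> Ob M" using i by (auto dest: hom_Dom hom_Cod)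
  note I = Idn_hom[OF A(1)] Idn_hom[OF A(2)]
  have "p \<cdot> j = Idn M A' \<cdot> i" using p(3) Idn_comp[OF i] by simp
  from l[OF p(1,2) j(3) I(2) this] obtain h where h: "h \<in> Hom A' E" "h \<cdot> i = j" "p \<cdot> h = Idn M A'" by auto
  have "square M i j (Idn M A) h" "square M j i (Idn M A) p"
    unfolding square_def using i j p h I comp_Idn[OF i] comp_Idn[OF j(3)] by (auto simp: in_hom)
  moreover have "Idn M A \<cdot> Idn M A = Idn M (Dom i)" "p \<cdot> h = Idn M (Cod i)"
    using h(3) comp_Idn[OF I(1)] i by (auto simp: in_hom)
  ultimately have "is_retract M i j" unfolding is_retract_def by blast
  then show ?thesis using retracts j by blast
qed

definition fibrant :: "('a, 'b) pspsh \<Rightarrow> bool" where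
  "fibrant B \<longleftrightarrow> B \<in> Ob M \<and> Zero B point \<in> Fb"

lemma fibrant_Ob: "fibrant B \<Longrightarrow> B \<in> Ob M"
  by (simp add: fibrant_def)

lemma Zero_hom [intro]: "A \<in> Ob M \<Longrightarrow> B \<in> Ob M \<Longrightarrow> Zero A B \<in> Hom A B"
  by (rule zero_hom)

lemma fibrant_extend:
  assumes "fibrant B" "i \<in> Cof" "i \<in> W" "i \<in> Hom A A'" "u \<in> Hom A B"
  obtains h where "h \<in> Hom A' B" "h \<cdot> i = u"
proof -
  have o: "A' \<in> Ob M" "B \<in> Ob M" "A \<in> Ob M" using assms(4,5) by (auto dest: hom_Cod hom_Dom)
  have "Zero B point \<cdot> u = Zero A' point \<cdot> i"
    using assms by (simp add: zero_comp[where R = point])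
  with assms(1) Fb_lift[OF _ Zero_hom[OF o(2) point_Ob] assms(2-5) Zero_hom[OF o(1) point_Ob]] that
  show ?thesis by (auto simp: fibrant_def)
qed

lemma fibrantI:
  assumes B: "B \<in> Ob M"
    and l: "\<And>i A A' u. i \<in> Cof \<Longrightarrow> i \<in> W \<Longrightarrow> i \<in> Hom A A' \<Longrightarrow> u \<in> Hom A B \<Longrightarrow> \<exists>h\<in>Hom A' B. h \<cdot> i = u"
  shows "fibrant B"
proof -
  have "Zero B point \<in> Fb"
  proof (rule FbI[OF Zero_hom[OF B point_Ob]])
    fix i A A' u v assume a: "i \<in> Cof" "i \<in> W" "i \<in> Hom A A'" "u \<in> Hom A B" "v \<in> Hom A' point"
    then obtain h where h: "h \<in> Hom A' B" "h \<cdot> i = u" using l by blast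
    moreover have "Zero B point \<cdot> h = v"
      using hom_point[OF a(5)] zero_comp[OF h(1)] by simp
    ultimately show "\<exists>h\<in>Hom A' B. h \<cdot> i = u \<and> Zero B point \<cdot> h = v" by blast
  qed
  then show ?thesis using B by (simp add: fibrant_def)
qed

lemma fibrant_total:
  assumes p: "p \<in> Fb" "p \<in> Hom E B" and B: "fibrant B"
  shows "fibrant E"
proof (rule fibrantI[OF hom_Dom[OF p(2)]])
  fix i A A' u assume a: "i \<in> Cof" "i \<in> W" "i \<in> Hom A A'" "u \<in> Hom A E"
  obtain v where v: "v \<in> Hom A' B" "v \<cdot> i = p \<cdot> u"
    using fibrant_extend[OF B a(1-3) comp_hom[OF a(4) p(2)]] by metis
  show "\<exists>h\<in>Hom A' E. h \<cdot> i = u" using Fb_lift[OF p a v(1) v(2)[symmetric]] by metis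
qed

text \<open>Fibrations are stable under base change: an extension problem for the fibre is a lifting
  problem for \<open>p\<close> over a zero map, and the lift factors through the fibre
  again.\<close>

lemma fibrant_fibre:
  assumes p: "p \<in> Fb" "p \<in> Hom E B"
  shows "fibrant (fibre p)"
proof (rule fibrantI[OF fibre_Ob[OF p(2)]])
  fix i A A' u assume a: "i \<in> Cof" "i \<in> W" "i \<in> Hom A A'" "u \<in> Hom A (fibre p)"
  have o: "A' \<in> Ob M" "B \<in> Ob M" "A \<in> Ob M" using a p by (auto dest: hom_Cod hom_Dom)
  note k = fibre_incl_hom[OF p(2)]
  have "p \<cdot> (fibre_incl X p \<cdot> u) = Zero A B"
    using assoc[OF a(4) k p(2)] fibre_incl_comp[OF p(2)] zero_comp[OF a(4) o(2)] by simp
  also have "\<dots> = Zero A' B \<cdot> i" using zero_comp[OF a(3) o(2)] by simp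
  finally obtain h where h: "h \<in> Hom A' E" "h \<cdot> i = fibre_incl X p \<cdot> u" "p \<cdot> h = Zero A' B"
    using Fb_lift[OF p a(1-3) comp_hom[OF a(4) k] Zero_hom[OF o(1,2)]] by metis
  obtain g where g: "g \<in> Hom A' (fibre p)" "fibre_incl X p \<cdot> g = h" using factor_fibre[OF p(2) h(1,3)] by metis
  have "g \<cdot> i = u"
    by (rule fibre_incl_cancel[OF p(2) comp_hom[OF a(3) g(1)] a(4)])
      (use assoc[OF a(3) g(1) k] g h in simp)
  then show "\<exists>h\<in>Hom A' (fibre p). h \<cdot> i = u" using g by blast
qed

subsection \<open>Cylinders and horns\<close>

text \<open>A map from \<open>smash (simplex_plus n) A\<close> to \<open>B\<close> is an
  \<open>n\<close>-simplex of the mapping space. Composing it with \<open>vtx n v\<close> takes its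
  vertex \<open>v\<close>, composing with \<open>dface\<close> takes a face, and composing a map on
  \<open>A\<close> with \<open>proj n\<close> gives the totally degenerate simplex on it.\<close>

definition vtx :: "nat \<Rightarrow> nat \<Rightarrow> ('a, 'b) pspsh \<Rightarrow> ('a, 'b) parr" where
  "vtx n v A = mk X A (smash (simplex_plus n) A) (\<lambda>Y l a. smash_pair A Y l (replicate (Suc l) v) a)"

definition proj :: "nat \<Rightarrow> ('a, 'b) pspsh \<Rightarrow> ('a, 'b) parr" where
  "proj n A = bimap (simplex_plus n) A A (\<lambda>Y l t a. if t = [] then Bpt A Y l else a)"

definition dface :: "nat \<Rightarrow> nat \<Rightarrow> ('a, 'b) pspsh \<Rightarrow> ('a, 'b) parr" where
  "dface n j A = smash_left X (simplex_plus n) (simplex_plus (Suc n)) (map (coface j)) A"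

abbreviation "cyl \<equiv> smash (simplex_plus (Suc 0))"

lemma cyl_end_vtx: "cyl_end X v A = vtx (Suc 0) v A"
  by (simp add: cyl_end_def vtx_def mk_def)

lemma replicate_simplex: "v \<le> n \<Longrightarrow> replicate (Suc l) v \<in> simplex n l"
  by (simp add: simplex_def sorted_replicate del: replicate_Suc)

lemma list_op_replicate: "\<theta> \<in> Delta m l \<Longrightarrow> list_op m \<theta> (replicate (Suc l) v) = replicate (Suc m) v"
  by (rule nth_equalityI) (auto simp: list_op_def less_Suc_eq_le Delta_le simp del: upt_Suc replicate_Suc)

lemma Spx_plus_replicate: "v \<le> n \<Longrightarrow> replicate (Suc l) v \<in> Spx (simplex_plus n) l"
  by (simp add: Spx_plus replicate_simplex del: replicate_Suc)

lemma vtx_hom: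
  assumes "v \<le> n" "A \<in> Ob M"
  shows "vtx n v A \<in> Hom A (smash (simplex_plus n) A)"
  unfolding vtx_def
proof (rule mk_hom)
  show "natural_family X A (smash (simplex_plus n) A) (\<lambda>Y l. smash_pair A Y l (replicate (Suc l) v))"
    using assms
    by (auto simp: natural_family_def smash_pair_El Spx_plus_replicate Op_smash Rst_smash Op_plus list_op_replicate simp del: replicate_Suc)
qed (use assms in auto)

lemma Fn_vtx [simp]: "Y \<in> S \<Longrightarrow> a \<in> El A Y l \<Longrightarrow> Fn (vtx n v A) Y l a = smash_pair A Y l (replicate (Suc l) v) a"
  by (simp add: vtx_def)

lemma proj_hom: "A \<in> Ob M \<Longrightarrow> proj n A \<in> Hom (smash (simplex_plus n) A) A"
  unfolding proj_def
  by (rule bimap_hom)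
    (auto simp: Bpt_El Op_El Op_Bpt Rst_Bpt Op_plus Spx_plus Sm_Cod list_op_def)

lemma Fn_proj [simp]: "Y \<in> S \<Longrightarrow> t \<in> Spx (simplex_plus n) l \<Longrightarrow> a \<in> El A Y l \<Longrightarrow>
    Fn (proj n A) Y l (smash_pair A Y l t a) = (if t = [] then Bpt A Y l else a)"
  unfolding proj_def by (subst Fn_bimap) auto

lemma proj_vtx: "v \<le> n \<Longrightarrow> A \<in> Ob M \<Longrightarrow> proj n A \<cdot> vtx n v A = Idn M A"
  by (rule hom_ext[OF comp_hom[OF vtx_hom proj_hom] Idn_hom])
    (auto simp: Fn_comp[OF vtx_hom] Spx_plus_replicate simp del: replicate_Suc, simp add: Idn_psPre)

lemma vtx_proj: "A \<in> Ob M \<Longrightarrow> vtx 0 0 A \<cdot> proj 0 A = Idn M (smash (simplex_plus 0) A)"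
proof (rule smash_hom_ext[OF comp_hom[OF proj_hom vtx_hom] Idn_hom])
  fix Y n t a assume a: "A \<in> Ob M" "Y \<in> S" "t \<in> Spx (simplex_plus 0) n" "a \<in> El A Y n"
  have "t = [] \<or> t = replicate (Suc n) 0"
    using a(3) by (auto simp: Spx_plus simplex_def intro: replicate_eqI simp del: replicate_Suc)
  then show "Fn (vtx 0 0 A \<cdot> proj 0 A) Y n (smash_pair A Y n t a) = Fn (Idn M (smash (simplex_plus 0) A)) Y n (smash_pair A Y n t a)"
    using a by (auto simp: Fn_comp[OF proj_hom[OF a(1)]] smash_pair_El Idn_psPre Bpt_El Spx_plus_replicate simp del: replicate_Suc)
qed auto

lemma smash_left_vtx:
  assumes "pointed_smap (simplex_plus n) T \<psi>" "v \<le> n" "A \<in> Ob M" "f \<in> Hom A (smash T A)"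
    "\<And>l. \<psi> (replicate (Suc l) v) = \<psi>' l"
    "\<And>Y l a. Y \<in> S \<Longrightarrow> a \<in> El A Y l \<Longrightarrow> Fn f Y l a = smash_pair A Y l (\<psi>' l) a"
  shows "smash_left X (simplex_plus n) T \<psi> A \<cdot> vtx n v A = f"
  by (rule hom_ext[OF comp_hom[OF vtx_hom[OF assms(2,3)] smash_left_hom[OF assms(1,3)]] assms(4)])
    (simp add: Fn_comp[OF vtx_hom[OF assms(2,3)]] Fn_smash_left[OF assms(1)] Spx_plus_replicate assms(2) assms(5,6) del: replicate_Suc)

lemma map_vtx:
  assumes "pointed_smap (simplex_plus n) (simplex_plus m) (map \<phi>)" "v \<le> n" "\<phi> v \<le> m" "A \<in> Ob M"
  shows "smash_left X (simplex_plus n) (simplex_plus m) (map \<phi>) A \<cdot> vtx n v A = vtx m (\<phi> v) A"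
  by (rule smash_left_vtx[where \<psi>' = "\<lambda>l. replicate (Suc l) (\<phi> v)"]) (use assms in \<open>auto simp: vtx_hom simp del: replicate_Suc\<close>)

lemma vtx_natural:
  assumes "v \<le> n" "f \<in> Hom A B"
  shows "smash_map X (simplex_plus n) f \<cdot> vtx n v A = vtx n v B \<cdot> f"
proof -
  note AB = hom_Dom[OF assms(2)] hom_Cod[OF assms(2)]
  note h = vtx_hom[OF assms(1) AB(1)] vtx_hom[OF assms(1) AB(2)] smash_map_hom[OF pointed_plus assms(2), of n]
  show ?thesis
    by (rule hom_ext[OF comp_hom[OF h(1) h(3)] comp_hom[OF assms(2) h(2)]])
      (use assms in \<open>simp add: Fn_comp[OF h(1)] Fn_comp[OF assms(2)] Fn_hom[OF assms(2)] Fn_smash_map[OF assms(2)] Spx_plus_replicate del: replicate_Suc\<close>)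
qed

lemma proj_natural:
  assumes "f \<in> Hom A B"
  shows "proj n B \<cdot> smash_map X (simplex_plus n) f = f \<cdot> proj n A"
proof -
  note AB = hom_Dom[OF assms] hom_Cod[OF assms]
  note h = smash_map_hom[OF pointed_plus assms, of n] proj_hom[OF AB(1), of n] proj_hom[OF AB(2), of n]
  show ?thesis
    by (rule smash_hom_ext[OF comp_hom[OF h(1) h(3)] comp_hom[OF h(2) assms]])
      (simp add: Fn_comp[OF h(1)] Fn_comp[OF h(2)] Fn_smash_map[OF assms] Fn_hom[OF assms] smash_pair_El Fn_Bpt[OF assms])
qed

lemma dface_hom [intro]: "A \<in> Ob M \<Longrightarrow> dface n j A \<in> Hom (smash (simplex_plus n) A) (smash (simplex_plus (Suc n)) A)"
  unfolding dface_def by (rule smash_left_hom) auto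

lemma dface_vtx: "v \<le> n \<Longrightarrow> A \<in> Ob M \<Longrightarrow> dface n j A \<cdot> vtx n v A = vtx (Suc n) (coface j v) A"
  unfolding dface_def by (rule map_vtx) (auto intro: coface_le)

lemma dface_dface:
  assumes "i < j" "A \<in> Ob M"
  shows "dface (Suc n) j A \<cdot> dface n i A = dface (Suc n) i A \<cdot> dface n (j - 1) A"
proof -
  have "coface j (coface i v) = coface i (coface (j - 1) v)" for v
    using assms(1) by (auto simp: coface_def)
  then show ?thesis
    unfolding dface_def smash_left_comp[OF smap_coface_plus smap_coface_plus assms(2)] by (simp add: comp_def)
qed

text \<open>\<open>face\<close> restricts \<open>coface j\<close> to \<open>{..n}\<close> in order
  to have an element of \<open>Delta\<close>. The entries of lists in \<open>simplex n l\<close> are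
  at most \<open>n\<close>, so on them the restriction changes nothing.\<close>

lemma face_pMap:
  assumes "\<sigma> \<in> Hom (smash (simplex_plus (Suc n)) A) B" "A \<in> Ob M"
  shows "face (pMap X A B) (Suc n) j \<sigma> = \<sigma> \<cdot> dface n j A"
proof -
  have "map (coface j) t = map (restrict (coface j) {..n}) t" if "t \<in> Spx (simplex_plus n) l" for l t
    using that by (auto simp: Spx_plus simplex_def)
  then have "smash_left X (simplex_plus n) (simplex_plus (Suc n)) (map (restrict (coface j) {..n})) A = dface n j A"
    unfolding dface_def by (intro smash_left_cong[OF smap_coface_plus, symmetric] assms(2))
  then show ?thesis by (simp add: face_def pMap_def)
qed

lemma hom_smash_point:
  assumes "pointed_sset T" "f \<in> Hom (smash T point) B"
  shows "f = Zero (smash T point) B"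
proof -
  have z: "smash_pair point Y n t a = enc ([], undefined)" if "a \<in> El point Y n" for Y n t and a :: 'b
    using that by (simp add: smash_pair_def point_def)
  note h = Zero_hom[OF smash_Ob[OF assms(1) point_Ob] hom_Cod[OF assms(2)]]
  show ?thesis
  proof (rule smash_hom_ext[OF assms(2) h])
    fix Y n t and a :: 'b assume "Y \<in> S" "a \<in> El point Y n"
    then show "Fn f Y n (smash_pair point Y n t a) = Fn (Zero (smash T point) B) Y n (smash_pair point Y n t a)"
      using Fn_Bpt[OF assms(2)] Fn_Bpt[OF h] by (simp add: z)
  qed
qed

lemma point_mono: "K \<in> Ob M \<Longrightarrow> Zero point K \<in> Cof"
  by (rule injective_mono[OF Zero_hom[OF point_Ob]]) (auto simp: point_def)

text \<open>SM7 for the cofibration from \<open>point\<close> to \<open>K\<close>. The mapping space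
  out of \<open>point\<close> has one simplex in each dimension, so a simplex of the pullback in SM7
  amounts to a simplex of the mapping space from \<open>K\<close> to \<open>B\<close>.\<close>

lemma pMap_kan:
  assumes p: "p \<in> Fb" "p \<in> Hom E B" and K: "K \<in> Ob M"
  shows "kan_fibration (pMap X K E) (pMap X K B) (\<lambda>n \<sigma>. p \<cdot> \<sigma>)"
proof -
  have EB: "E \<in> Ob M" "B \<in> Ob M" using p by (auto dest: hom_Dom hom_Cod)
  define i where "i = Zero point K"
  have i: "i \<in> Cof" "i \<in> Hom point K" "Dom i = point" "Cod i = K" "Dom p = E" "Cod p = B"
    using point_mono[OF K] Zero_hom[OF point_Ob K] p(2) by (simp_all add: i_def in_hom)
  define T where "T = pMap_pullback X i p"
  define f where "f = (\<lambda>n \<sigma>. (pMap_pre X i n \<sigma>, p \<cdot> \<sigma>))"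
  have kan: "kan_fibration (pMap X K E) T f"
    using simplicial i p by (auto simp: simplicial_model_def T_def f_def Let_def)
  define z0 where "z0 n = Zero (smash (simplex_plus n) point) E" for n
  have z0: "z0 n \<in> Hom (smash (simplex_plus n) point) E" for n
    unfolding z0_def by (intro Zero_hom smash_Ob EB) auto
  have pt: "g = z0 n" if "g \<in> Hom (smash (simplex_plus n) point) E" for g n
    using hom_smash_point[OF pointed_plus that] by (simp add: z0_def)
  have pre: "pMap_pre X i n \<sigma> \<in> Hom (smash (simplex_plus n) point) Q" if "\<sigma> \<in> Hom (smash (simplex_plus n) K) Q" for n \<sigma> Q
    unfolding pMap_pre_def by (rule comp_hom[OF smash_map_hom[OF pointed_plus i(2)] that])
  have face0: "face (pMap X point E) n j (z0 n) = z0 (n - 1)" if "1 \<le> n" for n j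
  proof -
    obtain m where n: "n = Suc m" using \<open>1 \<le> n\<close> by (cases n) auto
    show ?thesis unfolding n
      using face_pMap[OF z0 point_Ob, of m j] pt[OF comp_hom[OF dface_hom[OF point_Ob] z0]] by simp
  qed
  show ?thesis
    unfolding kan_fibration_def
  proof (intro allI impI, elim conjE)
    fix n k x y
    assume a: "1 \<le> n" "k \<le> n" "y \<in> Spx (pMap X K B) n"
      "\<forall>j\<le>n. j \<noteq> k \<longrightarrow> x j \<in> Spx (pMap X K E) (n - 1) \<and> p \<cdot> x j = face (pMap X K B) n j y"
      "2 \<le> n \<longrightarrow> (\<forall>i j. i < j \<and> j \<le> n \<and> i \<noteq> k \<and> j \<noteq> k \<longrightarrow>
           face (pMap X K E) (n - 1) i (x j) = face (pMap X K E) (n - 1) (j - 1) (x i))"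
    have y: "y \<in> Hom (smash (simplex_plus n) K) B" using a(3) by (simp add: pMap_def)
    have "p \<cdot> z0 n = pMap_pre X i n y"
      using hom_smash_point[OF pointed_plus pre[OF y]] comp_zero[OF p(2) smash_Ob[OF pointed_plus point_Ob]]
      by (simp add: z0_def)
    then have yT: "(z0 n, y) \<in> Spx T n" using z0 y by (simp add: T_def pMap_pullback_def pMap_def i)
    have fT: "face T n j (z0 n, y) = (z0 (n - 1), face (pMap X K B) n j y)" for j
      using face0[OF a(1), of j] by (simp add: T_def pMap_pullback_def face_def i)
    have "\<forall>j\<le>n. j \<noteq> k \<longrightarrow> x j \<in> Spx (pMap X K E) (n - 1) \<and> f (n - 1) (x j) = face T n j (z0 n, y)"
      using a(4) pre pt by (auto simp: fT f_def pMap_def)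
    then have "\<exists>z\<in>Spx (pMap X K E) n. f n z = (z0 n, y) \<and> (\<forall>j\<le>n. j \<noteq> k \<longrightarrow> face (pMap X K E) n j z = x j)"
      using kan_fibrationD[OF kan a(1,2) yT _ a(5)] by simp
    then show "\<exists>z\<in>Spx (pMap X K E) n. p \<cdot> z = y \<and> (\<forall>j\<le>n. j \<noteq> k \<longrightarrow> face (pMap X K E) n j z = x j)"
      by (auto simp: f_def)
  qed
qed

text \<open>The Kan property in lifting form, with \<open>k\<close> the missing face. The
  compatibility condition is stated for \<open>n = Suc m\<close>, as the prescribed faces have faces
  themselves only in dimension at least 1.\<close>

lemma horn:
  assumes p: "p \<in> Fb" "p \<in> Hom E B" and K: "K \<in> Ob M" and k: "k \<le> Suc n"
    and y: "y \<in> Hom (smash (simplex_plus (Suc n)) K) B"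
    and x: "\<And>j. j \<le> Suc n \<Longrightarrow> j \<noteq> k \<Longrightarrow> x j \<in> Hom (smash (simplex_plus n) K) E \<and> p \<cdot> x j = y \<cdot> dface n j K"
    and c: "\<And>i j m. n = Suc m \<Longrightarrow> i < j \<Longrightarrow> j \<le> Suc n \<Longrightarrow> i \<noteq> k \<Longrightarrow> j \<noteq> k \<Longrightarrow> x j \<cdot> dface m i K = x i \<cdot> dface m (j - 1) K"
  obtains z where "z \<in> Hom (smash (simplex_plus (Suc n)) K) E" "p \<cdot> z = y"
    "\<And>j. j \<le> Suc n \<Longrightarrow> j \<noteq> k \<Longrightarrow> z \<cdot> dface n j K = x j"
proof -
  have 1: "y \<in> Spx (pMap X K B) (Suc n)" using y by (simp add: pMap_def)
  have 2: "\<forall>j\<le>Suc n. j \<noteq> k \<longrightarrow> x j \<in> Spx (pMap X K E) (Suc n - 1) \<and> p \<cdot> x j = face (pMap X K B) (Suc n) j y"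
    unfolding face_pMap[OF y K] using x by (simp add: pMap_def)
  have 3: "\<forall>i j. i < j \<and> j \<le> Suc n \<and> i \<noteq> k \<and> j \<noteq> k \<longrightarrow>
           face (pMap X K E) (Suc n - 1) i (x j) = face (pMap X K E) (Suc n - 1) (j - 1) (x i)" if "2 \<le> Suc n"
  proof -
    obtain m where m: "n = Suc m" using \<open>2 \<le> Suc n\<close> by (cases n) auto
    have f: "face (pMap X K E) (Suc n - 1) i (x j) = x j \<cdot> dface m i K" if "j \<le> Suc n" "j \<noteq> k" for i j
      using face_pMap[of "x j" m K E i, OF _ K] conjunct1[OF x[OF that]] unfolding m by simp
    show ?thesis
    proof (intro allI impI, elim conjE)
      fix i j assume "i < j" "j \<le> Suc n" "i \<noteq> k" "j \<noteq> k"
      then show "face (pMap X K E) (Suc n - 1) i (x j) = face (pMap X K E) (Suc n - 1) (j - 1) (x i)"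
        using f[of j i] f[of i "j - 1"] c[OF m, of i j] by simp
    qed
  qed
  have "\<exists>z\<in>Spx (pMap X K E) (Suc n). p \<cdot> z = y \<and> (\<forall>j\<le>Suc n. j \<noteq> k \<longrightarrow> face (pMap X K E) (Suc n) j z = x j)"
    by (rule kan_fibrationD[OF pMap_kan[OF p K] _ k 1 2]) (use 3 in simp_all)
  then obtain z where z: "z \<in> Hom (smash (simplex_plus (Suc n)) K) E" "p \<cdot> z = y"
    "\<forall>j\<le>Suc n. j \<noteq> k \<longrightarrow> face (pMap X K E) (Suc n) j z = x j"
    by (auto simp: pMap_def)
  show ?thesis
  proof (rule that[OF z(1,2)])
    fix j assume "j \<le> Suc n" "j \<noteq> k"
    then show "z \<cdot> dface n j K = x j" using z(3) face_pMap[OF z(1) K, of j] by simp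
  qed
qed

subsection \<open>Edges and triangles in mapping spaces\<close>

definition edge :: "('a, 'b) pspsh \<Rightarrow> ('a, 'b) pspsh \<Rightarrow> ('a, 'b) parr \<Rightarrow> ('a, 'b) parr \<Rightarrow> ('a, 'b) parr \<Rightarrow> bool" where
  "edge K B x a b \<longleftrightarrow> K \<in> Ob M \<and> x \<in> Hom (cyl K) B \<and> x \<cdot> vtx (Suc 0) 0 K = a \<and> x \<cdot> vtx (Suc 0) (Suc 0) K = b"

text \<open>With vertices 0, 1, 2 the faces are \<open>x\<close> from 1 to 2, \<open>y\<close> from
  0 to 2 and \<open>z\<close> from 0 to 1. So the triangle exhibits \<open>y\<close> as
  \<open>z\<close> followed by \<open>x\<close>.\<close>

definition triangle :: "('a, 'b) pspsh \<Rightarrow> ('a, 'b) pspsh \<Rightarrow> ('a, 'b) parr \<Rightarrow>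
    ('a, 'b) parr \<Rightarrow> ('a, 'b) parr \<Rightarrow> ('a, 'b) parr \<Rightarrow> bool" where
  "triangle K B c x y z \<longleftrightarrow> K \<in> Ob M \<and> c \<in> Hom (smash (simplex_plus (Suc (Suc 0))) K) B \<and>
     c \<cdot> dface (Suc 0) 0 K = x \<and> c \<cdot> dface (Suc 0) (Suc 0) K = y \<and> c \<cdot> dface (Suc 0) (Suc (Suc 0)) K = z"

definition cst :: "('a, 'b) pspsh \<Rightarrow> ('a, 'b) parr \<Rightarrow> ('a, 'b) parr" where
  "cst K a = a \<cdot> proj (Suc 0) K"

lemma edgeD:
  assumes "edge K B x a b"
  shows "K \<in> Ob M" "B \<in> Ob M" "x \<in> Hom (cyl K) B" "a \<in> Hom K B" "b \<in> Hom K B"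
    "x \<cdot> vtx (Suc 0) 0 K = a" "x \<cdot> vtx (Suc 0) (Suc 0) K = b"
  using assms comp_hom[OF vtx_hom, of _ "Suc 0" K x B] by (auto simp: edge_def dest: hom_Cod)

lemma edgeI: "K \<in> Ob M \<Longrightarrow> x \<in> Hom (cyl K) B \<Longrightarrow> edge K B x (x \<cdot> vtx (Suc 0) 0 K) (x \<cdot> vtx (Suc 0) (Suc 0) K)"
  by (simp add: edge_def)

lemma dface_comp_vtx:
  assumes K: "K \<in> Ob M" and c: "c \<in> Hom (smash (simplex_plus (Suc n)) K) B" and v: "v \<le> n"
  shows "(c \<cdot> dface n j K) \<cdot> vtx n v K = c \<cdot> vtx (Suc n) (coface j v) K"
  using assoc[OF vtx_hom[OF v K] dface_hom[OF K] c] dface_vtx[OF v K] by simp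

lemma triangle_edges:
  assumes "triangle K B c x y z"
  obtains u v w where "edge K B x v w" "edge K B y u w" "edge K B z u v"
proof -
  have K: "K \<in> Ob M" and c: "c \<in> Hom (smash (simplex_plus (Suc (Suc 0))) K) B"
    and d: "c \<cdot> dface (Suc 0) 0 K = x" "c \<cdot> dface (Suc 0) (Suc 0) K = y" "c \<cdot> dface (Suc 0) (Suc (Suc 0)) K = z"
    using assms by (auto simp: triangle_def)
  note v = dface_comp_vtx[OF K c]
  show ?thesis
    by (rule that[of "c \<cdot> vtx (Suc (Suc 0)) (Suc 0) K" "c \<cdot> vtx (Suc (Suc 0)) (Suc (Suc 0)) K" "c \<cdot> vtx (Suc (Suc 0)) 0 K"])
      (use v comp_hom[OF dface_hom[OF K] c] in \<open>auto simp: edge_def K d[symmetric] coface_def\<close>)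
qed

lemma edge_post:
  assumes "edge K E x a b" "p \<in> Hom E B"
  shows "edge K B (p \<cdot> x) (p \<cdot> a) (p \<cdot> b)"
  using edgeD[OF assms(1)] assms(2) assoc[OF vtx_hom _ assms(2), of _ "Suc 0" K x]
  by (auto simp: edge_def intro: comp_hom)

lemma triangle_post:
  assumes "triangle K E c x y z" "p \<in> Hom E B"
  shows "triangle K B (p \<cdot> c) (p \<cdot> x) (p \<cdot> y) (p \<cdot> z)"
proof -
  have K: "K \<in> Ob M" and c: "c \<in> Hom (smash (simplex_plus (Suc (Suc 0))) K) E" using assms by (auto simp: triangle_def)
  show ?thesis
    using assms assoc[OF dface_hom[OF K] c assms(2), symmetric] comp_hom[OF c assms(2)] by (simp add: triangle_def)
qed

lemma edge_pre:
  assumes "edge K B x a b" "f \<in> Hom L K"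
  shows "edge L B (x \<cdot> smash_map X (simplex_plus (Suc 0)) f) (a \<cdot> f) (b \<cdot> f)"
proof -
  note e = edgeD[OF assms(1)] and f = assms(2)
  note m = smash_map_hom[OF pointed_plus f, of "Suc 0"]
  have L: "L \<in> Ob M" using f by (rule hom_Dom)
  have "(x \<cdot> smash_map X (simplex_plus (Suc 0)) f) \<cdot> vtx (Suc 0) v L = (x \<cdot> vtx (Suc 0) v K) \<cdot> f" if "v \<le> Suc 0" for v
    using assoc[OF vtx_hom[OF that L] m e(3)] assoc[OF f vtx_hom[OF that e(1)] e(3)] vtx_natural[OF that f] by simp
  then show ?thesis using e L comp_hom[OF m e(3)] by (simp add: edge_def)
qed

lemma cst_hom: "a \<in> Hom K B \<Longrightarrow> cst K a \<in> Hom (cyl K) B"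
  unfolding cst_def by (intro comp_hom[OF proj_hom] hom_Dom)

lemma cst_edge: "a \<in> Hom K B \<Longrightarrow> edge K B (cst K a) a a"
proof -
  assume a: "a \<in> Hom K B"
  then have K: "K \<in> Ob M" by (rule hom_Dom)
  have "cst K a \<cdot> vtx (Suc 0) v K = a" if "v \<le> Suc 0" for v
    unfolding cst_def using assoc[OF vtx_hom[OF that K] proj_hom[OF K] a] proj_vtx[OF that K] comp_Idn[OF a] by simp
  then show ?thesis using K cst_hom[OF a] by (simp add: edge_def)
qed

lemma cst_post: "a \<in> Hom K E \<Longrightarrow> p \<in> Hom E B \<Longrightarrow> p \<cdot> cst K a = cst K (p \<cdot> a)"
  unfolding cst_def by (rule assoc[OF proj_hom[OF hom_Dom]])

definition codeg :: "nat \<Rightarrow> nat \<Rightarrow> nat" where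
  "codeg j i = (if i \<le> j then i else i - 1)"

lemma smap_codeg: "j \<le> n \<Longrightarrow> pointed_smap (simplex_plus (Suc n)) (simplex_plus n) (map (codeg j))"
  by (rule smap_plus) (auto simp: codeg_def)

lemma smap_const: "v \<le> m \<Longrightarrow> pointed_smap (simplex_plus n) (simplex_plus m) (map (\<lambda>_. v))"
  by (rule smap_plus) auto

lemma smash_left_const:
  assumes "v \<le> m" "A \<in> Ob M"
  shows "smash_left X (simplex_plus n) (simplex_plus m) (map (\<lambda>_. v)) A = vtx m v A \<cdot> proj n A"
proof (rule smash_hom_ext[OF smash_left_hom[OF smap_const[OF assms(1)] assms(2)] comp_hom[OF proj_hom[OF assms(2)] vtx_hom[OF assms]]])
  fix Y l t a assume a: "Y \<in> S" "t \<in> Spx (simplex_plus n) l" "a \<in> El A Y l"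
  have "map (\<lambda>_. v) t = (if t = [] then [] else replicate (Suc l) v)"
    using a(2) by (auto simp: Spx_plus simplexD map_replicate_const simp del: replicate_Suc)
  then show "Fn (smash_left X (simplex_plus n) (simplex_plus m) (map (\<lambda>_. v)) A) Y l (smash_pair A Y l t a) =
      Fn (vtx m v A \<cdot> proj n A) Y l (smash_pair A Y l t a)"
    using a assms by (auto simp: Fn_smash_left[OF smap_const[OF assms(1)]] Fn_comp[OF proj_hom[OF assms(2)]] smash_pair_El Bpt_El simp del: replicate_Suc)
qed

text \<open>The two degeneracies of the edge \<open>x\<close>. They supply the unit laws for loops
  and the base triangles over which a lift is concatenated with a homotopy inside the fibre.\<close>

lemma degenerate:
  assumes x: "edge K B x a b"
  obtains c c' where "triangle K B c x x (cst K a)" "triangle K B c' (cst K b) x x"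
proof -
  note e = edgeD[OF x] and K = edgeD(1)[OF x]
  define s where "s j = smash_left X (simplex_plus (Suc (Suc 0))) (simplex_plus (Suc 0)) (map (codeg j)) K" for j
  have sh: "s j \<in> Hom (smash (simplex_plus (Suc (Suc 0))) K) (cyl K)" if "j \<le> Suc 0" for j
    unfolding s_def by (rule smash_left_hom[OF smap_codeg[OF that] K])
  have xs: "(x \<cdot> s j) \<cdot> dface (Suc 0) i K = x \<cdot> smash_left X (simplex_plus (Suc 0)) (simplex_plus (Suc 0)) (\<lambda>t. map (codeg j) (map (coface i) t)) K"
    if "j \<le> Suc 0" for i j
    using assoc[OF dface_hom[OF K] sh[OF that] e(3)] smash_left_comp[OF smap_coface_plus smap_codeg[OF that] K]
    by (simp add: s_def dface_def)
  have id: "smash_left X (simplex_plus (Suc 0)) (simplex_plus (Suc 0)) (\<lambda>t. map (codeg j) (map (coface i) t)) K = Idn M (cyl K)"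
    if "j \<le> Suc 0" "i = j \<or> i = Suc j" for i j
  proof -
    have "codeg j (coface i v) = v" for v using that(2) by (auto simp: codeg_def coface_def)
    then have 1: "(\<lambda>t. map (codeg j) (map (coface i) t)) = (\<lambda>t. t)" by (simp add: comp_def map_idI fun_eq_iff)
    have 2: "pointed_smap (simplex_plus (Suc 0)) (simplex_plus (Suc 0)) (\<lambda>t. t)"
      using smap_plus[of "Suc 0" "\<lambda>x. x" "Suc 0"] by simp
    show ?thesis unfolding 1
      by (rule smash_hom_ext[OF smash_left_hom[OF 2 K] Idn_hom[OF smash_Ob[OF pointed_plus K]]])
        (simp add: Fn_smash_left[OF 2] Idn_psPre smash_pair_El)
  qed
  have cs: "x \<cdot> smash_left X (simplex_plus (Suc 0)) (simplex_plus (Suc 0)) (\<lambda>t. map (codeg j) (map (coface i) t)) K = cst K (x \<cdot> vtx (Suc 0) v K)"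
    if "v \<le> Suc 0" "\<And>w. w \<le> Suc 0 \<Longrightarrow> codeg j (coface i w) = v" for i j v
  proof -
    have "smash_left X (simplex_plus (Suc 0)) (simplex_plus (Suc 0)) (map (\<lambda>_. v)) K =
      smash_left X (simplex_plus (Suc 0)) (simplex_plus (Suc 0)) (\<lambda>t. map (codeg j) (map (coface i) t)) K"
      by (rule smash_left_cong[OF smap_const[OF that(1)] _ K]) (use that(2) in \<open>auto simp: Spx_plus simplex_def\<close>)
    then show ?thesis
      unfolding cst_def smash_left_const[OF that(1) K] assoc[OF proj_hom[OF K] vtx_hom[OF that(1) K] e(3), symmetric] by simp
  qed
  have "triangle K B (x \<cdot> s 0) x x (cst K a)"
    using id[of 0 0] id[of 0 "Suc 0"] cs[of 0 0 "Suc (Suc 0)"] comp_hom[OF sh e(3)]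
    by (auto simp: triangle_def K xs comp_Idn[OF e(3)] e(6)[symmetric] codeg_def coface_def)
  moreover have "triangle K B (x \<cdot> s (Suc 0)) (cst K b) x x"
    using id[of "Suc 0" "Suc 0"] id[of "Suc 0" "Suc (Suc 0)"] cs[of "Suc 0" "Suc 0" 0] comp_hom[OF sh e(3)]
    by (auto simp: triangle_def K xs comp_Idn[OF e(3)] e(7)[symmetric] codeg_def coface_def)
  ultimately show ?thesis by (rule that)
qed

lemma lift_edge:
  assumes p: "p \<in> Fb" "p \<in> Hom E B" and y: "edge K B y (p \<cdot> a) b" and a: "a \<in> Hom K E"
  obtains x where "edge K E x a (x \<cdot> vtx (Suc 0) (Suc 0) K)" "p \<cdot> x = y"
proof -
  note e = edgeD[OF y] and K = edgeD(1)[OF y]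
  note h = proj_hom[OF K, of 0] dface_hom[OF K, of 0 "Suc 0"] vtx_hom[of 0 0, OF _ K]
  have y1: "p \<cdot> (a \<cdot> proj 0 K) = y \<cdot> dface 0 (Suc 0) K"
  proof -
    have "p \<cdot> (a \<cdot> proj 0 K) = (y \<cdot> vtx (Suc 0) 0 K) \<cdot> proj 0 K" using assoc[OF h(1) a p(2)] e(6) by simp
    also have "\<dots> = y \<cdot> (dface 0 (Suc 0) K \<cdot> (vtx 0 0 K \<cdot> proj 0 K))"
      using dface_vtx[of 0 0 K "Suc 0", OF _ K] assoc[OF h(1) h(3) h(2)]
        assoc[OF h(1) comp_hom[OF h(3,2)] e(3)] by (simp add: coface_def)
    finally show ?thesis using vtx_proj[OF K] comp_Idn[OF h(2)] by simp
  qed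
  \<comment> \<open>Face 1 of an edge omits vertex 1, so it is the starting vertex: the horn with
    \<open>k = 0\<close> prescribes the start and leaves the end free.\<close>
  obtain z where z: "z \<in> Hom (cyl K) E" "p \<cdot> z = y" and zd: "\<And>j. j \<le> Suc 0 \<Longrightarrow> j \<noteq> 0 \<Longrightarrow> z \<cdot> dface 0 j K = a \<cdot> proj 0 K"
  proof (rule horn[OF p K, of 0 0 y "\<lambda>_. a \<cdot> proj 0 K"])
    fix j assume "j \<le> Suc 0" "j \<noteq> (0::nat)"
    then show "a \<cdot> proj 0 K \<in> Hom (smash (simplex_plus 0) K) E \<and> p \<cdot> (a \<cdot> proj 0 K) = y \<cdot> dface 0 j K"
      using y1 comp_hom[OF h(1) a] by (simp add: le_Suc_eq)
  qed (use e in auto)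
  have "z \<cdot> vtx (Suc 0) 0 K = (a \<cdot> proj 0 K) \<cdot> vtx 0 0 K"
    using zd[of "Suc 0"] dface_comp_vtx[OF K z(1), of 0 "Suc 0"] by (simp add: coface_def)
  also have "\<dots> = a" using assoc[OF h(3) h(1) a] proj_vtx[of 0 0 K] K comp_Idn[OF a] by simp
  finally show ?thesis using that[of z] z edgeI[OF K z(1)] by simp
qed

lemma zero_dim_eq:
  assumes "f \<in> Hom (smash (simplex_plus 0) K) E" "g \<in> Hom (smash (simplex_plus 0) K) E" "K \<in> Ob M"
    "f \<cdot> vtx 0 0 K = g \<cdot> vtx 0 0 K"
  shows "f = g"
proof -
  have "h = (h \<cdot> vtx 0 0 K) \<cdot> proj 0 K" if h: "h \<in> Hom (smash (simplex_plus 0) K) E" for h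
    using assoc[OF proj_hom[OF assms(3)] vtx_hom[OF le_refl assms(3)] h, symmetric] vtx_proj[OF assms(3)] comp_Idn[OF h] by simp
  from this[OF assms(1)] this[OF assms(2)] assms(4) show ?thesis by simp
qed

lemma edge_faces_eq:
  assumes K: "K \<in> Ob M" and x: "x \<in> Hom (cyl K) E" "x' \<in> Hom (cyl K) E"
    and e: "x \<cdot> vtx (Suc 0) (coface i 0) K = x' \<cdot> vtx (Suc 0) (coface j 0) K"
  shows "x \<cdot> dface 0 i K = x' \<cdot> dface 0 j K"
  by (rule zero_dim_eq[OF comp_hom[OF dface_hom[OF K] x(1)] comp_hom[OF dface_hom[OF K] x(2)] K])
    (simp add: dface_comp_vtx[OF K x(1)] dface_comp_vtx[OF K x(2)] e)

text \<open>Relative composition: the missing face is 1, so a homotopy over \<open>z\<close> and a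
  following one over \<open>x\<close> compose to a homotopy strictly over the given
  \<open>y\<close>.\<close>

lemma horn_inner:
  assumes p: "p \<in> Fb" "p \<in> Hom E B" and t: "triangle K B c x y z"
    and x': "edge K E x' v w" "p \<cdot> x' = x" and z': "edge K E z' u v" "p \<cdot> z' = z"
  obtains c' y' where "triangle K E c' x' y' z'" "edge K E y' u w" "p \<cdot> c' = c" "p \<cdot> y' = y"
proof -
  have K: "K \<in> Ob M" using t by (simp add: triangle_def)
  note ex = edgeD[OF x'(1)] and ez = edgeD[OF z'(1)]
  obtain c' where c': "c' \<in> Hom (smash (simplex_plus (Suc (Suc 0))) K) E" "p \<cdot> c' = c"
    and d: "\<And>j. j \<le> Suc (Suc 0) \<Longrightarrow> j \<noteq> Suc 0 \<Longrightarrow> c' \<cdot> dface (Suc 0) j K = (if j = 0 then x' else z')"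
  proof (rule horn[OF p K, of "Suc 0" "Suc 0" c "\<lambda>j. if j = 0 then x' else z'"])
    fix j assume "j \<le> Suc (Suc 0)" "j \<noteq> Suc 0"
    then have "j = 0 \<or> j = Suc (Suc 0)" by auto
    then show "(if j = 0 then x' else z') \<in> Hom (cyl K) E \<and> p \<cdot> (if j = 0 then x' else z') = c \<cdot> dface (Suc 0) j K"
      using t ex ez x'(2) z'(2) by (auto simp: triangle_def)
  next
    fix i j m assume a: "Suc 0 = Suc m" "i < j" "j \<le> Suc (Suc 0)" "i \<noteq> Suc 0" "j \<noteq> Suc 0"
    then have ij: "i = 0" "j = Suc (Suc 0)" "m = 0" by auto
    show "(if j = 0 then x' else z') \<cdot> dface m i K = (if i = 0 then x' else z') \<cdot> dface m (j - 1) K"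
      using edge_faces_eq[OF K ez(3) ex(3), of 0 "Suc 0"] ez ex by (simp add: ij coface_def)
  qed (use t in \<open>auto simp: triangle_def\<close>)
  have t': "triangle K E c' x' (c' \<cdot> dface (Suc 0) (Suc 0) K) z'"
    using c' d[of 0] d[of "Suc (Suc 0)"] K by (simp add: triangle_def)
  obtain u' v' w' where "edge K E x' v' w'" "edge K E (c' \<cdot> dface (Suc 0) (Suc 0) K) u' w'" "edge K E z' u' v'"
    using triangle_edges[OF t'] by blast
  then have "edge K E (c' \<cdot> dface (Suc 0) (Suc 0) K) u w" using ex ez by (simp add: edge_def)
  moreover have "p \<cdot> (c' \<cdot> dface (Suc 0) (Suc 0) K) = y"
    using assoc[OF dface_hom[OF K] c'(1) p(2)] c'(2) t by (simp add: triangle_def)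
  ultimately show ?thesis using that[OF t'] c'(2) by blast
qed

text \<open>Relative division: the missing face is 0, so two homotopies with the same start, over
  \<open>y\<close> and \<open>z\<close>, yield one between their ends strictly over
  \<open>x\<close>.\<close>

lemma horn_outer:
  assumes p: "p \<in> Fb" "p \<in> Hom E B" and t: "triangle K B c x y z"
    and y': "edge K E y' u w" "p \<cdot> y' = y" and z': "edge K E z' u v" "p \<cdot> z' = z"
  obtains c' x' where "triangle K E c' x' y' z'" "edge K E x' v w" "p \<cdot> c' = c" "p \<cdot> x' = x"
proof -
  have K: "K \<in> Ob M" using t by (simp add: triangle_def)
  note ey = edgeD[OF y'(1)] and ez = edgeD[OF z'(1)]
  obtain c' where c': "c' \<in> Hom (smash (simplex_plus (Suc (Suc 0))) K) E" "p \<cdot> c' = c"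
    and d: "\<And>j. j \<le> Suc (Suc 0) \<Longrightarrow> j \<noteq> 0 \<Longrightarrow> c' \<cdot> dface (Suc 0) j K = (if j = Suc 0 then y' else z')"
  proof (rule horn[OF p K, of 0 "Suc 0" c "\<lambda>j. if j = Suc 0 then y' else z'"])
    fix j assume "j \<le> Suc (Suc 0)" "j \<noteq> (0::nat)"
    then have "j = Suc 0 \<or> j = Suc (Suc 0)" by auto
    then show "(if j = Suc 0 then y' else z') \<in> Hom (cyl K) E \<and> p \<cdot> (if j = Suc 0 then y' else z') = c \<cdot> dface (Suc 0) j K"
      using t ey ez y'(2) z'(2) by (auto simp: triangle_def)
  next
    fix i j m :: nat assume a: "Suc 0 = Suc m" "i < j" "j \<le> Suc (Suc 0)" "i \<noteq> 0" "j \<noteq> 0"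
    then have ij: "i = Suc 0" "j = Suc (Suc 0)" "m = 0" by auto
    show "(if j = Suc 0 then y' else z') \<cdot> dface m i K = (if i = Suc 0 then y' else z') \<cdot> dface m (j - 1) K"
      using edge_faces_eq[OF K ez(3) ey(3), of "Suc 0" "Suc 0"] ez ey by (simp add: ij coface_def)
  qed (use t in \<open>auto simp: triangle_def\<close>)
  have t': "triangle K E c' (c' \<cdot> dface (Suc 0) 0 K) y' z'"
    using c' d[of "Suc 0"] d[of "Suc (Suc 0)"] K by (simp add: triangle_def)
  obtain u' v' w' where "edge K E (c' \<cdot> dface (Suc 0) 0 K) v' w'" "edge K E y' u' w'" "edge K E z' u' v'"
    using triangle_edges[OF t'] by blast
  then have "edge K E (c' \<cdot> dface (Suc 0) 0 K) v w" using ey ez by (simp add: edge_def)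
  moreover have "p \<cdot> (c' \<cdot> dface (Suc 0) 0 K) = x"
    using assoc[OF dface_hom[OF K] c'(1) p(2)] c'(2) t by (simp add: triangle_def)
  ultimately show ?thesis using that[OF t'] c'(2) by blast
qed

lemma point_triangle:
  assumes "K \<in> Ob M" "f \<in> Hom (cyl K) point" "g \<in> Hom (cyl K) point" "h \<in> Hom (cyl K) point"
  shows "triangle K point (Zero (smash (simplex_plus (Suc (Suc 0))) K) point) f g h"
  using assms(2-4)[THEN hom_point] zero_comp[OF dface_hom[OF assms(1)] point_Ob] assms(1)
  by (auto simp: triangle_def intro!: Zero_hom)

lemma fill_inner:
  assumes B: "fibrant B" and x: "edge K B x v w" and z: "edge K B z u v"
  obtains c y where "triangle K B c x y z" "edge K B y u w"
proof -
  have p: "Zero B point \<in> Fb" "Zero B point \<in> Hom B point" using B by (auto simp: fibrant_def)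
  note e = edgeD[OF x] edgeD(3)[OF z]
  show ?thesis
    by (rule horn_inner[OF p point_triangle[OF e(1) comp_hom[OF e(3) p(2)] comp_hom[OF e(3) p(2)] comp_hom[OF e(8) p(2)]] x refl z refl])
      (rule that)
qed

lemma fill_outer:
  assumes B: "fibrant B" and y: "edge K B y u w" and z: "edge K B z u v"
  obtains c x where "triangle K B c x y z" "edge K B x v w"
proof -
  have p: "Zero B point \<in> Fb" "Zero B point \<in> Hom B point" using B by (auto simp: fibrant_def)
  note e = edgeD[OF y] edgeD(3)[OF z]
  show ?thesis
    by (rule horn_outer[OF p point_triangle[OF e(1) comp_hom[OF e(3) p(2)] comp_hom[OF e(3) p(2)] comp_hom[OF e(8) p(2)]] y refl z refl])
      (rule that)
qed

section \<open>Simplicial homotopy of maps into a fibrant object\<close>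

definition sh :: "('a, 'b) pspsh \<Rightarrow> ('a, 'b) pspsh \<Rightarrow> ('a, 'b) parr \<Rightarrow> ('a, 'b) parr \<Rightarrow> bool" where
  "sh K B a b \<longleftrightarrow> (\<exists>x. edge K B x a b)"

lemma sh_refl: "a \<in> Hom K B \<Longrightarrow> sh K B a a"
  using cst_edge by (auto simp: sh_def)

lemma sh_sym: "fibrant B \<Longrightarrow> sh K B a b \<Longrightarrow> sh K B b a"
  unfolding sh_def using fill_outer cst_edge edgeD(4) by metis

lemma sh_trans: "fibrant B \<Longrightarrow> sh K B a b \<Longrightarrow> sh K B b c \<Longrightarrow> sh K B a c"
  unfolding sh_def using fill_inner by metis

lemma sh_pre: "sh K B a b \<Longrightarrow> f \<in> Hom L K \<Longrightarrow> sh L B (a \<cdot> f) (b \<cdot> f)"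
  unfolding sh_def using edge_pre by blast

lemma sh_homs: "sh K B a b \<Longrightarrow> a \<in> Hom K B \<and> b \<in> Hom K B"
  unfolding sh_def by (auto dest: edgeD(4,5))

text \<open>\<open>lift_edge\<close> says that the inclusion of the end 0 of the cylinder lifts
  against every fibration; the retract argument \<open>triv_cofI\<close> makes it a trivial
  cofibration, and two-out-of-three then treats the projection.\<close>

lemma cyl_triv_cof:
  assumes K: "K \<in> Ob M"
  shows "vtx (Suc 0) 0 K \<in> Cof" "vtx (Suc 0) 0 K \<in> W" "proj (Suc 0) K \<in> W"
proof -
  have v: "vtx (Suc 0) 0 K \<in> Hom K (cyl K)" by (rule vtx_hom[OF _ K]) simp
  have "vtx (Suc 0) 0 K \<in> Cof \<and> vtx (Suc 0) 0 K \<in> W"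
  proof (rule triv_cofI[OF v])
    fix p E B u y
    assume a: "p \<in> Fb" "p \<in> Hom E B" "u \<in> Hom K E" "y \<in> Hom (cyl K) B" "p \<cdot> u = y \<cdot> vtx (Suc 0) 0 K"
    have "edge K B y (p \<cdot> u) (y \<cdot> vtx (Suc 0) (Suc 0) K)" using edgeI[OF K a(4)] a(5) by simp
    from lift_edge[OF a(1,2) this a(3)] obtain x where "edge K E x u (x \<cdot> vtx (Suc 0) (Suc 0) K)" "p \<cdot> x = y" by blast
    then show "\<exists>h\<in>Hom (cyl K) E. h \<cdot> vtx (Suc 0) 0 K = u \<and> p \<cdot> h = y"
      by (auto dest: edgeD(3,6))
  qed
  then show "vtx (Suc 0) 0 K \<in> Cof" and W: "vtx (Suc 0) 0 K \<in> W" by auto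
  \<comment> \<open>Two-out-of-three applied to \<open>i \<cdot> Idn M K = i\<close>, where
    \<open>i\<close> is any weak equivalence out of \<open>K\<close>; the factorization axiom
    provides one.\<close>
  have "Idn M K \<in> W"
  proof -
    obtain i p E where i: "i \<in> W" "i \<in> Hom K E" using factor_CW_F[OF v] by metis
    show ?thesis using W_right[OF Idn_hom[OF K] i(2) i(1)] comp_Idn[OF i(2)] i(1) by simp
  qed
  then show "proj (Suc 0) K \<in> W"
    using W_left[OF v proj_hom[OF K] W] proj_vtx[of 0 "Suc 0" K] K by simp
qed

lemma Idn_W: "A \<in> Ob M \<Longrightarrow> Idn M A \<in> W"
proof -
  assume A: "A \<in> Ob M"
  have v: "vtx (Suc 0) 0 A \<in> Hom A (cyl A)" by (rule vtx_hom[OF _ A]) simp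
  show ?thesis using W_right[OF Idn_hom[OF A] v] cyl_triv_cof(2)[OF A] comp_Idn[OF v] by simp
qed

subsection \<open>Filling boundaries against trivial fibrations\<close>

lemma smap_face_bd: "pointed_smap (simplex_plus n) (bd_plus (Suc n)) (map (coface j))" if "j \<le> Suc n"
proof -
  note D = pointed_smapD[OF smap_coface_plus[of n j]]
  have "j \<notin> set (map (coface j) t)" for t by (auto simp: coface_def)
  then have "set (map (coface j) t) \<noteq> {..Suc n}" for t using that by (metis atMost_iff)
  then show ?thesis
    using D pointed_bd[of "Suc n"] unfolding pointed_smap_def is_smap_def by (simp add: Pi_iff) (simp add: bd_plus_def)
qed

text \<open>The inverse of \<open>map (coface j)\<close> on the lists that omit
  \<open>j\<close>.\<close>

definition drop_vertex :: "nat \<Rightarrow> nat list \<Rightarrow> nat list" where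
  "drop_vertex j t = map (\<lambda>i. if i < j then i else i - 1) t"

lemma coface_drop_vertex: "j \<notin> set t \<Longrightarrow> map (coface j) (drop_vertex j t) = t"
proof -
  assume j: "j \<notin> set t"
  show ?thesis
    unfolding drop_vertex_def map_map
  proof (rule map_idI)
    fix x assume "x \<in> set t"
    then have "x \<noteq> j" using j by auto
    then show "(coface j \<circ> (\<lambda>i. if i < j then i else i - 1)) x = x" by (auto simp: coface_def)
  qed
qed

lemma drop_vertex_simplex:
  assumes "t \<in> simplex (Suc n) l" "j \<notin> set t" "j \<le> Suc n"
  shows "drop_vertex j t \<in> simplex n l"
proof -
  have "\<forall>i\<in>set t. i \<le> Suc n \<and> i \<noteq> j" using assms by (auto simp: simplex_def)
  then have "set (drop_vertex j t) \<subseteq> {..n}" using assms(3) by (fastforce simp: drop_vertex_def)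
  moreover have "sorted (drop_vertex j t)"
    using assms(1) unfolding simplex_def drop_vertex_def sorted_map by (auto intro!: sorted_wrt_mono_rel[of t "(\<le>)"])
  ultimately show ?thesis using assms(1) by (simp add: simplex_def drop_vertex_def)
qed

lemma drop_vertex_list_op:
  "\<theta> \<in> Delta m l \<Longrightarrow> length t = Suc l \<Longrightarrow> drop_vertex j (list_op m \<theta> t) = list_op m \<theta> (drop_vertex j t)"
  unfolding drop_vertex_def by (rule map_list_op)

text \<open>The boundary is glued from its faces. A list that omits \<open>j\<close> is evaluated by
  \<open>x j\<close> after \<open>j\<close> has been dropped; the simplicial identity
  \<open>c\<close> shows that the choice of an omitted vertex does not matter.\<close>

lemma boundary_map:
  assumes K: "K \<in> Ob M" and P: "P \<in> Ob M"
    and x: "\<And>j. j \<le> Suc n \<Longrightarrow> x j \<in> Hom (smash (simplex_plus n) K) P"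
    and c: "\<And>i j m. n = Suc m \<Longrightarrow> i < j \<Longrightarrow> j \<le> Suc n \<Longrightarrow> x j \<cdot> dface m i K = x i \<cdot> dface m (j - 1) K"
  obtains \<beta> where "\<beta> \<in> Hom (smash (bd_plus (Suc n)) K) P"
    "\<And>j. j \<le> Suc n \<Longrightarrow> \<beta> \<cdot> smash_left X (simplex_plus n) (bd_plus (Suc n)) (map (coface j)) K = x j"
proof -
  let ?T = "bd_plus (Suc n)"
  define v where "v j Y l t a = Fn (x j) Y l (smash_pair K Y l (drop_vertex j t) a)" for j Y l t a
  have T: "t = [] \<or> t \<in> simplex (Suc n) l \<and> (\<exists>j\<le>Suc n. j \<notin> set t)" if "t \<in> Spx ?T l" for t l
    using that by (auto simp: bd_plus_def Spx_plus simplex_def)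
  \<comment> \<open>A list that omits both \<open>i\<close> and \<open>j\<close> comes from a list
    \<open>r\<close> on the common face of the faces \<open>i\<close> and \<open>j\<close>. This
    requires \<open>n\<close> to be positive: an edge has no such list, because a nonempty list over
    \<open>{0, 1}\<close> cannot omit both vertices.\<close>
  have indep1: "v j Y l t a = v i Y l t a"
    if "i < j" "j \<le> Suc n" "j \<notin> set t" "i \<notin> set t" "t \<in> simplex (Suc n) l" "Y \<in> S" "a \<in> El K Y l" for i j t l Y a
  proof -
    have "n \<noteq> 0"
    proof
      assume "n = 0"
      then have "i = 0" "j = 1" using that by auto
      moreover have "set t \<subseteq> {0, 1}" "t \<noteq> []" using that(5) \<open>n = 0\<close> by (auto simp: simplex_def)
      ultimately show False using that(3,4) by (cases t) auto
    qed
    then obtain m where m: "n = Suc m" by (cases n) auto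
    have i': "i \<le> Suc n" using that by simp
    define r where "r = drop_vertex i (drop_vertex j t)"
    have jn: "drop_vertex j t \<in> simplex n l" "drop_vertex i t \<in> simplex n l"
      using drop_vertex_simplex that i' by auto
    have ne: "w \<noteq> j" "w \<noteq> i" if "w \<in> set t" for w using that \<open>j \<notin> set t\<close> \<open>i \<notin> set t\<close> by auto
    have inot: "i \<notin> set (drop_vertex j t)"
    proof
      assume "i \<in> set (drop_vertex j t)"
      then obtain w where w: "w \<in> set t" "i = (if w < j then w else w - 1)" by (auto simp: drop_vertex_def)
      then show False using ne[OF w(1)] that(1) by (auto split: if_splits)
    qed
    have r: "r \<in> simplex m l" unfolding r_def
      using drop_vertex_simplex[of "drop_vertex j t" m l i] jn inot that(1,2) m by auto
    have 1: "map (coface i) r = drop_vertex j t" unfolding r_def by (rule coface_drop_vertex[OF inot])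
    have 2: "map (coface (j - 1)) r = drop_vertex i t"
      unfolding r_def drop_vertex_def map_map comp_def
    proof (rule map_cong[OF refl])
      fix w assume "w \<in> set t"
      then have "w \<noteq> j" "w \<noteq> i" using ne by auto
      then show "coface (j - 1) (if (if w < j then w else w - 1) < i then if w < j then w else w - 1 else (if w < j then w else w - 1) - 1) = (if w < i then w else w - 1)"
        using \<open>i < j\<close> by (auto simp: coface_def)
    qed
    note xj = x[OF that(2)] and xi = x[OF i']
    have rS: "r \<in> Spx (simplex_plus m) l" using r by (simp add: Spx_plus)
    note F = Fn_smash_left[OF smap_coface_plus that(6) rS that(7)]
    note d = dface_hom[OF K, of m]
    have "v j Y l t a = Fn (x j \<cdot> dface m i K) Y l (smash_pair K Y l r a)"
      unfolding v_def 1[symmetric] using Fn_comp[OF d that(6) smash_pair_El[OF rS that(7)]] F by (simp add: dface_def)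
    also have "\<dots> = Fn (x i \<cdot> dface m (j - 1) K) Y l (smash_pair K Y l r a)" using c[OF m that(1,2)] by simp
    also have "\<dots> = v i Y l t a"
      unfolding v_def 2[symmetric] using Fn_comp[OF d that(6) smash_pair_El[OF rS that(7)]] F by (simp add: dface_def)
    finally show ?thesis .
  qed
  then have indep: "v j Y l t a = v i Y l t a"
    if "i \<le> Suc n" "j \<le> Suc n" "j \<notin> set t" "i \<notin> set t" "t \<in> simplex (Suc n) l" "Y \<in> S" "a \<in> El K Y l" for i j t l Y a
  proof (cases i j rule: linorder_cases)
    case less
    then show ?thesis using indep1[OF less] that by simp
  next
    case greater
    then show ?thesis using indep1[OF greater] that by simp
  qed simp
  define \<phi> where "\<phi> Y l t a = (if t = [] then Bpt P Y l else v (SOME j. j \<le> Suc n \<and> j \<notin> set t) Y l t a)" for Y l t a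
  have \<phi>: "\<phi> Y l t a = v j Y l t a"
    if "j \<le> Suc n" "j \<notin> set t" "t \<in> simplex (Suc n) l" "Y \<in> S" "a \<in> El K Y l" for j Y l t a
    using indep[of j "SOME j. j \<le> Suc n \<and> j \<notin> set t" t l Y a] someI[of "\<lambda>j. j \<le> Suc n \<and> j \<notin> set t" j] that simplexD(2)[OF that(3)]
    by (auto simp: \<phi>_def)
  have \<phi>0: "\<phi> Y l [] a = Bpt P Y l" for Y l a by (simp add: \<phi>_def)
  let ?\<beta> = "bimap ?T K P \<phi>"
  have D: "drop_vertex j t \<in> Spx (simplex_plus n) l" if "j \<le> Suc n" "j \<notin> set t" "t \<in> simplex (Suc n) l" for j l t
    using drop_vertex_simplex[OF that(3,2,1)] by (simp add: Spx_plus)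
  have bpt: "\<phi> Y l t (Bpt K Y l) = Bpt P Y l" if Y: "Y \<in> S" and t: "t \<in> Spx ?T l" for Y l t
  proof (cases "t = []")
    case False
    then obtain j where j: "j \<le> Suc n" "j \<notin> set t" "t \<in> simplex (Suc n) l" using T[OF t] by blast
    show ?thesis unfolding \<phi>[OF j Y Bpt_El[OF K Y]] v_def using Fn_Bpt[OF x[OF j(1)] Y, of l] by simp
  qed (simp add: \<phi>0)
  have \<beta>: "?\<beta> \<in> Hom (smash ?T K) P"
  proof (rule bimap_hom[where \<phi> = \<phi>, OF pointed_bd K P _ bpt])
    fix Y l t a assume a: "Y \<in> S" "t \<in> Spx ?T l" "a \<in> El K Y l"
    show "\<phi> Y l t a \<in> El P Y l"
    proof (cases "t = []")
      case False
      then obtain j where j: "j \<le> Suc n" "j \<notin> set t" "t \<in> simplex (Suc n) l" using T[OF a(2)] by blast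
      show ?thesis unfolding \<phi>[OF j a(1,3)] v_def by (rule Fn_hom[OF x[OF j(1)] a(1) smash_pair_El[OF D[OF j] a(3)]])
    qed (simp add: \<phi>0 Bpt_El[OF P a(1)])
  next
    fix Y m l \<theta> t a assume a: "Y \<in> S" "\<theta> \<in> Delta m l" "t \<in> Spx ?T l" "a \<in> El K Y l"
    show "\<phi> Y m (Op ?T m l \<theta> t) (Op (Val K Y) m l \<theta> a) = Op (Val P Y) m l \<theta> (\<phi> Y l t a)"
    proof (cases "t = []")
      case False
      then obtain j where j: "j \<le> Suc n" "j \<notin> set t" "t \<in> simplex (Suc n) l" using T[OF a(3)] by blast
      have o: "Op ?T m l \<theta> t = list_op m \<theta> t" using False by (simp add: bd_plus_def Op_plus)
      have j': "j \<notin> set (list_op m \<theta> t)" "list_op m \<theta> t \<in> simplex (Suc n) m"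
        using set_list_op[OF a(2) j(3)] j list_op_simplex[OF a(2) j(3)] by auto
      have "drop_vertex j t \<noteq> []" using j(3) by (auto simp: drop_vertex_def simplex_def)
      then have "Op (Val (smash (simplex_plus n) K) Y) m l \<theta> (smash_pair K Y l (drop_vertex j t) a) =
          smash_pair K Y m (drop_vertex j (list_op m \<theta> t)) (Op (Val K Y) m l \<theta> a)"
        using Op_smash[OF pointed_plus K a(1,2)] drop_vertex_list_op[OF a(2) simplexD(1)[OF j(3)]] by (simp add: Op_plus)
      then show ?thesis
        unfolding o \<phi>[OF j(1) j' a(1) Op_El[OF K a(1,2,4)]] \<phi>[OF j a(1,4)] v_def
        using Fn_Op[OF x[OF j(1)] a(1,2) smash_pair_El[OF D[OF j] a(4)]] by simp
    qed (simp add: \<phi>0 Op_Bpt[OF P a(1,2)] pointed_ssetD(2)[OF pointed_bd a(2)])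
  next
    fix u l t a assume a: "u \<in> Ar (Sm X)" "t \<in> Spx ?T l" "a \<in> El K (Cod u) l"
    show "\<phi> (Dom u) l t (Rst K u l a) = Rst P u l (\<phi> (Cod u) l t a)"
    proof (cases "t = []")
      case False
      then obtain j where j: "j \<le> Suc n" "j \<notin> set t" "t \<in> simplex (Suc n) l" using T[OF a(2)] by blast
      show ?thesis
        unfolding \<phi>[OF j Sm_Dom[OF a(1)] Rst_El[OF K a(1,3)]] \<phi>[OF j Sm_Cod[OF a(1)] a(3)] v_def
        using Fn_Rst[OF x[OF j(1)] a(1) smash_pair_El[OF D[OF j] a(3)]] Rst_smash[OF K a(1)] by simp
    qed (simp add: \<phi>0 Rst_Bpt[OF P a(1)])
  qed (auto simp: \<phi>0)
  show ?thesis
  proof (rule that[OF \<beta>])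
    fix j assume j: "j \<le> Suc n"
    note f = smash_left_hom[OF smap_face_bd[OF j] K]
    show "?\<beta> \<cdot> smash_left X (simplex_plus n) ?T (map (coface j)) K = x j"
    proof (rule smash_hom_ext[OF comp_hom[OF f \<beta>] x[OF j]])
      fix Y l t a assume a: "Y \<in> S" "t \<in> Spx (simplex_plus n) l" "a \<in> El K Y l"
      let ?t = "map (coface j) t"
      have t': "?t \<in> Spx ?T l" by (rule pointed_smapD(4)[OF smap_face_bd[OF j] a(2)])
      have "\<phi> Y l ?t a = Fn (x j) Y l (smash_pair K Y l t a)"
      proof (cases "t = []")
        case False
        then have "t \<in> simplex n l" using a(2) by (simp add: Spx_plus)
        then have t: "?t \<in> simplex (Suc n) l" by (rule simplex_map) (auto intro: coface_mono coface_le)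
        have 1: "drop_vertex j ?t = t" by (auto simp: drop_vertex_def coface_def intro!: map_idI)
        have "j \<notin> set ?t" by (auto simp: coface_def)
        then show ?thesis using \<phi>[OF j _ t a(1,3)] by (simp add: v_def 1)
      qed (use Fn_Bpt[OF x[OF j] a(1), of l] in \<open>simp add: \<phi>0\<close>)
      then show "Fn (?\<beta> \<cdot> smash_left X (simplex_plus n) ?T (map (coface j)) K) Y l (smash_pair K Y l t a) = Fn (x j) Y l (smash_pair K Y l t a)"
        using Fn_comp[OF f a(1) smash_pair_El[OF a(2,3)]] Fn_smash_left[OF smap_face_bd[OF j] a]
          Fn_bimap[where \<phi> = \<phi> and B = P, OF a(1) t' a(3) bpt[OF a(1)] \<phi>0] by simp
    qed
  qed
qed

text \<open>The inclusion of the boundary smashed with \<open>K\<close> is a monomorphism, hence a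
  cofibration, so trivial fibrations lift against it. Unlike for horns, all faces may be
  prescribed.\<close>

lemma boundary_fill:
  assumes p: "p \<in> Fb" "p \<in> W" "p \<in> Hom P B" and K: "K \<in> Ob M"
    and y: "y \<in> Hom (smash (simplex_plus (Suc n)) K) B"
    and x: "\<And>j. j \<le> Suc n \<Longrightarrow> x j \<in> Hom (smash (simplex_plus n) K) P \<and> p \<cdot> x j = y \<cdot> dface n j K"
    and c: "\<And>i j m. n = Suc m \<Longrightarrow> i < j \<Longrightarrow> j \<le> Suc n \<Longrightarrow> x j \<cdot> dface m i K = x i \<cdot> dface m (j - 1) K"
  obtains z where "z \<in> Hom (smash (simplex_plus (Suc n)) K) P" "p \<cdot> z = y" "\<And>j. j \<le> Suc n \<Longrightarrow> z \<cdot> dface n j K = x j"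
proof -
  have xh: "x j \<in> Hom (smash (simplex_plus n) K) P" if "j \<le> Suc n" for j using x[OF that] by simp
  have "\<exists>\<beta>. \<beta> \<in> Hom (smash (bd_plus (Suc n)) K) P \<and>
      (\<forall>j\<le>Suc n. \<beta> \<cdot> smash_left X (simplex_plus n) (bd_plus (Suc n)) (map (coface j)) K = x j)"
    by (rule boundary_map[OF K hom_Dom[OF p(3)] xh c]) auto
  then obtain \<beta> where \<beta>: "\<beta> \<in> Hom (smash (bd_plus (Suc n)) K) P"
    and bf: "\<And>j. j \<le> Suc n \<Longrightarrow> \<beta> \<cdot> smash_left X (simplex_plus n) (bd_plus (Suc n)) (map (coface j)) K = x j"
    by blast
  define i where "i = smash_left X (bd_plus (Suc n)) (simplex_plus (Suc n)) (\<lambda>t. t) K"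
  have i: "i \<in> Hom (smash (bd_plus (Suc n)) K) (smash (simplex_plus (Suc n)) K)"
    unfolding i_def by (rule smash_left_hom[OF smap_bd K])
  have im: "i \<in> Cof" unfolding i_def by (rule smash_left_mono[OF smap_bd K]) simp
  have fi: "i \<cdot> smash_left X (simplex_plus n) (bd_plus (Suc n)) (map (coface j)) K = dface n j K" if "j \<le> Suc n" for j
    using smash_left_comp[OF smap_face_bd[OF that] smap_bd K] by (simp add: i_def dface_def)
  have "p \<cdot> \<beta> = y \<cdot> i"
  proof (rule smash_hom_ext[OF comp_hom[OF \<beta> p(3)] comp_hom[OF i y]])
    fix Y l t a assume a: "Y \<in> S" "t \<in> Spx (bd_plus (Suc n)) l" "a \<in> El K Y l"
    then consider "t = []" | j where "j \<le> Suc n" "j \<notin> set t" "t \<in> simplex (Suc n) l"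
      by (auto simp: bd_plus_def Spx_plus simplex_def)
    then show "Fn (p \<cdot> \<beta>) Y l (smash_pair K Y l t a) = Fn (y \<cdot> i) Y l (smash_pair K Y l t a)"
    proof cases
      case 1
      then show ?thesis using Fn_Bpt[OF comp_hom[OF \<beta> p(3)] a(1), of l] Fn_Bpt[OF comp_hom[OF i y] a(1), of l] by simp
    next
      case (2 j)
      let ?f = "smash_left X (simplex_plus n) (bd_plus (Suc n)) (map (coface j)) K"
      note f = smash_left_hom[OF smap_face_bd[OF 2(1)] K]
      have r: "drop_vertex j t \<in> Spx (simplex_plus n) l" using drop_vertex_simplex[OF 2(3,2,1)] by (simp add: Spx_plus)
      have rt: "Fn ?f Y l (smash_pair K Y l (drop_vertex j t) a) = smash_pair K Y l t a"
        using Fn_smash_left[OF smap_face_bd[OF 2(1)] a(1) r a(3)] coface_drop_vertex[OF 2(2)] by simp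
      have "(p \<cdot> \<beta>) \<cdot> ?f = (y \<cdot> i) \<cdot> ?f"
        using assoc[OF f \<beta> p(3)] assoc[OF f i y] bf[OF 2(1)] fi[OF 2(1)] x[OF 2(1)] by simp
      then show ?thesis
        using Fn_comp[OF f a(1) smash_pair_El[OF r a(3)], of "p \<cdot> \<beta>"] Fn_comp[OF f a(1) smash_pair_El[OF r a(3)], of "y \<cdot> i"] rt by simp
    qed
  qed
  then obtain z where z: "z \<in> Hom (smash (simplex_plus (Suc n)) K) P" "z \<cdot> i = \<beta>" "p \<cdot> z = y"
    using FbW_lift[OF p im i \<beta> y] by metis
  have "z \<cdot> dface n j K = x j" if "j \<le> Suc n" for j
    using assoc[OF smash_left_hom[OF smap_face_bd[OF that] K] i z(1)] fi[OF that] bf[OF that] z(2) by simp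
  then show ?thesis using that z by blast
qed

subsection \<open>Path objects\<close>

text \<open>The product of \<open>B\<close> with itself is obtained as the pullback of the map from
  \<open>B\<close> to \<open>point\<close> along itself, which the finite limits of the model
  category provide.\<close>

lemma product:
  assumes B: "B \<in> Ob M"
  obtains Q \<pi>0 \<pi>1 where "Q \<in> Ob M" "\<pi>0 \<in> Hom Q B" "\<pi>1 \<in> Hom Q B"
    "\<forall>A u v. u \<in> Hom A B \<longrightarrow> v \<in> Hom A B \<longrightarrow> (\<exists>!w. w \<in> Hom A Q \<and> \<pi>0 \<cdot> w = u \<and> \<pi>1 \<cdot> w = v)"
proof -
  have z: "Zero B point \<in> Hom B point" by (rule Zero_hom[OF B point_Ob])
  have "\<forall>f\<in>Ar M. \<forall>g\<in>Ar M. Cod f = Cod g \<longrightarrow>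
        (\<exists>p\<in>Ar M. \<exists>q\<in>Ar M. Dom p = Dom q \<and> Cod p = Dom f \<and> Cod q = Dom g \<and>
           f \<cdot> p = g \<cdot> q \<and>
           (\<forall>u\<in>Ar M. \<forall>v\<in>Ar M. Dom u = Dom v \<and> Cod u = Dom f \<and> Cod v = Dom g \<and> f \<cdot> u = g \<cdot> v \<longrightarrow>
              (\<exists>!w. w \<in> Hom (Dom u) (Dom p) \<and> p \<cdot> w = u \<and> q \<cdot> w = v)))"
    using limits unfolding finite_limits_def by (elim conjE)
  note 1 = bspec[OF bspec[OF this] , of "Zero B point" "Zero B point"]
  have z': "Zero B point \<in> Ar M" "Dom (Zero B point) = B" using z by (auto simp: in_hom)
  from 1[OF z'(1) z'(1), THEN mp, OF refl, unfolded z'(2)]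
  obtain p q where pq: "p \<in> Ar M" "q \<in> Ar M" "Dom p = Dom q" "Cod p = B" "Cod q = B"
    and u: "\<forall>u\<in>Ar M. \<forall>v\<in>Ar M. Dom u = Dom v \<and> Cod u = B \<and> Cod v = B \<and>
       Zero B point \<cdot> u = Zero B point \<cdot> v \<longrightarrow> (\<exists>!w. w \<in> Hom (Dom u) (Dom p) \<and> p \<cdot> w = u \<and> q \<cdot> w = v)"
    by (elim bexE conjE)
  show ?thesis
  proof (rule that[of "Dom p" p q])
    show "Dom p \<in> Ob M" using pq Dom_Ob by blast
    show "p \<in> Hom (Dom p) B" "q \<in> Hom (Dom p) B" using pq by (auto simp: in_hom)
    show "\<forall>A u v. u \<in> Hom A B \<longrightarrow> v \<in> Hom A B \<longrightarrow> (\<exists>!w. w \<in> Hom A (Dom p) \<and> p \<cdot> w = u \<and> q \<cdot> w = v)"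
    proof (intro allI impI)
    fix A u' v' assume a: "u' \<in> Hom A B" "v' \<in> Hom A B"
    then show "\<exists>!w. w \<in> Hom A (Dom p) \<and> p \<cdot> w = u' \<and> q \<cdot> w = v'"
      using u[rule_format, of u' v'] zero_comp[OF a(1) point_Ob] zero_comp[OF a(2) point_Ob] by (simp add: in_hom)
    qed
  qed
qed

text \<open>\<open>Q\<close> is the product of \<open>B\<close> with itself, and its diagonal
  \<open>d\<close> is the weak equivalence \<open>s\<close> followed by the fibration
  \<open>q\<close>. The initial point map \<open>\<pi>0 \<cdot> q\<close> is required to be a
  trivial fibration because boundaries are filled along it.\<close>

definition path_object :: "('a, 'b) pspsh \<Rightarrow> ('a, 'b) pspsh \<Rightarrow> ('a, 'b) pspsh \<Rightarrow> ('a, 'b) parr \<Rightarrow> ('a, 'b) parr \<Rightarrow>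
    ('a, 'b) parr \<Rightarrow> ('a, 'b) parr \<Rightarrow> ('a, 'b) parr \<Rightarrow> bool" where
  "path_object B P Q q s \<pi>0 \<pi>1 d \<longleftrightarrow> q \<in> Fb \<and> q \<in> Hom P Q \<and> s \<in> Hom B P \<and> s \<in> W \<and> \<pi>0 \<in> Hom Q B \<and> \<pi>1 \<in> Hom Q B \<and>
     (\<pi>0 \<cdot> q) \<cdot> s = Idn M B \<and> (\<pi>1 \<cdot> q) \<cdot> s = Idn M B \<and> \<pi>0 \<cdot> q \<in> Fb \<and> \<pi>0 \<cdot> q \<in> W \<and>
     d = q \<cdot> s \<and>
     (\<forall>A u v. u \<in> Hom A B \<longrightarrow> v \<in> Hom A B \<longrightarrow> (\<exists>!w. w \<in> Hom A Q \<and> \<pi>0 \<cdot> w = u \<and> \<pi>1 \<cdot> w = v))"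

lemma ex1_unique: "\<exists>!x. P x \<Longrightarrow> P a \<Longrightarrow> P b \<Longrightarrow> a = b"
  by blast

lemma path_object_exists:
  assumes fB: "fibrant B"
  obtains P Q q s \<pi>0 \<pi>1 d where "path_object B P Q q s \<pi>0 \<pi>1 d"
proof -
  have B: "B \<in> Ob M" by (rule fibrant_Ob[OF fB])
  obtain Q \<pi>0 \<pi>1 where Q: "Q \<in> Ob M" "\<pi>0 \<in> Hom Q B" "\<pi>1 \<in> Hom Q B"
    and U': "\<forall>A u v. u \<in> Hom A B \<longrightarrow> v \<in> Hom A B \<longrightarrow> (\<exists>!w. w \<in> Hom A Q \<and> \<pi>0 \<cdot> w = u \<and> \<pi>1 \<cdot> w = v)"
    by (rule product[OF B])
  note U = U'[rule_format]
  obtain d where d: "d \<in> Hom B Q" "\<pi>0 \<cdot> d = Idn M B" "\<pi>1 \<cdot> d = Idn M B"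
    using U[OF Idn_hom[OF B] Idn_hom[OF B]] by blast
  obtain s q P where s: "s \<in> Cof" "s \<in> W" "s \<in> Hom B P" and q: "q \<in> Fb" "q \<in> Hom P Q" "q \<cdot> s = d"
    using factor_CW_F[OF d(1)] by metis
  note e = comp_hom[OF q(2) Q(2)] comp_hom[OF q(2) Q(3)]
  have es: "(\<pi>0 \<cdot> q) \<cdot> s = Idn M B" "(\<pi>1 \<cdot> q) \<cdot> s = Idn M B"
    using assoc[OF s(3) q(2) Q(2)] assoc[OF s(3) q(2) Q(3)] q(3) d by simp_all
  \<comment> \<open>This is where \<open>B\<close> must be fibrant: the second coordinate
    \<open>(\<pi>1 \<cdot> q) \<cdot> u\<close> is extended along \<open>i\<close> freely, it is
    paired with \<open>v\<close> to a map to \<open>Q\<close>, and this map is lifted along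
    \<open>q\<close>.\<close>
  have eF: "\<pi>0 \<cdot> q \<in> Fb"
  proof (rule FbI[OF e(1)])
    fix i A A' u v assume a: "i \<in> Cof" "i \<in> W" "i \<in> Hom A A'" "u \<in> Hom A P" "v \<in> Hom A' B" "(\<pi>0 \<cdot> q) \<cdot> u = v \<cdot> i"
    obtain v1 where v1: "v1 \<in> Hom A' B" "v1 \<cdot> i = (\<pi>1 \<cdot> q) \<cdot> u"
      using fibrant_extend[OF fB a(1-3) comp_hom[OF a(4) e(2)]] by metis
    obtain w where w: "w \<in> Hom A' Q" "\<pi>0 \<cdot> w = v" "\<pi>1 \<cdot> w = v1" using U[OF a(5) v1(1)] by blast
    note c = comp_hom[OF a(4) q(2)] comp_hom[OF a(3) w(1)]
    have eq: "\<pi>0 \<cdot> (w \<cdot> i) = \<pi>0 \<cdot> (q \<cdot> u)" "\<pi>1 \<cdot> (w \<cdot> i) = \<pi>1 \<cdot> (q \<cdot> u)"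
      using assoc[OF a(4) q(2) Q(2)] assoc[OF a(4) q(2) Q(3)] assoc[OF a(3) w(1) Q(2)] assoc[OF a(3) w(1) Q(3)] a(6) v1(2) w by simp_all
    have "q \<cdot> u = w \<cdot> i"
      by (rule ex1_unique[OF U[OF comp_hom[OF c(1) Q(2)] comp_hom[OF c(1) Q(3)]]]) (use c eq in auto)
    then obtain h where h: "h \<in> Hom A' P" "h \<cdot> i = u" "q \<cdot> h = w" by (rule Fb_lift[OF q(1,2) a(1-4) w(1)])
    then show "\<exists>h\<in>Hom A' P. h \<cdot> i = u \<and> (\<pi>0 \<cdot> q) \<cdot> h = v"
      using assoc[OF h(1) q(2) Q(2)] w(2) by (intro bexI[of _ h]) auto
  qed
  have "\<pi>0 \<cdot> q \<in> W" using W_left[OF s(3) e(1) s(2)] es Idn_W[OF B] by simp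
  then have "path_object B P Q q s \<pi>0 \<pi>1 d"
    unfolding path_object_def using q s Q es eF U' by simp
  then show ?thesis by (rule that)
qed

section \<open>The homotopy category\<close>

sublocale loc: localized_category M W
  by standard (rule W_Ar)

abbreviation "H \<equiv> localization M W"
abbreviation "ho \<equiv> loc_fun M W"

section \<open>Simplicial homotopies and right homotopies\<close>

lemma proj_dface: "K \<in> Ob M \<Longrightarrow> proj (Suc n) K \<cdot> dface n j K = proj n K"
proof (rule smash_hom_ext[OF comp_hom[OF dface_hom proj_hom] proj_hom])
  fix Y l t a assume a: "K \<in> Ob M" "Y \<in> S" "t \<in> Spx (simplex_plus n) l" "a \<in> El K Y l"
  note f = Fn_smash_left[OF smap_coface_plus[of n j] a(2-4), folded dface_def]
  show "Fn (proj (Suc n) K \<cdot> dface n j K) Y l (smash_pair K Y l t a) = Fn (proj n K) Y l (smash_pair K Y l t a)"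
    using Fn_comp[OF dface_hom[OF a(1)] a(2) smash_pair_El[OF a(3,4)]] f a pointed_smapD(4)[OF smap_coface_plus a(3), of j]
    by simp
qed auto

text \<open>The pair of the constant homotopy on \<open>a\<close> and of \<open>x\<close> is a
  homotopy in \<open>Q\<close> starting at the diagonal of \<open>a\<close>. Lifted to
  \<open>P\<close> from \<open>s \<cdot> a\<close>, it ends in a path from \<open>a\<close> to
  \<open>b\<close>.\<close>

lemma sh_right_homotopy:
  assumes P: "path_object B P Q q s \<pi>0 \<pi>1 d" and h: "sh K B a b"
  obtains k where "k \<in> Hom K P" "(\<pi>0 \<cdot> q) \<cdot> k = a" "(\<pi>1 \<cdot> q) \<cdot> k = b"
proof -
  obtain x where x: "edge K B x a b" using h by (auto simp: sh_def)
  note e = edgeD[OF x] and K = edgeD(1)[OF x]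
  have q: "q \<in> Fb" "q \<in> Hom P Q" and s: "s \<in> Hom B P" and \<pi>: "\<pi>0 \<in> Hom Q B" "\<pi>1 \<in> Hom Q B"
    and es: "(\<pi>0 \<cdot> q) \<cdot> s = Idn M B" "(\<pi>1 \<cdot> q) \<cdot> s = Idn M B"
    and U: "\<And>A u v. u \<in> Hom A B \<Longrightarrow> v \<in> Hom A B \<Longrightarrow> \<exists>!w. w \<in> Hom A Q \<and> \<pi>0 \<cdot> w = u \<and> \<pi>1 \<cdot> w = v"
    using P by (auto simp: path_object_def)
  note e0 = comp_hom[OF q(2) \<pi>(1)] and e1 = comp_hom[OF q(2) \<pi>(2)]
  have v: "vtx (Suc 0) 0 K \<in> Hom K (cyl K)" "vtx (Suc 0) (Suc 0) K \<in> Hom K (cyl K)" using vtx_hom[OF _ K] by auto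
  obtain w where w: "w \<in> Hom (cyl K) Q" "\<pi>0 \<cdot> w = cst K a" "\<pi>1 \<cdot> w = x" using U[OF cst_hom[OF e(4)] e(3)] by blast
  have sa: "s \<cdot> a \<in> Hom K P" by (rule comp_hom[OF e(4) s])
  have id: "(\<pi>0 \<cdot> q) \<cdot> (s \<cdot> a) = a" "(\<pi>1 \<cdot> q) \<cdot> (s \<cdot> a) = a"
    using assoc[OF e(4) s e0] assoc[OF e(4) s e1] es Idn_comp[OF e(4)] by simp_all
  note c = comp_hom[OF sa q(2)] comp_hom[OF v(1) w(1)]
  note ca = edgeD[OF cst_edge[OF e(4)]]
  have "q \<cdot> (s \<cdot> a) = w \<cdot> vtx (Suc 0) 0 K"
  proof (rule ex1_unique[OF U[OF comp_hom[OF c(1) \<pi>(1)] comp_hom[OF c(1) \<pi>(2)]]])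
    show "w \<cdot> vtx (Suc 0) 0 K \<in> Hom K Q \<and> \<pi>0 \<cdot> (w \<cdot> vtx (Suc 0) 0 K) = \<pi>0 \<cdot> (q \<cdot> (s \<cdot> a)) \<and>
        \<pi>1 \<cdot> (w \<cdot> vtx (Suc 0) 0 K) = \<pi>1 \<cdot> (q \<cdot> (s \<cdot> a))"
      using c(2) assoc[OF v(1) w(1) \<pi>(1)] assoc[OF v(1) w(1) \<pi>(2)] assoc[OF sa q(2) \<pi>(1)] assoc[OF sa q(2) \<pi>(2)]
        w id ca e by simp
  qed (use c in auto)
  then obtain h where h: "h \<in> Hom (cyl K) P" "h \<cdot> vtx (Suc 0) 0 K = s \<cdot> a" "q \<cdot> h = w"
    by (rule Fb_lift[OF q cyl_triv_cof(1,2)[OF K] v(1) sa w(1)])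
  show ?thesis
  proof (rule that[OF comp_hom[OF v(2) h(1)]])
    show "(\<pi>0 \<cdot> q) \<cdot> (h \<cdot> vtx (Suc 0) (Suc 0) K) = a"
      using assoc[OF v(2) h(1) e0] assoc[OF h(1) q(2) \<pi>(1)] h(3) w(2) ca(7) by simp
    show "(\<pi>1 \<cdot> q) \<cdot> (h \<cdot> vtx (Suc 0) (Suc 0) K) = b"
      using assoc[OF v(2) h(1) e1] assoc[OF h(1) q(2) \<pi>(2)] h(3) w(3) e(7) by simp
  qed
qed

text \<open>A path \<open>k\<close> and the constant path at its initial point have the same image
  under the trivial fibration \<open>\<pi>0 \<cdot> q\<close>, so an edge in \<open>P\<close> joins
  them. Its image under \<open>\<pi>1 \<cdot> q\<close> is the homotopy.\<close>

lemma right_homotopy_sh: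
  assumes P: "path_object B P Q q s \<pi>0 \<pi>1 d" and k: "k \<in> Hom K P"
  shows "sh K B ((\<pi>0 \<cdot> q) \<cdot> k) ((\<pi>1 \<cdot> q) \<cdot> k)"
proof -
  have K: "K \<in> Ob M" using k by (rule hom_Dom)
  have q: "q \<in> Fb" "q \<in> Hom P Q" and s: "s \<in> Hom B P" and \<pi>: "\<pi>0 \<in> Hom Q B" "\<pi>1 \<in> Hom Q B"
    and es: "(\<pi>0 \<cdot> q) \<cdot> s = Idn M B" "(\<pi>1 \<cdot> q) \<cdot> s = Idn M B" and e0W: "\<pi>0 \<cdot> q \<in> Fb" "\<pi>0 \<cdot> q \<in> W"
    using P by (auto simp: path_object_def)
  note e0 = comp_hom[OF q(2) \<pi>(1)] and e1 = comp_hom[OF q(2) \<pi>(2)]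
  define a where "a = (\<pi>0 \<cdot> q) \<cdot> k"
  have a: "a \<in> Hom K B" unfolding a_def by (rule comp_hom[OF k e0])
  have sa: "s \<cdot> a \<in> Hom K P" by (rule comp_hom[OF a s])
  have id: "(\<pi>0 \<cdot> q) \<cdot> (s \<cdot> a) = a" "(\<pi>1 \<cdot> q) \<cdot> (s \<cdot> a) = a"
    using assoc[OF a s e0] assoc[OF a s e1] es Idn_comp[OF a] by simp_all
  have cf: "cst K a \<cdot> dface 0 j K = a \<cdot> proj 0 K" for j
    unfolding cst_def using assoc[OF dface_hom[OF K] proj_hom[OF K] a, of 0 j] proj_dface[OF K] by simp
  \<comment> \<open>Face 1 of the edge is its start \<open>s \<cdot> a\<close>, face 0 is its end
    \<open>k\<close>.\<close>
  define x where "x j = (if j = Suc 0 then s \<cdot> a else k) \<cdot> proj 0 K" for j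
  obtain z where z: "z \<in> Hom (cyl K) P" "(\<pi>0 \<cdot> q) \<cdot> z = cst K a" "\<And>j. j \<le> Suc 0 \<Longrightarrow> z \<cdot> dface 0 j K = x j"
  proof (rule boundary_fill[OF e0W e0 K cst_hom[OF a], of x])
    fix j :: nat
    show "x j \<in> Hom (smash (simplex_plus 0) K) P \<and> (\<pi>0 \<cdot> q) \<cdot> x j = cst K a \<cdot> dface 0 j K"
      unfolding cf x_def using comp_hom[OF proj_hom[OF K] sa, of 0] comp_hom[OF proj_hom[OF K] k, of 0]
        assoc[OF proj_hom[OF K] sa e0, of 0] assoc[OF proj_hom[OF K] k e0, of 0] id a_def by simp
  qed auto
  have v0: "vtx 0 0 K \<in> Hom K (smash (simplex_plus 0) K)" using vtx_hom[OF _ K] by auto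
  have xv: "x j \<cdot> vtx 0 0 K = (if j = Suc 0 then s \<cdot> a else k)" for j
    using assoc[OF v0 proj_hom[OF K] sa] assoc[OF v0 proj_hom[OF K] k] proj_vtx[OF _ K, of 0 0] comp_Idn[OF sa] comp_Idn[OF k]
    by (simp add: x_def)
  have "edge K P z (s \<cdot> a) k"
    using edgeI[OF K z(1)] dface_comp_vtx[OF K z(1), of 0 "Suc 0"] dface_comp_vtx[OF K z(1), of 0 0] z(3)[of 0] z(3)[of "Suc 0"] xv[of 0] xv[of "Suc 0"]
    by (simp add: coface_def)
  from edge_post[OF this e1] show ?thesis using id a_def by (auto simp: sh_def)
qed

section \<open>Weak equivalences act bijectively on homotopy classes of maps into fibrant
  objects\<close>

lemma split_mono:
  assumes s: "s \<in> Hom A B" and p: "p \<in> Hom B A" and "p \<cdot> s = Idn M A"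
  shows "s \<in> Cof"
  unfolding monomorphisms_def
proof (intro CollectI conjI ballI impI)
  show "s \<in> Ar M" using s by (simp add: in_hom)
  fix g h assume "g \<in> Ar M" "h \<in> Ar M" and e: "Cod g = Dom s \<and> Cod h = Dom s \<and> Dom g = Dom h \<and> s \<cdot> g = s \<cdot> h"
  then have g: "g \<in> Hom (Dom g) A" and h: "h \<in> Hom (Dom g) A" using s by (auto simp: in_hom)
  have "g = p \<cdot> (s \<cdot> g)" unfolding assoc[OF g s p] assms(3) by (rule Idn_comp[OF g, symmetric])
  also have "\<dots> = p \<cdot> (s \<cdot> h)" using e by (simp only: )
  also have "\<dots> = h" unfolding assoc[OF h s p] assms(3) by (rule Idn_comp[OF h])
  finally show "g = h" .
qed

text \<open>As \<open>A'\<close> is cofibrant, its identity lifts through \<open>p\<close>. The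
  section is a split monomorphism and a weak equivalence, that is, a trivial cofibration; this
  reduces questions about weak equivalences to trivial cofibrations.\<close>

lemma trivial_fibration_section:
  assumes p: "p \<in> Fb" "p \<in> W" "p \<in> Hom A A'"
  obtains s where "s \<in> Hom A' A" "p \<cdot> s = Idn M A'" "s \<in> Cof" "s \<in> W"
proof -
  have A: "A \<in> Ob M" "A' \<in> Ob M" using p by (auto dest: hom_Dom hom_Cod)
  have "p \<cdot> Zero point A = Idn M A' \<cdot> Zero point A'"
    using comp_zero[OF p(3) point_Ob] comp_zero[OF Idn_hom[OF A(2)] point_Ob] by simp
  then obtain s where s: "s \<in> Hom A' A" "p \<cdot> s = Idn M A'"
    by (rule FbW_lift[OF p point_mono[OF A(2)] Zero_hom[OF point_Ob A(2)] Zero_hom[OF point_Ob A(1)] Idn_hom[OF A(2)]])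
  have "s \<in> W" using W_right[OF s(1) p(3) p(2)] s(2) Idn_W[OF A(2)] by simp
  then show ?thesis using that s split_mono[OF s(1) p(3) s(2)] by blast
qed

text \<open>A homotopy between \<open>f \<cdot> w\<close> and \<open>g \<cdot> w\<close> becomes a
  map \<open>k\<close> to the path object. It extends along the trivial cofibration \<open>w\<close>
  over the pair of \<open>f\<close> and \<open>g\<close>, and the extension is a homotopy between
  these.\<close>

lemma sh_inj_triv_cof:
  assumes B: "fibrant B" and w: "w \<in> Cof" "w \<in> W" "w \<in> Hom A A'" and f: "f \<in> Hom A' B" "g \<in> Hom A' B"
    and h: "sh A B (f \<cdot> w) (g \<cdot> w)"
  shows "sh A' B f g"
proof -
  obtain P Q q s \<pi>0 \<pi>1 d where P: "path_object B P Q q s \<pi>0 \<pi>1 d" by (rule path_object_exists[OF B])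
  have q: "q \<in> Fb" "q \<in> Hom P Q" and \<pi>: "\<pi>0 \<in> Hom Q B" "\<pi>1 \<in> Hom Q B"
    and U: "\<And>A u v. u \<in> Hom A B \<Longrightarrow> v \<in> Hom A B \<Longrightarrow> \<exists>!w. w \<in> Hom A Q \<and> \<pi>0 \<cdot> w = u \<and> \<pi>1 \<cdot> w = v"
    using P by (auto simp: path_object_def)
  obtain k where k: "k \<in> Hom A P" "(\<pi>0 \<cdot> q) \<cdot> k = f \<cdot> w" "(\<pi>1 \<cdot> q) \<cdot> k = g \<cdot> w"
    by (rule sh_right_homotopy[OF P h])
  obtain v where v: "v \<in> Hom A' Q" "\<pi>0 \<cdot> v = f" "\<pi>1 \<cdot> v = g" using U[OF f] by blast
  note c = comp_hom[OF k(1) q(2)] comp_hom[OF w(3) v(1)]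
  have "q \<cdot> k = v \<cdot> w"
    by (rule ex1_unique[OF U[OF comp_hom[OF c(1) \<pi>(1)] comp_hom[OF c(1) \<pi>(2)]]])
      (use c assoc[OF k(1) q(2) \<pi>(1)] assoc[OF k(1) q(2) \<pi>(2)] assoc[OF w(3) v(1) \<pi>(1)] assoc[OF w(3) v(1) \<pi>(2)] k v in simp_all)
  then obtain h where h: "h \<in> Hom A' P" "h \<cdot> w = k" "q \<cdot> h = v" by (rule Fb_lift[OF q w k(1) v(1)])
  have "(\<pi>0 \<cdot> q) \<cdot> h = f" "(\<pi>1 \<cdot> q) \<cdot> h = g"
    using assoc[OF h(1) q(2) \<pi>(1)] assoc[OF h(1) q(2) \<pi>(2)] h(3) v by simp_all
  then show ?thesis using right_homotopy_sh[OF P h(1)] by simp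
qed

text \<open>Factor \<open>w\<close> as a trivial cofibration \<open>i\<close> followed by a trivial
  fibration \<open>p\<close>. Both \<open>i\<close> and a section \<open>s\<close> of
  \<open>p\<close> are trivial cofibrations, so maps into \<open>B\<close> extend along them and
  homotopies descend from them.\<close>

lemma sh_W:
  assumes B: "fibrant B" and w: "w \<in> W" "w \<in> Hom A A'"
  shows "\<And>f g. f \<in> Hom A' B \<Longrightarrow> g \<in> Hom A' B \<Longrightarrow> sh A B (f \<cdot> w) (g \<cdot> w) \<Longrightarrow> sh A' B f g"
    and "\<And>f. f \<in> Hom A B \<Longrightarrow> \<exists>g\<in>Hom A' B. sh A B (g \<cdot> w) f"
proof -
  obtain i p E where i: "i \<in> Cof" "i \<in> W" "i \<in> Hom A E" and p: "p \<in> Fb" "p \<in> Hom E A'" "p \<cdot> i = w"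
    by (rule factor_CW_F[OF w(2)])
  have pW: "p \<in> W" using W_left[OF i(3) p(2) i(2)] p(3) w(1) by simp
  obtain s where s: "s \<in> Hom A' E" "p \<cdot> s = Idn M A'" "s \<in> Cof" "s \<in> W" by (rule trivial_fibration_section[OF p(1) pW p(2)])
  {
    fix f g assume f: "f \<in> Hom A' B" and g: "g \<in> Hom A' B" and h: "sh A B (f \<cdot> w) (g \<cdot> w)"
    have "sh A B ((f \<cdot> p) \<cdot> i) ((g \<cdot> p) \<cdot> i)"
      using h assoc[OF i(3) p(2) f] assoc[OF i(3) p(2) g] p(3) by simp
    then have "sh E B (f \<cdot> p) (g \<cdot> p)" by (rule sh_inj_triv_cof[OF B i comp_hom[OF p(2) f] comp_hom[OF p(2) g]])
    from sh_pre[OF this s(1)] show "sh A' B f g"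
      using assoc[OF s(1) p(2) f] assoc[OF s(1) p(2) g] s(2) comp_Idn[OF f] comp_Idn[OF g] by simp
  }
  fix f assume f: "f \<in> Hom A B"
  obtain g where g: "g \<in> Hom E B" "g \<cdot> i = f" by (rule fibrant_extend[OF B i f])
  have gs: "g \<cdot> s \<in> Hom A' B" by (rule comp_hom[OF s(1) g(1)])
  \<comment> \<open>\<open>g\<close> need not factor through \<open>p\<close>, but
    \<open>(g \<cdot> s) \<cdot> p\<close> and \<open>g\<close> agree after composition with
    \<open>s\<close>, and \<open>s\<close> reflects homotopy.\<close>
  have "((g \<cdot> s) \<cdot> p) \<cdot> s = g \<cdot> s"
    using assoc[OF s(1) p(2) gs] s(2) comp_Idn[OF gs] by simp
  then have "sh A' B (((g \<cdot> s) \<cdot> p) \<cdot> s) (g \<cdot> s)" using sh_refl[OF gs] by simp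
  then have "sh E B ((g \<cdot> s) \<cdot> p) g" by (rule sh_inj_triv_cof[OF B s(3,4,1) comp_hom[OF p(2) gs] g(1)])
  from sh_pre[OF this i(3)] have "sh A B ((g \<cdot> s) \<cdot> w) f"
    using assoc[OF i(3) p(2) gs] p(3) g(2) by simp
  then show "\<exists>g\<in>Hom A' B. sh A B (g \<cdot> w) f" using gs by blast
qed

text \<open>In the homotopy category both end inclusions of the cylinder are inverse to the
  invertible map \<open>proj\<close>, so they coincide.\<close>

lemma sh_ho: "sh K B a b \<Longrightarrow> ho a = ho b"
proof -
  assume "sh K B a b"
  then obtain x where x: "edge K B x a b" by (auto simp: sh_def)
  note e = edgeD[OF x] and K = edgeD(1)[OF x]
  have v: "vtx (Suc 0) 0 K \<in> Hom K (cyl K)" "vtx (Suc 0) (Suc 0) K \<in> Hom K (cyl K)" using vtx_hom[OF _ K] by auto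
  have "ho (vtx (Suc 0) 0 K) = ho (vtx (Suc 0) (Suc 0) K)"
    by (rule loc.W_cancel_left[OF cyl_triv_cof(3)[OF K] proj_hom[OF K] loc.q_hom[OF v(1)] loc.q_hom[OF v(2)]])
      (simp add: loc.q_comp[OF v(1) proj_hom[OF K]] loc.q_comp[OF v(2) proj_hom[OF K]] proj_vtx K)
  then show ?thesis using loc.q_comp[OF v(1) e(3)] loc.q_comp[OF v(2) e(3)] e by simp
qed

text \<open>Zigzags into a fibrant object straighten from the tail, which still ends at
  \<open>B\<close>. A backward step along \<open>w\<close> replaces the map \<open>f\<close> found
  for the tail by some \<open>g\<close> with \<open>g \<cdot> w\<close> homotopic to
  \<open>f\<close>.\<close>

lemma ho_surj:
  assumes B: "fibrant B" and \<phi>: "\<phi> \<in> homset H A B"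
  obtains f where "f \<in> Hom A B" "\<phi> = ho f"
proof -
  obtain p where p: "zpath M W A B p" "\<phi> = zclass M W A B p" using \<phi> by (auto simp: loc.in_hom_L)
  have "\<exists>f\<in>Hom A B. zclass M W A B p = ho f"
    using p(1) B
  proof (induction rule: zpath.induct)
    case (zpath_nil A)
    then show ?case using Idn_hom[of A] loc.q_Idn[of A] by (intro bexI[of _ "Idn M A"]) (auto simp: localization_def)
  next
    case (zpath_fwd g B p)
    then obtain f where f: "f \<in> Hom (Cod g) B" "zclass M W (Cod g) B p = ho f" by blast
    have g: "g \<in> Hom (Dom g) (Cod g)" using zpath_fwd by (simp add: in_hom)
    then have "zpath M W (Dom g) (Cod g) [Fwd g]" using Cod_Ob by (auto simp: in_hom)
    from loc.comp_zclass[OF this zpath_fwd(2)] have "zclass M W (Dom g) B (Fwd g # p) = Cmp H (ho f) (ho g)"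
      using f(2) by (simp add: loc_fun_def[of _ _ g])
    then show ?case using loc.q_comp[OF g f(1)] comp_hom[OF g f(1)] by auto
  next
    case (zpath_bwd w B p)
    then obtain f where f: "f \<in> Hom (Dom w) B" "zclass M W (Dom w) B p = ho f" by blast
    have w: "w \<in> Hom (Dom w) (Cod w)" using zpath_bwd W_Ar by (auto simp: in_hom)
    then have b: "zpath M W (Cod w) (Dom w) [Bwd w]" using zpath_bwd(1) Dom_Ob by (auto simp: in_hom)
    obtain g where g: "g \<in> Hom (Cod w) B" "sh (Dom w) B (g \<cdot> w) f" using sh_W(2)[OF zpath_bwd(4) zpath_bwd(1) w f(1)] by blast
    have z: "zclass M W (Cod w) B (Bwd w # p) = Cmp H (ho f) (zclass M W (Cod w) (Dom w) [Bwd w])"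
      using loc.comp_zclass[OF b zpath_bwd(2)] f(2) by simp
    obtain v where v: "v \<in> homset H (Cod w) (Dom w)" "v = zclass M W (Cod w) (Dom w) [Bwd w]" "Cmp H (ho w) v = ho (Idn M (Cod w))"
      using loc.W_inverse[OF zpath_bwd(1) w] by blast
    have "Cmp H (ho f) v = Cmp H (Cmp H (ho g) (ho w)) v" using sh_ho[OF g(2)] loc.q_comp[OF w g(1)] by simp
    also have "\<dots> = ho g" using loc.assoc_L[OF v(1) loc.q_hom[OF w] loc.q_hom[OF g(1)]] v(3) loc.Idn_L(1)[OF loc.q_hom[OF g(1)]] by simp
    finally show ?case using z v(2) g(1) by auto
  qed
  then show ?thesis using that p by auto
qed

text \<open>Weak equivalences act bijectively on homotopy classes of maps into a fibrant \<open>B\<close>; hence zigzags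
  act on these classes, compatibly with the relations of the localization.\<close>

primrec zig_act :: "('a, 'b) pspsh \<Rightarrow> ('a, 'b) parr zig \<Rightarrow> ('a, 'b) parr set \<Rightarrow> ('a, 'b) parr set" where
  "zig_act B (Fwd g) c = {h. \<exists>f\<in>c. sh (Dom g) B (f \<cdot> g) h}"
| "zig_act B (Bwd w) c = {h \<in> Hom (Cod w) B. \<exists>f\<in>c. sh (Dom w) B (h \<cdot> w) f}"

lemma sh_class_eq: "fibrant B \<Longrightarrow> sh D B f g \<Longrightarrow> Collect (sh D B f) = Collect (sh D B g)"
  using sh_sym sh_trans by blast

lemma zig_act_Fwd:
  assumes B: "fibrant B" and g: "g \<in> Hom A D" and f: "f \<in> Hom D B"
  shows "zig_act B (Fwd g) (Collect (sh D B f)) = Collect (sh A B (f \<cdot> g))"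
proof -
  have D: "Dom g = A" using g by (simp add: in_hom)
  have "sh A B (f \<cdot> g) h" if "sh D B f f'" "sh A B (f' \<cdot> g) h" for f' h
    using sh_trans[OF B sh_pre[OF that(1) g] that(2)] .
  then show ?thesis using sh_refl[OF f] D by auto
qed

lemma zig_act_Bwd:
  assumes B: "fibrant B" and w: "w \<in> W" "w \<in> Hom A D" and f: "f \<in> Hom D B"
  shows "zig_act B (Bwd w) (Collect (sh A B (f \<cdot> w))) = Collect (sh D B f)"
proof -
  have D: "Dom w = A" "Cod w = D" using w by (simp_all add: in_hom)
  have "sh D B f h" if "h \<in> Hom D B" "sh A B (f \<cdot> w) f'" "sh A B (h \<cdot> w) f'" for f' h
    using sh_W(1)[OF B w f that(1)] sh_trans[OF B that(2) sh_sym[OF B that(3)]] .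
  moreover have "h \<in> Hom D B \<and> sh A B (f \<cdot> w) (h \<cdot> w)" if "sh D B f h" for h
    using sh_pre[OF that w(2)] sh_homs[OF that] by simp
  ultimately show ?thesis using sh_refl[OF comp_hom[OF w(2)]] D by (auto, blast)
qed

text \<open>The second conjunct, that a zigzag takes a homotopy class to a homotopy class, is
  carried along for the case \<open>zeq_append\<close>: the hypothesis for the left part is applied
  to the class produced by the right part.\<close>

lemma zeq_act:
  assumes "zeq M W A D p p'" and B: "fibrant B" and f: "f \<in> Hom D B"
  shows "foldr (zig_act B) p (Collect (sh D B f)) = foldr (zig_act B) p' (Collect (sh D B f)) \<and>
    (\<exists>g\<in>Hom A B. foldr (zig_act B) p (Collect (sh D B f)) = Collect (sh A B g))"
  using assms
proof (induction arbitrary: f rule: zeq.induct)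
  case (zeq_refl A D p)
  have "\<exists>g\<in>Hom A B. foldr (zig_act B) p (Collect (sh D B f)) = Collect (sh A B g)"
    using zeq_refl(1) zeq_refl(3)
  proof (induction rule: zpath.induct)
    case (zpath_nil A)
    then show ?case by auto
  next
    case (zpath_fwd g D p)
    then obtain h where h: "h \<in> Hom (Cod g) B" "foldr (zig_act B) p (Collect (sh D B f)) = Collect (sh (Cod g) B h)" by blast
    have g: "g \<in> Hom (Dom g) (Cod g)" using zpath_fwd by (simp add: in_hom)
    show ?case using zig_act_Fwd[OF B g h(1)] h(2) comp_hom[OF g h(1)] by (auto simp del: zig_act.simps)
  next
    case (zpath_bwd w D p)
    then obtain h where h: "h \<in> Hom (Dom w) B" "foldr (zig_act B) p (Collect (sh D B f)) = Collect (sh (Dom w) B h)" by blast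
    have w: "w \<in> Hom (Dom w) (Cod w)" using zpath_bwd W_Ar by (auto simp: in_hom)
    obtain g where g: "g \<in> Hom (Cod w) B" "sh (Dom w) B (g \<cdot> w) h" using sh_W(2)[OF B zpath_bwd(1) w h(1)] by blast
    show ?case using zig_act_Bwd[OF B zpath_bwd(1) w g(1)] h(2) sh_class_eq[OF B g(2)] g(1) by (auto simp del: zig_act.simps)
  qed
  then show ?case by simp
next
  case (zeq_sym A D p q)
  then show ?case by metis
next
  case (zeq_trans A D p q r)
  then show ?case by metis
next
  case (zeq_append A D p q E p' q')
  obtain g where g: "g \<in> Hom D B" "foldr (zig_act B) p' (Collect (sh E B f)) = Collect (sh D B g)"
    "foldr (zig_act B) p' (Collect (sh E B f)) = foldr (zig_act B) q' (Collect (sh E B f))"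
    using zeq_append(4)[OF zeq_append(5,6)] by blast
  obtain g' where g': "g' \<in> Hom A B" "foldr (zig_act B) q (Collect (sh D B g)) = Collect (sh A B g')"
    "foldr (zig_act B) p (Collect (sh D B g)) = Collect (sh A B g')"
    using zeq_append(3)[OF zeq_append(5) g(1)] by metis
  then show ?case using g(2) g(3)[symmetric] by (auto intro: bexI[OF _ g'(1)])
next
  case (zeq_id A)
  show ?case using zig_act_Fwd[OF B Idn_hom[OF zeq_id(1)] zeq_id(3)] comp_Idn[OF zeq_id(3)] zeq_id(3)
    by (auto simp del: zig_act.simps)
next
  case (zeq_comp g h)
  have g: "g \<in> Hom (Dom g) (Cod g)" and h: "h \<in> Hom (Cod g) (Cod h)" using zeq_comp by (auto simp: in_hom)
  note f = zeq_comp(5)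
  show ?case
    using zig_act_Fwd[OF B h f] zig_act_Fwd[OF B g comp_hom[OF h f]] zig_act_Fwd[OF B comp_hom[OF g h] f] assoc[OF g h f]
      comp_hom[OF comp_hom[OF g h] f] by (auto simp del: zig_act.simps)
next
  case (zeq_inv1 w)
  have w: "w \<in> Hom (Dom w) (Cod w)" using zeq_inv1 W_Ar by (auto simp: in_hom)
  obtain g where g: "g \<in> Hom (Cod w) B" "sh (Dom w) B (g \<cdot> w) f" using sh_W(2)[OF B zeq_inv1(1) w zeq_inv1(3)] by blast
  show ?case using zig_act_Bwd[OF B zeq_inv1(1) w g(1)] zig_act_Fwd[OF B w g(1)] sh_class_eq[OF B g(2)] zeq_inv1(3)
    by (auto simp del: zig_act.simps)
next
  case (zeq_inv2 w)
  have w: "w \<in> Hom (Dom w) (Cod w)" using zeq_inv2 W_Ar by (auto simp: in_hom)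
  show ?case using zig_act_Bwd[OF B zeq_inv2(1) w zeq_inv2(3)] zig_act_Fwd[OF B w zeq_inv2(3)] zeq_inv2(3)
    by (auto simp del: zig_act.simps)
qed

text \<open>Equal classes of \<open>f\<close> and \<open>g\<close> act equally on homotopy classes
  of maps into \<open>B\<close>; acting on the class of the identity of \<open>B\<close> returns the
  homotopy classes of \<open>f\<close> and \<open>g\<close> themselves.\<close>

lemma ho_eq_iff:
  assumes B: "fibrant B" and f: "f \<in> Hom A B" "g \<in> Hom A B"
  shows "ho f = ho g \<longleftrightarrow> sh A B f g"
proof
  assume "ho f = ho g"
  have AB: "A \<in> Ob M" "B \<in> Ob M" using f by (auto dest: hom_Dom hom_Cod)
  have "zpath M W A B [Fwd f]" using f AB by (auto simp: in_hom)
  then have "zeq M W A B [Fwd f] [Fwd g]"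
    using \<open>ho f = ho g\<close> f loc.zclass_eq_iff by (auto simp: loc_fun_def in_hom)
  from zeq_act[OF this B Idn_hom[OF AB(2)]]
  have "zig_act B (Fwd f) (Collect (sh B B (Idn M B))) = zig_act B (Fwd g) (Collect (sh B B (Idn M B)))" by simp
  then have "Collect (sh A B f) = Collect (sh A B g)"
    using zig_act_Fwd[OF B f(1) Idn_hom[OF AB(2)]] zig_act_Fwd[OF B f(2) Idn_hom[OF AB(2)]] Idn_comp[OF f(1)] Idn_comp[OF f(2)]
    by (simp del: zig_act.simps)
  then show "sh A B f g" using sh_refl[OF f(2)] by auto
qed (rule sh_ho)

end

context infinite_sections
begin

section \<open>Suspension preserves weak equivalences\<close>

text \<open>A monomorphism equalizes the projections of its kernel pair, which is encoded in \<open>'b\<close>.\<close>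

lemma mono_injective:
  assumes f: "f \<in> monomorphisms M" "f \<in> Hom P Q" and Y: "Y \<in> S"
  shows "inj_on (Fn f Y n) (El P Y n)"
proof -
  have PQ: "P \<in> Ob M" "Q \<in> Ob M" using f(2) by (auto dest: hom_Dom hom_Cod)
  have "|(UNIV :: 'b set) \<times> (UNIV :: 'b set)| \<le>o |UNIV :: 'b set|"
    using infinite_values by (intro card_of_Times_ordLeq_infinite) auto
  then obtain e :: "'b \<times> 'b \<Rightarrow> 'b" where e: "inj e"
    by (auto simp: card_of_ordLeq[symmetric])
  define m where "m F G w = (case inv_into UNIV e w of (x, y) \<Rightarrow> e (F x, G y))" for F G w
  have m: "m F G (e (x, y)) = e (F x, G y)" for F G x y using e by (simp add: m_def)
  have eq: "e z = e z' \<longleftrightarrow> z = z'" for z z' using e by (auto dest: injD)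
  define R where "R = \<lparr>Val = (\<lambda>Y. \<lparr>Spx = (\<lambda>n. {e (x, y) | x y. x \<in> El P Y n \<and> y \<in> El P Y n \<and> Fn f Y n x = Fn f Y n y}),
      Op = (\<lambda>m' n \<theta>. m (Op (Val P Y) m' n \<theta>) (Op (Val P Y) m' n \<theta>))\<rparr>),
      Rst = (\<lambda>u n. m (Rst P u n) (Rst P u n)), Bpt = (\<lambda>Y n. e (Bpt P Y n, Bpt P Y n))\<rparr>"
  have El: "El R Y n = {e (x, y) | x y. x \<in> El P Y n \<and> y \<in> El P Y n \<and> Fn f Y n x = Fn f Y n y}"
    and Op: "Op (Val R Y) m' n \<theta> (e (x, y)) = e (Op (Val P Y) m' n \<theta> x, Op (Val P Y) m' n \<theta> y)"
    and Rst: "Rst R u n (e (x, y)) = e (Rst P u n x, Rst P u n y)"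
    and Bpt: "Bpt R Y n = e (Bpt P Y n, Bpt P Y n)" for Y m' n \<theta> u x y
    by (simp_all add: R_def m)
  have R: "R \<in> Ob M"
    unfolding Ob_psPre
  proof (intro conjI ballI allI impI funcsetI)
    fix Y assume Y: "Y \<in> S"
    show "is_sset (Val R Y)"
      using PQ(1) Y unfolding is_sset_def Ob_psPre
      by (auto simp: El Op eq Fn_Op[OF f(2)] Pi_iff)
  next
    fix u n x assume "u \<in> Ar (Sm X)" "x \<in> El R (Cod u) n"
    then show "Rst R u n x \<in> El R (Dom u) n" by (auto simp: El Rst eq Fn_Rst[OF f(2)] Rst_El[OF PQ(1)])
  qed (use PQ(1) in \<open>auto simp: El Op Rst Bpt eq Ob_psPre\<close>)
  define g where "g = mk X R P (\<lambda>Y n w. fst (inv_into UNIV e w))"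
  define h where "h = mk X R P (\<lambda>Y n w. snd (inv_into UNIV e w))"
  have gh: "g \<in> Hom R P" "h \<in> Hom R P"
    unfolding g_def h_def
    by (rule mk_hom[OF R PQ(1)], use e in \<open>auto simp: natural_family_def El Op Rst Bpt\<close>)+
  have "f \<cdot> g = f \<cdot> h"
    by (rule hom_ext[OF comp_hom[OF gh(1) f(2)] comp_hom[OF gh(2) f(2)]])
      (simp add: Fn_comp[OF gh(1)] Fn_comp[OF gh(2)], use e in \<open>auto simp: g_def h_def El\<close>)
  then have "g = h" using f gh unfolding monomorphisms_def by (simp add: in_hom)
  show ?thesis
  proof (rule inj_onI)
    fix x y assume "x \<in> El P Y n" "y \<in> El P Y n" "Fn f Y n x = Fn f Y n y"
    then have "e (x, y) \<in> El R Y n" by (auto simp: El)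
    then show "x = y" using arg_cong[OF \<open>g = h\<close>, of "\<lambda>g. Fn g Y n (e (x, y))"] Y e by (simp add: g_def h_def)
  qed
qed

subsection \<open>Maps out of simplices with collapsed vertices\<close>

definition qt :: "nat \<Rightarrow> ('a, 'b) pspsh \<Rightarrow> ('a, 'b) parr" where
  "qt n K = smash_left X (simplex_plus n) (simplex_mod_vertices n) collapse K"

lemma qt_hom: "K \<in> Ob M \<Longrightarrow> qt n K \<in> Hom (smash (simplex_plus n) K) (smash (simplex_mod_vertices n) K)"
  unfolding qt_def by (rule smash_left_hom[OF smap_collapse])

lemma Spx_mod_plus: "t \<in> Spx (simplex_mod_vertices n) l \<Longrightarrow> t \<in> Spx (simplex_plus n) l \<and> collapse t = t"
  by (auto simp: Spx_mod Spx_plus collapse_def)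

lemma Fn_qt: "Y \<in> S \<Longrightarrow> t \<in> Spx (simplex_plus n) l \<Longrightarrow> a \<in> El K Y l \<Longrightarrow>
    Fn (qt n K) Y l (smash_pair K Y l t a) = smash_pair K Y l (collapse t) a"
  unfolding qt_def by (rule Fn_smash_left[OF smap_collapse])

lemma qt_epi:
  assumes K: "K \<in> Ob M" and f: "f \<in> Hom (smash (simplex_mod_vertices n) K) B" "g \<in> Hom (smash (simplex_mod_vertices n) K) B"
    and e: "f \<cdot> qt n K = g \<cdot> qt n K"
  shows "f = g"
proof (rule smash_hom_ext[OF f])
  fix Y l t a assume a: "Y \<in> S" "t \<in> Spx (simplex_mod_vertices n) l" "a \<in> El K Y l"
  have t: "t \<in> Spx (simplex_plus n) l" "collapse t = t" using Spx_mod_plus[OF a(2)] by auto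
  show "Fn f Y l (smash_pair K Y l t a) = Fn g Y l (smash_pair K Y l t a)"
    using arg_cong[OF e, of "\<lambda>f. Fn f Y l (smash_pair K Y l t a)"]
      Fn_comp[OF qt_hom[OF K] a(1) smash_pair_El[OF t(1) a(3)]] Fn_qt[OF a(1) t(1) a(3)] t(2) by simp
qed

end

lemma constant_list_replicate:
  assumes "t \<in> simplex n l" "constant_list t"
  obtains v where "v \<le> n" "t = replicate (Suc l) v"
proof -
  obtain v where v: "set t = {v}" using assms(2) by (auto simp: constant_list_def card_1_singleton_iff)
  then have "t = replicate (Suc l) v" using simplexD(1)[OF assms(1)] by (intro replicate_eqI) auto
  moreover have "v \<le> n" using assms(1) v by (auto simp: simplex_def)
  ultimately show ?thesis using that by blast
qed

lemma constant_replicate: "constant_list (replicate (Suc l) v)"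
  by (simp add: constant_list_def del: replicate_Suc)

context presheaf_model
begin

text \<open>The universal property of the quotient by the vertices. Constant lists are degenerate on
  vertices, where \<open>\<sigma>\<close> is zero, so replacing them by \<open>[]\<close> is
  compatible with the simplicial operators.\<close>

lemma qt_factor:
  assumes K: "K \<in> Ob M" and \<sigma>: "\<sigma> \<in> Hom (smash (simplex_plus n) K) B"
    and z: "\<And>v. v \<le> n \<Longrightarrow> \<sigma> \<cdot> vtx n v K = Zero K B"
  obtains \<sigma>' where "\<sigma>' \<in> Hom (smash (simplex_mod_vertices n) K) B" "\<sigma>' \<cdot> qt n K = \<sigma>"
proof -
  let ?T = "simplex_mod_vertices n"
  have B: "B \<in> Ob M" using \<sigma> by (rule hom_Cod)
  define \<phi> where "\<phi> Y l t a = Fn \<sigma> Y l (smash_pair K Y l t a)" for Y l t a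
  have const: "\<phi> Y l t a = Bpt B Y l" if t: "t \<in> simplex n l" "constant_list t" and Y: "Y \<in> S" and a: "a \<in> El K Y l" for Y l t a
  proof -
    obtain v where v: "v \<le> n" "t = replicate (Suc l) v" by (rule constant_list_replicate[OF t])
    have "Fn (\<sigma> \<cdot> vtx n v K) Y l a = \<phi> Y l t a" using Fn_comp[OF vtx_hom[OF v(1) K] Y a, of \<sigma>] Y a v by (simp add: \<phi>_def)
    then show ?thesis using z[OF v(1)] Y a by simp
  qed
  have b: "\<phi> Y l t (Bpt K Y l) = Bpt B Y l" "\<phi> Y l [] a = Bpt B Y l" if "Y \<in> S" for Y l t a
    using Fn_Bpt[OF \<sigma> that, of l] by (simp_all add: \<phi>_def)
  let ?s = "bimap ?T K B \<phi>"
  have s: "?s \<in> Hom (smash ?T K) B"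
  proof (rule bimap_hom[where \<phi> = \<phi>, OF pointed_mod K B])
    fix Y l t a assume a: "Y \<in> S" "t \<in> Spx ?T l" "a \<in> El K Y l"
    then show "\<phi> Y l t a \<in> El B Y l" unfolding \<phi>_def using Spx_mod_plus[OF a(2)] by (intro Fn_hom[OF \<sigma>] smash_pair_El) auto
  next
    fix Y m l \<theta> t a assume a: "Y \<in> S" "\<theta> \<in> Delta m l" "t \<in> Spx ?T l" "a \<in> El K Y l"
    have t: "t \<in> Spx (simplex_plus n) l" using Spx_mod_plus[OF a(3)] by auto
    have ta: "Op (simplex_plus n) m l \<theta> t \<in> Spx (simplex_plus n) m" by (rule pointed_ssetD(3)[OF pointed_plus a(2) t])
    have "\<phi> Y m (Op ?T m l \<theta> t) (Op (Val K Y) m l \<theta> a) = \<phi> Y m (Op (simplex_plus n) m l \<theta> t) (Op (Val K Y) m l \<theta> a)"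
    proof (cases "constant_list (Op (simplex_plus n) m l \<theta> t)")
      case True
      then have "t \<noteq> []" by (auto simp: Op_plus)
      moreover have "Op (simplex_plus n) m l \<theta> t \<in> simplex n m" using ta True by (auto simp: Spx_plus)
      ultimately show ?thesis
        using const[OF _ True a(1) Op_El[OF K a(1,2,4)]] b(2)[OF a(1)] True
        by (simp add: simplex_mod_vertices_def simplex_quot_def Op_plus)
    next
      case False
      then show ?thesis by (auto simp: simplex_mod_vertices_def simplex_quot_def Op_plus)
    qed
    also have "\<dots> = Op (Val B Y) m l \<theta> (\<phi> Y l t a)"
      unfolding \<phi>_def using Fn_Op[OF \<sigma> a(1,2) smash_pair_El[OF t a(4)]] Op_smash[OF pointed_plus K a(1,2), of n t a] by simp
    finally show "\<phi> Y m (Op ?T m l \<theta> t) (Op (Val K Y) m l \<theta> a) = Op (Val B Y) m l \<theta> (\<phi> Y l t a)" .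
  next
    fix u l t a assume a: "u \<in> Ar (Sm X)" "t \<in> Spx ?T l" "a \<in> El K (Cod u) l"
    have t: "t \<in> Spx (simplex_plus n) l" using Spx_mod_plus[OF a(2)] by auto
    show "\<phi> (Dom u) l t (Rst K u l a) = Rst B u l (\<phi> (Cod u) l t a)"
      unfolding \<phi>_def using Fn_Rst[OF \<sigma> a(1) smash_pair_El[OF t a(3)]] Rst_smash[OF K a(1), of "simplex_plus n" l t a] by simp
  qed (auto simp: b)
  show ?thesis
  proof (rule that[OF s])
    show "?s \<cdot> qt n K = \<sigma>"
    proof (rule smash_hom_ext[OF comp_hom[OF qt_hom[OF K] s] \<sigma>])
      fix Y l t a assume a: "Y \<in> S" "t \<in> Spx (simplex_plus n) l" "a \<in> El K Y l"
      have "Fn (?s \<cdot> qt n K) Y l (smash_pair K Y l t a) = \<phi> Y l (collapse t) a"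
        using Fn_comp[OF qt_hom[OF K] a(1) smash_pair_El[OF a(2,3)]] Fn_qt[OF a]
          Fn_bimap[where \<phi> = \<phi> and B = B, OF a(1) pointed_smapD(4)[OF smap_collapse a(2)] a(3)] b[OF a(1)] by simp
      also have "\<dots> = \<phi> Y l t a"
      proof (cases "constant_list t")
        case True
        then have "t \<in> simplex n l" using a(2) by (auto simp: Spx_plus)
        then show ?thesis using const[OF _ True a(1,3)] b[OF a(1)] True by (simp add: collapse_def)
      qed (simp add: collapse_def)
      finally show "Fn (?s \<cdot> qt n K) Y l (smash_pair K Y l t a) = Fn \<sigma> Y l (smash_pair K Y l t a)" by (simp add: \<phi>_def)
    qed
  qed
qed

lemma qt_vtx: "v \<le> n \<Longrightarrow> K \<in> Ob M \<Longrightarrow> qt n K \<cdot> vtx n v K = Zero K (smash (simplex_mod_vertices n) K)"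
proof (rule hom_ext[OF comp_hom[OF vtx_hom qt_hom] Zero_hom])
  fix Y l a assume a: "v \<le> n" "K \<in> Ob M" "Y \<in> S" "a \<in> El K Y l"
  show "Fn (qt n K \<cdot> vtx n v K) Y l a = Fn (Zero K (smash (simplex_mod_vertices n) K)) Y l a"
    using Fn_comp[OF vtx_hom[OF a(1,2)] a(3,4)] Fn_qt[OF a(3) Spx_plus_replicate[OF a(1)] a(4)] a constant_replicate[of l v]
    by (simp add: collapse_def del: replicate_Suc)
qed auto

lemma qt_natural:
  "f \<in> Hom L K \<Longrightarrow> smash_map X (simplex_mod_vertices n) f \<cdot> qt n L = qt n K \<cdot> smash_map X (simplex_plus n) f"
  unfolding qt_def by (rule smash_left_natural[OF smap_collapse])

text \<open>For a trivial cofibration \<open>j\<close> from \<open>A\<close> to \<open>A'\<close> let \<open>P\<close> be the union of the cylinder on \<open>A\<close> and the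
  two ends of the cylinder on \<open>A'\<close>. Then \<open>P\<close> is included into the whole cylinder by a trivial
  cofibration, and \<open>S\<^sup>1 \<and> j\<close> is a pushout of this inclusion.\<close>

lemma circle_triv_cof:
  assumes j: "j \<in> Cof" "j \<in> W" "j \<in> Hom A A'"
  shows "smash_map X circle j \<in> Cof" "smash_map X circle j \<in> W"
proof -
  have A: "A \<in> Ob M" "A' \<in> Ob M" using j(3) by (auto dest: hom_Dom hom_Cod)
  let ?I = "simplex_plus (Suc 0)"
  have circle: "circle = simplex_mod_vertices (Suc 0)" by simp
  note inj = mono_injective[OF j(1,3)]
  define ji where "ji Y l = inv_into (El A Y l) (Fn j Y l)" for Y l
  have ji: "ji Y l (Fn j Y l a) = a" if "Y \<in> S" "a \<in> El A Y l" for Y l a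
    unfolding ji_def by (rule inv_into_f_f[OF inj[OF that(1)] that(2)])
  have jb: "ji Y l (Bpt A' Y l) = Bpt A Y l" if "Y \<in> S" for Y l
    using ji[OF that Bpt_El[OF A(1) that]] Fn_Bpt[OF j(3) that] by simp
  define PP where "PP Y l = {smash_pair A' Y l t a | t a. t \<in> Spx ?I l \<and> a \<in> El A' Y l \<and>
    (t = [] \<or> constant_list t \<or> a \<in> Fn j Y l ` El A Y l)}" for Y l
  have PPI: "smash_pair A' Y l t a \<in> PP Y l" if "t \<in> Spx ?I l" "a \<in> El A' Y l"
    "t = [] \<or> constant_list t \<or> a \<in> Fn j Y l ` El A Y l" for Y l t a
    using that unfolding PP_def by blast
  have PPE: "thesis" if "w \<in> PP Y l" "Y \<in> S"
    "\<And>v a. v \<le> Suc 0 \<Longrightarrow> a \<in> El A' Y l \<Longrightarrow> w = smash_pair A' Y l (replicate (Suc l) v) a \<Longrightarrow> thesis"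
    "\<And>t a. t \<in> Spx ?I l \<Longrightarrow> a \<in> El A Y l \<Longrightarrow> w = smash_pair A' Y l t (Fn j Y l a) \<Longrightarrow> thesis" for w Y l thesis
  proof -
    obtain t a where w: "w = smash_pair A' Y l t a" "t \<in> Spx ?I l" "a \<in> El A' Y l"
      and c: "t = [] \<or> constant_list t \<or> a \<in> Fn j Y l ` El A Y l"
      using \<open>w \<in> PP Y l\<close> unfolding PP_def by blast
    from c consider "t = []" | "t \<noteq> []" "constant_list t" | a0 where "a0 \<in> El A Y l" "a = Fn j Y l a0" by blast
    then show ?thesis
    proof cases
      \<comment> \<open>The base point is counted as a point of the cylinder on \<open>A\<close>,
        paired with the base point of \<open>A\<close>; this leaves two cases in the
        conclusion.\<close>
      case 1
      then have "w = smash_pair A' Y l [] (Fn j Y l (Bpt A Y l))" using w by simp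
      then show ?thesis using that(4)[of "[]" "Bpt A Y l"] Bpt_El[OF A(1) that(2)] by (simp add: Spx_plus)
    next
      case 2
      then have t: "t \<in> simplex (Suc 0) l" using w by (simp add: Spx_plus)
      obtain v where "v \<le> Suc 0" "t = replicate (Suc l) v" by (rule constant_list_replicate[OF t 2(2)])
      then show ?thesis using that(3) w by blast
    next
      case 3
      then show ?thesis using that(4) w by blast
    qed
  qed
  have closed: "closed_part X (cyl A') PP"
    unfolding closed_part_def
  proof (intro conjI ballI allI)
    fix Y l assume Y: "Y \<in> S"
    show "PP Y l \<subseteq> El (cyl A') Y l" by (auto simp: PP_def El_smash)
    show "Bpt (cyl A') Y l \<in> PP Y l" using PPI[of "[]" l "Bpt A' Y l" Y] Bpt_El[OF A(2) Y] by (simp add: Spx_plus)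
  next
    fix Y m l \<theta> w assume a: "Y \<in> S" "\<theta> \<in> Delta m l" "w \<in> PP Y l"
    from a(3,1) show "Op (Val (cyl A') Y) m l \<theta> w \<in> PP Y m"
    proof (rule PPE)
      fix v b assume b: "v \<le> Suc 0" "b \<in> El A' Y l" "w = smash_pair A' Y l (replicate (Suc l) v) b"
      show ?thesis unfolding b(3) Op_smash[OF pointed_plus A(2) a(1,2)]
        by (rule PPI) (use b(1) list_op_replicate[OF a(2), of v] Op_El[OF A(2) a(1,2) b(2)] constant_replicate[of m v] Spx_plus_replicate[OF b(1)]
          in \<open>auto simp: Op_plus simp del: replicate_Suc\<close>)
    next
      fix t b assume b: "t \<in> Spx ?I l" "b \<in> El A Y l" "w = smash_pair A' Y l t (Fn j Y l b)"
      show ?thesis unfolding b(3) Op_smash[OF pointed_plus A(2) a(1,2)]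
        by (rule PPI) (use Op_El[OF A(2) a(1,2) Fn_hom[OF j(3) a(1) b(2)]] pointed_ssetD(3)[OF pointed_plus a(2) b(1)]
          Fn_Op[OF j(3) a(1,2) b(2)] Op_El[OF A(1) a(1,2) b(2)] in \<open>auto intro: rev_image_eqI\<close>)
    qed
  next
    fix u l w assume a: "u \<in> Ar (Sm X)" "w \<in> PP (Cod u) l"
    from a(2) Sm_Cod[OF a(1)] show "Rst (cyl A') u l w \<in> PP (Dom u) l"
    proof (rule PPE)
      fix v b assume b: "v \<le> Suc 0" "b \<in> El A' (Cod u) l" "w = smash_pair A' (Cod u) l (replicate (Suc l) v) b"
      show ?thesis unfolding b(3) Rst_smash[OF A(2) a(1)]
        by (rule PPI[OF Spx_plus_replicate[OF b(1)] Rst_El[OF A(2) a(1) b(2)]]) (use constant_replicate[of l v] in simp)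
    next
      fix t b assume b: "t \<in> Spx ?I l" "b \<in> El A (Cod u) l" "w = smash_pair A' (Cod u) l t (Fn j (Cod u) l b)"
      show ?thesis unfolding b(3) Rst_smash[OF A(2) a(1)]
        by (rule PPI[OF b(1) Rst_El[OF A(2) a(1) Fn_hom[OF j(3) Sm_Cod[OF a(1)] b(2)]]])
          (use Fn_Rst[OF j(3) a(1) b(2)] Rst_El[OF A(1) a(1) b(2)] in \<open>auto intro: rev_image_eqI\<close>)
    qed
  qed
  define P where "P = subpsh (cyl A') PP"
  define i where "i = subincl X (cyl A') PP"
  have cA: "cyl A' \<in> Ob M" using A by simp
  have P: "P \<in> Ob M" unfolding P_def by (rule subpsh_Ob[OF cA closed])
  have i: "i \<in> Hom P (cyl A')" unfolding i_def P_def by (rule subincl_hom[OF cA closed])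
  have Fi: "Fn i Y l w = w" if "Y \<in> S" "w \<in> El P Y l" for Y l w using that by (simp add: i_def P_def)
  have iC: "i \<in> Cof" by (rule injective_mono[OF i]) (simp add: inj_on_def Fi)
  have ElP: "El P Y l = PP Y l" and OpP: "Op (Val P Y) = Op (Val (cyl A') Y)" and RstP: "Rst P = Rst (cyl A')" and BptP: "Bpt P = Bpt (cyl A')"
    for Y l by (simp_all add: P_def)
  have vP: "smash_pair A' Y l (replicate (Suc l) v) a \<in> El P Y l" if "v \<le> Suc 0" "a \<in> El A' Y l" for Y l v a
    unfolding ElP by (rule PPI[OF Spx_plus_replicate[OF that(1)] that(2)]) (use constant_replicate[of l v] in simp)
  have tP: "smash_pair A' Y l t (Fn j Y l a) \<in> El P Y l" if "Y \<in> S" "t \<in> Spx ?I l" "a \<in> El A Y l" for Y l t a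
    unfolding ElP by (rule PPI[OF that(2) Fn_hom[OF j(3) that(1,3)]]) (use that(3) in blast)
  text \<open>Gluing maps along the description of \<open>P\<close> as a union.\<close>
  have glue: "\<exists>z\<in>Hom P E. (\<forall>Y l t a. Y \<in> S \<longrightarrow> t \<in> Spx ?I l \<longrightarrow> a \<in> El A Y l \<longrightarrow>
        Fn z Y l (smash_pair A' Y l t (Fn j Y l a)) = Fn u Y l (smash_pair A Y l t a)) \<and>
      (\<forall>Y l v a. Y \<in> S \<longrightarrow> v \<le> Suc 0 \<longrightarrow> a \<in> El A' Y l \<longrightarrow>
        Fn z Y l (smash_pair A' Y l (replicate (Suc l) v) a) = Fn (h v) Y l a)"
    if u: "u \<in> Hom (cyl A) E" and h: "\<And>v. v \<le> Suc 0 \<Longrightarrow> h v \<in> Hom A' E \<and> h v \<cdot> j = u \<cdot> vtx (Suc 0) v A" for u h E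
  proof -
    have E: "E \<in> Ob M" using u by (rule hom_Cod)
    define F where "F Y l w = (case dec w of (t, a) \<Rightarrow> if t = [] then Bpt E Y l else if constant_list t then Fn (h (hd t)) Y l a
      else Fn u Y l (smash_pair A Y l t (ji Y l a)))" for Y l and w :: 'b
    have Fp: "F Y l (smash_pair A' Y l t a) = (if t = [] then Bpt E Y l else if constant_list t then Fn (h (hd t)) Y l a
        else Fn u Y l (smash_pair A Y l t (ji Y l a)))" if "Y \<in> S" "t \<in> Spx ?I l" for Y l t a
    proof (cases "t = [] \<or> a = Bpt A' Y l")
      case True
      have "Fn (h (hd t)) Y l (Bpt A' Y l) = Bpt E Y l" if c: "constant_list t"
      proof -
        have "t \<in> simplex (Suc 0) l" using \<open>t \<in> Spx ?I l\<close> c by (auto simp: Spx_plus)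
        then obtain v where v: "v \<le> Suc 0" "t = replicate (Suc l) v" using c by (rule constant_list_replicate)
        then show ?thesis using Fn_Bpt[OF conjunct1[OF h[OF v(1)]] \<open>Y \<in> S\<close>] by simp
      qed
      moreover have "Fn u Y l (enc ([], undefined)) = Bpt E Y l" using Fn_Bpt[OF u that(1), of l] by simp
      ultimately show ?thesis using True jb[OF that(1)] by (auto simp: F_def)
    qed (simp add: F_def smash_pair_def)
    have F1: "F Y l (smash_pair A' Y l (replicate (Suc l) v) a) = Fn (h v) Y l a" if "Y \<in> S" "v \<le> Suc 0" for Y l v a
      using Fp[OF that(1) Spx_plus_replicate[OF that(2)]] constant_replicate[of l v] by simp
    have F2: "F Y l (smash_pair A' Y l t (Fn j Y l a)) = Fn u Y l (smash_pair A Y l t a)"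
      if Y: "Y \<in> S" and t: "t \<in> Spx ?I l" and a: "a \<in> El A Y l" for Y l t a
    proof -
      have "Fn (h (hd t)) Y l (Fn j Y l a) = Fn u Y l (smash_pair A Y l t a)" if c: "constant_list t"
      proof -
        have "t \<in> simplex (Suc 0) l" using t c by (auto simp: Spx_plus)
        then obtain v where v: "v \<le> Suc 0" "t = replicate (Suc l) v" using c by (rule constant_list_replicate)
        have "Fn (h v \<cdot> j) Y l a = Fn (u \<cdot> vtx (Suc 0) v A) Y l a" using h[OF v(1)] by simp
        then show ?thesis using Fn_comp[OF j(3) Y a, of "h v"] Fn_comp[OF vtx_hom[OF v(1) A(1)] Y a, of u] Y a v by simp
      qed
      moreover have "Fn u Y l (enc ([], undefined)) = Bpt E Y l" using Fn_Bpt[OF u Y, of l] by simp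
      ultimately show ?thesis using Fp[OF Y t] ji[OF Y a] by auto
    qed
    have z: "mk X P E F \<in> Hom P E"
    proof (rule mk_hom[OF P E], unfold natural_family_def, intro conjI ballI allI funcsetI)
      fix Y l w assume Y: "Y \<in> S" and w: "w \<in> El P Y l"
      from w[unfolded ElP] Y show "F Y l w \<in> El E Y l"
        by (rule PPE) (use Y Fn_hom[OF conjunct1[OF h] Y] in \<open>simp_all add: F1 F2 Fn_hom[OF u Y] smash_pair_El del: replicate_Suc\<close>)
    next
      fix Y m l \<theta> w assume Y: "Y \<in> S" and \<theta>: "\<theta> \<in> Delta m l" and w: "w \<in> El P Y l"
      from w[unfolded ElP] Y show "F Y m (Op (Val P Y) m l \<theta> w) = Op (Val E Y) m l \<theta> (F Y l w)"
      proof (rule PPE)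
        fix v b assume b: "v \<le> Suc 0" "b \<in> El A' Y l" "w = smash_pair A' Y l (replicate (Suc l) v) b"
        have "Op ?I m l \<theta> (replicate (Suc l) v) = replicate (Suc m) v" using list_op_replicate[OF \<theta>, of v] by (simp add: Op_plus)
        then show ?thesis unfolding b(3) OpP Op_smash[OF pointed_plus A(2) Y \<theta>]
          using F1[OF Y b(1)] Fn_Op[OF conjunct1[OF h[OF b(1)]] Y \<theta> b(2)] by simp
      next
        fix t b assume b: "t \<in> Spx ?I l" "b \<in> El A Y l" "w = smash_pair A' Y l t (Fn j Y l b)"
        show ?thesis unfolding b(3) OpP Op_smash[OF pointed_plus A(2) Y \<theta>] F2[OF Y b(1,2)]
          unfolding Fn_Op[OF j(3) Y \<theta> b(2), symmetric] F2[OF Y pointed_ssetD(3)[OF pointed_plus \<theta> b(1)] Op_El[OF A(1) Y \<theta> b(2)]]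
          using Fn_Op[OF u Y \<theta> smash_pair_El[OF b(1,2)]] Op_smash[OF pointed_plus A(1) Y \<theta>] by simp
      qed
    next
      fix x l w assume x: "x \<in> Ar (Sm X)" and w: "w \<in> El P (Cod x) l"
      from w[unfolded ElP] Sm_Cod[OF x] show "F (Dom x) l (Rst P x l w) = Rst E x l (F (Cod x) l w)"
      proof (rule PPE)
        fix v b assume b: "v \<le> Suc 0" "b \<in> El A' (Cod x) l" "w = smash_pair A' (Cod x) l (replicate (Suc l) v) b"
        show ?thesis unfolding b(3) RstP Rst_smash[OF A(2) x]
          using F1[OF Sm_Dom[OF x] b(1)] F1[OF Sm_Cod[OF x] b(1)] Fn_Rst[OF conjunct1[OF h[OF b(1)]] x b(2)] by simp
      next
        fix t b assume b: "t \<in> Spx ?I l" "b \<in> El A (Cod x) l" "w = smash_pair A' (Cod x) l t (Fn j (Cod x) l b)"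
        show ?thesis unfolding b(3) RstP Rst_smash[OF A(2) x] F2[OF Sm_Cod[OF x] b(1,2)]
          unfolding Fn_Rst[OF j(3) x b(2), symmetric] F2[OF Sm_Dom[OF x] b(1) Rst_El[OF A(1) x b(2)]]
          using Fn_Rst[OF u x smash_pair_El[OF b(1,2)]] Rst_smash[OF A(1) x] by simp
      qed
    next
      fix Y l assume "Y \<in> S"
      then show "F Y l (Bpt P Y l) = Bpt E Y l" using Fp[of Y "[]" l undefined] by (simp add: BptP Spx_plus)
    qed
    show ?thesis
      by (rule bexI[OF _ z]) (auto simp: tP vP F1 F2 simp del: replicate_Suc)
  qed
  have Phom_ext: "f = g" if fg: "f \<in> Hom P E" "g \<in> Hom P E"
    and 1: "\<And>Y l t a. Y \<in> S \<Longrightarrow> t \<in> Spx ?I l \<Longrightarrow> a \<in> El A Y l \<Longrightarrow>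
        Fn f Y l (smash_pair A' Y l t (Fn j Y l a)) = Fn g Y l (smash_pair A' Y l t (Fn j Y l a))"
    and 2: "\<And>Y l v a. Y \<in> S \<Longrightarrow> v \<le> Suc 0 \<Longrightarrow> a \<in> El A' Y l \<Longrightarrow>
        Fn f Y l (smash_pair A' Y l (replicate (Suc l) v) a) = Fn g Y l (smash_pair A' Y l (replicate (Suc l) v) a)" for f g E
  proof (rule hom_ext[OF fg])
    fix Y l w assume Y: "Y \<in> S" and w: "w \<in> El P Y l"
    from w[unfolded ElP] Y show "Fn f Y l w = Fn g Y l w"
      by (rule PPE) (simp_all add: 1 2 Y del: replicate_Suc)
  qed
  define k where "k = mk X (cyl A) P (Fn (smash_map X ?I j))"
  have k: "k \<in> Hom (cyl A) P"
    unfolding k_def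
  proof (rule mk_hom[OF _ P])
    show "natural_family X (cyl A) P (Fn (smash_map X ?I j))"
      using smash_map_hom[OF pointed_plus j(3), of "Suc 0"] unfolding natural_family_def in_hom_psPre
      by (auto simp: OpP RstP BptP El_smash[of _ A] Fn_smash_map[OF j(3)] tP)
  qed (use A in simp)
  have Fk: "Fn k Y l (smash_pair A Y l t a) = smash_pair A' Y l t (Fn j Y l a)" if "Y \<in> S" "t \<in> Spx ?I l" "a \<in> El A Y l" for Y l t a
    using that smash_pair_El[OF that(2,3)] by (simp add: k_def Fn_smash_map[OF j(3)])
  have ik: "i \<cdot> k = smash_map X ?I j"
    by (rule smash_hom_ext[OF comp_hom[OF k i] smash_map_hom[OF pointed_plus j(3)]])
      (simp add: Fn_comp[OF k] smash_pair_El Fk Fi tP Fn_smash_map[OF j(3)])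
  \<comment> \<open>The projections of both cylinders are weak equivalences and commute with
    \<open>j\<close>, so two-out-of-three applies.\<close>
  have "smash_map X ?I j \<in> W"
  proof (rule W_right[OF smash_map_hom[OF pointed_plus j(3)] proj_hom[OF A(2)] cyl_triv_cof(3)[OF A(2)]])
    show "proj (Suc 0) A' \<cdot> smash_map X ?I j \<in> W"
      unfolding proj_natural[OF j(3)] by (rule W_comp[OF proj_hom[OF A(1)] j(3) cyl_triv_cof(3)[OF A(1)] j(2)])
  qed
  \<comment> \<open>\<open>k\<close> includes the cylinder on \<open>A\<close> into \<open>P\<close>
    and attaches a copy of \<open>A'\<close> along \<open>j\<close> at each end. Hence a lifting
    problem for \<open>k\<close> is solved by two lifts along \<open>j\<close>, which are glued with
    \<open>u\<close>.\<close>
  moreover have "k \<in> Cof \<and> k \<in> W"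
  proof (rule triv_cofI[OF k])
    fix p E B u y assume p: "p \<in> Fb" "p \<in> Hom E B" and u: "u \<in> Hom (cyl A) E" and y: "y \<in> Hom P B" and py: "p \<cdot> u = y \<cdot> k"
    define c where "c v = mk X A' P (\<lambda>Y l a. smash_pair A' Y l (replicate (Suc l) v) a)" for v
    have c: "c v \<in> Hom A' P" if "v \<le> Suc 0" for v
      unfolding c_def using vtx_hom[OF that A(2)] that vP
      by (intro mk_hom[OF A(2) P]) (auto simp: natural_family_def BptP OpP RstP Op_smash[OF pointed_plus A(2)] Rst_smash[OF A(2)] Op_plus list_op_replicate simp del: replicate_Suc)
    have Fc: "Fn (c v) Y l a = smash_pair A' Y l (replicate (Suc l) v) a" if "Y \<in> S" "a \<in> El A' Y l" for v Y l a
      using that by (simp add: c_def)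
    have "\<exists>h. h \<in> Hom A' E \<and> h \<cdot> j = u \<cdot> vtx (Suc 0) v A \<and> p \<cdot> h = y \<cdot> c v" if v: "v \<le> Suc 0" for v
    proof -
      note vA = vtx_hom[OF v A(1)]
      have kv: "k \<cdot> vtx (Suc 0) v A = c v \<cdot> j"
        by (rule hom_ext[OF comp_hom[OF vA k] comp_hom[OF j(3) c[OF v]]])
          (simp add: Fn_comp[OF vA] Fn_comp[OF j(3)] Fk Fc Spx_plus_replicate v Fn_hom[OF j(3)] del: replicate_Suc)
      have "p \<cdot> (u \<cdot> vtx (Suc 0) v A) = (y \<cdot> c v) \<cdot> j"
        using assoc[OF vA u p(2)] assoc[OF vA k y] assoc[OF j(3) c[OF v] y] py kv by simp
      then obtain h where "h \<in> Hom A' E" "h \<cdot> j = u \<cdot> vtx (Suc 0) v A" "p \<cdot> h = y \<cdot> c v"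
        by (rule Fb_lift[OF p j comp_hom[OF vA u] comp_hom[OF c[OF v] y]])
      then show ?thesis by blast
    qed
    then obtain h where h: "\<And>v. v \<le> Suc 0 \<Longrightarrow> h v \<in> Hom A' E \<and> h v \<cdot> j = u \<cdot> vtx (Suc 0) v A \<and> p \<cdot> h v = y \<cdot> c v" by metis
    obtain z where z: "z \<in> Hom P E"
      and z1: "\<And>Y l t a. Y \<in> S \<Longrightarrow> t \<in> Spx ?I l \<Longrightarrow> a \<in> El A Y l \<Longrightarrow>
        Fn z Y l (smash_pair A' Y l t (Fn j Y l a)) = Fn u Y l (smash_pair A Y l t a)"
      and z2: "\<And>Y l v a. Y \<in> S \<Longrightarrow> v \<le> Suc 0 \<Longrightarrow> a \<in> El A' Y l \<Longrightarrow>
        Fn z Y l (smash_pair A' Y l (replicate (Suc l) v) a) = Fn (h v) Y l a"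
      using glue[OF u, of h] h by blast
    have "z \<cdot> k = u"
      by (rule smash_hom_ext[OF comp_hom[OF k z] u]) (simp add: Fn_comp[OF k] smash_pair_El Fk z1)
    moreover have "p \<cdot> z = y"
    proof (rule Phom_ext[OF comp_hom[OF z p(2)] y])
      fix Y l t a assume a: "Y \<in> S" "t \<in> Spx ?I l" "a \<in> El A Y l"
      have "Fn (p \<cdot> u) Y l (smash_pair A Y l t a) = Fn (y \<cdot> k) Y l (smash_pair A Y l t a)" using py by simp
      then show "Fn (p \<cdot> z) Y l (smash_pair A' Y l t (Fn j Y l a)) = Fn y Y l (smash_pair A' Y l t (Fn j Y l a))"
        using Fn_comp[OF z a(1) tP[OF a]] z1[OF a] Fn_comp[OF u a(1) smash_pair_El[OF a(2,3)]]
          Fn_comp[OF k a(1) smash_pair_El[OF a(2,3)]] Fk[OF a] by simp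
    next
      fix Y l v a assume a: "Y \<in> S" "v \<le> Suc 0" "a \<in> El A' Y l"
      have "Fn (p \<cdot> h v) Y l a = Fn (y \<cdot> c v) Y l a" using h[OF a(2)] by simp
      then show "Fn (p \<cdot> z) Y l (smash_pair A' Y l (replicate (Suc l) v) a) = Fn y Y l (smash_pair A' Y l (replicate (Suc l) v) a)"
        using Fn_comp[OF z a(1) vP[OF a(2,3)]] z2[OF a] Fn_comp[OF conjunct1[OF h[OF a(2)]] a(1,3)]
          Fn_comp[OF c[OF a(2)] a(1,3)] Fc[OF a(1,3)] by simp
    qed
    ultimately show "\<exists>h\<in>Hom P E. h \<cdot> k = u \<and> p \<cdot> h = y" using z by blast
  qed
  \<comment> \<open>Two-out-of-three: both \<open>k\<close> and the composite
    \<open>i \<cdot> k\<close>, the cylinder on \<open>j\<close>, are weak equivalences.\<close>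
  ultimately have iW: "i \<in> W" using W_left[OF k i] ik by simp
  define g where "g = qt (Suc 0) A"
  have qA: "g \<in> Hom (cyl A) (smash circle A)" unfolding g_def using qt_hom[OF A(1), of "Suc 0"] by simp
  have cS: "smash circle A \<in> Ob M" using A by simp
  have z0: "Zero A' (smash circle A) \<in> Hom A' (smash circle A)" by (rule Zero_hom[OF A(2) cS])
  \<comment> \<open>The map \<open>r\<close> from \<open>P\<close> to \<open>S1 A\<close>, the other
    leg of the pushout square: the quotient map on the cylinder on \<open>A\<close>, and zero on the
    two copies of \<open>A'\<close>.\<close>
  have "\<exists>z\<in>Hom P (smash circle A). (\<forall>Y l t a. Y \<in> S \<longrightarrow> t \<in> Spx ?I l \<longrightarrow> a \<in> El A Y l \<longrightarrow>
        Fn z Y l (smash_pair A' Y l t (Fn j Y l a)) = Fn g Y l (smash_pair A Y l t a)) \<and>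
      (\<forall>Y l v a. Y \<in> S \<longrightarrow> v \<le> Suc 0 \<longrightarrow> a \<in> El A' Y l \<longrightarrow>
        Fn z Y l (smash_pair A' Y l (replicate (Suc l) v) a) = Fn (Zero A' (smash circle A)) Y l a)"
    by (rule glue[OF qA]) (use z0 zero_comp[OF j(3) cS] qt_vtx[OF _ A(1), of _ "Suc 0"] in \<open>auto simp: g_def\<close>)
  then obtain r where r: "r \<in> Hom P (smash circle A)"
    and r1: "\<And>Y l t a. Y \<in> S \<Longrightarrow> t \<in> Spx ?I l \<Longrightarrow> a \<in> El A Y l \<Longrightarrow>
        Fn r Y l (smash_pair A' Y l t (Fn j Y l a)) = smash_pair A Y l (collapse t) a"
    and r2: "\<And>Y l v a. Y \<in> S \<Longrightarrow> v \<le> Suc 0 \<Longrightarrow> a \<in> El A' Y l \<Longrightarrow>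
        Fn r Y l (smash_pair A' Y l (replicate (Suc l) v) a) = enc ([], undefined)"
    by (auto simp: g_def Fn_qt simp del: replicate_Suc)
  note Sj = smash_map_hom[OF pointed_mod j(3), of "Suc 0"]
  have "smash_map X (simplex_mod_vertices (Suc 0)) j \<in> Cof \<and> smash_map X (simplex_mod_vertices (Suc 0)) j \<in> W"
  proof (rule triv_cofI[OF Sj])
    fix p E B u v assume p: "p \<in> Fb" "p \<in> Hom E B" and u: "u \<in> Hom (smash (simplex_mod_vertices (Suc 0)) A) E"
      and v: "v \<in> Hom (smash (simplex_mod_vertices (Suc 0)) A') B" and e: "p \<cdot> u = v \<cdot> smash_map X (simplex_mod_vertices (Suc 0)) j"
    have u': "u \<in> Hom (smash circle A) E" using u by simp
    note q' = qt_hom[OF A(2), of "Suc 0"]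
    \<comment> \<open>The lifting problem for the suspension of \<open>j\<close> is pulled back to
      one for \<open>i\<close>, along \<open>r\<close> on the source and the quotient map on the
      target.\<close>
    have sq: "p \<cdot> (u \<cdot> r) = (v \<cdot> qt (Suc 0) A') \<cdot> i"
    proof (rule Phom_ext[OF comp_hom[OF comp_hom[OF r u'] p(2)] comp_hom[OF i comp_hom[OF q' v]]])
      fix Y l t a assume a: "Y \<in> S" "t \<in> Spx ?I l" "a \<in> El A Y l"
      have ct: "collapse t \<in> Spx (simplex_mod_vertices (Suc 0)) l" by (rule pointed_smapD(4)[OF smap_collapse a(2)])
      have "Fn (p \<cdot> u) Y l (smash_pair A Y l (collapse t) a) = Fn (v \<cdot> smash_map X (simplex_mod_vertices (Suc 0)) j) Y l (smash_pair A Y l (collapse t) a)"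
        using e by simp
      then show "Fn (p \<cdot> (u \<cdot> r)) Y l (smash_pair A' Y l t (Fn j Y l a)) = Fn ((v \<cdot> qt (Suc 0) A') \<cdot> i) Y l (smash_pair A' Y l t (Fn j Y l a))"
        using Fn_comp[OF comp_hom[OF r u'] a(1) tP[OF a]] Fn_comp[OF r a(1) tP[OF a]] r1[OF a] Fn_comp[OF u a(1) smash_pair_El[OF ct a(3)]]
          Fn_comp[OF Sj a(1) smash_pair_El[OF ct a(3)]] Fn_smash_map[OF j(3) a(1) ct a(3)]
          Fn_comp[OF i a(1) tP[OF a]] Fi[OF a(1) tP[OF a]] Fn_comp[OF q' a(1) smash_pair_El[OF a(2) Fn_hom[OF j(3) a(1,3)]]]
          Fn_qt[OF a(1,2) Fn_hom[OF j(3) a(1,3)]] by simp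
    next
      fix Y l w a assume a: "Y \<in> S" "w \<le> Suc 0" "a \<in> El A' Y l"
      have c: "collapse (replicate (Suc l) w) = []" using constant_replicate[of l w] by (simp add: collapse_def)
      show "Fn (p \<cdot> (u \<cdot> r)) Y l (smash_pair A' Y l (replicate (Suc l) w) a) = Fn ((v \<cdot> qt (Suc 0) A') \<cdot> i) Y l (smash_pair A' Y l (replicate (Suc l) w) a)"
        using Fn_comp[OF comp_hom[OF r u'] a(1) vP[OF a(2,3)]] Fn_comp[OF r a(1) vP[OF a(2,3)]] r2[OF a]
          Fn_comp[OF i a(1) vP[OF a(2,3)]] Fi[OF a(1) vP[OF a(2,3)]] Fn_comp[OF q' a(1) smash_pair_El[OF Spx_plus_replicate[OF a(2)] a(3)]]
          Fn_qt[OF a(1) Spx_plus_replicate[OF a(2)] a(3)] c Fn_Bpt[OF u a(1), of l] Fn_Bpt[OF v a(1), of l] Fn_Bpt[OF p(2) a(1), of l] by simp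
    qed
    obtain z where z: "z \<in> Hom (cyl A') E" "z \<cdot> i = u \<cdot> r" "p \<cdot> z = v \<cdot> qt (Suc 0) A'"
      by (rule Fb_lift[OF p iC iW i comp_hom[OF r u'] comp_hom[OF q' v] sq])
    have zi: "Fn z Y l w = Fn u Y l (Fn r Y l w)" if "Y \<in> S" "w \<in> El P Y l" for Y l w
      using Fn_comp[OF i that, of z] Fn_comp[OF r that, of u] z(2) Fi[OF that] by simp
    \<comment> \<open>Because \<open>r\<close> kills both ends, the lift \<open>z\<close> on the
      cylinder vanishes there and descends to \<open>S1 A'\<close>.\<close>
    have z0: "z \<cdot> vtx (Suc 0) w A' = Zero A' E" if w: "w \<le> Suc 0" for w
    proof (rule hom_ext[OF comp_hom[OF vtx_hom[OF w A(2)] z(1)] Zero_hom[OF A(2) hom_Cod[OF u]]])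
      fix Y l a assume a: "Y \<in> S" "a \<in> El A' Y l"
      show "Fn (z \<cdot> vtx (Suc 0) w A') Y l a = Fn (Zero A' E) Y l a"
        using Fn_comp[OF vtx_hom[OF w A(2)] a, of z] a zi[OF a(1) vP[OF w a(2)]] r2[OF a(1) w a(2)] Fn_Bpt[OF u a(1), of l]
        by (simp del: replicate_Suc)
    qed
    obtain z' where z': "z' \<in> Hom (smash (simplex_mod_vertices (Suc 0)) A') E" "z' \<cdot> qt (Suc 0) A' = z"
      by (rule qt_factor[OF A(2) z(1) z0])
    have "z' \<cdot> smash_map X (simplex_mod_vertices (Suc 0)) j = u"
    proof (rule smash_hom_ext[OF comp_hom[OF Sj z'(1)] u])
      fix Y l t a assume a: "Y \<in> S" "t \<in> Spx (simplex_mod_vertices (Suc 0)) l" "a \<in> El A Y l"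
      have t: "t \<in> Spx ?I l" "collapse t = t" using Spx_mod_plus[OF a(2)] by auto
      have ja: "Fn j Y l a \<in> El A' Y l" by (rule Fn_hom[OF j(3) a(1,3)])
      show "Fn (z' \<cdot> smash_map X (simplex_mod_vertices (Suc 0)) j) Y l (smash_pair A Y l t a) = Fn u Y l (smash_pair A Y l t a)"
        using Fn_comp[OF Sj a(1) smash_pair_El[OF a(2,3)]] Fn_smash_map[OF j(3) a]
          Fn_comp[OF q' a(1) smash_pair_El[OF t(1) ja], of z'] z'(2) Fn_qt[OF a(1) t(1) ja] t(2)
          zi[OF a(1) tP[OF a(1) t(1) a(3)]] r1[OF a(1) t(1) a(3)] by simp
    qed
    moreover have "p \<cdot> z' = v"
      by (rule qt_epi[OF A(2) comp_hom[OF z'(1) p(2)] v]) (use assoc[OF q' z'(1) p(2)] z'(2) z(3) in simp)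
    ultimately show "\<exists>h\<in>Hom (smash (simplex_mod_vertices (Suc 0)) A') E. h \<cdot> smash_map X (simplex_mod_vertices (Suc 0)) j = u \<and> p \<cdot> h = v"
      using z'(1) by blast
  qed
  then show "smash_map X circle j \<in> Cof" "smash_map X circle j \<in> W" by simp_all
qed

text \<open>Trivial cofibrations suffice: \<open>w\<close> is a trivial cofibration followed by a
  trivial fibration \<open>p\<close>, and the suspension of \<open>p\<close> has as right inverse
  the suspension of a section, which is a trivial cofibration.\<close>

lemma circle_W:
  assumes w: "w \<in> W" "w \<in> Hom A A'"
  shows "smash_map X circle w \<in> W"
proof -
  obtain i p E where i: "i \<in> Cof" "i \<in> W" "i \<in> Hom A E" and p: "p \<in> Fb" "p \<in> Hom E A'" "p \<cdot> i = w"
    by (rule factor_CW_F[OF w(2)])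
  have pW: "p \<in> W" using W_left[OF i(3) p(2) i(2)] p(3) w(1) by simp
  obtain s where s: "s \<in> Hom A' E" "p \<cdot> s = Idn M A'" "s \<in> Cof" "s \<in> W" by (rule trivial_fibration_section[OF p(1) pW p(2)])
  note c = smash_map_hom[OF pointed_mod i(3), of 1] smash_map_hom[OF pointed_mod p(2), of 1] smash_map_hom[OF pointed_mod s(1), of 1]
  have A': "A' \<in> Ob M" using w(2) by (rule hom_Cod)
  have "smash_map X circle p \<cdot> smash_map X circle s = Idn M (smash circle A')"
    using smash_map_comp[OF pointed_mod s(1) p(2)] s(2) smash_map_Idn[OF pointed_mod A'] by simp
  then have "smash_map X circle p \<in> W"
    using W_left[OF c(3,2) circle_triv_cof(2)[OF s(3,4,1)]] Idn_W[OF smash_Ob[OF pointed_mod A']] by simp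
  then show ?thesis
    using W_comp[OF c(1,2) circle_triv_cof(2)[OF i]] smash_map_comp[OF pointed_mod i(3) p(2)] p(3) by simp
qed

section \<open>Loops and the group structure\<close>

abbreviation "S1 \<equiv> smash (simplex_mod_vertices (Suc 0))"
abbreviation "S2 \<equiv> smash (simplex_mod_vertices (Suc (Suc 0)))"
abbreviation "S1m \<equiv> smash_map X (simplex_mod_vertices (Suc 0))"

definition mface :: "nat \<Rightarrow> ('a, 'b) pspsh \<Rightarrow> ('a, 'b) parr" where
  "mface j K = smash_left X (simplex_mod_vertices (Suc 0)) (simplex_mod_vertices (Suc (Suc 0))) (map (coface j)) K"

lemma mface_hom: "K \<in> Ob M \<Longrightarrow> mface j K \<in> Hom (S1 K) (S2 K)"
  unfolding mface_def by (rule smash_left_hom[OF smap_coface_mod])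

lemma mface_qt:
  assumes K: "K \<in> Ob M"
  shows "mface j K \<cdot> qt (Suc 0) K = qt (Suc (Suc 0)) K \<cdot> dface (Suc 0) j K"
proof -
  have "map (coface j) (collapse t) = collapse (map (coface j) t)" for t
    by (auto simp: collapse_def constant_list_map) (auto simp: constant_list_def card_image inj_on_subset[OF inj_coface])
  then show ?thesis
    unfolding mface_def qt_def dface_def
    by (simp add: smash_left_comp[OF smap_collapse smap_coface_mod K] smash_left_comp[OF smap_coface_plus smap_collapse K])
qed

lemma mface_natural: "f \<in> Hom L K \<Longrightarrow> smash_map X (simplex_mod_vertices (Suc (Suc 0))) f \<cdot> mface j L = mface j K \<cdot> S1m f"
  unfolding mface_def by (rule smash_left_natural[OF smap_coface_mod])

lemma S1_Ob [simp]: "K \<in> Ob M \<Longrightarrow> S1 K \<in> Ob M" and S2_Ob [simp]: "K \<in> Ob M \<Longrightarrow> S2 K \<in> Ob M"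
  by simp_all

lemma S1m_hom: "f \<in> Hom L K \<Longrightarrow> S1m f \<in> Hom (S1 L) (S1 K)"
  by (rule smash_map_hom[OF pointed_mod])

lemma loop_hom: "K \<in> Ob M \<Longrightarrow> x \<in> Hom (S1 K) B \<Longrightarrow> x \<cdot> qt (Suc 0) K \<in> Hom (cyl K) B"
  by (rule comp_hom[OF qt_hom])

lemma loop_edge:
  assumes K: "K \<in> Ob M" and x: "x \<in> Hom (S1 K) B"
  shows "edge K B (x \<cdot> qt (Suc 0) K) (Zero K B) (Zero K B)"
proof -
  have "(x \<cdot> qt (Suc 0) K) \<cdot> vtx (Suc 0) v K = Zero K B" if "v \<le> Suc 0" for v
    using assoc[OF vtx_hom[OF that K] qt_hom[OF K] x] qt_vtx[OF that K] comp_zero[OF x K] by simp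
  then show ?thesis using K loop_hom[OF K x] by (simp add: edge_def)
qed

lemma edge_loop:
  assumes "edge K B y (Zero K B) (Zero K B)"
  obtains x where "x \<in> Hom (S1 K) B" "x \<cdot> qt (Suc 0) K = y"
proof -
  note e = edgeD[OF assms]
  have z: "y \<cdot> vtx (Suc 0) v K = Zero K B" if "v \<le> Suc 0" for v using that e by (auto simp: le_Suc_eq)
  obtain x where "x \<in> Hom (S1 K) B" "x \<cdot> qt (Suc 0) K = y" by (rule qt_factor[OF e(1,3) z])
  then show ?thesis by (rule that)
qed

lemma loop_eqI: "K \<in> Ob M \<Longrightarrow> x \<in> Hom (S1 K) B \<Longrightarrow> y \<in> Hom (S1 K) B \<Longrightarrow> x \<cdot> qt (Suc 0) K = y \<cdot> qt (Suc 0) K \<Longrightarrow> x = y"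
  by (rule qt_epi)

lemma comp_qt: "K \<in> Ob M \<Longrightarrow> x \<in> Hom (S1 K) E \<Longrightarrow> p \<in> Hom E B \<Longrightarrow> (p \<cdot> x) \<cdot> qt (Suc 0) K = p \<cdot> (x \<cdot> qt (Suc 0) K)"
  by (rule assoc[OF qt_hom, symmetric])

lemma zero_qt: "K \<in> Ob M \<Longrightarrow> B \<in> Ob M \<Longrightarrow> Zero (S1 K) B \<cdot> qt (Suc 0) K = cst K (Zero K B)"
  unfolding cst_def using zero_comp[OF qt_hom, of K B "Suc 0"] zero_comp[OF proj_hom, of K B "Suc 0"] by simp

text \<open>\<open>tri K B x y z\<close>: some map on the 2-simplex with vertices identified (smashed with \<open>K\<close>) has
  faces \<open>x\<close>, \<open>y\<close>, \<open>z\<close>, so that \<open>y\<close> represents the product of \<open>x\<close> and \<open>z\<close>.\<close>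

definition tri :: "('a, 'b) pspsh \<Rightarrow> ('a, 'b) pspsh \<Rightarrow> ('a, 'b) parr \<Rightarrow> ('a, 'b) parr \<Rightarrow> ('a, 'b) parr \<Rightarrow> bool" where
  "tri K B x y z \<longleftrightarrow> K \<in> Ob M \<and> (\<exists>c\<in>Hom (S2 K) B. x = c \<cdot> mface 0 K \<and> y = c \<cdot> mface (Suc 0) K \<and> z = c \<cdot> mface (Suc (Suc 0)) K)"

lemma triD:
  assumes "tri K B x y z"
  shows "K \<in> Ob M" "x \<in> Hom (S1 K) B" "y \<in> Hom (S1 K) B" "z \<in> Hom (S1 K) B" "B \<in> Ob M"
  using assms comp_hom[OF mface_hom] by (auto simp: tri_def dest: hom_Cod)

lemma tri_triangle:
  assumes "tri K B x y z"
  obtains c where "triangle K B c (x \<cdot> qt (Suc 0) K) (y \<cdot> qt (Suc 0) K) (z \<cdot> qt (Suc 0) K)"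
proof -
  obtain c where K: "K \<in> Ob M" and c: "c \<in> Hom (S2 K) B" "x = c \<cdot> mface 0 K" "y = c \<cdot> mface (Suc 0) K" "z = c \<cdot> mface (Suc (Suc 0)) K"
    using assms by (auto simp: tri_def)
  have "(c \<cdot> qt (Suc (Suc 0)) K) \<cdot> dface (Suc 0) j K = (c \<cdot> mface j K) \<cdot> qt (Suc 0) K" for j
    using assoc[OF dface_hom[OF K] qt_hom[OF K] c(1)] assoc[OF qt_hom[OF K] mface_hom[OF K] c(1)] mface_qt[OF K] by simp
  then have "triangle K B (c \<cdot> qt (Suc (Suc 0)) K) (x \<cdot> qt (Suc 0) K) (y \<cdot> qt (Suc 0) K) (z \<cdot> qt (Suc 0) K)"
    using K comp_hom[OF qt_hom[OF K] c(1)] c by (simp add: triangle_def)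
  then show ?thesis by (rule that)
qed

text \<open>Every vertex of the triangle is an end of one of the loops \<open>x\<close> and
  \<open>z\<close>. So all vertices vanish and the triangle descends to the quotient by the
  vertices.\<close>

lemma triangle_tri:
  assumes t: "triangle K B c (x \<cdot> qt (Suc 0) K) (y \<cdot> qt (Suc 0) K) (z \<cdot> qt (Suc 0) K)"
    and h: "x \<in> Hom (S1 K) B" "y \<in> Hom (S1 K) B" "z \<in> Hom (S1 K) B"
  shows "tri K B x y z"
proof -
  have K: "K \<in> Ob M" and c: "c \<in> Hom (smash (simplex_plus (Suc (Suc 0))) K) B"
    and d: "c \<cdot> dface (Suc 0) 0 K = x \<cdot> qt (Suc 0) K" "c \<cdot> dface (Suc 0) (Suc 0) K = y \<cdot> qt (Suc 0) K"
      "c \<cdot> dface (Suc 0) (Suc (Suc 0)) K = z \<cdot> qt (Suc 0) K" using t by (auto simp: triangle_def)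
  note v = dface_comp_vtx[OF K c]
  note ex = edgeD[OF loop_edge[OF K h(1)]] and ez = edgeD[OF loop_edge[OF K h(3)]]
  have "c \<cdot> vtx (Suc (Suc 0)) v K = Zero K B" if "v \<le> Suc (Suc 0)" for v
  proof -
    consider "v = 0" | "v = Suc 0" | "v = Suc (Suc 0)" using \<open>v \<le> Suc (Suc 0)\<close> by (auto simp: le_Suc_eq)
    then show ?thesis
    proof cases
      case 1 then show ?thesis using v[of 0 "Suc (Suc 0)"] d(3) ez by (simp add: coface_def)
    next
      case 2 then show ?thesis using v[of 0 0] d(1) ex by (simp add: coface_def)
    next
      case 3 then show ?thesis using v[of "Suc 0" 0] d(1) ex by (simp add: coface_def)
    qed
  qed
  then obtain c' where c': "c' \<in> Hom (S2 K) B" "c' \<cdot> qt (Suc (Suc 0)) K = c" by (rule qt_factor[OF K c])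
  have "(c' \<cdot> mface j K) \<cdot> qt (Suc 0) K = c \<cdot> dface (Suc 0) j K" for j
    using assoc[OF dface_hom[OF K] qt_hom[OF K] c'(1)] assoc[OF qt_hom[OF K] mface_hom[OF K] c'(1)] mface_qt[OF K] c'(2) by simp
  then have "x = c' \<cdot> mface 0 K" "y = c' \<cdot> mface (Suc 0) K" "z = c' \<cdot> mface (Suc (Suc 0)) K"
    using loop_eqI[OF K h(1) comp_hom[OF mface_hom[OF K] c'(1)]] loop_eqI[OF K h(2) comp_hom[OF mface_hom[OF K] c'(1)]]
      loop_eqI[OF K h(3) comp_hom[OF mface_hom[OF K] c'(1)]] d by simp_all
  then show ?thesis using K c'(1) by (auto simp: tri_def)
qed

lemma tri_post:
  assumes "tri K E x y z" "p \<in> Hom E B"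
  shows "tri K B (p \<cdot> x) (p \<cdot> y) (p \<cdot> z)"
proof -
  obtain c where K: "K \<in> Ob M" and c: "c \<in> Hom (S2 K) E" "x = c \<cdot> mface 0 K" "y = c \<cdot> mface (Suc 0) K" "z = c \<cdot> mface (Suc (Suc 0)) K"
    using assms(1) by (auto simp: tri_def)
  show ?thesis using K comp_hom[OF c(1) assms(2)] assoc[OF mface_hom[OF K] c(1) assms(2)] c
    unfolding tri_def by (auto intro!: bexI[of _ "p \<cdot> c"])
qed

lemma tri_pre:
  assumes "tri K B x y z" and f: "f \<in> Hom L K"
  shows "tri L B (x \<cdot> S1m f) (y \<cdot> S1m f) (z \<cdot> S1m f)"
proof -
  obtain c where K: "K \<in> Ob M" and c: "c \<in> Hom (S2 K) B" "x = c \<cdot> mface 0 K" "y = c \<cdot> mface (Suc 0) K" "z = c \<cdot> mface (Suc (Suc 0)) K"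
    using assms(1) by (auto simp: tri_def)
  have L: "L \<in> Ob M" using f by (rule hom_Dom)
  note f2 = smash_map_hom[OF pointed_mod f, of "Suc (Suc 0)"]
  have "(c \<cdot> mface j K) \<cdot> S1m f = (c \<cdot> smash_map X (simplex_mod_vertices (Suc (Suc 0))) f) \<cdot> mface j L" for j
    using assoc[OF S1m_hom[OF f] mface_hom[OF K] c(1)] assoc[OF mface_hom[OF L] f2 c(1)] mface_natural[OF f] by simp
  then show ?thesis using L comp_hom[OF f2 c(1)] c unfolding tri_def by blast
qed

lemma tri_degenerate:
  assumes K: "K \<in> Ob M" and x: "x \<in> Hom (S1 K) B"
  shows "tri K B x x (Zero (S1 K) B)" "tri K B (Zero (S1 K) B) x x"
proof -
  have B: "B \<in> Ob M" using x by (rule hom_Cod)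
  obtain c c' where "triangle K B c (x \<cdot> qt (Suc 0) K) (x \<cdot> qt (Suc 0) K) (cst K (Zero K B))"
    "triangle K B c' (cst K (Zero K B)) (x \<cdot> qt (Suc 0) K) (x \<cdot> qt (Suc 0) K)"
    by (rule degenerate[OF loop_edge[OF K x]])
  then show "tri K B x x (Zero (S1 K) B)" "tri K B (Zero (S1 K) B) x x"
    using zero_qt[OF K B] x Zero_hom[OF S1_Ob[OF K] B] by (auto intro: triangle_tri)
qed

section \<open>Products of loops: existence, inverses, associativity and independence of
  representatives\<close>

lemma tri_exists:
  assumes B: "fibrant B" and K: "K \<in> Ob M" and x: "x \<in> Hom (S1 K) B" and z: "z \<in> Hom (S1 K) B"
  obtains y where "tri K B x y z"
proof -
  obtain c y' where c: "triangle K B c (x \<cdot> qt (Suc 0) K) y' (z \<cdot> qt (Suc 0) K)" and y': "edge K B y' (Zero K B) (Zero K B)"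
    by (rule fill_inner[OF B loop_edge[OF K x] loop_edge[OF K z]])
  obtain y where y: "y \<in> Hom (S1 K) B" "y \<cdot> qt (Suc 0) K = y'" by (rule edge_loop[OF y'])
  show ?thesis by (rule that[of y], rule triangle_tri) (use c x y z in auto)
qed

text \<open>A left inverse from an outer horn: the side from 0 to 2 is the zero loop, the side from
  0 to 1 is \<open>z\<close>, and the filler supplies the remaining side.\<close>

lemma tri_inverse:
  assumes B: "fibrant B" and K: "K \<in> Ob M" and z: "z \<in> Hom (S1 K) B"
  obtains x where "tri K B x (Zero (S1 K) B) z"
proof -
  have Bo: "B \<in> Ob M" using B by (rule fibrant_Ob)
  have o: "Zero (S1 K) B \<in> Hom (S1 K) B" by (rule Zero_hom[OF S1_Ob[OF K] Bo])
  obtain c x' where c: "triangle K B c x' (Zero (S1 K) B \<cdot> qt (Suc 0) K) (z \<cdot> qt (Suc 0) K)" and x': "edge K B x' (Zero K B) (Zero K B)"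
    by (rule fill_outer[OF B loop_edge[OF K o] loop_edge[OF K z]])
  obtain x where x: "x \<in> Hom (S1 K) B" "x \<cdot> qt (Suc 0) K = x'" by (rule edge_loop[OF x'])
  show ?thesis by (rule that[of x], rule triangle_tri) (use c x o z in auto)
qed

text \<open>In \<open>eij\<close> the digits name the vertices of a tetrahedron. The hypotheses are
  its faces 3, 0 and 1; filling the horn with missing face 2 gives the conclusion, which says that
  the two bracketings of the product of \<open>e23\<close>, \<open>e12\<close> and
  \<open>e01\<close> agree in \<open>e03\<close>.\<close>

lemma tri_assoc:
  assumes B: "fibrant B" and 3: "tri K B e12 e02 e01" and 0: "tri K B e23 e13 e12" and 1: "tri K B e23 e03 e02"
  shows "tri K B e13 e03 e01"
proof -
  have K: "K \<in> Ob M" using 3 by (simp add: tri_def)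
  obtain c3 where c3: "triangle K B c3 (e12 \<cdot> qt (Suc 0) K) (e02 \<cdot> qt (Suc 0) K) (e01 \<cdot> qt (Suc 0) K)" by (rule tri_triangle[OF 3])
  obtain c0 where c0: "triangle K B c0 (e23 \<cdot> qt (Suc 0) K) (e13 \<cdot> qt (Suc 0) K) (e12 \<cdot> qt (Suc 0) K)" by (rule tri_triangle[OF 0])
  obtain c1 where c1: "triangle K B c1 (e23 \<cdot> qt (Suc 0) K) (e03 \<cdot> qt (Suc 0) K) (e02 \<cdot> qt (Suc 0) K)" by (rule tri_triangle[OF 1])
  have p: "Zero B point \<in> Fb" "Zero B point \<in> Hom B point" using B by (auto simp: fibrant_def)
  let ?n = "Suc (Suc (Suc 0))"
  have T: "smash (simplex_plus ?n) K \<in> Ob M" using K by simp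
  define x where "x j = (if j = 0 then c0 else if j = Suc 0 then c1 else c3)" for j :: nat
  have xh: "x j \<in> Hom (smash (simplex_plus (Suc (Suc 0))) K) B" for j
    using c0 c1 c3 by (simp add: x_def triangle_def)
  obtain z where z: "z \<in> Hom (smash (simplex_plus ?n) K) B"
    and zd: "\<And>j. j \<le> ?n \<Longrightarrow> j \<noteq> Suc (Suc 0) \<Longrightarrow> z \<cdot> dface (Suc (Suc 0)) j K = x j"
  proof (rule horn[OF p K, of "Suc (Suc 0)" "Suc (Suc 0)" "Zero (smash (simplex_plus ?n) K) point" x])
    show "Zero (smash (simplex_plus ?n) K) point \<in> Hom (smash (simplex_plus ?n) K) point" by (rule Zero_hom[OF T point_Ob])
    fix j
    show "x j \<in> Hom (smash (simplex_plus (Suc (Suc 0))) K) B \<and> Zero B point \<cdot> x j = Zero (smash (simplex_plus ?n) K) point \<cdot> dface (Suc (Suc 0)) j K"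
      using xh zero_comp[OF xh point_Ob] zero_comp[OF dface_hom[OF K] point_Ob] by simp
  next
    fix i j m :: nat assume a: "Suc (Suc 0) = Suc m" "i < j" "j \<le> ?n" "i \<noteq> Suc (Suc 0)" "j \<noteq> Suc (Suc 0)"
    then have m: "m = Suc 0" by simp
    consider "i = 0" "j = Suc 0" | "i = 0" "j = ?n" | "i = Suc 0" "j = ?n"
      using a by (auto simp: le_Suc_eq less_Suc_eq)
    then show "x j \<cdot> dface m i K = x i \<cdot> dface m (j - 1) K"
      by cases (use c0 c1 c3 in \<open>simp_all add: x_def m triangle_def\<close>)
  qed auto
  define c where "c = z \<cdot> dface (Suc (Suc 0)) (Suc (Suc 0)) K"
  have zc: "c \<cdot> dface (Suc 0) i K = (z \<cdot> dface (Suc (Suc 0)) k K) \<cdot> dface (Suc 0) l K"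
    if "dface (Suc (Suc 0)) (Suc (Suc 0)) K \<cdot> dface (Suc 0) i K = dface (Suc (Suc 0)) k K \<cdot> dface (Suc 0) l K" for i k l
    unfolding c_def using assoc[OF dface_hom[OF K] dface_hom[OF K] z, symmetric] that by simp
  have cd: "c \<cdot> dface (Suc 0) i K = x i \<cdot> dface (Suc 0) (Suc 0) K" if "i < Suc (Suc 0)" for i
    using zc[of i i "Suc 0"] dface_dface[OF that K, of "Suc 0"] zd[of i] that by simp
  have "c \<cdot> dface (Suc 0) (Suc (Suc 0)) K = x ?n \<cdot> dface (Suc 0) (Suc (Suc 0)) K"
    using zc[of "Suc (Suc 0)" ?n "Suc (Suc 0)"] dface_dface[of "Suc (Suc 0)" ?n K "Suc 0", OF _ K] zd[of ?n] by simp
  then have "triangle K B c (e13 \<cdot> qt (Suc 0) K) (e03 \<cdot> qt (Suc 0) K) (e01 \<cdot> qt (Suc 0) K)"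
    using cd[of 0] cd[of "Suc 0"] c0 c1 c3 K comp_hom[OF dface_hom[OF K] z] by (simp add: triangle_def x_def c_def)
  then show ?thesis by (rule triangle_tri) (use triD[OF 3] triD[OF 0] triD[OF 1] in auto)
qed

text \<open>Homotopies of \<open>x\<close> with \<open>x'\<close> and of \<open>z\<close> with
  \<open>z'\<close> are loops in the path object \<open>P\<close>. They lie over two sides of the
  triangle in \<open>Q\<close> formed by the two given triangles; filling the horn along
  \<open>q\<close> gives a third loop in \<open>P\<close>, a homotopy of \<open>y\<close> with
  \<open>y'\<close>.\<close>

lemma tri_unique:
  assumes B: "fibrant B" and t: "tri K B x y z" "tri K B x' y' z'" and h: "ho x = ho x'" "ho z = ho z'"
  shows "ho y = ho y'"
proof -
  note d = triD[OF t(1)] and d' = triD[OF t(2)] and K = triD(1)[OF t(1)]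
  obtain P Q q s \<pi>0 \<pi>1 dd where P: "path_object B P Q q s \<pi>0 \<pi>1 dd" by (rule path_object_exists[OF B])
  have q: "q \<in> Fb" "q \<in> Hom P Q" and \<pi>: "\<pi>0 \<in> Hom Q B" "\<pi>1 \<in> Hom Q B"
    and U: "\<And>A u v. u \<in> Hom A B \<Longrightarrow> v \<in> Hom A B \<Longrightarrow> \<exists>!w. w \<in> Hom A Q \<and> \<pi>0 \<cdot> w = u \<and> \<pi>1 \<cdot> w = v"
    using P by (auto simp: path_object_def)
  note e0 = comp_hom[OF q(2) \<pi>(1)] and e1 = comp_hom[OF q(2) \<pi>(2)]
  have "sh (S1 K) B x x'" using h(1) ho_eq_iff[OF B d(2) d'(2)] by simp
  then obtain kx where kx: "kx \<in> Hom (S1 K) P" "(\<pi>0 \<cdot> q) \<cdot> kx = x" "(\<pi>1 \<cdot> q) \<cdot> kx = x'"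
    by (rule sh_right_homotopy[OF P])
  have "sh (S1 K) B z z'" using h(2) ho_eq_iff[OF B d(4) d'(4)] by simp
  then obtain kz where kz: "kz \<in> Hom (S1 K) P" "(\<pi>0 \<cdot> q) \<cdot> kz = z" "(\<pi>1 \<cdot> q) \<cdot> kz = z'"
    by (rule sh_right_homotopy[OF P])
  obtain c where c: "triangle K B c (x \<cdot> qt (Suc 0) K) (y \<cdot> qt (Suc 0) K) (z \<cdot> qt (Suc 0) K)" by (rule tri_triangle[OF t(1)])
  obtain c' where c': "triangle K B c' (x' \<cdot> qt (Suc 0) K) (y' \<cdot> qt (Suc 0) K) (z' \<cdot> qt (Suc 0) K)" by (rule tri_triangle[OF t(2)])
  have ch: "c \<in> Hom (smash (simplex_plus (Suc (Suc 0))) K) B" "c' \<in> Hom (smash (simplex_plus (Suc (Suc 0))) K) B"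
    using c c' by (simp_all add: triangle_def)
  obtain w where w: "w \<in> Hom (smash (simplex_plus (Suc (Suc 0))) K) Q" "\<pi>0 \<cdot> w = c" "\<pi>1 \<cdot> w = c'" using U[OF ch] by blast
  \<comment> \<open>Maps into the product \<open>Q\<close> are compared by their two
    coordinates.\<close>
  have face: "q \<cdot> (k \<cdot> qt (Suc 0) K) = w \<cdot> dface (Suc 0) j K"
    if k: "k \<in> Hom (S1 K) P" and k0: "((\<pi>0 \<cdot> q) \<cdot> k) \<cdot> qt (Suc 0) K = c \<cdot> dface (Suc 0) j K"
      and k1: "((\<pi>1 \<cdot> q) \<cdot> k) \<cdot> qt (Suc 0) K = c' \<cdot> dface (Suc 0) j K" for k j
  proof -
    note kq = loop_hom[OF K k]
    note h1 = comp_hom[OF kq q(2)] and h2 = comp_hom[OF dface_hom[OF K] w(1)]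
    have e: "\<pi>0 \<cdot> (w \<cdot> dface (Suc 0) j K) = \<pi>0 \<cdot> (q \<cdot> (k \<cdot> qt (Suc 0) K))" "\<pi>1 \<cdot> (w \<cdot> dface (Suc 0) j K) = \<pi>1 \<cdot> (q \<cdot> (k \<cdot> qt (Suc 0) K))"
      using assoc[OF kq q(2) \<pi>(1)] assoc[OF kq q(2) \<pi>(2)] comp_qt[OF K k e0] comp_qt[OF K k e1] k0 k1
        assoc[OF dface_hom[OF K] w(1) \<pi>(1)] assoc[OF dface_hom[OF K] w(1) \<pi>(2)] w(2,3) by simp_all
    show ?thesis
      by (rule ex1_unique[OF U[OF comp_hom[OF h1 \<pi>(1)] comp_hom[OF h1 \<pi>(2)]]]) (use h1 h2 e in auto)
  qed
  have tw: "triangle K Q w (q \<cdot> (kx \<cdot> qt (Suc 0) K)) (w \<cdot> dface (Suc 0) (Suc 0) K) (q \<cdot> (kz \<cdot> qt (Suc 0) K))"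
    using face[OF kx(1), of 0] face[OF kz(1), of "Suc (Suc 0)"] kx kz c c' w K by (simp add: triangle_def)
  obtain cc yy where cc: "triangle K P cc (kx \<cdot> qt (Suc 0) K) yy (kz \<cdot> qt (Suc 0) K)" and yy: "edge K P yy (Zero K P) (Zero K P)"
    and qq: "q \<cdot> yy = w \<cdot> dface (Suc 0) (Suc 0) K"
    by (rule horn_inner[OF q tw loop_edge[OF K kx(1)] refl loop_edge[OF K kz(1)] refl])
  obtain ky where ky: "ky \<in> Hom (S1 K) P" "ky \<cdot> qt (Suc 0) K = yy" by (rule edge_loop[OF yy])
  note yq = loop_hom[OF K ky(1)]
  have "(\<pi>0 \<cdot> q) \<cdot> ky = y" "(\<pi>1 \<cdot> q) \<cdot> ky = y'"
    using loop_eqI[OF K comp_hom[OF ky(1) e0] d(3)] loop_eqI[OF K comp_hom[OF ky(1) e1] d'(3)]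
      comp_qt[OF K ky(1) e0] comp_qt[OF K ky(1) e1] assoc[OF yq q(2) \<pi>(1)] assoc[OF yq q(2) \<pi>(2)] ky(2) qq
      assoc[OF dface_hom[OF K] w(1) \<pi>(1)] assoc[OF dface_hom[OF K] w(1) \<pi>(2)] w(2,3) c c' by (simp_all add: triangle_def)
  then show ?thesis using sh_ho[OF right_homotopy_sh[OF P ky(1)]] by simp
qed

text \<open>A homotopy between maps on \<open>S1 K\<close> is turned into a triangle in the mapping
  space of \<open>K\<close>, with a constant side. \<open>lifted_unique\<close> needs this form,
  since there the horns are lifted along \<open>p\<close>.\<close>

lemma tri_strict:
  assumes B: "fibrant B" and K: "K \<in> Ob M" and x: "x \<in> Hom (S1 K) B" "x' \<in> Hom (S1 K) B" and h: "ho x = ho x'"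
  obtains c where "triangle K B c (cst K (Zero K B)) (x' \<cdot> qt (Suc 0) K) (x \<cdot> qt (Suc 0) K)"
proof -
  have Bo: "B \<in> Ob M" using B by (rule fibrant_Ob)
  obtain P Q q s \<pi>0 \<pi>1 dd where P: "path_object B P Q q s \<pi>0 \<pi>1 dd" by (rule path_object_exists[OF B])
  have q: "q \<in> Hom P Q" and \<pi>: "\<pi>0 \<in> Hom Q B" "\<pi>1 \<in> Hom Q B" and s: "s \<in> Hom B P"
    and es: "(\<pi>0 \<cdot> q) \<cdot> s = Idn M B" "(\<pi>1 \<cdot> q) \<cdot> s = Idn M B" and e0W: "\<pi>0 \<cdot> q \<in> Fb" "\<pi>0 \<cdot> q \<in> W"
    using P by (auto simp: path_object_def)
  have Po: "P \<in> Ob M" using q by (rule hom_Dom)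
  note e0 = comp_hom[OF q \<pi>(1)] and e1 = comp_hom[OF q \<pi>(2)]
  have "sh (S1 K) B x x'" using h ho_eq_iff[OF B x] by simp
  then obtain k where k: "k \<in> Hom (S1 K) P" "(\<pi>0 \<cdot> q) \<cdot> k = x" "(\<pi>1 \<cdot> q) \<cdot> k = x'" by (rule sh_right_homotopy[OF P])
  have sx: "s \<cdot> x \<in> Hom (S1 K) P" "(\<pi>0 \<cdot> q) \<cdot> (s \<cdot> x) = x" "(\<pi>1 \<cdot> q) \<cdot> (s \<cdot> x) = x"
    using comp_hom[OF x(1) s] assoc[OF x(1) s e0] assoc[OF x(1) s e1] es Idn_comp[OF x(1)] by simp_all
  define o' where "o' = Zero (S1 K) P"
  have o': "o' \<in> Hom (S1 K) P" "(\<pi>0 \<cdot> q) \<cdot> o' = Zero (S1 K) B" "(\<pi>1 \<cdot> q) \<cdot> o' = Zero (S1 K) B"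
    unfolding o'_def using Zero_hom[OF S1_Ob[OF K] Po] comp_zero[OF e0 S1_Ob[OF K]] comp_zero[OF e1 S1_Ob[OF K]] by auto
  \<comment> \<open>Three loops in \<open>P\<close> that \<open>\<pi>0 \<cdot> q\<close> sends to
    the boundary \<open>(0, x, x)\<close> of a degenerate triangle, so they bound a triangle in
    \<open>P\<close>. Its image under \<open>\<pi>1 \<cdot> q\<close> has the boundary
    \<open>(0, x', x)\<close>.\<close>
  define l where "l j = (if j = 0 then o' else if j = Suc 0 then k else s \<cdot> x)" for j :: nat
  have lh: "l j \<in> Hom (S1 K) P" for j using k(1) sx(1) o'(1) by (simp add: l_def)
  obtain c1 c0 where c0: "triangle K B c0 (cst K (Zero K B)) (x \<cdot> qt (Suc 0) K) (x \<cdot> qt (Suc 0) K)"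
    by (rule degenerate[OF loop_edge[OF K x(1)]])
  have c0h: "c0 \<in> Hom (smash (simplex_plus (Suc (Suc 0))) K) B" using c0 by (simp add: triangle_def)
  obtain z where z: "z \<in> Hom (smash (simplex_plus (Suc (Suc 0))) K) P" "(\<pi>0 \<cdot> q) \<cdot> z = c0"
    and zd: "\<And>j. j \<le> Suc (Suc 0) \<Longrightarrow> z \<cdot> dface (Suc 0) j K = l j \<cdot> qt (Suc 0) K"
  proof (rule boundary_fill[OF e0W e0 K c0h, of "\<lambda>j. l j \<cdot> qt (Suc 0) K"])
    fix j assume "j \<le> Suc (Suc 0)"
    then consider "j = 0" | "j = Suc 0" | "j = Suc (Suc 0)" by (auto simp: le_Suc_eq)
    then show "l j \<cdot> qt (Suc 0) K \<in> Hom (cyl K) P \<and> (\<pi>0 \<cdot> q) \<cdot> (l j \<cdot> qt (Suc 0) K) = c0 \<cdot> dface (Suc 0) j K"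
      by cases (use loop_hom[OF K k(1)] loop_hom[OF K sx(1)] loop_hom[OF K o'(1)] comp_qt[OF K k(1) e0] comp_qt[OF K sx(1) e0]
        comp_qt[OF K o'(1) e0] k(2) sx(2) o'(2) c0 zero_qt[OF K Bo] in \<open>simp_all add: l_def triangle_def\<close>)
  next
    fix i j m :: nat assume "Suc 0 = Suc m"
    then have m: "m = 0" by simp
    have "(l j \<cdot> qt (Suc 0) K) \<cdot> vtx (Suc 0) (coface i 0) K = Zero K P" for i j
      using edgeD(6,7)[OF loop_edge[OF K lh]] by (simp add: coface_def)
    then show "(l j \<cdot> qt (Suc 0) K) \<cdot> dface m i K = (l i \<cdot> qt (Suc 0) K) \<cdot> dface m (j - 1) K"
      unfolding m by (intro edge_faces_eq[OF K loop_hom[OF K lh] loop_hom[OF K lh]]) simp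
  qed auto
  have "triangle K P z (l 0 \<cdot> qt (Suc 0) K) (l (Suc 0) \<cdot> qt (Suc 0) K) (l (Suc (Suc 0)) \<cdot> qt (Suc 0) K)"
    using K z(1) zd by (simp add: triangle_def)
  from triangle_post[OF this e1] show ?thesis
    by (intro that[of "(\<pi>1 \<cdot> q) \<cdot> z"])
      (use comp_qt[OF K k(1) e1] comp_qt[OF K sx(1) e1] comp_qt[OF K o'(1) e1] k sx o' zero_qt[OF K Bo] in \<open>simp add: l_def\<close>)
qed

section \<open>The group of homotopy classes of loops\<close>

definition gmult :: "('a, 'b) pspsh \<Rightarrow> ('a, 'b) pspsh \<Rightarrow> ('a, 'b) harr \<Rightarrow> ('a, 'b) harr \<Rightarrow> ('a, 'b) harr" where
  "gmult K B a b = (THE x. \<exists>c\<in>homset H (S2 K) B.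
     Cmp H c (ho (mface 0 K)) = a \<and> Cmp H c (ho (mface (Suc (Suc 0)) K)) = b \<and> Cmp H c (ho (mface (Suc 0) K)) = x)"

text \<open>As \<open>B\<close> is fibrant, any witness in the homotopy category is the class of a
  presheaf map on \<open>S2 K\<close>, hence a triangle of loops; \<open>tri_unique\<close> then
  makes the description in \<open>gmult\<close> definite.\<close>

lemma gmult_tri:
  assumes B: "fibrant B" and t: "tri K B x y z"
  shows "gmult K B (ho x) (ho z) = ho y"
proof -
  obtain c where K: "K \<in> Ob M" and c: "c \<in> Hom (S2 K) B" "x = c \<cdot> mface 0 K" "y = c \<cdot> mface (Suc 0) K" "z = c \<cdot> mface (Suc (Suc 0)) K"
    using t by (auto simp: tri_def)
  have cm: "Cmp H (ho c) (ho (mface j K)) = ho (c \<cdot> mface j K)" if "c \<in> Hom (S2 K) B" for c j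
    by (rule loc.q_comp[OF mface_hom[OF K] that])
  show ?thesis
    unfolding gmult_def
  proof (rule the_equality)
    show "\<exists>c\<in>homset H (S2 K) B. Cmp H c (ho (mface 0 K)) = ho x \<and> Cmp H c (ho (mface (Suc (Suc 0)) K)) = ho z \<and> Cmp H c (ho (mface (Suc 0) K)) = ho y"
      using loc.q_hom[OF c(1)] cm[OF c(1)] c(2-4) by auto
  next
    fix u assume "\<exists>c\<in>homset H (S2 K) B. Cmp H c (ho (mface 0 K)) = ho x \<and> Cmp H c (ho (mface (Suc (Suc 0)) K)) = ho z \<and> Cmp H c (ho (mface (Suc 0) K)) = u"
    then obtain \<gamma> where \<gamma>: "\<gamma> \<in> homset H (S2 K) B" "Cmp H \<gamma> (ho (mface 0 K)) = ho x" "Cmp H \<gamma> (ho (mface (Suc (Suc 0)) K)) = ho z" "Cmp H \<gamma> (ho (mface (Suc 0) K)) = u"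
      by blast
    obtain g where g: "g \<in> Hom (S2 K) B" "\<gamma> = ho g" by (rule ho_surj[OF B \<gamma>(1)])
    have "tri K B (g \<cdot> mface 0 K) (g \<cdot> mface (Suc 0) K) (g \<cdot> mface (Suc (Suc 0)) K)" using K g(1) by (auto simp: tri_def)
    from tri_unique[OF B this t] show "u = ho y" using \<gamma> cm[OF g(1)] g(2) by simp
  qed
qed

lemma gmult_mem:
  assumes B: "fibrant B" and K: "K \<in> Ob M" and a: "a \<in> homset H (S1 K) B" "b \<in> homset H (S1 K) B"
  obtains x y z where "a = ho x" "b = ho z" "tri K B x y z" "gmult K B a b = ho y" "x \<in> Hom (S1 K) B" "y \<in> Hom (S1 K) B" "z \<in> Hom (S1 K) B"
proof -
  obtain x where x: "x \<in> Hom (S1 K) B" "a = ho x" by (rule ho_surj[OF B a(1)])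
  obtain z where z: "z \<in> Hom (S1 K) B" "b = ho z" by (rule ho_surj[OF B a(2)])
  obtain y where y: "tri K B x y z" by (rule tri_exists[OF B K x(1) z(1)])
  show ?thesis by (rule that[OF x(2) z(2) y]) (use gmult_tri[OF B y] x z triD[OF y] in simp_all)
qed

text \<open>The operations of \<open>G\<close> enter as equations, so that the lemma applies to the
  record \<open>Hgrp\<close> in every positive degree, with \<open>K\<close> an iterated
  suspension.\<close>

lemma loop_group:
  assumes B: "fibrant B" and K: "K \<in> Ob M"
    and G: "carrier G = homset H (S1 K) B" "\<And>a b. a \<otimes>\<^bsub>G\<^esub> b = gmult K B a b" "\<one>\<^bsub>G\<^esub> = ho (Zero (S1 K) B)"
  shows "group G"
proof (rule groupI)
  have Bo: "B \<in> Ob M" using B by (rule fibrant_Ob)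
  have o: "Zero (S1 K) B \<in> Hom (S1 K) B" by (rule Zero_hom[OF S1_Ob[OF K] Bo])
  show "\<one>\<^bsub>G\<^esub> \<in> carrier G" unfolding G by (rule loc.q_hom[OF o])
  show "a \<otimes>\<^bsub>G\<^esub> b \<in> carrier G" if a: "a \<in> carrier G" "b \<in> carrier G" for a b
  proof -
    obtain x y z where "gmult K B a b = ho y" "y \<in> Hom (S1 K) B" by (rule gmult_mem[OF B K a[unfolded G(1)]])
    then show ?thesis using loc.q_hom by (simp add: G)
  qed
  show "\<one>\<^bsub>G\<^esub> \<otimes>\<^bsub>G\<^esub> a = a" if a: "a \<in> carrier G" for a
  proof -
    obtain x where x: "x \<in> Hom (S1 K) B" "a = ho x" by (rule ho_surj[OF B a[unfolded G(1)]])
    show ?thesis using gmult_tri[OF B tri_degenerate(2)[OF K x(1)]] by (simp add: G x(2))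
  qed
  show "\<exists>b\<in>carrier G. b \<otimes>\<^bsub>G\<^esub> a = \<one>\<^bsub>G\<^esub>" if a: "a \<in> carrier G" for a
  proof -
    obtain x where x: "x \<in> Hom (S1 K) B" "a = ho x" by (rule ho_surj[OF B a[unfolded G(1)]])
    obtain y where y: "tri K B y (Zero (S1 K) B) x" by (rule tri_inverse[OF B K x(1)])
    show ?thesis using gmult_tri[OF B y] loc.q_hom[OF triD(2)[OF y]] by (auto simp: G x(2))
  qed
  show "a \<otimes>\<^bsub>G\<^esub> b \<otimes>\<^bsub>G\<^esub> c = a \<otimes>\<^bsub>G\<^esub> (b \<otimes>\<^bsub>G\<^esub> c)" if a: "a \<in> carrier G" "b \<in> carrier G" "c \<in> carrier G" for a b c
  proof -
    obtain x where x: "x \<in> Hom (S1 K) B" "a = ho x" by (rule ho_surj[OF B a(1)[unfolded G(1)]])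
    obtain y where y: "y \<in> Hom (S1 K) B" "b = ho y" by (rule ho_surj[OF B a(2)[unfolded G(1)]])
    obtain z where z: "z \<in> Hom (S1 K) B" "c = ho z" by (rule ho_surj[OF B a(3)[unfolded G(1)]])
    obtain yz where yz: "tri K B y yz z" by (rule tri_exists[OF B K y(1) z(1)])
    obtain xy where xy: "tri K B x xy y" by (rule tri_exists[OF B K x(1) y(1)])
    obtain w where w: "tri K B x w yz" by (rule tri_exists[OF B K x(1) triD(3)[OF yz]])
    show ?thesis using gmult_tri[OF B yz] gmult_tri[OF B xy] gmult_tri[OF B w] gmult_tri[OF B tri_assoc[OF B yz xy w]]
      by (simp add: G x(2) y(2) z(2))
  qed
qed

lemma gmult_post:
  assumes E: "fibrant E" and B: "fibrant B" and K: "K \<in> Ob M" and p: "p \<in> Hom E B"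
    and a: "a \<in> homset H (S1 K) E" "b \<in> homset H (S1 K) E"
  shows "Cmp H (ho p) (gmult K E a b) = gmult K B (Cmp H (ho p) a) (Cmp H (ho p) b)"
proof -
  obtain x y z where t: "a = ho x" "b = ho z" "tri K E x y z" "gmult K E a b = ho y" "x \<in> Hom (S1 K) E" "y \<in> Hom (S1 K) E" "z \<in> Hom (S1 K) E"
    by (rule gmult_mem[OF E K a])
  show ?thesis using gmult_tri[OF B tri_post[OF t(3) p]] loc.q_comp[OF t(5) p] loc.q_comp[OF t(6) p] loc.q_comp[OF t(7) p] t by simp
qed

end

lemma (in presheaf_model) edge_ho: "edge K B x a b \<Longrightarrow> ho a = ho b"
  by (rule sh_ho) (auto simp: sh_def)

lemma (in presheaf_model) ho_inverse:
  assumes "w \<in> W" "w \<in> Hom A D"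
  obtains v where "v \<in> homset H D A" "Cmp H v (ho w) = ho (Idn M A)" "Cmp H (ho w) v = ho (Idn M D)"
  using loc.W_inverse[OF assms] by (elim exE conjE)

section \<open>The action on the fibre\<close>

locale presheaf_fibration = presheaf_model X W for X :: "('a, 'a) rspace" and W :: "('a, 'b) parr set" +
  fixes p :: "('a, 'b) parr" and E B :: "('a, 'b) pspsh"
  assumes p_Fb: "p \<in> Fb" and p_hom: "p \<in> Hom E B" and B: "fibrant B"
begin

abbreviation "F \<equiv> fibre p"
abbreviation "i \<equiv> fibre_incl X p"

lemma E: "fibrant E" and F: "fibrant F"
  by (rule fibrant_total[OF p_Fb p_hom B], rule fibrant_fibre[OF p_Fb p_hom])

lemma EBF_Ob: "E \<in> Ob M" "B \<in> Ob M" "F \<in> Ob M"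
  by (rule fibrant_Ob[OF E], rule fibrant_Ob[OF B], rule fibrant_Ob[OF F])

lemma i_hom: "i \<in> Hom F E"
  by (rule fibre_incl_hom[OF p_hom])

lemma p_i: "d \<in> Hom K F \<Longrightarrow> p \<cdot> (i \<cdot> d) = Zero K B"
  using assoc[OF _ i_hom p_hom] fibre_incl_comp[OF p_hom] zero_comp[OF _ EBF_Ob(2)] by simp

lemma into_fibre:
  assumes "x \<in> Hom K E" "p \<cdot> x = Zero K B"
  obtains d where "d \<in> Hom K F" "i \<cdot> d = x"
  by (rule factor_fibre[OF p_hom assms])

lemma i_cancel: "d \<in> Hom K F \<Longrightarrow> e \<in> Hom K F \<Longrightarrow> i \<cdot> d = i \<cdot> e \<Longrightarrow> d = e"
  by (rule fibre_incl_cancel[OF p_hom])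

lemma i_zero: "K \<in> Ob M \<Longrightarrow> i \<cdot> Zero K F = Zero K E"
  by (rule comp_zero[OF i_hom])

text \<open>A homotopy in \<open>E\<close> over the constant homotopy at zero factors through the
  fibre, and its ends are identified there because the inclusion is a monomorphism.\<close>

lemma edge_into_fibre:
  assumes l: "edge K E l (i \<cdot> d) (i \<cdot> e)" and pl: "p \<cdot> l = cst K (Zero K B)" and d: "d \<in> Hom K F" "e \<in> Hom K F"
  obtains n where "edge K F n d e"
proof -
  note a = edgeD[OF l]
  have "cst K (Zero K B) = Zero (cyl K) B" unfolding cst_def by (rule zero_comp[OF proj_hom[OF a(1)] EBF_Ob(2)])
  then have "p \<cdot> l = Zero (cyl K) B" using pl by simp
  then obtain n where n: "n \<in> Hom (cyl K) F" "i \<cdot> n = l" by (rule into_fibre[OF a(3)])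
  have v: "vtx (Suc 0) w K \<in> Hom K (cyl K)" if "w \<le> Suc 0" for w by (rule vtx_hom[OF that a(1)])
  have "n \<cdot> vtx (Suc 0) 0 K = d" "n \<cdot> vtx (Suc 0) (Suc 0) K = e"
    using i_cancel[OF comp_hom[OF v n(1)] d(1), of 0] i_cancel[OF comp_hom[OF v n(1)] d(2), of "Suc 0"]
      assoc[OF v n(1) i_hom, of 0] assoc[OF v n(1) i_hom, of "Suc 0"] n(2) a by simp_all
  then show ?thesis using that[of n] n(1) a(1) by (simp add: edge_def)
qed

text \<open>\<open>lifted K x d e\<close>: lifting the loop \<open>x\<close> to \<open>E\<close> from \<open>d\<close> one ends in \<open>e\<close>.\<close>

definition lifted :: "('a, 'b) pspsh \<Rightarrow> ('a, 'b) parr \<Rightarrow> ('a, 'b) parr \<Rightarrow> ('a, 'b) parr \<Rightarrow> bool" where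
  "lifted K x d e \<longleftrightarrow> x \<in> Hom (S1 K) B \<and> d \<in> Hom K F \<and> e \<in> Hom K F \<and>
     (\<exists>l. edge K E l (i \<cdot> d) (i \<cdot> e) \<and> p \<cdot> l = x \<cdot> qt (Suc 0) K)"

lemma lifted_exists:
  assumes x: "x \<in> Hom (S1 K) B" and d: "d \<in> Hom K F"
  obtains e where "lifted K x d e"
proof -
  have K: "K \<in> Ob M" using d by (rule hom_Dom)
  note xe = loop_edge[OF K x]
  have id: "i \<cdot> d \<in> Hom K E" by (rule comp_hom[OF d i_hom])
  have "edge K B (x \<cdot> qt (Suc 0) K) (p \<cdot> (i \<cdot> d)) (Zero K B)" using xe p_i[OF d] by simp
  then obtain l where l: "edge K E l (i \<cdot> d) (l \<cdot> vtx (Suc 0) (Suc 0) K)" "p \<cdot> l = x \<cdot> qt (Suc 0) K"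
    by (rule lift_edge[OF p_Fb p_hom _ id])
  have "p \<cdot> (l \<cdot> vtx (Suc 0) (Suc 0) K) = Zero K B"
    using edgeD[OF edge_post[OF l(1) p_hom]] edgeD[OF xe] l(2) by simp
  then obtain e where "e \<in> Hom K F" "i \<cdot> e = l \<cdot> vtx (Suc 0) (Suc 0) K" by (rule into_fibre[OF edgeD(5)[OF l(1)]])
  then show ?thesis using that[of e] l x d by (auto simp: lifted_def)
qed

text \<open>A homotopy from \<open>d\<close> to \<open>d'\<close> in the fibre followed by
  \<open>l'\<close> gives a lift \<open>l''\<close> of \<open>x'\<close> that starts at
  \<open>d\<close>. The triangle from \<open>tri_strict\<close> then compares \<open>l''\<close>
  with \<open>l\<close>: dividing along it leaves a homotopy from \<open>e\<close> to
  \<open>e'\<close> over a constant side, so inside the fibre.\<close>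

lemma lifted_unique:
  assumes a: "lifted K x d e" and a': "lifted K x' d' e'" and h: "ho x = ho x'" "ho d = ho d'"
  shows "ho e = ho e'"
proof -
  have x: "x \<in> Hom (S1 K) B" "x' \<in> Hom (S1 K) B" and d: "d \<in> Hom K F" "d' \<in> Hom K F" and e: "e \<in> Hom K F" "e' \<in> Hom K F"
    using a a' by (auto simp: lifted_def)
  have K: "K \<in> Ob M" using d(1) by (rule hom_Dom)
  obtain l where l: "edge K E l (i \<cdot> d) (i \<cdot> e)" "p \<cdot> l = x \<cdot> qt (Suc 0) K" using a by (auto simp: lifted_def)
  obtain l' where l': "edge K E l' (i \<cdot> d') (i \<cdot> e')" "p \<cdot> l' = x' \<cdot> qt (Suc 0) K" using a' by (auto simp: lifted_def)
  obtain m where m: "edge K F m d d'" using h(2) ho_eq_iff[OF F d] by (auto simp: sh_def)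
  note im = edge_post[OF m i_hom]
  have pim: "p \<cdot> (i \<cdot> m) = cst K (Zero K B)"
    using p_i[OF edgeD(3)[OF m]] zero_comp[OF proj_hom[OF K] EBF_Ob(2)] by (simp add: cst_def)
  obtain c c1 where c: "triangle K B c (x' \<cdot> qt (Suc 0) K) (x' \<cdot> qt (Suc 0) K) (cst K (Zero K B))"
    by (rule degenerate[OF loop_edge[OF K x(2)]])
  obtain c2 l'' where l'': "edge K E l'' (i \<cdot> d) (i \<cdot> e')" "p \<cdot> l'' = x' \<cdot> qt (Suc 0) K"
    by (rule horn_inner[OF p_Fb p_hom c l' im pim])
  obtain c3 where c3: "triangle K B c3 (cst K (Zero K B)) (x' \<cdot> qt (Suc 0) K) (x \<cdot> qt (Suc 0) K)"
    by (rule tri_strict[OF B K x h(1)])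
  obtain c4 n where n: "edge K E n (i \<cdot> e) (i \<cdot> e')" "p \<cdot> n = cst K (Zero K B)"
    by (rule horn_outer[OF p_Fb p_hom c3 l'' l])
  obtain n' where "edge K F n' e e'" by (rule edge_into_fibre[OF n e])
  then show ?thesis by (rule edge_ho)
qed

lemma lifted_pre:
  assumes a: "lifted K x d e" and f: "f \<in> Hom L K"
  shows "lifted L (x \<cdot> S1m f) (d \<cdot> f) (e \<cdot> f)"
proof -
  have x: "x \<in> Hom (S1 K) B" and d: "d \<in> Hom K F" "e \<in> Hom K F" using a by (auto simp: lifted_def)
  have KL: "K \<in> Ob M" "L \<in> Ob M" using f by (auto dest: hom_Dom hom_Cod)
  obtain l where l: "edge K E l (i \<cdot> d) (i \<cdot> e)" "p \<cdot> l = x \<cdot> qt (Suc 0) K" using a by (auto simp: lifted_def)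
  note m = smash_map_hom[OF pointed_plus f, of "Suc 0"]
  have "p \<cdot> (l \<cdot> smash_map X (simplex_plus (Suc 0)) f) = (x \<cdot> S1m f) \<cdot> qt (Suc 0) L"
    using assoc[OF m edgeD(3)[OF l(1)] p_hom] l(2) assoc[OF m qt_hom[OF KL(1)] x] assoc[OF qt_hom[OF KL(2)] S1m_hom[OF f] x] qt_natural[OF f]
    by simp
  moreover have "edge L E (l \<cdot> smash_map X (simplex_plus (Suc 0)) f) (i \<cdot> (d \<cdot> f)) (i \<cdot> (e \<cdot> f))"
    using edge_pre[OF l(1) f] assoc[OF f d(1) i_hom] assoc[OF f d(2) i_hom] by simp
  ultimately show ?thesis using comp_hom[OF S1m_hom[OF f] x] comp_hom[OF f d(1)] comp_hom[OF f d(2)] by (auto simp: lifted_def)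
qed

text \<open>Lifts compose over the triangle, first that of \<open>z\<close>, then that of
  \<open>x\<close>. With \<open>y\<close> the product of \<open>x\<close> and \<open>z\<close> this
  is the law of a left action.\<close>

lemma lifted_tri:
  assumes t: "tri K B x y z" and z: "lifted K z d e" and x: "lifted K x e e'"
  shows "lifted K y d e'"
proof -
  obtain l where l: "edge K E l (i \<cdot> d) (i \<cdot> e)" "p \<cdot> l = z \<cdot> qt (Suc 0) K" using z by (auto simp: lifted_def)
  obtain l' where l': "edge K E l' (i \<cdot> e) (i \<cdot> e')" "p \<cdot> l' = x \<cdot> qt (Suc 0) K" using x by (auto simp: lifted_def)
  obtain c where c: "triangle K B c (x \<cdot> qt (Suc 0) K) (y \<cdot> qt (Suc 0) K) (z \<cdot> qt (Suc 0) K)" by (rule tri_triangle[OF t])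
  obtain c' l'' where "edge K E l'' (i \<cdot> d) (i \<cdot> e')" "p \<cdot> l'' = y \<cdot> qt (Suc 0) K"
    by (rule horn_inner[OF p_Fb p_hom c l' l])
  then show ?thesis using triD[OF t] x z by (auto simp: lifted_def)
qed

lemma lifted_zero:
  assumes d: "d \<in> Hom K F"
  shows "lifted K (Zero (S1 K) B) d d"
proof -
  have K: "K \<in> Ob M" using d by (rule hom_Dom)
  have id: "i \<cdot> d \<in> Hom K E" by (rule comp_hom[OF d i_hom])
  have "p \<cdot> cst K (i \<cdot> d) = Zero (S1 K) B \<cdot> qt (Suc 0) K"
    using cst_post[OF id p_hom] p_i[OF d] zero_qt[OF K EBF_Ob(2)] by simp
  then show ?thesis using cst_edge[OF id] d Zero_hom[OF S1_Ob[OF K] EBF_Ob(2)] by (auto simp: lifted_def)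
qed

text \<open>A homotopy in \<open>E\<close> between two maps into the fibre projects to a loop in
  \<open>B\<close>, and it is itself a lift of that loop.\<close>

lemma same_orbit:
  assumes d: "d \<in> Hom K F" "e \<in> Hom K F"
  shows "ho (i \<cdot> d) = ho (i \<cdot> e) \<longleftrightarrow> (\<exists>x. lifted K x d e)"
proof
  have K: "K \<in> Ob M" using d(1) by (rule hom_Dom)
  assume "ho (i \<cdot> d) = ho (i \<cdot> e)"
  then obtain l where l: "edge K E l (i \<cdot> d) (i \<cdot> e)"
    using ho_eq_iff[OF E comp_hom[OF d(1) i_hom] comp_hom[OF d(2) i_hom]] by (auto simp: sh_def)
  have "edge K B (p \<cdot> l) (Zero K B) (Zero K B)" using edge_post[OF l p_hom] p_i d by simp
  then obtain x where "x \<in> Hom (S1 K) B" "x \<cdot> qt (Suc 0) K = p \<cdot> l" by (rule edge_loop)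
  then show "\<exists>x. lifted K x d e" using l d unfolding lifted_def by (metis (no_types))
next
  assume "\<exists>x. lifted K x d e"
  then show "ho (i \<cdot> d) = ho (i \<cdot> e)" by (auto simp: lifted_def dest: edge_ho)
qed

lemma lift_null:
  assumes x: "x \<in> Hom K E" and h: "ho (p \<cdot> x) = ho (Zero K B)"
  obtains d where "d \<in> Hom K F" "ho (i \<cdot> d) = ho x"
proof -
  have K: "K \<in> Ob M" using x by (rule hom_Dom)
  obtain y where y: "edge K B y (p \<cdot> x) (Zero K B)"
    using h ho_eq_iff[OF B comp_hom[OF x p_hom] Zero_hom[OF K EBF_Ob(2)]] by (auto simp: sh_def)
  obtain l where l: "edge K E l x (l \<cdot> vtx (Suc 0) (Suc 0) K)" "p \<cdot> l = y" by (rule lift_edge[OF p_Fb p_hom y x])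
  have "p \<cdot> (l \<cdot> vtx (Suc 0) (Suc 0) K) = Zero K B"
    using edgeD[OF edge_post[OF l(1) p_hom]] edgeD[OF y] l(2) by simp
  then obtain d where d: "d \<in> Hom K F" "i \<cdot> d = l \<cdot> vtx (Suc 0) (Suc 0) K" by (rule into_fibre[OF edgeD(5)[OF l(1)]])
  moreover have "ho x = ho (l \<cdot> vtx (Suc 0) (Suc 0) K)" by (rule edge_ho[OF l(1)])
  ultimately show ?thesis using that by simp
qed

text \<open>The lift of \<open>x\<close> is followed by a homotopy in the fibre from its end back to
  zero, over a degenerate triangle. The result closes up and still lies over \<open>x\<close>
  itself, so \<open>x\<close> is a strict image.\<close>

lemma lifted_null:
  assumes a: "lifted K x (Zero K F) e" and h: "ho e = ho (Zero K F)"
  obtains y where "y \<in> Hom (S1 K) E" "p \<cdot> y = x"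
proof -
  have x: "x \<in> Hom (S1 K) B" and e: "e \<in> Hom K F" using a by (auto simp: lifted_def)
  have K: "K \<in> Ob M" using e by (rule hom_Dom)
  obtain l where l: "edge K E l (Zero K E) (i \<cdot> e)" "p \<cdot> l = x \<cdot> qt (Suc 0) K" using a i_zero[OF K] by (auto simp: lifted_def)
  obtain m where m: "edge K F m e (Zero K F)" using h ho_eq_iff[OF F e Zero_hom[OF K EBF_Ob(3)]] by (auto simp: sh_def)
  have im: "edge K E (i \<cdot> m) (i \<cdot> e) (Zero K E)" using edge_post[OF m i_hom] i_zero[OF K] by simp
  have pim: "p \<cdot> (i \<cdot> m) = cst K (Zero K B)"
    using p_i[OF edgeD(3)[OF m]] zero_comp[OF proj_hom[OF K] EBF_Ob(2)] by (simp add: cst_def)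
  obtain c1 c where c: "triangle K B c (cst K (Zero K B)) (x \<cdot> qt (Suc 0) K) (x \<cdot> qt (Suc 0) K)"
    by (rule degenerate[OF loop_edge[OF K x]])
  obtain c2 y' where y': "edge K E y' (Zero K E) (Zero K E)" "p \<cdot> y' = x \<cdot> qt (Suc 0) K"
    by (rule horn_inner[OF p_Fb p_hom c im pim l])
  obtain y where y: "y \<in> Hom (S1 K) E" "y \<cdot> qt (Suc 0) K = y'" by (rule edge_loop[OF y'(1)])
  have "p \<cdot> y = x" by (rule loop_eqI[OF K comp_hom[OF y(1) p_hom] x]) (use comp_qt[OF K y(1) p_hom] y(2) y'(2) in simp)
  then show ?thesis using that y(1) by blast
qed

lemma lifted_image:
  assumes y: "y \<in> Hom (S1 K) E" and K: "K \<in> Ob M"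
  shows "lifted K (p \<cdot> y) (Zero K F) (Zero K F)"
  using loop_edge[OF K y] i_zero[OF K] comp_qt[OF K y p_hom] comp_hom[OF y p_hom] Zero_hom[OF K EBF_Ob(3)]
  by (auto simp: lifted_def)

end

section \<open>Loop objects\<close>

locale motivic_presheaves = presheaf_model X W for X :: "('a, 'a) rspace" and W :: "('a, 'b) parr set" +
  assumes W_eq: "W = motivic_weq X"
begin

lemma HoC_eq: "HoC X = H" and Ho_eq: "Ho X = ho"
  by (simp_all add: HoC_def Ho_def W_eq)

lemma Dom_smash_map: "Dom (smash_map X T f) = smash T (Dom f)" and Cod_smash_map: "Cod (smash_map X T f) = smash T (Cod f)"
  by (simp_all add: smash_map_def)

lemma circle_Ar: "f \<in> Ar M \<Longrightarrow> S1m f \<in> Ar M"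
  using S1m_hom[of f "Dom f" "Cod f"] by (simp add: in_hom)

lemma circle_W': "w \<in> W \<Longrightarrow> S1m w \<in> W"
  using circle_W[of w "Dom w" "Cod w"] W_Ar by (auto simp: in_hom)

lemma zpath_circle: "zpath M W A D p \<Longrightarrow> zpath M W (S1 A) (S1 D) (map (map_zig S1m) p)"
  by (induction rule: zpath.induct) (auto simp: circle_Ar circle_W' Dom_smash_map Cod_smash_map)

text \<open>\<open>S1m\<close> is a functor that preserves \<open>W\<close>, so it respects each
  relation of the localization. Hence \<open>Hsusp\<close> does not depend on the zigzag that
  represents a morphism.\<close>

lemma zeq_circle: "zeq M W A D p q \<Longrightarrow> zeq M W (S1 A) (S1 D) (map (map_zig S1m) p) (map (map_zig S1m) q)"
proof (induction rule: zeq.induct)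
  case (zeq_refl A B p)
  then show ?case by (intro zeq.zeq_refl zpath_circle)
next
  case (zeq_id A)
  then show ?case using zeq.zeq_id[OF S1_Ob, of A W] smash_map_Idn[OF pointed_mod zeq_id, of "Suc 0"] by simp
next
  case (zeq_comp f g)
  have "S1m g \<cdot> S1m f = S1m (g \<cdot> f)" using zeq_comp by (intro smash_map_comp[of _ _ "Dom f" "Cod f" _ "Cod g"]) (auto simp: in_hom)
  then show ?case using zeq.zeq_comp[OF circle_Ar[OF zeq_comp(1)] circle_Ar[OF zeq_comp(2)], of W] zeq_comp(3)
    by (simp add: Dom_smash_map Cod_smash_map)
next
  case (zeq_inv1 w)
  then show ?case using zeq.zeq_inv1[OF circle_W', of w M] by (simp add: Dom_smash_map Cod_smash_map)
next
  case (zeq_inv2 w)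
  then show ?case using zeq.zeq_inv2[OF circle_W', of w M] by (simp add: Dom_smash_map Cod_smash_map)
next
  case (zeq_sym A B p q)
  show ?case by (rule zeq.zeq_sym[OF zeq_sym.IH])
next
  case (zeq_trans A B p q r)
  show ?case by (rule zeq.zeq_trans[OF zeq_trans.IH])
next
  case (zeq_append A B p q D p' q')
  show ?case using zeq.zeq_append[OF zeq_append.IH] by simp
qed

lemma Hsusp_zclass:
  assumes "zpath M W A D p"
  shows "Hsusp X (zclass M W A D p) = zclass M W (S1 A) (S1 D) (map (map_zig S1m) p)"
proof -
  have "(\<exists>q. zeq M W A D p q \<and> zeq M W (S1 A) (S1 D) (map (map_zig S1m) q) r) \<longleftrightarrow> zeq M W (S1 A) (S1 D) (map (map_zig S1m) p) r" for r
    using assms by (meson zeq_circle zeq_refl zeq_sym zeq_trans)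
  then show ?thesis by (simp add: Hsusp_def zclass_def W_eq)
qed

lemma Hsusp_hom: "\<phi> \<in> homset H A D \<Longrightarrow> Hsusp X \<phi> \<in> homset H (S1 A) (S1 D)"
  by (auto simp: loc.in_hom_L Hsusp_zclass intro: zpath_circle)

lemma Hsusp_comp: "\<phi> \<in> homset H A B \<Longrightarrow> \<psi> \<in> homset H B D \<Longrightarrow> Hsusp X (Cmp H \<psi> \<phi>) = Cmp H (Hsusp X \<psi>) (Hsusp X \<phi>)"
  by (auto simp: loc.in_hom_L loc.comp_zclass Hsusp_zclass zpath_append zpath_circle)

lemma Hsusp_ho:
  assumes "f \<in> Hom A D"
  shows "Hsusp X (ho f) = ho (S1m f)"
proof -
  have "zpath M W A D [Fwd f]" using assms Cod_Ob by (auto simp: in_hom)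
  from Hsusp_zclass[OF this] show ?thesis using assms by (simp add: loc_fun_def in_hom Dom_smash_map Cod_smash_map)
qed

end

locale loop_objects = motivic_presheaves X W for X :: "('a, 'a) rspace" and W :: "('a, 'b) parr set" +
  fixes \<Omega> :: "('a, 'b) pspsh \<Rightarrow> ('a, 'b) pspsh" and \<epsilon> :: "('a, 'b) pspsh \<Rightarrow> ('a, 'b) harr"
  assumes adj: "loop_adjunction X \<Omega> \<epsilon>"
begin

text \<open>A fibrant replacement \<open>R\<close> of the loop object, to which the counit extends.\<close>

lemma loop_object:
  assumes B: "fibrant B"
  obtains R j e where "fibrant R" "j \<in> W" "j \<in> Hom (\<Omega> B) R" "e \<in> Hom (S1 R) B" "\<epsilon> B = ho (e \<cdot> S1m j)"
    "\<forall>L \<psi> k. \<psi> \<in> homset H L (\<Omega> B) \<longrightarrow> k \<in> Hom L R \<longrightarrow> ho k = Cmp H (ho j) \<psi> \<longrightarrow> adjoint_map X (\<epsilon> B) \<psi> = ho (e \<cdot> S1m k)"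
proof -
  have Bo: "B \<in> Ob M" using B by (rule fibrant_Ob)
  have O: "\<Omega> B \<in> Ob M" and eps: "\<epsilon> B \<in> homset H (S1 (\<Omega> B)) B"
    using adj Bo by (auto simp: loop_adjunction_def HoC_eq)
  obtain e0 where e0: "e0 \<in> Hom (S1 (\<Omega> B)) B" "\<epsilon> B = ho e0" by (rule ho_surj[OF B eps])
  obtain j t R where j: "j \<in> Cof" "j \<in> W" "j \<in> Hom (\<Omega> B) R" and t: "t \<in> Fb" "t \<in> Hom R point"
    by (rule factor_CW_F[OF Zero_hom[OF O point_Ob]])
  have R: "fibrant R" using t hom_point[OF t(2)] hom_Dom[OF t(2)] by (simp add: fibrant_def)
  \<comment> \<open>The extension of the counit from \<open>S1 (\<Omega> B)\<close> to
    \<open>S1 R\<close> rests on this: smashing with the circle keeps \<open>j\<close> a trivial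
    cofibration, and \<open>B\<close> is fibrant.\<close>
  have Sj: "S1m j \<in> Cof" "S1m j \<in> W" using circle_triv_cof[OF j] by simp_all
  obtain e where e: "e \<in> Hom (S1 R) B" "e \<cdot> S1m j = e0" by (rule fibrant_extend[OF B Sj S1m_hom[OF j(3)] e0(1)])
  show ?thesis
  proof (rule that[OF R j(2,3) e(1)])
    show "\<epsilon> B = ho (e \<cdot> S1m j)" using e e0 by simp
    show "\<forall>L \<psi> k. \<psi> \<in> homset H L (\<Omega> B) \<longrightarrow> k \<in> Hom L R \<longrightarrow> ho k = Cmp H (ho j) \<psi> \<longrightarrow> adjoint_map X (\<epsilon> B) \<psi> = ho (e \<cdot> S1m k)"
    proof (intro allI impI)
    fix L \<psi> k assume a: "\<psi> \<in> homset H L (\<Omega> B)" "k \<in> Hom L R" "ho k = Cmp H (ho j) \<psi>"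
    have "adjoint_map X (\<epsilon> B) \<psi> = Cmp H (Cmp H (ho e) (ho (S1m j))) (Hsusp X \<psi>)"
      using e0(2) e(2) loc.q_comp[OF S1m_hom[OF j(3)] e(1)] by (simp add: adjoint_map_def HoC_eq)
    also have "\<dots> = Cmp H (ho e) (Hsusp X (Cmp H (ho j) \<psi>))"
      using loc.assoc_L[OF Hsusp_hom[OF a(1)] loc.q_hom[OF S1m_hom[OF j(3)]] loc.q_hom[OF e(1)]]
        Hsusp_comp[OF a(1) loc.q_hom[OF j(3)]] Hsusp_ho[OF j(3)] by simp
    also have "\<dots> = ho (e \<cdot> S1m k)" using a(3)[symmetric] Hsusp_ho[OF a(2)] loc.q_comp[OF S1m_hom[OF a(2)] e(1)] by simp
    finally show "adjoint_map X (\<epsilon> B) \<psi> = ho (e \<cdot> S1m k)" .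
    qed
  qed
qed

text \<open>\<open>R\<close> is isomorphic to \<open>\<Omega> B\<close> in the homotopy category
  through \<open>ho j\<close>. Transported along this isomorphism, the adjunction bijection is given
  by \<open>k \<mapsto> e \<cdot> S1m k\<close> on presheaf maps \<open>k\<close>, surjective and
  injective up to homotopy.\<close>

lemma loop_object_represents:
  assumes B: "fibrant B"
  obtains R e where "fibrant R" "e \<in> Hom (S1 R) B"
    "\<forall>L x. L \<in> Ob M \<longrightarrow> x \<in> homset H (S1 L) B \<longrightarrow> (\<exists>k\<in>Hom L R. ho (e \<cdot> S1m k) = x)"
    "\<forall>L k k'. k \<in> Hom L R \<longrightarrow> k' \<in> Hom L R \<longrightarrow> ho (e \<cdot> S1m k) = ho (e \<cdot> S1m k') \<longrightarrow> ho k = ho k'"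
proof -
  have Bo: "B \<in> Ob M" using B by (rule fibrant_Ob)
  have bij: "bij_betw (adjoint_map X (\<epsilon> B)) (homset H L (\<Omega> B)) (homset H (S1 L) B)" if "L \<in> Ob M" for L
    using adj Bo that by (auto simp: loop_adjunction_def HoC_eq)
  obtain R j e where R: "fibrant R" and j: "j \<in> W" "j \<in> Hom (\<Omega> B) R" and e: "e \<in> Hom (S1 R) B" and eps: "\<epsilon> B = ho (e \<cdot> S1m j)"
    and adj'': "\<forall>L \<psi> k. \<psi> \<in> homset H L (\<Omega> B) \<longrightarrow> k \<in> Hom L R \<longrightarrow> ho k = Cmp H (ho j) \<psi> \<longrightarrow> adjoint_map X (\<epsilon> B) \<psi> = ho (e \<cdot> S1m k)"
    by (rule loop_object[OF B])
  note adj' = adj''[rule_format]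
  obtain v where v: "v \<in> homset H R (\<Omega> B)" "Cmp H v (ho j) = ho (Idn M (\<Omega> B))" "Cmp H (ho j) v = ho (Idn M R)"
    by (rule ho_inverse[OF j])
  show ?thesis
  proof (rule that[OF R e])
    show "\<forall>L x. L \<in> Ob M \<longrightarrow> x \<in> homset H (S1 L) B \<longrightarrow> (\<exists>k\<in>Hom L R. ho (e \<cdot> S1m k) = x)"
    proof (intro allI impI)
    fix L x assume L: "L \<in> Ob M" and x: "x \<in> homset H (S1 L) B"
    have "x \<in> adjoint_map X (\<epsilon> B) ` homset H L (\<Omega> B)"
      unfolding bij_betw_imp_surj_on[OF bij[OF L]] by (rule x)
    then obtain \<psi> where "x = adjoint_map X (\<epsilon> B) \<psi>" and \<psi>1: "\<psi> \<in> homset H L (\<Omega> B)" by (rule imageE)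
    then have \<psi>: "\<psi> \<in> homset H L (\<Omega> B)" "adjoint_map X (\<epsilon> B) \<psi> = x" by simp_all
    obtain k where k: "k \<in> Hom L R" "Cmp H (ho j) \<psi> = ho k" by (rule ho_surj[OF R loc.comp_hom_L[OF \<psi>(1) loc.q_hom[OF j(2)]]])
    show "\<exists>k\<in>Hom L R. ho (e \<cdot> S1m k) = x" using adj'[OF \<psi>(1) k(1) k(2)[symmetric]] \<psi>(2) by (intro bexI[OF _ k(1)]) simp
    qed
    show "\<forall>L k k'. k \<in> Hom L R \<longrightarrow> k' \<in> Hom L R \<longrightarrow> ho (e \<cdot> S1m k) = ho (e \<cdot> S1m k') \<longrightarrow> ho k = ho k'"
    proof (intro allI impI)
    fix L k k' assume k: "k \<in> Hom L R" "k' \<in> Hom L R" and h: "ho (e \<cdot> S1m k) = ho (e \<cdot> S1m k')"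
    have L: "L \<in> Ob M" using k(1) by (rule hom_Dom)
    have jv: "Cmp H (ho j) (Cmp H v (ho k)) = ho k" if "k \<in> Hom L R" for k
      using loc.assoc_L[OF loc.q_hom[OF that] v(1) loc.q_hom[OF j(2)]] v(3) loc.Idn_L(2)[OF loc.q_hom[OF that]] by simp
    have vk: "Cmp H v (ho k) \<in> homset H L (\<Omega> B)" if "k \<in> Hom L R" for k by (rule loc.comp_hom_L[OF loc.q_hom[OF that] v(1)])
    have adj_eq: "adjoint_map X (\<epsilon> B) (Cmp H v (ho k)) = adjoint_map X (\<epsilon> B) (Cmp H v (ho k'))"
      using adj'[OF vk[OF k(1)] k(1)] adj'[OF vk[OF k(2)] k(2)] jv k h by simp
    have "Cmp H v (ho k) = Cmp H v (ho k')"
      by (rule inj_onD[OF bij_betw_imp_inj_on[OF bij[OF L]] adj_eq vk[OF k(1)] vk[OF k(2)]])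
    from arg_cong[OF this, of "Cmp H (ho j)"] show "ho k = ho k'" unfolding jv[OF k(1)] jv[OF k(2)] .
    qed
  qed
qed

text \<open>Eckmann--Hilton: products of maps on \<open>S\<^sup>1 \<and> S\<^sup>1 \<and> K\<close> in the outer and in the inner coordinate.
  The inner product is computed in the loop object, in which the outer one is natural.\<close>

lemma eckmann_hilton:
  assumes R: "fibrant R" and B: "fibrant B" and e: "e \<in> Hom (S1 R) B"
    and surj': "\<forall>L x. L \<in> Ob M \<longrightarrow> x \<in> homset H (S1 L) B \<longrightarrow> (\<exists>k\<in>Hom L R. ho (e \<cdot> S1m k) = x)"
    and inj': "\<forall>L k k'. k \<in> Hom L R \<longrightarrow> k' \<in> Hom L R \<longrightarrow> ho (e \<cdot> S1m k) = ho (e \<cdot> S1m k') \<longrightarrow> ho k = ho k'"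
    and x: "x \<in> Hom (S1 K) R" and y: "y \<in> Hom (S1 K) R" and K: "K \<in> Ob M"
  shows "tri K R x z y \<Longrightarrow> gmult (S1 K) B (ho (e \<cdot> S1m x)) (ho (e \<cdot> S1m y)) = ho (e \<cdot> S1m z)"
    and "tri K R y z x \<Longrightarrow> gmult (S1 K) B (ho (e \<cdot> S1m x)) (ho (e \<cdot> S1m y)) = ho (e \<cdot> S1m z)"
proof -
  note surj = surj'[rule_format] and inj = inj'[rule_format]
  have Ro: "R \<in> Ob M" using R by (rule fibrant_Ob)
  have Bo: "B \<in> Ob M" using B by (rule fibrant_Ob)
  define \<Phi> where "\<Phi> k = ho (e \<cdot> S1m k)" for k
  have eh: "e \<cdot> S1m k \<in> Hom (S1 L) B" if "k \<in> Hom L R" for k L by (rule comp_hom[OF S1m_hom[OF that] e])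
  have pre: "(e \<cdot> S1m k) \<cdot> S1m f = e \<cdot> S1m (k \<cdot> f)" if "f \<in> Hom L' L" "k \<in> Hom L R" for L L' f k
    using assoc[OF S1m_hom[OF that(1)] S1m_hom[OF that(2)] e] smash_map_comp[OF pointed_mod that] by simp
  have \<Phi>cong: "\<Phi> k = \<Phi> k'" if "k \<in> Hom L R" "k' \<in> Hom L R" "ho k = ho k'" for L k k'
    using Hsusp_ho[OF that(1)] Hsusp_ho[OF that(2)] loc.q_comp[OF S1m_hom[OF that(1)] e] loc.q_comp[OF S1m_hom[OF that(2)] e] that(3)
    by (simp add: \<Phi>_def)
  have \<Phi>0: "e \<cdot> S1m (Zero (S1 K) R) = Zero (S1 (S1 K)) B"
    using smash_map_zero[OF pointed_mod S1_Ob[OF K] Ro, of "Suc 0"] comp_zero[OF e S1_Ob[OF S1_Ob[OF K]]] by simp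
  have unit: "gmult (S1 K) B (\<Phi> k) (\<Phi> (Zero (S1 K) R)) = \<Phi> k" "gmult (S1 K) B (\<Phi> (Zero (S1 K) R)) (\<Phi> k) = \<Phi> k"
    if "k \<in> Hom (S1 K) R" for k
    using gmult_tri[OF B tri_degenerate(1)[OF S1_Ob[OF K] eh[OF that]]] gmult_tri[OF B tri_degenerate(2)[OF S1_Ob[OF K] eh[OF that]]] \<Phi>0
    by (simp_all add: \<Phi>_def)
  \<comment> \<open>Two inner triangles are maps \<open>g\<close> and \<open>h\<close> on
    \<open>S2 K\<close>. The outer product of the corresponding maps on \<open>S1 (S2 K)\<close> is
    represented by some \<open>w\<close> on \<open>S2 K\<close>; by naturality of the outer product,
    the three faces of \<open>w\<close> are the outer products of the sides, and they form an inner
    triangle.\<close>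
  have interchange: "\<exists>a b c. tri K R a b c \<and> gmult (S1 K) B (\<Phi> a1) (\<Phi> a2) = \<Phi> a \<and> gmult (S1 K) B (\<Phi> b1) (\<Phi> b2) = \<Phi> b \<and>
      gmult (S1 K) B (\<Phi> c1) (\<Phi> c2) = \<Phi> c"
    if t1: "tri K R a1 b1 c1" and t2: "tri K R a2 b2 c2" for a1 b1 c1 a2 b2 c2
  proof -
    obtain g where g: "g \<in> Hom (S2 K) R" "a1 = g \<cdot> mface 0 K" "b1 = g \<cdot> mface (Suc 0) K" "c1 = g \<cdot> mface (Suc (Suc 0)) K"
      using t1 by (auto simp: tri_def)
    obtain h where h: "h \<in> Hom (S2 K) R" "a2 = h \<cdot> mface 0 K" "b2 = h \<cdot> mface (Suc 0) K" "c2 = h \<cdot> mface (Suc (Suc 0)) K"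
      using t2 by (auto simp: tri_def)
    obtain u where u: "tri (S2 K) B (e \<cdot> S1m g) u (e \<cdot> S1m h)" by (rule tri_exists[OF B S2_Ob[OF K] eh[OF g(1)] eh[OF h(1)]])
    obtain w where w: "w \<in> Hom (S2 K) R" "ho (e \<cdot> S1m w) = ho u"
      using surj[OF S2_Ob[OF K] loc.q_hom[OF triD(3)[OF u]]] by (elim bexE)
    have gm: "gmult (S1 K) B (\<Phi> (g \<cdot> mface n K)) (\<Phi> (h \<cdot> mface n K)) = \<Phi> (w \<cdot> mface n K)" for n
    proof -
      note m = mface_hom[OF K, of n]
      have "ho (u \<cdot> S1m (mface n K)) = ho ((e \<cdot> S1m w) \<cdot> S1m (mface n K))"
        using loc.q_comp[OF S1m_hom[OF m] triD(3)[OF u]] loc.q_comp[OF S1m_hom[OF m] eh[OF w(1)]] w(2) by simp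
      then show ?thesis using gmult_tri[OF B tri_pre[OF u m]] pre[OF m g(1)] pre[OF m h(1)] pre[OF m w(1)] by (simp add: \<Phi>_def)
    qed
    have tw: "tri K R (w \<cdot> mface 0 K) (w \<cdot> mface (Suc 0) K) (w \<cdot> mface (Suc (Suc 0)) K)" using K w(1) by (auto simp: tri_def)
    show ?thesis unfolding g(2-4) h(2-4) by (intro exI conjI) (rule tw gm)+
  qed
  show "gmult (S1 K) B (ho (e \<cdot> S1m x)) (ho (e \<cdot> S1m y)) = ho (e \<cdot> S1m z)" if t: "tri K R x z y"
  proof -
    \<comment> \<open>The degenerate triangles \<open>(x, x, 0)\<close> and \<open>(0, y, y)\<close>
      have as outer products of their sides \<open>x\<close>, the outer product of \<open>x\<close>
      and \<open>y\<close>, and \<open>y\<close>. So the outer product is an inner product of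
      \<open>x\<close> and \<open>y\<close>.\<close>
    obtain a b c where abc: "tri K R a b c" "\<Phi> x = \<Phi> a" "gmult (S1 K) B (\<Phi> x) (\<Phi> y) = \<Phi> b" "\<Phi> y = \<Phi> c"
      using interchange[OF tri_degenerate(1)[OF K x] tri_degenerate(2)[OF K y], unfolded unit[OF x] unit[OF y]] by (elim exE conjE)
    note d = triD[OF abc(1)]
    have "ho x = ho a" "ho y = ho c" using inj[OF x d(2)] inj[OF y d(4)] abc by (simp_all add: \<Phi>_def)
    then have "ho z = ho b" by (rule tri_unique[OF R t abc(1)])
    then have "\<Phi> z = \<Phi> b" by (rule \<Phi>cong[OF triD(3)[OF t] d(3)])
    then show ?thesis using abc(3) by (simp add: \<Phi>_def)
  qed
  show "gmult (S1 K) B (ho (e \<cdot> S1m x)) (ho (e \<cdot> S1m y)) = ho (e \<cdot> S1m z)" if t: "tri K R y z x"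
  proof -
    \<comment> \<open>The other pair of degeneracies, \<open>(0, x, x)\<close> and
      \<open>(y, y, 0)\<close>, gives the inner product in the opposite order.\<close>
    obtain a b c where abc: "tri K R a b c" "\<Phi> y = \<Phi> a" "gmult (S1 K) B (\<Phi> x) (\<Phi> y) = \<Phi> b" "\<Phi> x = \<Phi> c"
      using interchange[OF tri_degenerate(2)[OF K x] tri_degenerate(1)[OF K y], unfolded unit[OF x] unit[OF y]] by (elim exE conjE)
    note d = triD[OF abc(1)]
    have "ho y = ho a" "ho x = ho c" using inj[OF x d(4)] inj[OF y d(2)] abc by (simp_all add: \<Phi>_def)
    then have "ho z = ho b" by (rule tri_unique[OF R t abc(1)])
    then have "\<Phi> z = \<Phi> b" by (rule \<Phi>cong[OF triD(3)[OF t] d(3)])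
    then show ?thesis using abc(3) by (simp add: \<Phi>_def)
  qed
qed

text \<open>The outer product of \<open>a\<close> and \<open>b\<close> equals the inner product in
  either order, so one inner triangle computes both sides.\<close>

lemma gmult_commute:
  assumes B: "fibrant B" and K: "K \<in> Ob M"
    and a: "a \<in> homset H (S1 (S1 K)) B" "b \<in> homset H (S1 (S1 K)) B"
  shows "gmult (S1 K) B a b = gmult (S1 K) B b a"
proof -
  obtain R e where R: "fibrant R" and e: "e \<in> Hom (S1 R) B"
    and surj: "\<forall>L x. L \<in> Ob M \<longrightarrow> x \<in> homset H (S1 L) B \<longrightarrow> (\<exists>k\<in>Hom L R. ho (e \<cdot> S1m k) = x)"
    and inj: "\<forall>L k k'. k \<in> Hom L R \<longrightarrow> k' \<in> Hom L R \<longrightarrow> ho (e \<cdot> S1m k) = ho (e \<cdot> S1m k') \<longrightarrow> ho k = ho k'"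
    by (rule loop_object_represents[OF B])
  obtain x where x: "x \<in> Hom (S1 K) R" "ho (e \<cdot> S1m x) = a" using surj[rule_format, OF S1_Ob[OF K] a(1)] by (elim bexE)
  obtain y where y: "y \<in> Hom (S1 K) R" "ho (e \<cdot> S1m y) = b" using surj[rule_format, OF S1_Ob[OF K] a(2)] by (elim bexE)
  obtain z where z: "tri K R x z y" by (rule tri_exists[OF R K x(1) y(1)])
  show ?thesis
    using eckmann_hilton(1)[OF R B e surj inj x(1) y(1) K z] eckmann_hilton(2)[OF R B e surj inj y(1) x(1) K z] x(2) y(2) by simp
qed

end

section \<open>The exact sequence of a fibration\<close>

locale loop_fibration = loop_objects X W \<Omega> \<epsilon> + presheaf_fibration X W p E B
  for X :: "('a, 'a) rspace" and W :: "('a, 'b) parr set"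
    and \<Omega> :: "('a, 'b) pspsh \<Rightarrow> ('a, 'b) pspsh" and \<epsilon> :: "('a, 'b) pspsh \<Rightarrow> ('a, 'b) harr"
    and p :: "('a, 'b) parr" and E B :: "('a, 'b) pspsh"
begin

abbreviation "\<delta> \<equiv> boundary_map X \<Omega> \<epsilon> p i"

text \<open>The map \<open>g1\<close> of a single stage, for an arbitrary source \<open>L\<close>;
  \<open>inv_into\<close> transposes back along the loop adjunction.\<close>

definition bd :: "('a, 'b) pspsh \<Rightarrow> ('a, 'b) harr \<Rightarrow> ('a, 'b) harr" where
  "bd L x = Cmp H \<delta> (inv_into (homset H L (\<Omega> B)) (adjoint_map X (\<epsilon> B)) x)"

lemma cyl_collapse_qt: "cyl_collapse X A = qt (Suc 0) A"
  by (simp add: cyl_collapse_def qt_def collapse_def[abs_def])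

lemma Omega_Ob: "\<Omega> B \<in> Ob M"
  using adj EBF_Ob(2) by (simp add: loop_adjunction_def HoC_eq)

text \<open>The data under \<open>THE\<close> in \<open>boundary_map\<close> are a representative of
  the counit together with a lift of it that starts at zero. By \<open>lifted_unique\<close> the
  class of the end depends neither on the representative nor on the lift.\<close>

lemma boundary_map_eq:
  assumes e: "e \<in> Hom (S1 (\<Omega> B)) B" "ho e = \<epsilon> B" and l: "lifted (\<Omega> B) e (Zero (\<Omega> B) F) d"
  shows "\<delta> = ho d"
proof -
  have D: "Cod p = B" "Dom p = E" "Dom i = F" using p_hom i_hom by (simp_all add: in_hom)
  note O = Omega_Ob
  have *: "(\<exists>l. l \<in> Hom (cyl (\<Omega> B)) E \<and> p \<cdot> l = e' \<cdot> qt (Suc 0) (\<Omega> B) \<and> l \<cdot> vtx (Suc 0) 0 (\<Omega> B) = Zero (\<Omega> B) E \<and>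
      d' \<in> Hom (\<Omega> B) F \<and> l \<cdot> vtx (Suc 0) (Suc 0) (\<Omega> B) = i \<cdot> d') \<longleftrightarrow> lifted (\<Omega> B) e' (Zero (\<Omega> B) F) d'"
    if "e' \<in> Hom (S1 (\<Omega> B)) B" for e' d'
    unfolding lifted_def edge_def i_zero[OF O] using that O Zero_hom[OF O EBF_Ob(3)] by blast
  show ?thesis
    unfolding boundary_map_def Let_def D cyl_collapse_qt cyl_end_vtx Ho_eq One_nat_def
  proof (rule the_equality)
    from l obtain l' where "l' \<in> Hom (cyl (\<Omega> B)) E" "p \<cdot> l' = e \<cdot> qt (Suc 0) (\<Omega> B)" "l' \<cdot> vtx (Suc 0) 0 (\<Omega> B) = Zero (\<Omega> B) E"
      "d \<in> Hom (\<Omega> B) F" "l' \<cdot> vtx (Suc 0) (Suc 0) (\<Omega> B) = i \<cdot> d" unfolding *[OF e(1), symmetric] by (elim exE conjE)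
    with e show "\<exists>e l d'. e \<in> Hom (S1 (\<Omega> B)) B \<and> ho e = \<epsilon> B \<and> l \<in> Hom (cyl (\<Omega> B)) E \<and> p \<cdot> l = e \<cdot> qt (Suc 0) (\<Omega> B) \<and>
        l \<cdot> vtx (Suc 0) 0 (\<Omega> B) = Zero (\<Omega> B) E \<and> d' \<in> Hom (\<Omega> B) F \<and> l \<cdot> vtx (Suc 0) (Suc 0) (\<Omega> B) = i \<cdot> d' \<and> ho d = ho d'"
      by (intro exI conjI) (assumption | rule refl)+
  next
    fix y assume "\<exists>e l d'. e \<in> Hom (S1 (\<Omega> B)) B \<and> ho e = \<epsilon> B \<and> l \<in> Hom (cyl (\<Omega> B)) E \<and> p \<cdot> l = e \<cdot> qt (Suc 0) (\<Omega> B) \<and>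
        l \<cdot> vtx (Suc 0) 0 (\<Omega> B) = Zero (\<Omega> B) E \<and> d' \<in> Hom (\<Omega> B) F \<and> l \<cdot> vtx (Suc 0) (Suc 0) (\<Omega> B) = i \<cdot> d' \<and> y = ho d'"
    then obtain e' l' d' where e': "e' \<in> Hom (S1 (\<Omega> B)) B" "ho e' = \<epsilon> B" and "l' \<in> Hom (cyl (\<Omega> B)) E" "p \<cdot> l' = e' \<cdot> qt (Suc 0) (\<Omega> B)"
        "l' \<cdot> vtx (Suc 0) 0 (\<Omega> B) = Zero (\<Omega> B) E" "d' \<in> Hom (\<Omega> B) F" "l' \<cdot> vtx (Suc 0) (Suc 0) (\<Omega> B) = i \<cdot> d'" and y: "y = ho d'"
      by (elim exE conjE)
    then have "lifted (\<Omega> B) e' (Zero (\<Omega> B) F) d'" unfolding *[OF e'(1), symmetric] by (intro exI conjI) assumption+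
    from lifted_unique[OF this l] e(2) e'(2) y show "y = ho d" by simp
  qed
qed

text \<open>The tautological loop on \<open>R\<close> is lifted once, with end \<open>c\<close>. Up
  to homotopy every loop is \<open>e \<cdot> S1m k\<close>, so by naturality its lift ends in
  \<open>c \<cdot> k\<close>; and by naturality along \<open>j\<close> the boundary map is the class
  of \<open>c \<cdot> j\<close>.\<close>

lemma bd_eq:
  assumes x: "lifted L x (Zero L F) d"
  shows "bd L (ho x) = ho d"
proof -
  have xh: "x \<in> Hom (S1 L) B" and d: "d \<in> Hom L F" using x by (auto simp: lifted_def)
  have L: "L \<in> Ob M" using d by (rule hom_Dom)
  obtain R j e where R: "fibrant R" and j: "j \<in> W" "j \<in> Hom (\<Omega> B) R" and e: "e \<in> Hom (S1 R) B" and eps: "\<epsilon> B = ho (e \<cdot> S1m j)"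
    and adj'': "\<forall>L \<psi> k. \<psi> \<in> homset H L (\<Omega> B) \<longrightarrow> k \<in> Hom L R \<longrightarrow> ho k = Cmp H (ho j) \<psi> \<longrightarrow> adjoint_map X (\<epsilon> B) \<psi> = ho (e \<cdot> S1m k)"
    by (rule loop_object[OF B])
  have Ro: "R \<in> Ob M" using R by (rule fibrant_Ob)
  have bij: "bij_betw (adjoint_map X (\<epsilon> B)) (homset H L (\<Omega> B)) (homset H (S1 L) B)"
    using adj EBF_Ob(2) L by (simp add: loop_adjunction_def HoC_eq)
  define \<psi> where "\<psi> = inv_into (homset H L (\<Omega> B)) (adjoint_map X (\<epsilon> B)) (ho x)"
  have "ho x \<in> adjoint_map X (\<epsilon> B) ` homset H L (\<Omega> B)"
    unfolding bij_betw_imp_surj_on[OF bij] by (rule loc.q_hom[OF xh])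
  then have \<psi>: "\<psi> \<in> homset H L (\<Omega> B)" "adjoint_map X (\<epsilon> B) \<psi> = ho x"
    unfolding \<psi>_def by (rule inv_into_into, rule f_inv_into_f)
  obtain k where k: "k \<in> Hom L R" "Cmp H (ho j) \<psi> = ho k" by (rule ho_surj[OF R loc.comp_hom_L[OF \<psi>(1) loc.q_hom[OF j(2)]]])
  have xk: "ho x = ho (e \<cdot> S1m k)" using adj''[rule_format, OF \<psi>(1) k(1) k(2)[symmetric]] \<psi>(2) by simp
  obtain c where c: "lifted R e (Zero R F) c" by (rule lifted_exists[OF e Zero_hom[OF Ro EBF_Ob(3)]])
  then have ch: "c \<in> Hom R F" by (simp add: lifted_def)
  have "lifted (\<Omega> B) (e \<cdot> S1m j) (Zero (\<Omega> B) F) (c \<cdot> j)" using lifted_pre[OF c j(2)] zero_comp[OF j(2) EBF_Ob(3)] by simp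
  from boundary_map_eq[OF comp_hom[OF S1m_hom[OF j(2)] e] eps[symmetric] this]
  have "bd L (ho x) = Cmp H (Cmp H (ho c) (ho j)) \<psi>" using loc.q_comp[OF j(2) ch] by (simp add: bd_def \<psi>_def)
  also have "\<dots> = ho (c \<cdot> k)"
    using loc.assoc_L[OF \<psi>(1) loc.q_hom[OF j(2)] loc.q_hom[OF ch]] k(2) loc.q_comp[OF k(1) ch] by simp
  also have "\<dots> = ho d"
  proof (rule lifted_unique[OF _ x])
    show "lifted L (e \<cdot> S1m k) (Zero L F) (c \<cdot> k)" using lifted_pre[OF c k(1)] zero_comp[OF k(1) EBF_Ob(3)] by simp
  qed (use xk in simp_all)
  finally show ?thesis .
qed

lemma bd_obtain:
  assumes L: "L \<in> Ob M" and a: "a \<in> homset H (S1 L) B"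
  obtains x d where "x \<in> Hom (S1 L) B" "a = ho x" "d \<in> Hom L F" "lifted L x (Zero L F) d" "bd L a = ho d"
proof -
  obtain x where x: "x \<in> Hom (S1 L) B" "a = ho x" by (rule ho_surj[OF B a])
  obtain d where d: "lifted L x (Zero L F) d" by (rule lifted_exists[OF x(1) Zero_hom[OF L EBF_Ob(3)]])
  then show ?thesis using that[OF x _ d] bd_eq[OF d] x(2) by (simp add: lifted_def)
qed

lemma bd_hom: "L \<in> Ob M \<Longrightarrow> a \<in> homset H (S1 L) B \<Longrightarrow> bd L a \<in> homset H L F"
  using bd_obtain[of L a "bd L a \<in> homset H L F"] loc.q_hom by simp

section \<open>Exactness at the total object, the fibre and the base\<close>

lemma exact_E:
  assumes L: "L \<in> Ob M"
  shows "Cmp H (ho i) ` homset H L F = {x \<in> homset H L E. Cmp H (ho p) x = ho (Zero L B)}"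
proof (intro equalityI subsetI)
  fix y assume "y \<in> Cmp H (ho i) ` homset H L F"
  then obtain x where x: "x \<in> homset H L F" "y = Cmp H (ho i) x" by (elim imageE)
  obtain d where d: "d \<in> Hom L F" "x = ho d" by (rule ho_surj[OF F x(1)])
  have "y = ho (i \<cdot> d)" using x(2) d(2) loc.q_comp[OF d(1) i_hom] by simp
  moreover have "Cmp H (ho p) (ho (i \<cdot> d)) = ho (Zero L B)"
    using loc.q_comp[OF comp_hom[OF d(1) i_hom] p_hom] p_i[OF d(1)] by simp
  ultimately show "y \<in> {x \<in> homset H L E. Cmp H (ho p) x = ho (Zero L B)}" using loc.q_hom[OF comp_hom[OF d(1) i_hom]] by simp
next
  fix y assume y: "y \<in> {x \<in> homset H L E. Cmp H (ho p) x = ho (Zero L B)}"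
  then have y1: "y \<in> homset H L E" by simp
  obtain x where x: "x \<in> Hom L E" "y = ho x" by (rule ho_surj[OF E y1])
  have "ho (p \<cdot> x) = ho (Zero L B)" using y x(2) loc.q_comp[OF x(1) p_hom] by simp
  then obtain d where d: "d \<in> Hom L F" "ho (i \<cdot> d) = ho x" by (rule lift_null[OF x(1)])
  have "y = Cmp H (ho i) (ho d)" using loc.q_comp[OF d(1) i_hom] d(2) x(2) by simp
  then show "y \<in> Cmp H (ho i) ` homset H L F" using loc.q_hom[OF d(1)] by (rule image_eqI)
qed

lemma exact_F:
  assumes L: "L \<in> Ob M"
  shows "bd L ` homset H (S1 L) B = {x \<in> homset H L F. Cmp H (ho i) x = ho (Zero L E)}"
proof (intro equalityI subsetI)
  note z = Zero_hom[OF L EBF_Ob(3)]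
  {
    fix y assume "y \<in> bd L ` homset H (S1 L) B"
    then obtain a where a: "a \<in> homset H (S1 L) B" "y = bd L a" by (elim imageE)
    obtain x d where d: "x \<in> Hom (S1 L) B" "a = ho x" "d \<in> Hom L F" "lifted L x (Zero L F) d" "bd L a = ho d"
      by (rule bd_obtain[OF L a(1)])
    have "ho (i \<cdot> Zero L F) = ho (i \<cdot> d)" using same_orbit[OF z d(3)] d(4) by blast
    then have "Cmp H (ho i) y = ho (Zero L E)" using a(2) d(5) loc.q_comp[OF d(3) i_hom] i_zero[OF L] by simp
    then show "y \<in> {x \<in> homset H L F. Cmp H (ho i) x = ho (Zero L E)}" using a d(5) loc.q_hom[OF d(3)] by simp
  }
  fix y assume y: "y \<in> {x \<in> homset H L F. Cmp H (ho i) x = ho (Zero L E)}"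
  then have y1: "y \<in> homset H L F" by simp
  obtain d where d: "d \<in> Hom L F" "y = ho d" by (rule ho_surj[OF F y1])
  have "ho (i \<cdot> Zero L F) = ho (i \<cdot> d)" using y d(2) loc.q_comp[OF d(1) i_hom] i_zero[OF L] by simp
  then obtain x where x: "lifted L x (Zero L F) d" using same_orbit[OF z d(1)] by auto
  then have "x \<in> Hom (S1 L) B" by (simp add: lifted_def)
  then show "y \<in> bd L ` homset H (S1 L) B" using bd_eq[OF x] d(2) loc.q_hom by (intro image_eqI[of _ _ "ho x"]) simp_all
qed

lemma exact_B:
  assumes L: "L \<in> Ob M"
  shows "Cmp H (ho p) ` homset H (S1 L) E = {x \<in> homset H (S1 L) B. bd L x = ho (Zero L F)}"
proof (intro equalityI subsetI)
  {
    fix y assume "y \<in> Cmp H (ho p) ` homset H (S1 L) E"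
    then obtain a where a: "a \<in> homset H (S1 L) E" "y = Cmp H (ho p) a" by (elim imageE)
    obtain x where x: "x \<in> Hom (S1 L) E" "a = ho x" by (rule ho_surj[OF E a(1)])
    have "y = ho (p \<cdot> x)" using a(2) x(2) loc.q_comp[OF x(1) p_hom] by simp
    then show "y \<in> {x \<in> homset H (S1 L) B. bd L x = ho (Zero L F)}"
      using bd_eq[OF lifted_image[OF x(1) L]] loc.q_hom[OF comp_hom[OF x(1) p_hom]] by simp
  }
  fix y assume y: "y \<in> {x \<in> homset H (S1 L) B. bd L x = ho (Zero L F)}"
  then have y1: "y \<in> homset H (S1 L) B" "bd L y = ho (Zero L F)" by simp_all
  obtain x d where d: "x \<in> Hom (S1 L) B" "y = ho x" "d \<in> Hom L F" "lifted L x (Zero L F) d" "bd L y = ho d"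
    by (rule bd_obtain[OF L y1(1)])
  have "ho d = ho (Zero L F)" using y1(2) d(5) by simp
  then obtain u where u: "u \<in> Hom (S1 L) E" "p \<cdot> u = x" by (rule lifted_null[OF d(4)])
  have "y = Cmp H (ho p) (ho u)" using loc.q_comp[OF u(1) p_hom] u(2) d(2) by simp
  then show "y \<in> Cmp H (ho p) ` homset H (S1 L) E" using loc.q_hom[OF u(1)] by (rule image_eqI)
qed

text \<open>By the Eckmann--Hilton argument the product in \<open>[S\<^sup>1 \<and> S\<^sup>1 \<and> L, B]\<close> may be formed in the inner
  coordinate, in which the lifting construction is natural.\<close>

lemma bd_gmult:
  assumes L: "L \<in> Ob M" and a: "a \<in> homset H (S1 (S1 L)) B" "b \<in> homset H (S1 (S1 L)) B"
  shows "bd (S1 L) (gmult (S1 L) B a b) = gmult L F (bd (S1 L) a) (bd (S1 L) b)"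
proof -
  obtain R e where R: "fibrant R" and e: "e \<in> Hom (S1 R) B"
    and surj: "\<forall>L x. L \<in> Ob M \<longrightarrow> x \<in> homset H (S1 L) B \<longrightarrow> (\<exists>k\<in>Hom L R. ho (e \<cdot> S1m k) = x)"
    and inj: "\<forall>L k k'. k \<in> Hom L R \<longrightarrow> k' \<in> Hom L R \<longrightarrow> ho (e \<cdot> S1m k) = ho (e \<cdot> S1m k') \<longrightarrow> ho k = ho k'"
    by (rule loop_object_represents[OF B])
  obtain x where x: "x \<in> Hom (S1 L) R" "ho (e \<cdot> S1m x) = a" using surj[rule_format, OF S1_Ob[OF L] a(1)] by (elim bexE)
  obtain y where y: "y \<in> Hom (S1 L) R" "ho (e \<cdot> S1m y) = b" using surj[rule_format, OF S1_Ob[OF L] a(2)] by (elim bexE)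
  obtain z where z: "tri L R x z y" by (rule tri_exists[OF R L x(1) y(1)])
  have Ro: "R \<in> Ob M" using R by (rule fibrant_Ob)
  obtain c where c: "lifted R e (Zero R F) c" by (rule lifted_exists[OF e Zero_hom[OF Ro EBF_Ob(3)]])
  then have ch: "c \<in> Hom R F" by (simp add: lifted_def)
  have b: "bd (S1 L) (ho (e \<cdot> S1m k)) = ho (c \<cdot> k)" if "k \<in> Hom (S1 L) R" for k
    using lifted_pre[OF c that] zero_comp[OF that EBF_Ob(3)] by (intro bd_eq) simp
  show ?thesis
    using eckmann_hilton(1)[OF R B e surj inj x(1) y(1) L z] x y b[OF x(1)] b[OF y(1)] b[OF triD(3)[OF z]]
      gmult_tri[OF F tri_post[OF z ch]] by simp
qed

text \<open>With \<open>n\<close> representing the boundary of \<open>a\<close>, the lift of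
  \<open>x\<close> starting at \<open>y\<close> is computed in two ways, once as the product of
  \<open>n\<close> and \<open>y\<close> and once as that of \<open>y\<close> and \<open>n\<close>.
  The two computations use the two degenerate triangles on the identity of \<open>S1 L\<close>,
  combined with the opposite ones on \<open>y\<close>.\<close>

lemma bd_central:
  assumes L: "L \<in> Ob M" and a: "a \<in> homset H (S1 (S1 L)) B" and b: "b \<in> homset H (S1 L) F"
  shows "gmult L F (bd (S1 L) a) b = gmult L F b (bd (S1 L) a)"
proof -
  obtain x where x: "x \<in> Hom (S1 (S1 L)) B" "a = ho x" by (rule ho_surj[OF B a])
  obtain y where y: "y \<in> Hom (S1 L) F" "b = ho y" by (rule ho_surj[OF F b])
  obtain d where d: "lifted (S1 L) x y d" by (rule lifted_exists[OF x(1) y(1)])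
  note Z1 = Zero_hom[OF S1_Ob[OF L] EBF_Ob(3)]
  have pre0: "x \<cdot> S1m (Zero (S1 L) (S1 L)) = Zero (S1 (S1 L)) B"
    using smash_map_zero[OF pointed_mod S1_Ob[OF L] S1_Ob[OF L], of "Suc 0"] comp_zero[OF x(1) S1_Ob[OF S1_Ob[OF L]]] by simp
  \<comment> \<open>Lifting over \<open>S2 L\<close> instead of \<open>S1 L\<close>: the loop is
    composed with a triangle in \<open>S1 L\<close>, the start is a triangle in the fibre, and by
    naturality the ends of the lifts form a triangle too.\<close>
  have step: "\<exists>u v w. tri L F u v w \<and> lifted (S1 L) (x \<cdot> S1m s0) y0 u \<and> lifted (S1 L) (x \<cdot> S1m s1) y1 v \<and> lifted (S1 L) (x \<cdot> S1m s2) y2 w"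
    if s: "tri L (S1 L) s0 s1 s2" and t: "tri L F y0 y1 y2" for s0 s1 s2 y0 y1 y2
  proof -
    obtain g where g: "g \<in> Hom (S2 L) (S1 L)" "s0 = g \<cdot> mface 0 L" "s1 = g \<cdot> mface (Suc 0) L" "s2 = g \<cdot> mface (Suc (Suc 0)) L"
      using s by (auto simp: tri_def)
    obtain h where h: "h \<in> Hom (S2 L) F" "y0 = h \<cdot> mface 0 L" "y1 = h \<cdot> mface (Suc 0) L" "y2 = h \<cdot> mface (Suc (Suc 0)) L"
      using t by (auto simp: tri_def)
    obtain w where w: "lifted (S2 L) (x \<cdot> S1m g) h w" by (rule lifted_exists[OF comp_hom[OF S1m_hom[OF g(1)] x(1)] h(1)])
    have m: "(x \<cdot> S1m g) \<cdot> S1m (mface n L) = x \<cdot> S1m (g \<cdot> mface n L)" for n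
      using assoc[OF S1m_hom[OF mface_hom[OF L]] S1m_hom[OF g(1)] x(1)] smash_map_comp[OF pointed_mod mface_hom[OF L] g(1)] by simp
    have l: "lifted (S1 L) (x \<cdot> S1m (g \<cdot> mface n L)) (h \<cdot> mface n L) (w \<cdot> mface n L)" for n
      using lifted_pre[OF w mface_hom[OF L, of n]] m by simp
    have "tri L F (w \<cdot> mface 0 L) (w \<cdot> mface (Suc 0) L) (w \<cdot> mface (Suc (Suc 0)) L)"
      using L w by (auto simp: tri_def lifted_def)
    then show ?thesis unfolding g(2-4) h(2-4) by (intro exI conjI) (assumption | rule l)+
  qed
  have id: "x \<cdot> S1m (Idn M (S1 L)) = x"
    using smash_map_Idn[OF pointed_mod S1_Ob[OF L], of "Suc 0"] comp_Idn[OF x(1)] by simp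
  note I = Idn_hom[OF S1_Ob[OF L]]
  note s1 = tri_degenerate(1)[OF L I] and s2 = tri_degenerate(2)[OF L I]
  note t1 = tri_degenerate(1)[OF L y(1)] and t2 = tri_degenerate(2)[OF L y(1)]
  obtain n where n: "lifted (S1 L) x (Zero (S1 L) F) n" by (rule lifted_exists[OF x(1) Z1])
  have n': "bd (S1 L) a = ho n" using bd_eq[OF n] x(2) by simp
  obtain u v w where 1: "tri L F u v w" "lifted (S1 L) x (Zero (S1 L) F) u" "lifted (S1 L) x y v" "lifted (S1 L) (Zero (S1 (S1 L)) B) y w"
    using step[OF s1 t2] unfolding id pre0 by (elim exE conjE)
  obtain u' v' w' where 2: "tri L F u' v' w'" "lifted (S1 L) (Zero (S1 (S1 L)) B) y u'" "lifted (S1 L) x y v'" "lifted (S1 L) x (Zero (S1 L) F) w'"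
    using step[OF s2 t1] unfolding id pre0 by (elim exE conjE)
  have "ho u = ho n" by (rule lifted_unique[OF 1(2) n refl refl])
  moreover have "ho w' = ho n" by (rule lifted_unique[OF 2(4) n refl refl])
  moreover have "ho w = ho y" by (rule lifted_unique[OF 1(4) lifted_zero[OF y(1)] refl refl])
  moreover have "ho u' = ho y" by (rule lifted_unique[OF 2(2) lifted_zero[OF y(1)] refl refl])
  moreover have "ho v = ho v'" by (rule lifted_unique[OF 1(3) 2(3) refl refl])
  ultimately show ?thesis using gmult_tri[OF F 1(1)] gmult_tri[OF F 2(1)] n' y(2) by simp
qed

section \<open>The action of loops in the base on maps into the fibre\<close>

definition act :: "('a, 'b) pspsh \<Rightarrow> ('a, 'b) harr \<Rightarrow> ('a, 'b) harr \<Rightarrow> ('a, 'b) harr" where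
  "act L a s = (THE t. \<exists>x d e. a = ho x \<and> s = ho d \<and> lifted L x d e \<and> t = ho e)"

lemma act_eq:
  assumes "lifted L x d e"
  shows "act L (ho x) (ho d) = ho e"
  unfolding act_def
proof (rule the_equality)
  show "\<exists>x' d' e'. ho x = ho x' \<and> ho d = ho d' \<and> lifted L x' d' e' \<and> ho e = ho e'"
    using assms by (intro exI conjI) (assumption | rule refl)+
next
  fix t assume "\<exists>x' d' e'. ho x = ho x' \<and> ho d = ho d' \<and> lifted L x' d' e' \<and> t = ho e'"
  then obtain x' d' e' where "ho x = ho x'" "ho d = ho d'" "lifted L x' d' e'" "t = ho e'" by (elim exE conjE)
  then show "t = ho e" using lifted_unique[OF assms, of x' d' e'] by simp
qed

end

text \<open>\<open>group_action\<close> asks for a homomorphism into \<open>BijGroup S\<close>,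
  whose elements are extensional; this accounts for the restriction. Bijectivity follows from the
  inverses in \<open>G\<close>.\<close>

lemma group_actionI:
  assumes G: "group G"
    and cl: "\<And>a s. a \<in> carrier G \<Longrightarrow> s \<in> S \<Longrightarrow> f a s \<in> S"
    and one: "\<And>s. s \<in> S \<Longrightarrow> f \<one>\<^bsub>G\<^esub> s = s"
    and mult: "\<And>a b s. a \<in> carrier G \<Longrightarrow> b \<in> carrier G \<Longrightarrow> s \<in> S \<Longrightarrow> f (a \<otimes>\<^bsub>G\<^esub> b) s = f a (f b s)"
  shows "group_action G S (\<lambda>a. restrict (f a) S)"
proof -
  interpret group G by (rule G)
  have "bij_betw (restrict (f a) S) S S" if a: "a \<in> carrier G" for a
  proof (rule bij_betw_byWitness[of _ "restrict (f (inv\<^bsub>G\<^esub> a)) S"])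
    show "\<forall>s\<in>S. restrict (f (inv\<^bsub>G\<^esub> a)) S (restrict (f a) S s) = s"
      using cl[OF a] mult[OF inv_closed[OF a] a] one a by simp
    show "\<forall>s\<in>S. restrict (f a) S (restrict (f (inv\<^bsub>G\<^esub> a)) S s) = s"
      using cl[OF inv_closed[OF a]] mult[OF a inv_closed[OF a]] one a by simp
  qed (use cl a in auto)
  then have B: "restrict (f a) S \<in> carrier (BijGroup S)" if "a \<in> carrier G" for a
    using that by (simp add: BijGroup_def Bij_def)
  show ?thesis
    unfolding group_action_def group_hom_def group_hom_axioms_def
  proof (intro conjI G group_BijGroup)
    show "(\<lambda>a. restrict (f a) S) \<in> hom G (BijGroup S)"
    proof (rule homI[OF B])
      fix a b assume a: "a \<in> carrier G" "b \<in> carrier G"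
      then have "restrict (f (a \<otimes>\<^bsub>G\<^esub> b)) S = compose S (restrict (f a) S) (restrict (f b) S)"
        using cl mult by (auto simp: compose_def fun_eq_iff)
      then show "restrict (f (a \<otimes>\<^bsub>G\<^esub> b)) S = restrict (f a) S \<otimes>\<^bsub>BijGroup S\<^esub> restrict (f b) S"
        using B[OF a(1)] B[OF a(2)] by (simp add: BijGroup_def)
    qed
  qed
qed

context loop_objects
begin

lemma susp_Ob: "K \<in> Ob M \<Longrightarrow> susp r K \<in> Ob M"
  by (induction r) (simp_all add: susp_def)

lemma susp_Suc: "susp (Suc r) K = S1 (susp r K)"
  by (simp add: susp_def)

lemma carrier_Hgrp: "carrier (Hgrp X r K B) = homset H (susp r K) B"
  and one_Hgrp: "\<one>\<^bsub>Hgrp X r K B\<^esub> = ho (Zero (susp r K) B)"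
  by (simp_all add: Hgrp_def HoC_eq Ho_eq)

lemma edge_map_mface: "edge_map X j K = mface j K"
  by (simp add: edge_map_def mface_def numeral_2_eq_2)

lemma mult_Hgrp: "a \<otimes>\<^bsub>Hgrp X (Suc r) K B\<^esub> b = gmult (susp r K) B a b"
  by (simp add: Hgrp_def gmult_def HoC_eq Ho_eq edge_map_mface numeral_2_eq_2 Let_def)

lemma group_Hgrp: "fibrant B \<Longrightarrow> K \<in> Ob M \<Longrightarrow> group (Hgrp X (Suc r) K B)"
  by (rule loop_group[OF _ susp_Ob]) (auto simp: carrier_Hgrp one_Hgrp susp_Suc mult_Hgrp)

lemma comm_group_Hgrp: "fibrant B \<Longrightarrow> K \<in> Ob M \<Longrightarrow> comm_group (Hgrp X (Suc (Suc r)) K B)"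
  by (rule group.group_comm_groupI[OF group_Hgrp])
    (auto simp: carrier_Hgrp susp_Suc mult_Hgrp intro: gmult_commute susp_Ob)

end

section \<open>One stage of the extended exact couple from one fibration\<close>

context loop_fibration
begin

lemma stage:
  assumes K: "K \<in> Ob M"
  shows "extended_exact_stage (\<lambda>r. Hgrp X r K E) (\<lambda>r. Hgrp X r K B) (\<lambda>r. Hgrp X r K F)
    (\<lambda>r. Cmp H (ho p)) (\<lambda>r. bd (susp r K)) (\<lambda>r. Cmp H (ho i))"
proof -
  note s = susp_Ob[OF K]
  have s0: "susp 0 K = K" by (simp add: susp_def)
  have pz: "Cmp H (ho p) (ho (Zero L E)) = ho (Zero L B)" and iz: "Cmp H (ho i) (ho (Zero L F)) = ho (Zero L E)"
    and bz: "bd L (ho (Zero (S1 L) B)) = ho (Zero L F)" if L: "L \<in> Ob M" for L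
    using loc.q_comp[OF Zero_hom[OF L EBF_Ob(1)] p_hom] comp_zero[OF p_hom L]
      loc.q_comp[OF Zero_hom[OF L EBF_Ob(3)] i_hom] i_zero[OF L] bd_eq[OF lifted_zero[OF Zero_hom[OF L EBF_Ob(3)]]] by simp_all
  have pc: "Cmp H (ho p) x \<in> homset H L B" if "x \<in> homset H L E" for x L by (rule loc.comp_hom_L[OF that loc.q_hom[OF p_hom]])
  have ic: "Cmp H (ho i) x \<in> homset H L E" if "x \<in> homset H L F" for x L by (rule loc.comp_hom_L[OF that loc.q_hom[OF i_hom]])
  have zc: "ho (Zero L A) \<in> homset H L A" if "L \<in> Ob M" "A \<in> Ob M" for L A by (rule loc.q_hom[OF Zero_hom[OF that]])
  have ex: "\<exists>r'. r = Suc r'" if "1 \<le> r" for r :: nat using that by (cases r) auto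
  have ex2: "\<exists>r'. r = Suc (Suc r')" if "2 \<le> r" for r :: nat
    using that by (auto simp: numeral_2_eq_2 Suc_le_eq dest!: less_imp_Suc_add)
  have action: "\<exists>\<alpha>. group_action (Hgrp X 1 K B) (carrier (Hgrp X 0 K F)) \<alpha> \<and>
      (\<forall>a\<in>carrier (Hgrp X 1 K B). bd (susp 0 K) a = \<alpha> a \<one>\<^bsub>Hgrp X 0 K F\<^esub>) \<and>
      (\<forall>x\<in>carrier (Hgrp X 0 K F). \<forall>y\<in>carrier (Hgrp X 0 K F).
         Cmp H (ho i) x = Cmp H (ho i) y \<longleftrightarrow> (\<exists>a\<in>carrier (Hgrp X 1 K B). y = \<alpha> a x))"
  proof (intro exI conjI ballI)
    have c1: "carrier (Hgrp X 1 K B) = homset H (S1 K) B" by (simp add: carrier_Hgrp susp_Suc s0)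
    have c0: "carrier (Hgrp X 0 K F) = homset H K F" by (simp add: carrier_Hgrp s0)
    have one1: "\<one>\<^bsub>Hgrp X 1 K B\<^esub> = ho (Zero (S1 K) B)" by (simp add: one_Hgrp susp_Suc s0)
    have one0: "\<one>\<^bsub>Hgrp X 0 K F\<^esub> = ho (Zero K F)" by (simp add: one_Hgrp s0)
    have rep: thesis if a: "a \<in> homset H (S1 K) B" and t: "t \<in> homset H K F"
      and C: "\<And>x d e. a = ho x \<Longrightarrow> t = ho d \<Longrightarrow> lifted K x d e \<Longrightarrow> x \<in> Hom (S1 K) B \<Longrightarrow> d \<in> Hom K F \<Longrightarrow> e \<in> Hom K F \<Longrightarrow> act K a t = ho e \<Longrightarrow> thesis" for a t thesis
    proof -
      obtain x where x: "x \<in> Hom (S1 K) B" "a = ho x" by (rule ho_surj[OF B a])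
      obtain d where d: "d \<in> Hom K F" "t = ho d" by (rule ho_surj[OF F t])
      obtain e where e: "lifted K x d e" by (rule lifted_exists[OF x(1) d(1)])
      then have "e \<in> Hom K F" by (simp add: lifted_def)
      then show ?thesis using C[OF x(2) d(2) e x(1) d(1)] act_eq[OF e] x(2) d(2) by simp
    qed
    show "group_action (Hgrp X 1 K B) (carrier (Hgrp X 0 K F)) (\<lambda>a. restrict (act K a) (carrier (Hgrp X 0 K F)))"
      unfolding c0
    proof (rule group_actionI)
      show "group (Hgrp X 1 K B)" using group_Hgrp[OF B K, of 0] by simp
      fix a t assume "a \<in> carrier (Hgrp X 1 K B)" and t: "t \<in> homset H K F"
      then have a: "a \<in> homset H (S1 K) B" using c1 by simp
      show "act K a t \<in> homset H K F" by (rule rep[OF a t]) (use loc.q_hom in simp)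
    next
      fix t assume t: "t \<in> homset H K F"
      obtain d where d: "d \<in> Hom K F" "t = ho d" by (rule ho_surj[OF F t])
      show "act K \<one>\<^bsub>Hgrp X 1 K B\<^esub> t = t" using act_eq[OF lifted_zero[OF d(1)]] d(2) by (simp only: one1)
    next
      fix a b t assume a: "a \<in> carrier (Hgrp X 1 K B)" "b \<in> carrier (Hgrp X 1 K B)" and t: "t \<in> homset H K F"
      obtain x y z where m: "a = ho x" "b = ho z" "tri K B x y z" "gmult K B a b = ho y" "x \<in> Hom (S1 K) B" "y \<in> Hom (S1 K) B" "z \<in> Hom (S1 K) B"
        by (rule gmult_mem[OF B K a[unfolded c1]])
      obtain d where d: "d \<in> Hom K F" "t = ho d" by (rule ho_surj[OF F t])
      obtain e where e: "lifted K z d e" by (rule lifted_exists[OF m(7) d(1)])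
      then have "e \<in> Hom K F" by (simp add: lifted_def)
      then obtain e' where e': "lifted K x e e'" by (rule lifted_exists[OF m(5)])
      have "a \<otimes>\<^bsub>Hgrp X 1 K B\<^esub> b = ho y" using mult_Hgrp[where r = 0 and K = K and B = B] m(4) by (simp add: s0)
      then show "act K (a \<otimes>\<^bsub>Hgrp X 1 K B\<^esub> b) t = act K a (act K b t)"
        using act_eq[OF e] act_eq[OF e'] act_eq[OF lifted_tri[OF m(3) e e']] m(1,2) d(2) by simp
    qed
    show "bd (susp 0 K) a = restrict (act K a) (carrier (Hgrp X 0 K F)) \<one>\<^bsub>Hgrp X 0 K F\<^esub>" if a: "a \<in> carrier (Hgrp X 1 K B)" for a
    proof -
      obtain x d where x: "x \<in> Hom (S1 K) B" "a = ho x" "d \<in> Hom K F" "lifted K x (Zero K F) d" "bd K a = ho d"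
        by (rule bd_obtain[OF K a[unfolded c1]])
      show ?thesis using act_eq[OF x(4)] x(2,5) zc[OF K EBF_Ob(3)] by (simp add: c0 one0 s0)
    qed
    fix t t' assume "t \<in> carrier (Hgrp X 0 K F)" "t' \<in> carrier (Hgrp X 0 K F)"
    then have t: "t \<in> homset H K F" "t' \<in> homset H K F" by (simp_all add: c0)
    obtain d where d: "d \<in> Hom K F" "t = ho d" by (rule ho_surj[OF F t(1)])
    obtain d' where d': "d' \<in> Hom K F" "t' = ho d'" by (rule ho_surj[OF F t(2)])
    have "Cmp H (ho i) t = Cmp H (ho i) t' \<longleftrightarrow> ho (i \<cdot> d) = ho (i \<cdot> d')"
      using loc.q_comp[OF d(1) i_hom] loc.q_comp[OF d'(1) i_hom] d(2) d'(2) by simp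
    also have "\<dots> \<longleftrightarrow> (\<exists>a\<in>homset H (S1 K) B. t' = act K a t)"
    proof
      assume "ho (i \<cdot> d) = ho (i \<cdot> d')"
      then obtain x where x: "lifted K x d d'" using same_orbit[OF d(1) d'(1)] by auto
      then have "x \<in> Hom (S1 K) B" by (simp add: lifted_def)
      then show "\<exists>a\<in>homset H (S1 K) B. t' = act K a t" using act_eq[OF x] d(2) d'(2) loc.q_hom by (intro bexI[of _ "ho x"]) simp_all
    next
      assume "\<exists>a\<in>homset H (S1 K) B. t' = act K a t"
      then obtain a where a: "a \<in> homset H (S1 K) B" "t' = act K a t" by (elim bexE)
      obtain x where x: "x \<in> Hom (S1 K) B" "a = ho x" by (rule ho_surj[OF B a(1)])
      obtain e where e: "lifted K x d e" by (rule lifted_exists[OF x(1) d(1)])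
      then have eh: "e \<in> Hom K F" by (simp add: lifted_def)
      have "ho d' = ho e" using act_eq[OF e] a(2) x(2) d(2) d'(2) by simp
      then have "ho (i \<cdot> d') = ho (i \<cdot> e)" using loc.q_comp[OF d'(1) i_hom] loc.q_comp[OF eh i_hom] by simp
      moreover have "ho (i \<cdot> d) = ho (i \<cdot> e)" using same_orbit[OF d(1) eh] e by blast
      ultimately show "ho (i \<cdot> d) = ho (i \<cdot> d')" by simp
    qed
    finally show "Cmp H (ho i) t = Cmp H (ho i) t' \<longleftrightarrow>
        (\<exists>a\<in>carrier (Hgrp X 1 K B). t' = restrict (act K a) (carrier (Hgrp X 0 K F)) t)"
      using t(1) by (simp add: c0 c1[unfolded One_nat_def])
  qed
  have homs: "Cmp H (ho p) \<in> hom (Hgrp X r K E) (Hgrp X r K B) \<and> bd (susp r K) \<in> hom (Hgrp X (Suc r) K B) (Hgrp X r K F) \<and>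
      Cmp H (ho i) \<in> hom (Hgrp X r K F) (Hgrp X r K E)" if "1 \<le> r" for r
  proof -
    obtain r' where r: "r = Suc r'" using ex[OF \<open>1 \<le> r\<close>] by blast
    show ?thesis
      unfolding r
    proof (intro conjI homI)
      show "Cmp H (ho p) x \<in> carrier (Hgrp X (Suc r') K B)" if "x \<in> carrier (Hgrp X (Suc r') K E)" for x
        using that pc by (simp add: carrier_Hgrp)
      show "Cmp H (ho i) x \<in> carrier (Hgrp X (Suc r') K E)" if "x \<in> carrier (Hgrp X (Suc r') K F)" for x
        using that ic by (simp add: carrier_Hgrp)
      show "bd (susp (Suc r') K) x \<in> carrier (Hgrp X (Suc r') K F)" if "x \<in> carrier (Hgrp X (Suc (Suc r')) K B)" for x
        using that bd_hom[OF s[of "Suc r'"]] by (simp add: carrier_Hgrp susp_Suc)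
      show "Cmp H (ho p) (x \<otimes>\<^bsub>Hgrp X (Suc r') K E\<^esub> y) = Cmp H (ho p) x \<otimes>\<^bsub>Hgrp X (Suc r') K B\<^esub> Cmp H (ho p) y"
        if "x \<in> carrier (Hgrp X (Suc r') K E)" "y \<in> carrier (Hgrp X (Suc r') K E)" for x y
        using that gmult_post[OF E B s p_hom] by (simp add: carrier_Hgrp susp_Suc mult_Hgrp)
      show "Cmp H (ho i) (x \<otimes>\<^bsub>Hgrp X (Suc r') K F\<^esub> y) = Cmp H (ho i) x \<otimes>\<^bsub>Hgrp X (Suc r') K E\<^esub> Cmp H (ho i) y"
        if "x \<in> carrier (Hgrp X (Suc r') K F)" "y \<in> carrier (Hgrp X (Suc r') K F)" for x y
        using that gmult_post[OF F E s i_hom] by (simp add: carrier_Hgrp susp_Suc mult_Hgrp)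
      show "bd (susp (Suc r') K) (x \<otimes>\<^bsub>Hgrp X (Suc (Suc r')) K B\<^esub> y) =
          bd (susp (Suc r') K) x \<otimes>\<^bsub>Hgrp X (Suc r') K F\<^esub> bd (susp (Suc r') K) y"
        if "x \<in> carrier (Hgrp X (Suc (Suc r')) K B)" "y \<in> carrier (Hgrp X (Suc (Suc r')) K B)" for x y
        using that bd_gmult[OF s] by (simp add: carrier_Hgrp susp_Suc mult_Hgrp)
    qed
  qed
  show ?thesis
    unfolding extended_exact_stage_def
  proof (intro conjI allI impI)
    fix r :: nat assume "1 \<le> r"
    then obtain r' where r: "r = Suc r'" using ex by blast
    show "group (Hgrp X r K E)" "group (Hgrp X r K B)" "group (Hgrp X r K F)"
      unfolding r using group_Hgrp K E B F by blast+
    show "Cmp H (ho p) \<in> hom (Hgrp X r K E) (Hgrp X r K B)" "bd (susp r K) \<in> hom (Hgrp X (Suc r) K B) (Hgrp X r K F)"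
      "Cmp H (ho i) \<in> hom (Hgrp X r K F) (Hgrp X r K E)" using homs[OF \<open>1 \<le> r\<close>] by blast+
  next
    fix r :: nat assume "2 \<le> r"
    then obtain r' where r: "r = Suc (Suc r')" using ex2 by blast
    show "comm_group (Hgrp X r K E)" "comm_group (Hgrp X r K B)" "comm_group (Hgrp X r K F)"
      unfolding r using comm_group_Hgrp K E B F by blast+
  next
    show "\<one>\<^bsub>Hgrp X 0 K E\<^esub> \<in> carrier (Hgrp X 0 K E)" "\<one>\<^bsub>Hgrp X 0 K B\<^esub> \<in> carrier (Hgrp X 0 K B)" "\<one>\<^bsub>Hgrp X 0 K F\<^esub> \<in> carrier (Hgrp X 0 K F)"
      using zc[OF s] EBF_Ob by (simp_all add: carrier_Hgrp one_Hgrp)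
    show "pointed_map (Hgrp X 0 K E) (Hgrp X 0 K B) (Cmp H (ho p))" "pointed_map (Hgrp X 0 K F) (Hgrp X 0 K E) (Cmp H (ho i))"
      using pz[OF s] iz[OF s] pc ic by (simp_all add: pointed_map_def carrier_Hgrp one_Hgrp)
    show "pointed_map (Hgrp X 1 K B) (Hgrp X 0 K F) (bd (susp 0 K))"
      using bz[OF K] bd_hom[OF K] by (simp add: pointed_map_def carrier_Hgrp one_Hgrp susp_Suc s0)
    show "\<forall>x\<in>bd (susp 1 K) ` carrier (Hgrp X 2 K B). \<forall>y\<in>carrier (Hgrp X 1 K F). x \<otimes>\<^bsub>Hgrp X 1 K F\<^esub> y = y \<otimes>\<^bsub>Hgrp X 1 K F\<^esub> x"
      using bd_central[OF K] mult_Hgrp[where r = 0 and K = K and B = F] by (simp add: carrier_Hgrp susp_Suc s0 numeral_2_eq_2)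
  next
    fix r
    show "Cmp H (ho i) ` carrier (Hgrp X r K F) = ker_of (Hgrp X r K E) (Hgrp X r K B) (Cmp H (ho p))"
      using exact_E[OF s] by (simp add: ker_of_def carrier_Hgrp one_Hgrp)
    show "bd (susp r K) ` carrier (Hgrp X (Suc r) K B) = ker_of (Hgrp X r K F) (Hgrp X r K E) (Cmp H (ho i))"
      using exact_F[OF s] by (simp add: ker_of_def carrier_Hgrp one_Hgrp susp_Suc)
    show "Cmp H (ho p) ` carrier (Hgrp X (Suc r) K E) = ker_of (Hgrp X (Suc r) K B) (Hgrp X r K F) (bd (susp r K))"
      using exact_B[OF s] by (simp add: ker_of_def carrier_Hgrp one_Hgrp susp_Suc)
  qed (rule action)
qed

end

section \<open>Weak equivalences and isomorphisms\<close>

abbreviation real_rel :: "'s sset \<Rightarrow> (nat \<times> 's \<times> (nat \<Rightarrow> real)) rel" where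
  "real_rel S \<equiv> (real_step S \<union> (real_step S)\<inverse>)\<^sup>*"

section \<open>Simplicial maps induce continuous maps of realizations\<close>

lemma real_class_eq_iff: "real_class S z = real_class S z' \<longleftrightarrow> (z, z') \<in> real_rel S"
proof -
  have "sym (real_rel S)" by (intro sym_rtrancl sym_Un_converse)
  then have "equiv UNIV (real_rel S)" by (intro equivI refl_rtrancl trans_rtrancl) simp
  then show ?thesis unfolding real_class_def by (rule eq_equiv_class_iff) simp_all
qed

lemma real_rel_map:
  assumes f: "is_smap S T f" and z: "((n, x, t), (n', x', t')) \<in> real_rel S"
  shows "((n, f n x, t), (n', f n' x', t')) \<in> real_rel T"
proof -
  define F :: "nat \<times> 'a \<times> (nat \<Rightarrow> real) \<Rightarrow> nat \<times> 'b \<times> (nat \<Rightarrow> real)" where "F = (\<lambda>(n, x, t). (n, f n x, t))"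
  have s: "(F z, F z') \<in> real_step T" if "(z, z') \<in> real_step S" for z z'
    using that f unfolding real_step_def is_smap_def F_def by fastforce
  have "(F z, F z') \<in> real_rel T" if "(z, z') \<in> real_rel S" for z z'
    using that
  proof (induction rule: rtrancl_induct)
    case (step y z)
    then have "(F y, F z) \<in> real_step T \<union> (real_step T)\<inverse>" using s[of y z] s[of z y] by (simp only: Un_iff converse_iff) blast
    with step(3) show ?case by (rule rtrancl.rtrancl_into_rtrancl)
  qed simp
  from this[OF z] show ?thesis by (simp add: F_def)
qed

lemma real_map_class:
  assumes f: "is_smap S T f" and z: "(n, x, t) \<in> real_points S"
  shows "real_map S T f (real_class S (n, x, t)) = real_class T (n, f n x, t)"
  unfolding real_map_def
proof (rule the_equality)
  show "\<exists>n' x' t'. (n', x', t') \<in> real_points S \<and> real_class S (n, x, t) = real_class S (n', x', t') \<and>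
      real_class T (n, f n x, t) = real_class T (n', f n' x', t')" using z by blast
next
  fix d assume "\<exists>n' x' t'. (n', x', t') \<in> real_points S \<and> real_class S (n, x, t) = real_class S (n', x', t') \<and>
      d = real_class T (n', f n' x', t')"
  then obtain n' x' t' where e: "real_class S (n, x, t) = real_class S (n', x', t')" and d: "d = real_class T (n', f n' x', t')"
    by (elim exE conjE)
  show "d = real_class T (n, f n x, t)"
    using real_rel_map[OF f e[unfolded real_class_eq_iff]] unfolding d real_class_eq_iff[symmetric] by (rule sym)
qed

text \<open>The predicate in the definition is a topology, since preimages along the characteristic
  maps of simplices commute with intersections and unions.\<close>

lemma openin_realization:
  "openin (realization S) U \<longleftrightarrow> U \<subseteq> real_class S ` real_points S \<and>
     (\<forall>n. \<forall>x\<in>Spx S n. openin (subtopology (powertop_real UNIV) (standard_simplex n))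
        {t \<in> standard_simplex n. real_class S (n, x, t) \<in> U})"
proof -
  let ?Q = "\<lambda>n x U. {t \<in> standard_simplex n. real_class S (n, x, t) \<in> U}"
  let ?O = "\<lambda>n. openin (subtopology (powertop_real UNIV) (standard_simplex n))"
  have I: "?Q n x (U \<inter> V) = ?Q n x U \<inter> ?Q n x V" for n x U V by blast
  have U: "?Q n x (\<Union>\<U>) = \<Union>(?Q n x ` \<U>)" for n x \<U> by blast
  have "?O n (\<Union>(?Q n x ` \<U>))" if "\<forall>U\<in>\<U>. ?O n (?Q n x U)" for n x \<U> using that by (intro openin_Union) blast
  then have "istopology (\<lambda>U. U \<subseteq> real_class S ` real_points S \<and> (\<forall>n. \<forall>x\<in>Spx S n. ?O n (?Q n x U)))"
    unfolding istopology_def U I by (simp add: openin_Int le_infI1 Union_least)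
  then show ?thesis unfolding realization_def by (simp add: topology_inverse')
qed

lemma topspace_realization: "topspace (realization S) = real_class S ` real_points S"
proof (rule antisym)
  show "topspace (realization S) \<subseteq> real_class S ` real_points S"
    using openin_realization[of S "topspace (realization S)"] by simp
  have "{t \<in> standard_simplex n. real_class S (n, x, t) \<in> real_class S ` real_points S} = standard_simplex n"
    if "x \<in> Spx S n" for n x using that by (auto simp: real_points_def)
  moreover have "openin (subtopology (powertop_real UNIV) (standard_simplex n)) (standard_simplex n)" for n
    using openin_topspace[of "subtopology (powertop_real UNIV) (standard_simplex n)"] by simp
  ultimately show "real_class S ` real_points S \<subseteq> topspace (realization S)"
    by (intro openin_subset) (simp add: openin_realization)
qed

lemma continuous_real_map:
  assumes f: "is_smap S T f"
  shows "continuous_map (realization S) (realization T) (real_map S T f)"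
  unfolding continuous_map
proof (intro conjI allI impI)
  have pts: "(n, x, t) \<in> real_points S \<Longrightarrow> (n, f n x, t) \<in> real_points T" for n x t
    using f by (auto simp: is_smap_def real_points_def)
  show "real_map S T f ` topspace (realization S) \<subseteq> topspace (realization T)"
    using real_map_class[OF f] pts by (fastforce simp: topspace_realization)
  fix U assume U: "openin (realization T) U"
  have "{t \<in> standard_simplex n. real_class S (n, x, t) \<in> {c \<in> topspace (realization S). real_map S T f c \<in> U}} =
      {t \<in> standard_simplex n. real_class T (n, f n x, t) \<in> U}" if "x \<in> Spx S n" for n x
    using that real_map_class[OF f, of n x] by (auto simp: topspace_realization real_points_def)
  moreover have "f n x \<in> Spx T n" if "x \<in> Spx S n" for n x using f that by (auto simp: is_smap_def)
  ultimately show "openin (realization S) {c \<in> topspace (realization S). real_map S T f c \<in> U}"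
    using U by (auto simp: openin_realization topspace_realization)
qed

section \<open>Homotopy sets under mutually inverse continuous maps\<close>

lemma cube_homotopic_cong:
  assumes "cube_homotopic n T x f g" "\<And>t. t \<in> cube n \<Longrightarrow> f' t = f t" "\<And>t. t \<in> cube n \<Longrightarrow> g' t = g t"
  shows "cube_homotopic n T x f' g'"
  using assms(1) unfolding cube_homotopic_def
  by (rule homotopic_with_eq) (use assms(2,3) in \<open>auto simp: cube_bd_def\<close>)

text \<open>The base point must be preserved only for positive \<open>n\<close>: the 0-cube has
  empty boundary, so there the condition on the boundary is void.\<close>

lemma pi_map_class:
  assumes h: "continuous_map T T' h" and x: "n = 0 \<or> h x = y" and \<alpha>: "cube_homotopic n T x \<alpha> \<alpha>"
  shows "pi_map n T' y h (Collect (cube_homotopic n T x \<alpha>)) = Collect (cube_homotopic n T' y (h \<circ> \<alpha>))"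
    and "cube_homotopic n T' y (h \<circ> \<alpha>) (h \<circ> \<alpha>)"
proof -
  have *: "cube_homotopic n T' y (h \<circ> \<beta>) (h \<circ> \<gamma>)" if "cube_homotopic n T x \<beta> \<gamma>" for \<beta> \<gamma>
    using that unfolding cube_homotopic_def
    by (rule homotopic_with_compose_continuous_map_left[OF _ h]) (use x in \<open>auto simp: cube_bd_def\<close>)
  show "cube_homotopic n T' y (h \<circ> \<alpha>) (h \<circ> \<alpha>)" by (rule *[OF \<alpha>])
  show "pi_map n T' y h (Collect (cube_homotopic n T x \<alpha>)) = Collect (cube_homotopic n T' y (h \<circ> \<alpha>))"
  proof (intro equalityI subsetI)
    fix \<beta> assume "\<beta> \<in> pi_map n T' y h (Collect (cube_homotopic n T x \<alpha>))"
    then obtain \<gamma> where "cube_homotopic n T x \<alpha> \<gamma>" "cube_homotopic n T' y (h \<circ> \<gamma>) \<beta>" by (auto simp: pi_map_def)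
    from homotopic_with_trans[OF *[OF this(1), unfolded cube_homotopic_def] this(2)[unfolded cube_homotopic_def]]
    show "\<beta> \<in> Collect (cube_homotopic n T' y (h \<circ> \<alpha>))" by (simp add: cube_homotopic_def)
  qed (use \<alpha> in \<open>auto simp: pi_map_def\<close>)
qed

lemma pi_map_bij:
  assumes h: "continuous_map T T' h" "continuous_map T' T h'"
    and inv: "\<And>a. a \<in> topspace T \<Longrightarrow> h' (h a) = a" "\<And>b. b \<in> topspace T' \<Longrightarrow> h (h' b) = b"
    and x: "n = 0 \<or> h x = y \<and> h' y = x"
  shows "bij_betw (pi_map n T' y h) (pi_set n T x) (pi_set n T' y)"
proof (rule bij_betw_byWitness[of _ "pi_map n T x h'"])
  \<comment> \<open>Stated for arbitrary spaces, so that it applies to both composites. The maps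
    invert each other only on the underlying spaces of the topologies, which is enough because
    representatives matter only on the cube.\<close>
  have retr: "pi_map n T x h' (pi_map n T' y h c) = c \<and> pi_map n T' y h c \<in> pi_set n T' y"
    if h: "continuous_map T T' h" "continuous_map T' T h'" and inv: "\<And>a. a \<in> topspace T \<Longrightarrow> h' (h a) = a"
      and x: "n = 0 \<or> h x = y" "n = 0 \<or> h' y = x" and c: "c \<in> pi_set n T x"
    for T :: "'u topology" and T' :: "'v topology" and h h' x y c
  proof -
    obtain \<alpha> where \<alpha>: "c = Collect (cube_homotopic n T x \<alpha>)" "cube_homotopic n T x \<alpha> \<alpha>" using c by (auto simp: pi_set_def)
    note 1 = pi_map_class[OF h(1) x(1) \<alpha>(2)] and 2 = pi_map_class[OF h(2) x(2) pi_map_class(2)[OF h(1) x(1) \<alpha>(2)]]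
    have "continuous_map (subtopology (powertop_real UNIV) (cube n)) T \<alpha>"
      using \<alpha>(2) by (simp add: cube_homotopic_def homotopic_with_imp_continuous_maps)
    then have e: "(h' \<circ> (h \<circ> \<alpha>)) t = \<alpha> t" if "t \<in> cube n" for t
      using that inv by (auto simp: continuous_map_def)
    have "cube_homotopic n T x (h' \<circ> (h \<circ> \<alpha>)) \<beta> \<longleftrightarrow> cube_homotopic n T x \<alpha> \<beta>" for \<beta>
      using cube_homotopic_cong[of n T x "h' \<circ> (h \<circ> \<alpha>)" \<beta> \<alpha> \<beta>] cube_homotopic_cong[of n T x \<alpha> \<beta> "h' \<circ> (h \<circ> \<alpha>)" \<beta>] e by auto
    then show ?thesis using 1 2 \<alpha>(1) by (auto simp: pi_set_def)
  qed
  show "\<forall>c\<in>pi_set n T x. pi_map n T x h' (pi_map n T' y h c) = c" "pi_map n T' y h ` pi_set n T x \<subseteq> pi_set n T' y"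
    using retr[OF h inv(1)] x by auto
  show "\<forall>c\<in>pi_set n T' y. pi_map n T' y h (pi_map n T x h' c) = c" "pi_map n T x h' ` pi_set n T' y \<subseteq> pi_set n T x"
    using retr[OF h(2,1) inv(2)] x by auto
qed

text \<open>Weak equivalences are defined through realizations, so composing with an isomorphism has
  to be carried through the homotopy sets. The use is in \<open>pMap_weak_equiv\<close>, where SM7
  yields a map into a pullback that is only isomorphic to the mapping space wanted.\<close>

lemma weak_equiv_iso:
  assumes w: "weak_equiv S T f" and f: "is_smap S T f" and g: "is_smap T T' g" "is_smap T' T g'"
    and inv: "\<And>n x. x \<in> Spx T n \<Longrightarrow> g' n (g n x) = x" "\<And>n x. x \<in> Spx T' n \<Longrightarrow> g n (g' n x) = x"
  shows "weak_equiv S T' (\<lambda>n x. g n (f n x))"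
  unfolding weak_equiv_def
proof (intro allI impI)
  fix n :: nat and x assume nx: "n = 0 \<or> x \<in> Spx S 0"
  let ?F = "real_map S T f" and ?G = "real_map T T' g" and ?G' = "real_map T' T g'"
  let ?gf = "\<lambda>n x. g n (f n x)"
  have gf: "is_smap S T' ?gf" using f g(1) by (auto simp: is_smap_def Pi_iff)
  have mem: "x \<in> Spx S n \<Longrightarrow> f n x \<in> Spx T n" "y \<in> Spx T n \<Longrightarrow> g n y \<in> Spx T' n" "y' \<in> Spx T' n \<Longrightarrow> g' n y' \<in> Spx T n" for n x y y'
    using f g by (auto simp: is_smap_def)
  have pt: "(n, f n x, t) \<in> real_points T" if "(n, x, t) \<in> real_points S" for n x t
    using that mem(1) by (simp add: real_points_def)
  have GF: "real_map S T' ?gf c = ?G (?F c)" if "c \<in> topspace (realization S)" for c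
    using that real_map_class[OF gf] real_map_class[OF f] real_map_class[OF g(1) pt] by (auto simp: topspace_realization)
  have i1: "?G' (?G c) = c" if "c \<in> topspace (realization T)" for c
    using that real_map_class[OF g(1)] real_map_class[OF g(2)] inv(1) mem(2)
    by (auto simp: topspace_realization real_points_def)
  have i2: "?G (?G' c) = c" if "c \<in> topspace (realization T')" for c
    using that real_map_class[OF g(1)] real_map_class[OF g(2)] inv(2) mem(3)
    by (auto simp: topspace_realization real_points_def)
  have v: "(\<lambda>i::nat. if i = 0 then 1 else 0 :: real) \<in> standard_simplex 0" by (auto simp: standard_simplex_def)
  have F0: "n = 0 \<or> ?F (real_vertex S x) = real_vertex T (f 0 x)"
    using nx real_map_class[OF f] v by (auto simp: real_vertex_def real_points_def)
  have G0: "n = 0 \<or> ?G (real_vertex T (f 0 x)) = real_vertex T' (g 0 (f 0 x)) \<and>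
      ?G' (real_vertex T' (g 0 (f 0 x))) = real_vertex T (f 0 x)"
    using nx real_map_class[OF g(1)] real_map_class[OF g(2)] mem inv(1) v by (auto simp: real_vertex_def real_points_def)
  have GF0: "n = 0 \<or> real_map S T' ?gf (real_vertex S x) = real_vertex T' (g 0 (f 0 x))"
    using nx real_map_class[OF gf] v by (auto simp: real_vertex_def real_points_def)
  note cF = continuous_real_map[OF f] and cG = continuous_real_map[OF g(1)] and cG' = continuous_real_map[OF g(2)]
  have "bij_betw (pi_map n (realization T') (real_vertex T' (g 0 (f 0 x))) ?G \<circ>
      spi_map n S T (f 0 x) f) (spi n S x) (spi n T' (g 0 (f 0 x)))"
  proof (rule bij_betw_trans)
    show "bij_betw (spi_map n S T (f 0 x) f) (spi n S x) (spi n T (f 0 x))" using w nx by (auto simp: weak_equiv_def)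
    show "bij_betw (pi_map n (realization T') (real_vertex T' (g 0 (f 0 x))) ?G) (spi n T (f 0 x)) (spi n T' (g 0 (f 0 x)))"
      unfolding spi_def by (rule pi_map_bij[OF cG cG' i1 i2 G0])
  qed
  moreover have "spi_map n S T' (g 0 (f 0 x)) ?gf c =
      (pi_map n (realization T') (real_vertex T' (g 0 (f 0 x))) ?G \<circ> spi_map n S T (f 0 x) f) c" if c: "c \<in> spi n S x" for c
  proof -
    obtain \<alpha> where \<alpha>: "c = Collect (cube_homotopic n (realization S) (real_vertex S x) \<alpha>)"
      "cube_homotopic n (realization S) (real_vertex S x) \<alpha> \<alpha>" using c by (auto simp: spi_def pi_set_def)
    have "continuous_map (subtopology (powertop_real UNIV) (cube n)) (realization S) \<alpha>"
      using \<alpha>(2) by (simp add: cube_homotopic_def homotopic_with_imp_continuous_maps)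
    then have e: "(real_map S T' ?gf \<circ> \<alpha>) t = (?G \<circ> (?F \<circ> \<alpha>)) t" if "t \<in> cube n" for t
      using that GF by (auto simp: continuous_map_def)
    define y' where "y' = real_vertex T' (g 0 (f 0 x))"
    have "Collect (cube_homotopic n (realization T') y' (real_map S T' ?gf \<circ> \<alpha>)) =
        Collect (cube_homotopic n (realization T') y' (?G \<circ> (?F \<circ> \<alpha>)))"
      by (intro Collect_cong iffI; elim cube_homotopic_cong; use e in simp)
    moreover have "n = 0 \<or> ?G (real_vertex T (f 0 x)) = y'" using G0 by (auto simp: y'_def)
    ultimately show ?thesis
      using pi_map_class(1)[OF continuous_real_map[OF gf] GF0 \<alpha>(2)] pi_map_class(1)[OF cF F0 \<alpha>(2)]
        pi_map_class(1)[OF cG _ pi_map_class(2)[OF cF F0 \<alpha>(2)], of y'] \<alpha>(1)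
      by (simp add: spi_map_def y'_def)
  qed
  ultimately show "bij_betw (spi_map n S T' (g 0 (f 0 x)) ?gf) (spi n S x) (spi n T' (g 0 (f 0 x)))"
    by (simp cong: bij_betw_cong)
qed

section \<open>The tower\<close>

context presheaf_model
begin

lemma fibrant_point: "fibrant point"
  by (rule fibrantI[OF point_Ob]) (metis Zero_hom comp_hom hom_Cod hom_point point_Ob)

lemma is_smap_pMap_pre:
  assumes j: "j \<in> Hom A A'"
  shows "is_smap (pMap X A' Z) (pMap X A Z) (pMap_pre X j)"
  unfolding is_smap_def
proof (intro conjI allI ballI)
  fix n show "pMap_pre X j n \<in> Spx (pMap X A' Z) n \<rightarrow> Spx (pMap X A Z) n"
    using comp_hom[OF smash_map_hom[OF pointed_plus j]] by (auto simp: pMap_def pMap_pre_def)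
next
  fix m n \<theta> \<sigma> assume t: "\<theta> \<in> Delta m n" and "\<sigma> \<in> Spx (pMap X A' Z) n"
  then have s: "\<sigma> \<in> Hom (smash (simplex_plus n) A') Z" by (simp add: pMap_def)
  have \<theta>: "pointed_smap (simplex_plus m) (simplex_plus n) (map \<theta>)"
    by (rule smap_plus) (use t in \<open>auto simp: Delta_def mono_on_def PiE_iff\<close>)
  note h = smash_left_hom[OF \<theta>] and k = smash_map_hom[OF pointed_plus j] and o = hom_Dom[OF j] hom_Cod[OF j]
  show "pMap_pre X j m (Op (pMap X A' Z) m n \<theta> \<sigma>) = Op (pMap X A Z) m n \<theta> (pMap_pre X j n \<sigma>)"
    using assoc[OF k h[OF o(2)] s] assoc[OF h[OF o(1)] k s] smash_left_natural[OF \<theta> j] by (simp add: pMap_def pMap_pre_def)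
qed

text \<open>Axiom SM7 for \<open>Z \<rightarrow> *\<close>.\<close>

lemma pMap_weak_equiv:
  assumes Z: "fibrant Z" and j: "j \<in> Cof" "j \<in> W"
  shows "weak_equiv (pMap X (Cod j) Z) (pMap X (Dom j) Z) (pMap_pre X j)"
proof -
  let ?z = "Zero Z point" and ?S = "pMap X (Cod j) Z"
  have jh: "j \<in> Hom (Dom j) (Cod j)" using j Cof_Ar by (auto simp: in_hom)
  note o = hom_Dom[OF jh] hom_Cod[OF jh] fibrant_Ob[OF Z]
  have z: "?z \<in> Fb" "?z \<in> Hom Z point" "Dom ?z = Z" "Cod ?z = point" using Z Zero_hom[OF o(3) point_Ob] by (simp_all add: fibrant_def in_hom)
  let ?T = "pMap_pullback X j ?z" and ?f = "\<lambda>n \<sigma>. (pMap_pre X j n \<sigma>, ?z \<cdot> \<sigma>)"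
  let ?g' = "\<lambda>n \<sigma>. (\<sigma>, Zero (smash (simplex_plus n) (Cod j)) point)"
  have "weak_equiv (pMap X (Cod j) (Dom ?z)) ?T ?f"
    using simplicial j z(1) by (auto simp: simplicial_model_def Let_def)
  then have w: "weak_equiv ?S ?T ?f" unfolding z(3) .
  note pre = is_smap_pMap_pre[OF jh, of Z]
  have pt: "\<sigma> = \<sigma>'" if "\<sigma> \<in> Hom L point" "\<sigma>' \<in> Hom L point" for \<sigma> \<sigma>' L using hom_point[OF that(1)] hom_point[OF that(2)] by simp
  have sO: "smash (simplex_plus n) A \<in> Ob M" if "A \<in> Ob M" for n A using that by simp
  have Op: "Op (pMap X A B) m n \<theta> \<sigma> \<in> Spx (pMap X A B) m" if "\<theta> \<in> Delta m n" "\<sigma> \<in> Spx (pMap X A B) n" "A \<in> Ob M" for A B m n \<theta> \<sigma>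
  proof -
    have "pointed_smap (simplex_plus m) (simplex_plus n) (map \<theta>)"
      by (rule smap_plus) (use that in \<open>auto simp: Delta_def mono_on_def PiE_iff\<close>)
    then show ?thesis using comp_hom[OF smash_left_hom[OF _ that(3)]] that(2) by (simp add: pMap_def)
  qed
  \<comment> \<open>The second component of a simplex of the pullback maps to \<open>point\<close>,
    so it is the zero map; hence \<open>fst\<close> is an isomorphism onto the mapping space out of
    \<open>Dom j\<close>.\<close>
  have T: "(a, b) \<in> Spx ?T n \<longleftrightarrow> a \<in> Spx (pMap X (Dom j) Z) n \<and> b = Zero (smash (simplex_plus n) (Cod j)) point" for a b n
  proof -
    have "?z \<cdot> a = pMap_pre X j n b" if "a \<in> Hom (smash (simplex_plus n) (Dom j)) Z" "b \<in> Hom (smash (simplex_plus n) (Cod j)) point"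
      using pt[OF comp_hom[OF that(1) z(2)] comp_hom[OF smash_map_hom[OF pointed_plus jh] that(2)]] by (simp add: pMap_pre_def)
    moreover have "b \<in> Hom (smash (simplex_plus n) (Cod j)) point \<longleftrightarrow> b = Zero (smash (simplex_plus n) (Cod j)) point"
      using hom_point Zero_hom[OF sO[OF o(2)] point_Ob] by blast
    ultimately show ?thesis by (auto simp: pMap_pullback_def pMap_def z)
  qed
  have OpT: "Op ?T m n \<theta> (a, b) = (Op (pMap X (Dom j) Z) m n \<theta> a, Zero (smash (simplex_plus m) (Cod j)) point)"
    if "\<theta> \<in> Delta m n" "(a, b) \<in> Spx ?T n" for m n \<theta> a b
  proof -
    have b: "b \<in> Spx (pMap X (Cod j) point) n" using that(2) Zero_hom[OF sO[OF o(2)] point_Ob] by (simp add: T) (simp add: pMap_def)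
    have "Op (pMap X (Cod j) point) m n \<theta> b = Zero (smash (simplex_plus m) (Cod j)) point"
      using Op[OF that(1) b o(2)] by (intro hom_point) (simp add: pMap_def)
    then show ?thesis by (simp add: pMap_pullback_def z)
  qed
  have zf: "?z \<cdot> \<sigma> = Zero (smash (simplex_plus n) (Cod j)) point" if "\<sigma> \<in> Spx ?S n" for \<sigma> n
    using that by (intro hom_point comp_hom[OF _ z(2)]) (simp add: pMap_def)
  have f: "is_smap ?S ?T ?f"
    unfolding is_smap_def
  proof (intro conjI allI ballI)
    show "?f n \<in> Spx ?S n \<rightarrow> Spx ?T n" for n using pre zf by (auto simp: is_smap_def T Pi_iff)
  next
    fix m n \<theta> \<sigma> assume a: "\<theta> \<in> Delta m n" "\<sigma> \<in> Spx ?S n"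
    have "?f n \<sigma> \<in> Spx ?T n" using pre zf a by (auto simp: is_smap_def T Pi_iff)
    from OpT[OF a(1) this] zf[OF Op[OF a o(2)]] pre a
    show "?f m (Op ?S m n \<theta> \<sigma>) = Op ?T m n \<theta> (?f n \<sigma>)" by (simp add: is_smap_def)
  qed
  have g: "is_smap ?T (pMap X (Dom j) Z) (\<lambda>n. fst)"
    unfolding is_smap_def by (auto simp: T OpT)
  have g': "is_smap (pMap X (Dom j) Z) ?T ?g'"
    unfolding is_smap_def using OpT Op[OF _ _ o(1)] by (auto simp: T)
  show ?thesis using weak_equiv_iso[OF w f g g'] by (simp add: T split_paired_all)
qed

end

context motivic_presheaves
begin

text \<open>Local objects are motivically fibrant, so by \<open>pMap_weak_equiv\<close> every
  motivic trivial cofibration is also a local one. Lifting against the larger class is the stronger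
  property.\<close>

lemma local_fib_Fb: "local_fib X V \<subseteq> Fb"
proof -
  have "Cof \<inter> W \<subseteq> local_weq X V"
  proof
    fix j assume j: "j \<in> Cof \<inter> W"
    have "weak_equiv (pMap X (Cod j) Z) (pMap X (Dom j) Z) (pMap_pre X j)" if "local_object X V Z" for Z
    proof -
      have "fibrant Z" using that by (simp add: local_object_def is_fibrant_def motivic_fib_def fibrant_def W_eq[symmetric])
      then show ?thesis by (rule pMap_weak_equiv) (use j in auto)
    qed
    then show "j \<in> local_weq X V" using j Cof_Ar by (auto simp: local_weq_def)
  qed
  then show ?thesis by (auto simp: local_fib_def rlp_def)
qed

end

locale loop_tower = loop_objects X W \<Omega> \<epsilon>
  for X :: "('a, 'a) rspace" and W :: "('a, 'b) parr set"
    and \<Omega> :: "('a, 'b) pspsh \<Rightarrow> ('a, 'b) pspsh" and \<epsilon> :: "('a, 'b) pspsh \<Rightarrow> ('a, 'b) harr" +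
  fixes \<Phi> :: "nat \<Rightarrow> ('a, 'b) parr \<Rightarrow> ('a, 'b) parr \<times> ('a, 'b) parr"
    and \<Psi> :: "nat \<Rightarrow> ('a, 'b) parr \<Rightarrow> ('a, 'b) parr \<Rightarrow> ('a, 'b) parr \<Rightarrow> ('a, 'b) parr \<Rightarrow> ('a, 'b) parr"
    and A K :: "('a, 'b) pspsh"
  assumes factor: "\<And>n. functorial_factorization (psPre X) (monomorphisms (psPre X) \<inter> local_weq X (WB X n))
      (local_fib X (WB X n)) (\<Phi> n) (\<Psi> n)"
    and A: "A \<in> Ob M" and K: "K \<in> Ob M"
begin

abbreviation "T n \<equiv> tau X \<Phi> A n"
abbreviation "N n \<equiv> nu X \<Phi> A n"

section \<open>The tower consists of fibrations between fibrant objects\<close>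

lemma factorization: "f \<in> Ar M \<Longrightarrow> fst (\<Phi> n f) \<in> Cof \<and> snd (\<Phi> n f) \<in> Fb \<and>
    Dom (snd (\<Phi> n f)) = Cod (fst (\<Phi> n f)) \<and> Cod (snd (\<Phi> n f)) = Cod f"
  using factor[of n] local_fib_Fb unfolding functorial_factorization_def by blast

lemma tau_le_Ar: "tau_le X \<Phi> A n \<in> Ar M"
proof (induction n)
  case 0
  show ?case using Zero_hom[OF A point_Ob] by (simp add: in_hom)
next
  case (Suc n)
  then show ?case using factorization[OF Suc, of n] Cof_Ar by auto
qed

lemma nu_Fb: "N n \<in> Fb" and nu_hom: "N n \<in> Hom (T (Suc n)) (T n)"
  using factorization[OF tau_le_Ar[of n], of n] by (auto simp: nu_def tau_def in_hom rlp_def)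

lemma tau_fibrant: "fibrant (T n)"
proof (induction n)
  case 0
  show ?case using fibrant_point by (simp add: tau_def zero_map_def)
next
  case (Suc n)
  show ?case by (rule fibrant_total[OF nu_Fb nu_hom Suc])
qed

lemma Hgrp_point: "carrier (Hgrp X r K point) = {\<one>\<^bsub>Hgrp X r K point\<^esub>}"
proof -
  have "x = ho (Zero (susp r K) point)" if x: "x \<in> homset H (susp r K) point" for x
  proof -
    obtain a where a: "a \<in> Hom (susp r K) point" "x = ho a" by (rule ho_surj[OF fibrant_point x])
    then show ?thesis using hom_point by blast
  qed
  then show ?thesis using loc.q_hom[OF Zero_hom[OF susp_Ob[OF K] point_Ob]] by (auto simp: carrier_Hgrp one_Hgrp)
qed

text \<open>The sequence of the map from \<open>B\<close> to \<open>point\<close>, whose fibre is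
  all of \<open>B\<close>: the maps to and from the column of \<open>point\<close> are trivial,
  \<open>h\<close> is the identity, and the trivial group acts trivially.\<close>

lemma bottom_stage:
  assumes B: "fibrant B"
  shows "extended_exact_stage (\<lambda>r. Hgrp X r K B) (\<lambda>r. Hgrp X r K point) (\<lambda>r. Hgrp X r K B)
    (\<lambda>r _. \<one>\<^bsub>Hgrp X r K point\<^esub>) (\<lambda>r _. \<one>\<^bsub>Hgrp X r K B\<^esub>) (\<lambda>r x. x)"
proof -
  note g = group_Hgrp[OF _ K] and gc = comm_group_Hgrp[OF _ K] and P = fibrant_point
  have oB: "\<one>\<^bsub>Hgrp X r K B\<^esub> \<in> carrier (Hgrp X r K B)" for r
    using loc.q_hom[OF Zero_hom[OF susp_Ob[OF K] fibrant_Ob[OF B]]] by (simp add: carrier_Hgrp one_Hgrp)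
  have oP: "\<one>\<^bsub>Hgrp X r K point\<^esub> \<in> carrier (Hgrp X r K point)" for r using Hgrp_point by simp
  have G: "group (Hgrp X r K B)" "group (Hgrp X r K point)" if "1 \<le> r" for r
    using that g[OF B, of "r - 1"] g[OF P, of "r - 1"] by simp_all
  have C: "comm_group (Hgrp X r K B)" "comm_group (Hgrp X r K point)" if "2 \<le> r" for r
  proof -
    have "r = Suc (Suc (r - 2))" using that by simp
    then show "comm_group (Hgrp X r K B)" "comm_group (Hgrp X r K point)"
      using gc[OF B, of "r - 2"] gc[OF P, of "r - 2"] by simp_all
  qed
  have one: "(\<lambda>_. \<one>\<^bsub>G'\<^esub>) \<in> hom G G'" if "group G'" for G :: "('a, 'b) harr monoid" and G' :: "('a, 'b) harr monoid"
  proof -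
    interpret group G' by (rule that)
    show ?thesis by (simp add: hom_def)
  qed
  have idh: "(\<lambda>x. x) \<in> hom G G" for G :: "('a, 'b) harr monoid" by (simp add: hom_def)
  have c: "\<one>\<^bsub>Hgrp X 1 K B\<^esub> \<otimes>\<^bsub>Hgrp X 1 K B\<^esub> y = y \<otimes>\<^bsub>Hgrp X 1 K B\<^esub> \<one>\<^bsub>Hgrp X 1 K B\<^esub>" if "y \<in> carrier (Hgrp X 1 K B)" for y
  proof -
    interpret group "Hgrp X 1 K B" by (rule G) simp
    show ?thesis using that by (simp del: One_nat_def)
  qed
  define act where "act = (\<lambda>a :: ('a, 'b) harr. restrict (\<lambda>x :: ('a, 'b) harr. x) (carrier (Hgrp X 0 K B)))"
  have act: "group_action (Hgrp X 1 K point) (carrier (Hgrp X 0 K B)) act"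
    unfolding act_def by (rule group_actionI[OF G(2)]) simp_all
  show ?thesis
    unfolding extended_exact_stage_def
  proof (intro conjI allI impI)
    show "\<exists>act. group_action (Hgrp X 1 K point) (carrier (Hgrp X 0 K B)) act \<and>
        (\<forall>a\<in>carrier (Hgrp X 1 K point). \<one>\<^bsub>Hgrp X 0 K B\<^esub> = act a \<one>\<^bsub>Hgrp X 0 K B\<^esub>) \<and>
        (\<forall>x\<in>carrier (Hgrp X 0 K B). \<forall>y\<in>carrier (Hgrp X 0 K B). x = y \<longleftrightarrow> (\<exists>a\<in>carrier (Hgrp X 1 K point). y = act a x))"
      using act oB oP[of 1] by (intro exI[of _ act]) (auto simp: act_def)
  next
    show "(\<lambda>_. \<one>\<^bsub>Hgrp X (Suc r) K point\<^esub>) ` carrier (Hgrp X (Suc r) K B) =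
        ker_of (Hgrp X (Suc r) K point) (Hgrp X r K B) (\<lambda>_. \<one>\<^bsub>Hgrp X r K B\<^esub>)" for r
      using oB[of "Suc r"] Hgrp_point[of "Suc r"] by (auto simp: ker_of_def)
  qed (use G C one idh c oB oP Hgrp_point in \<open>auto simp: pointed_map_def ker_of_def simp del: One_nat_def\<close>)
qed

text \<open>Column \<open>p\<close> of \<open>D1\<close> belongs to \<open>T (Suc p)\<close>, so the
  fibration \<open>N (Suc p)\<close> relates the columns \<open>p + 1\<close> and \<open>p\<close>.
  The second index \<open>Suc p + r\<close> of \<open>g1\<close> makes the degree of its target
  \<open>q - p - 1 = r\<close>.\<close>

lemma tower_stage:
  "extended_exact_stage (\<lambda>r. Hgrp X r K (T (Suc (Suc p)))) (\<lambda>r. Hgrp X r K (T (Suc p)))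
     (\<lambda>r. Hgrp X r K (sfib X \<Phi> A (Suc p))) (\<lambda>r. f1 X \<Phi> A p (p + r))
     (\<lambda>r. g1 X \<Phi> \<Omega> \<epsilon> K A p (Suc p + r)) (\<lambda>r. h1 X \<Phi> A (Suc p) (Suc p + r))"
proof -
  interpret F: loop_fibration X W \<Omega> \<epsilon> "N (Suc p)" "T (Suc (Suc p))" "T (Suc p)"
    by standard (rule nu_Fb nu_hom tau_fibrant)+
  have "f1 X \<Phi> A p (p + r) = Cmp H (ho (N (Suc p)))" for r by (simp add: f1_def HoC_eq Ho_eq fun_eq_iff)
  moreover have "g1 X \<Phi> \<Omega> \<epsilon> K A p (Suc p + r) = F.bd (susp r K)" for r
    by (simp add: g1_def F.bd_def sincl_def Let_def HoC_eq fun_eq_iff)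
  moreover have "h1 X \<Phi> A (Suc p) (Suc p + r) = Cmp H (ho (fibre_incl X (N (Suc p))))" for r
    by (simp add: h1_def sincl_def HoC_eq Ho_eq fun_eq_iff)
  ultimately show ?thesis using F.stage[OF K] by (simp add: sfib_def)
qed

lemma exact_couple:
  "extended_exact_couple (\<lambda>r. Hgrp X r K point) (D1 X \<Phi> K A) (E1 X \<Phi> K A)
     (f1 X \<Phi> A) (g1 X \<Phi> \<Omega> \<epsilon> K A) (h1 X \<Phi> A)"
  unfolding extended_exact_couple_def
proof (intro conjI allI impI)
  show "carrier (Hgrp X r K point) = {\<one>\<^bsub>Hgrp X r K point\<^esub>}" for r by (rule Hgrp_point)
  have "h1 X \<Phi> A 0 r = (\<lambda>x. x)" for r by (simp add: h1_def fun_eq_iff)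
  then show "extended_exact_stage (\<lambda>r. D1 X \<Phi> K A 0 r) (\<lambda>r. Hgrp X r K point) (\<lambda>r. E1 X \<Phi> K A 0 r)
      (\<lambda>r _. \<one>\<^bsub>Hgrp X r K point\<^esub>) (\<lambda>r _. \<one>\<^bsub>E1 X \<Phi> K A 0 r\<^esub>) (\<lambda>r. h1 X \<Phi> A 0 r)"
    using bottom_stage[OF tau_fibrant[of 1]] by (simp add: D1_def E1_def sfib_def)
next
  fix p :: nat assume "1 \<le> p"
  then obtain p' where p: "p = Suc p'" by (cases p) auto
  show "extended_exact_stage (\<lambda>r. D1 X \<Phi> K A p (p + r)) (\<lambda>r. D1 X \<Phi> K A (p - 1) (p - 1 + r)) (\<lambda>r. E1 X \<Phi> K A p (p + r))
      (\<lambda>r. f1 X \<Phi> A (p - 1) (p - 1 + r)) (\<lambda>r. g1 X \<Phi> \<Omega> \<epsilon> K A (p - 1) (p + r)) (\<lambda>r. h1 X \<Phi> A p (p + r))"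
    using tower_stage[of p'] by (simp add: p D1_def E1_def)
qed

end

theorem theorem4p3:
  fixes X :: "('a, 'a) rspace"
    and \<Phi> :: "nat \<Rightarrow> ('a, 'b) parr \<Rightarrow> ('a, 'b) parr \<times> ('a, 'b) parr"
    and \<Psi> :: "nat \<Rightarrow> ('a, 'b) parr \<Rightarrow> ('a, 'b) parr \<Rightarrow> ('a, 'b) parr \<Rightarrow> ('a, 'b) parr \<Rightarrow> ('a, 'b) parr"
    and \<Omega> :: "('a, 'b) pspsh \<Rightarrow> ('a, 'b) pspsh"
    and \<epsilon> :: "('a, 'b) pspsh \<Rightarrow> ('a, 'b) harr"
    and A K :: "('a, 'b) pspsh"
  assumes "infinite (UNIV :: 'a set)"
    and "\<exists>e :: 'a smarr option \<Rightarrow> 'b. inj e"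
    and "noetherian_scheme X" and "separated X" and "topological_dim (sp X) < \<infinity>"
    and "simplicial_model X (motivic_weq X :: ('a, 'b) parr set) (monomorphisms (psPre X)) (motivic_fib X)"
    and "\<And>n. model_category (psPre X) (local_weq X (WB X n) :: ('a, 'b) parr set)
           (monomorphisms (psPre X)) (local_fib X (WB X n))"
    and "\<And>n. functorial_factorization (psPre X) (monomorphisms (psPre X) \<inter> local_weq X (WB X n))
           (local_fib X (WB X n)) (\<Phi> n) (\<Psi> n)"
    and "loop_adjunction X \<Omega> \<epsilon>"
    and "is_fibrant X (motivic_fib X) A"
    and "is_cofibrant X (monomorphisms (psPre X)) K"
  shows "extended_exact_couple (\<lambda>r. Hgrp X r K point) (D1 X \<Phi> K A) (E1 X \<Phi> K A)
           (f1 X \<Phi> A) (g1 X \<Phi> \<Omega> \<epsilon> K A) (h1 X \<Phi> A)"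
proof -
  obtain e :: "'a smarr option \<Rightarrow> 'b" where e: "inj e" using assms(2) by (elim exE)
  \<comment> \<open>Arrow records whose point map is constant at \<open>a\<close> embed
    \<open>'a\<close> into the arrows; hence \<open>'b\<close>, into which all arrows embed, is
    infinite.\<close>
  define c :: "'a \<Rightarrow> 'a smarr option"
    where "c = (\<lambda>a. Some (Arr undefined undefined \<lparr>src = undefined, tgt = undefined, pt = (\<lambda>_. a), sh = undefined\<rparr>))"
  have "inj c" by (rule injI) (simp add: c_def fun_eq_iff)
  then have "inj (e \<circ> c)" using e by (rule inj_compose[rotated])
  then have "infinite (range (e \<circ> c))" using assms(1) finite_imageD by blast
  then have "infinite (UNIV :: 'b set)" using finite_subset subset_UNIV by blast
  then interpret loop_tower X "motivic_weq X" \<Omega> \<epsilon> \<Phi> \<Psi> A K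
    using assms(6,8-11)
    by unfold_locales (simp_all add: motivic_fib_def is_fibrant_def is_cofibrant_def)
  show ?thesis by (rule exact_couple)
qed

end
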